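(* Let $K$ be a locally integrable function on $(S\times S)\setminus\{(x,x):x\in S\}$ such that $$\sup_{y\in S}\,\sup_{r>0}\int_{r<d(x,y)\le 2r}\big[|K(x,y)|+|K(y,x)|\big]\,d\rho(x)<\infty$$ and $$\sup_{R\in\mathcal R}\ \sup_{y,y'\in R}\int_{S\setminus R^\ast}\big[|K(x,y)-K(x,y')|+|K(y,x)-K(y',x)|\big]\,d\rho(x)<\infty .$$ Let $T$ be a linear operator associated with the kernel $K$, i.e. $Tf(x)=\int_S K(x,y)f(y)\,d\rho(y)$ for all $f\in L^\infty_c$ and $x\notin\operatorname{supp} f$. If $T$ is bounded on $L^2$, then the maximal singular integral operator $$T^\ast f(x)=\sup_{R\in\mathcal R(x)}\left|\int_{S\setminus R^\ast}K(x,y)f(y)\,d\rho(y)\right|,\qquad f\in L^\infty_c,\ x\in S,$$ is bounded from $L^1$ to $L^{1,\infty}$, from $L^p$ to $L^p$ for all $p\in(1,\infty)$, and from $L^\infty_c$ to $\mathrm{BMO}$.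
   Context: Fix an integer $n\ge 1$ and write $\mathbb R^+=(0,\infty)$. $S=\mathbb R^n\ltimes\mathbb R^+$ is the group with product $(x,a)\cdot(x',a')=(x+ax',aa')$ and unit $e=(0,1)$. It carries the left-invariant Riemannian distance $$d\big((x,a),(x',a')\big)=\cosh^{-1}\Big(\frac{a^2+a'^2+|x-x'|^2}{2aa'}\Big)$$ and the right Haar measure $d\rho(x,a)=a^{-1}\,dx\,da$. Functions are complex-valued; $L^p$, $L^1_{\rm loc}$ and weak $L^p$, denoted $L^{p,\infty}$, with $\|f\|_{L^{p,\infty}}=\sup_{\alpha>0}\alpha[\rho(\{|f|>\alpha\})]^{1/p}$, are taken with respect to $\rho$. $L^\infty_c$ is the set of functions in $L^\infty$ with compact support. Calderón–Zygmund sets: a Calderón–Zygmund set is a set $R=Q\times[ae^{-r},ae^r)\subset S$, where $Q$ is a dyadic cube in $\mathbb R^n$ with side length $L$, $a\in\mathbb R^+$, $r>0$, and $e^2ar\le L<e^8ar$ if $r<1$, while $ae^{2r}\le L<ae^{8r}$ if $r\ge1$. Put $r_R=r$. $\mathcal R$ is the family of all Calderón–Zygmund sets, $\mathcal R(x)=\{R\in\mathcal R: x\in R\}$, and $R^\ast=\{x\in S: d(x,R)<r_R\}$. $\mathrm{BMO}$ is the space of $f\in L^1_{\rm loc}$ with $\|f\|_{\mathrm{BMO}}=\sup_{R\in\mathcal R}\frac1{\rho(R)}\int_R|f-f_R|\,d\rho<\infty$, where $f_R=\frac1{\rho(R)}\int_R f\,d\rho$. $T^\ast$ is defined on $L^\infty_c$;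 "bounded from $A$ to $B$" for $T^\ast$ means that there is a constant $C$ with $\|T^\ast f\|_B\le C\|f\|_A$ for all $f\in L^\infty_c$ (with $A=L^\infty_c$ normed by $\|\cdot\|_{L^\infty}$). *)

theory Defs
  imports "HOL-Analysis.Analysis" "HOL-Probability.Essential_Supremum"
begin

type_synonym 'n pt = "(real ^ 'n) \<times> real"

text \<open>The group \<open>S\<close> is the open upper half-space, carried by a type that also contains the points
  with nonpositive second coordinate; functions are only considered on \<open>S\<close>, and the topology induced by
  \<open>hdist\<close> is the subspace topology.\<close>

definition S :: "('n::finite) pt set" where
  "S = {x. 0 < snd x}"

definition hdist :: "('n::finite) pt \<Rightarrow> 'n pt \<Rightarrow> real" where
  "hdist x y =
     arcosh (((snd x)\<^sup>2 + (snd y)\<^sup>2 + (norm (fst x - fst y))\<^sup>2) / (2 * snd x * snd y))"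

text \<open>The right Haar measure for the product \<open>(x, a) \<cdot> (x', a') = (x + a x', a a')\<close>, as a Borel measure.\<close>

definition rho :: "('n::finite) pt measure" where
  "rho = density (restrict_space lborel S) (\<lambda>x. ennreal (1 / snd x))"


section \<open>Function spaces\<close>

text \<open>Functions stand for their classes modulo equality \<open>rho\<close>-almost everywhere. Norms take values in \<^typ>\<open>ennreal\<close>; for measurable functions, the value \<open>\<infinity>\<close> means that the
  function is not in the space.\<close>

definition lp_norm :: "real \<Rightarrow> (('n::finite) pt \<Rightarrow> complex) \<Rightarrow> ennreal" where
  "lp_norm p f =
     (let I = (\<integral>\<^sup>+x. ennreal (norm (f x) powr p) \<partial>rho)
      in if I = \<infinity> then \<infinity> else ennreal (enn2real I powr (1 / p)))"

definition lp_space :: "real \<Rightarrow> (('n::finite) pt \<Rightarrow> complex) set" where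
  "lp_space p = {f \<in> borel_measurable rho. lp_norm p f < \<infinity>}"

definition linf_norm :: "(('n::finite) pt \<Rightarrow> complex) \<Rightarrow> ennreal" where
  "linf_norm f = esssup rho (\<lambda>x. ennreal (norm (f x)))"

definition weak_l1_norm :: "(('n::finite) pt \<Rightarrow> complex) \<Rightarrow> ennreal" where
  "weak_l1_norm f =
     (SUP \<alpha>\<in>{0<..}. ennreal \<alpha> * emeasure rho {x \<in> space rho. \<alpha> < norm (f x)})"

text \<open>The support of an almost-everywhere class: the complement in \<open>S\<close> of the largest open set on
  which the function vanishes almost everywhere.\<close>

definition ess_supp :: "(('n::finite) pt \<Rightarrow> complex) \<Rightarrow> 'n pt set" where
  "ess_supp f = {x \<in> S. \<forall>U. open U \<and> x \<in> U \<longrightarrow> \<not> (AE z in rho. z \<in> U \<longrightarrow> f z = 0)}"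

definition linf_c :: "(('n::finite) pt \<Rightarrow> complex) set" where
  "linf_c = {f \<in> borel_measurable rho. linf_norm f < \<infinity> \<and> compact (ess_supp f)}"

definition l1_loc :: "(('n::finite) pt \<Rightarrow> complex) set" where
  "l1_loc = {f \<in> borel_measurable rho.
               \<forall>C. compact C \<and> C \<subseteq> S \<longrightarrow> set_integrable rho C f}"


section \<open>Calderon-Zygmund sets\<close>

text \<open>The dyadic cube of generation \<open>j\<close> and position \<open>k\<close>; its side length is \<open>2 powi j\<close>.\<close>

definition dyadic_cube :: "int \<Rightarrow> ('n \<Rightarrow> int) \<Rightarrow> (real ^ 'n::finite) set" where
  "dyadic_cube j k =
     {x. \<forall>i. of_int (k i) * 2 powi j \<le> x $ i \<and> x $ i < (of_int (k i) + 1) * 2 powi j}"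

definition cz_box :: "int \<Rightarrow> ('n \<Rightarrow> int) \<Rightarrow> real \<Rightarrow> real \<Rightarrow> ('n::finite) pt set" where
  "cz_box j k a r = dyadic_cube j k \<times> {a * exp (- r)..<a * exp r}"

definition cz_admissible :: "real \<Rightarrow> real \<Rightarrow> real \<Rightarrow> bool" where
  "cz_admissible L a r \<longleftrightarrow>
     (if r < 1 then exp 2 * a * r \<le> L \<and> L < exp 8 * a * r
      else a * exp (2 * r) \<le> L \<and> L < a * exp (8 * r))"

definition cz_sets :: "('n::finite) pt set set" where
  "cz_sets = {cz_box j k a r | j k a r. 0 < a \<and> 0 < r \<and> cz_admissible (2 powi j) a r}"

text \<open>The parameter \<open>r\<close> is determined by the set, see \<open>cz_radius_cz_box\<close> below.\<close>

definition cz_radius :: "('n::finite) pt set \<Rightarrow> real" where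
  "cz_radius R =
     (THE r. \<exists>j k a. R = cz_box j k a r \<and> 0 < a \<and> 0 < r \<and> cz_admissible (2 powi j) a r)"

definition cz_star :: "('n::finite) pt set \<Rightarrow> 'n pt set" where
  "cz_star R = {x \<in> S. (INF y\<in>R. hdist x y) < cz_radius R}"

lemma cz_box_radius_unique:
  assumes eq: "cz_box j k a r = cz_box j' k' a' r'"
    and pos: "0 < a" "0 < r" "0 < a'" "0 < r'"
  shows "r = r'"
proof -
  have ne: "dyadic_cube j k \<noteq> {}" for j k
  proof -
    have "(\<chi> i. of_int (k i) * 2 powi j) \<in> dyadic_cube j k"
      by (simp add: dyadic_cube_def)
    then show ?thesis by blast
  qed
  have im: "snd ` cz_box j k a r = {a * exp (- r)..<a * exp r}" for j k a r
    using ne[of j k] by (simp add: cz_box_def)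
  have I: "{a * exp (- r)..<a * exp r} = {a' * exp (- r')..<a' * exp r'}"
    using eq im by metis
  have l: "a * exp (- r) < a * exp r" using pos by simp
  have e: "a * exp (- r) = a' * exp (- r')" "a * exp r = a' * exp r'"
    using atLeastLessThan_inj[OF I l] pos by auto
  have "exp r / exp (- r) = exp r' / exp (- r')"
    using e pos by (metis mult_divide_mult_cancel_left_if less_irrefl)
  then have "exp (r - - r) = exp (r' - - r')"
    by (simp only: exp_diff)
  then show ?thesis by simp
qed

lemma cz_radius_cz_box:
  assumes "0 < a" "0 < r" "cz_admissible (2 powi j) a r"
  shows "cz_radius (cz_box j k a r) = r"
  unfolding cz_radius_def
  by (rule the_equality) (use assms cz_box_radius_unique in blast)+


section \<open>BMO\<close>

definition cz_mean :: "(('n::finite) pt \<Rightarrow> complex) \<Rightarrow> 'n pt set \<Rightarrow> complex" where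
  "cz_mean f R = (LINT x:R|rho. f x) / of_real (measure rho R)"

definition bmo_norm :: "(('n::finite) pt \<Rightarrow> complex) \<Rightarrow> ennreal" where
  "bmo_norm f =
     (if f \<in> l1_loc
      then SUP R\<in>cz_sets. (\<integral>\<^sup>+x\<in>R. ennreal (norm (f x - cz_mean f R)) \<partial>rho) / emeasure rho R
      else \<infinity>)"


section \<open>Singular integrals\<close>

text \<open>An operator on the Lebesgue spaces is given by a map on representatives, and identities between
  its values hold almost everywhere.\<close>

text \<open>The values of \<open>K\<close> on the diagonal are irrelevant.\<close>

definition loc_integrable_off_diag :: "(('n::finite) pt \<Rightarrow> 'n pt \<Rightarrow> complex) \<Rightarrow> bool" where
  "loc_integrable_off_diag K \<longleftrightarrow>
     (\<forall>C. compact C \<and> C \<subseteq> S \<times> S - Id \<longrightarrow>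
          set_integrable (rho \<Otimes>\<^sub>M rho) C (\<lambda>(x, y). K x y))"

definition linear_on_l2 :: "((('n::finite) pt \<Rightarrow> complex) \<Rightarrow> 'n pt \<Rightarrow> complex) \<Rightarrow> bool" where
  "linear_on_l2 T \<longleftrightarrow>
     (\<forall>f\<in>lp_space 2. \<forall>g\<in>lp_space 2. \<forall>c d.
        AE x in rho. T (\<lambda>z. c * f z + d * g z) x = c * T f x + d * T g x)"

definition bounded_on_l2 :: "((('n::finite) pt \<Rightarrow> complex) \<Rightarrow> 'n pt \<Rightarrow> complex) \<Rightarrow> bool" where
  "bounded_on_l2 T \<longleftrightarrow>
     (\<exists>C::real. \<forall>f\<in>lp_space 2.
        T f \<in> borel_measurable rho \<and> lp_norm 2 (T f) \<le> ennreal C * lp_norm 2 f)"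

definition has_kernel ::
  "((('n::finite) pt \<Rightarrow> complex) \<Rightarrow> 'n pt \<Rightarrow> complex) \<Rightarrow> ('n pt \<Rightarrow> 'n pt \<Rightarrow> complex) \<Rightarrow> bool" where
  "has_kernel T K \<longleftrightarrow>
     (\<forall>f\<in>linf_c. AE x in rho. x \<notin> ess_supp f \<longrightarrow> T f x = (LINT y|rho. K x y * f y))"

definition max_sing ::
  "(('n::finite) pt \<Rightarrow> 'n pt \<Rightarrow> complex) \<Rightarrow> ('n pt \<Rightarrow> complex) \<Rightarrow> 'n pt \<Rightarrow> ennreal" where
  "max_sing K f x =
     (SUP R\<in>{R \<in> cz_sets. x \<in> R}. ennreal (norm (LINT y:(S - cz_star R)|rho. K x y * f y)))"

text \<open>Boundedness on \<open>linf_c\<close> of an operator with values in \<open>[0, \<infinity>]\<close>, with respect to norms \<open>A\<close> and \<open>B\<close>.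
  The output has to be finite almost everywhere and is then regarded as a complex-valued function.\<close>

definition bounded_from_to ::
  "((('n::finite) pt \<Rightarrow> complex) \<Rightarrow> ennreal) \<Rightarrow> (('n pt \<Rightarrow> complex) \<Rightarrow> ennreal) \<Rightarrow>
   (('n pt \<Rightarrow> complex) \<Rightarrow> 'n pt \<Rightarrow> ennreal) \<Rightarrow> bool" where
  "bounded_from_to A B U \<longleftrightarrow>
     (\<exists>C::real. \<forall>f\<in>linf_c.
        U f \<in> borel_measurable rho \<and> (AE x in rho. U f x < \<infinity>) \<and>
        B (\<lambda>x. complex_of_real (enn2real (U f x))) \<le> ennreal C * A f)"

end

theory Submission
  imports Defs
begin

text \<open>In logarithmic scale the second factors of Calderon-Zygmund sets can be taken dyadic. This singles
  out a nested system of Calderon-Zygmund sets with bounded jumps of measure from a set to its parent, and stopping in it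
  gives Calderon-Zygmund decompositions at every height, although \<open>S\<close> has exponential growth. Moreover
  families of Calderon-Zygmund sets satisfy a covering lemma, in which sets are selected by the
  side length of their bases.

  Let \<open>f\<close> be bounded by \<open>a\<close>. On \<open>R\<close>, the truncation of \<open>T f\<close> at \<open>R\<^sup>*\<close> is \<open>T f - T (f 1\<^bsub>R\<^sup>*\<^esub>)\<close> and
  oscillates by at most a multiple of \<open>a\<close>, so that averaging over \<open>R\<close> and the covering lemma give an \<open>L\<^sup>2\<close> estimate
  of the level sets of \<open>T\<^sup>* f\<close> at heights above a multiple of \<open>a\<close>. This is enough for the good part of
  a decomposition. The bad part is handled by cancellation, except for the sets that cross the boundary of
  \<open>R\<^sup>*\<close>: they lie in an annulus, on which the size condition applies. Hence the weak type (1,1).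

  Since \<open>T\<^sup>*\<close> is not bounded on \<open>L\<^sup>\<infinity>\<close>, there is no end point to interpolate with. Instead, localizing the weak type bound shows that
  the measure of the level sets of \<open>T\<^sup>* f\<close> at least halves when the height grows by a multiple of \<open>a\<close>. For
  general \<open>f\<close> one splits \<open>f\<close> into layers according to size, applies this decay to each layer of small size
  and the weak type bound to the rest, and integrates over the heights.\<close>

text \<open>Large balls are not doubling for \<open>rho\<close>, which is why truncations, averages
  and stopping sets are all boxes. The lower bounds on the side length keep the horizontal spread of
  \<open>cz_star R\<close> within one side length, so that its measure is comparable to that of
  \<open>R\<close>; the upper bounds keep the diameter of \<open>R\<close> comparable to its radius,
  so that the size condition can be applied to annuli.

  One comparison is used twice. If \<open>f\<close> vanishes on the star of \<open>R0\<close>, the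
  values of the maximal operator at two points of \<open>R0\<close> differ by at most a multiple of
  the bound of \<open>f\<close>: any box around the first point can be exchanged for one containing
  both, at the price of an annulus. This yields the halving of the level sets, and together with the
  case p = 2 of the strong type, applied to the part of \<open>f\<close> on the star, the BMO bound.

  The supremum runs over uncountably many boxes. Level sets are therefore first enclosed in
  measurable sets; measurability itself comes from rational box parameters relative to the height of
  the point. The kernel is given only off the diagonal and is put equal to zero on it, to be
  measurable on the product.\<close>

lemma powi_2_pos [simp]: "0 < (2::real) powi j"
  by simp

lemma powi_2_le_iff: "(2::real) powi i \<le> 2 powi j \<longleftrightarrow> i \<le> j"
  by (auto simp: power_int_strict_increasing power_int_increasing not_le[symmetric])
     (meson linorder_not_le one_less_numeral_iff power_int_strict_increasing semiring_norm(76))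

section \<open>The hyperbolic distance\<close>

text \<open>The argument of \<open>arcosh\<close> in \<open>hdist\<close>. It is the cosh of the
  distance and rational in the coordinates, so estimates are made for it and transferred to the
  distance by monotonicity of cosh.\<close>

definition hquot :: "('n::finite) pt \<Rightarrow> 'n pt \<Rightarrow> real" where
  "hquot x y = ((snd x)\<^sup>2 + (snd y)\<^sup>2 + (norm (fst x - fst y))\<^sup>2) / (2 * snd x * snd y)"

lemma hquot_ge_1:
  assumes "x \<in> S" "y \<in> S"
  shows "1 \<le> hquot x y"
proof -
  have "0 \<le> (snd x - snd y)\<^sup>2 + (norm (fst x - fst y))\<^sup>2"
    by simp
  then have "2 * snd x * snd y \<le> (snd x)\<^sup>2 + (snd y)\<^sup>2 + (norm (fst x - fst y))\<^sup>2"
    by (simp add: power2_eq_square algebra_simps)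
  then show ?thesis using assms by (simp add: hquot_def S_def le_divide_eq)
qed

lemma hdist_nonneg: "x \<in> S \<Longrightarrow> y \<in> S \<Longrightarrow> 0 \<le> hdist x y"
  using hquot_ge_1[of x y] by (simp add: hdist_def hquot_def)

lemma cosh_hdist: "x \<in> S \<Longrightarrow> y \<in> S \<Longrightarrow> cosh (hdist x y) = hquot x y"
  using hquot_ge_1[of x y] by (simp add: hdist_def hquot_def)

lemma hdist_commute: "hdist x y = hdist y x"
  by (simp add: hdist_def norm_minus_commute algebra_simps)

lemma hdist_self [simp]: "x \<in> S \<Longrightarrow> hdist x x = 0"
  by (simp add: hdist_def S_def power2_eq_square)

lemma hdist_less_iff:
  assumes "x \<in> S" "y \<in> S" "0 \<le> r"
  shows "hdist x y < r \<longleftrightarrow> hquot x y < cosh r"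
  using cosh_real_nonneg_less_iff[of "hdist x y" r] assms by (simp add: hdist_nonneg cosh_hdist)

text \<open>In the hyperboloid model with base point \<open>z\<close>, \<open>hquot z p\<close> is
  the time coordinate of \<open>p\<close> and the pair on the right is its spatial part. The claim
  is the equation of the hyperboloid: time squared minus space squared equals 1.\<close>

lemma sinh_hdist:
  assumes "z \<in> S" "p \<in> S"
  shows "sinh (hdist z p) = norm (((norm (fst p - fst z))\<^sup>2 + (snd p)\<^sup>2 - (snd z)\<^sup>2) / (2 * snd z * snd p),
           (1 / snd p) *\<^sub>R (fst p - fst z))"
proof -
  define N where "N = (norm (fst p - fst z))\<^sup>2"
  define a where "a = snd z"
  define b where "b = snd p"
  have pos: "0 < a" "0 < b" using assms by (auto simp: S_def a_def b_def)
  have "(hquot z p)\<^sup>2 - 1 = ((N + b\<^sup>2 - a\<^sup>2) / (2 * a * b))\<^sup>2 + N / b\<^sup>2"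
    using pos unfolding hquot_def N_def a_def[symmetric] b_def[symmetric] norm_minus_commute[of "fst z"]
    by (simp add: field_simps power2_eq_square)
  moreover have "sinh (hdist z p) = sqrt ((hquot z p)\<^sup>2 - 1)"
    using hquot_ge_1[OF assms] by (simp add: hdist_def hquot_def sinh_arcosh_real)
  ultimately show ?thesis
    using pos by (simp add: norm_Pair N_def a_def b_def power_divide power_mult_distrib)
qed

text \<open>In the hyperboloid model with base point \<open>z\<close> the triangle inequality is the addition theorem
  for \<open>cosh\<close> combined with the Cauchy-Schwarz inequality.\<close>

lemma hdist_triangle:
  assumes "p \<in> S" "z \<in> S" "q \<in> S"
  shows "hdist p q \<le> hdist p z + hdist z q"
proof -
  define A where "A p = ((norm (fst p - fst z))\<^sup>2 + (snd p)\<^sup>2 - (snd z)\<^sup>2) / (2 * snd z * snd p)" for p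
  define B where "B p = (1 / snd p) *\<^sub>R (fst p - fst z)" for p
  have pos: "0 < snd z" "0 < snd p" "0 < snd q" using assms by (auto simp: S_def)
  define a where "a = fst p - fst z"
  define b where "b = fst q - fst z"
  have ab: "fst p - fst q = a - b" by (simp add: a_def b_def)
  have n: "(norm (a - b))\<^sup>2 = (norm a)\<^sup>2 + (norm b)\<^sup>2 - 2 * (a \<bullet> b)"
    by (simp add: power2_norm_eq_inner algebra_simps inner_commute)
  have i: "(A p, B p) \<bullet> (A q, B q) =
      ((norm a)\<^sup>2 + (snd p)\<^sup>2 - (snd z)\<^sup>2) / (2 * snd z * snd p) *
      (((norm b)\<^sup>2 + (snd q)\<^sup>2 - (snd z)\<^sup>2) / (2 * snd z * snd q)) + (a \<bullet> b) / (snd p * snd q)"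
    by (simp add: A_def B_def a_def[symmetric] b_def[symmetric])
  have h1: "hquot z p = ((snd z)\<^sup>2 + (snd p)\<^sup>2 + (norm a)\<^sup>2) / (2 * snd z * snd p)"
    and h2: "hquot z q = ((snd z)\<^sup>2 + (snd q)\<^sup>2 + (norm b)\<^sup>2) / (2 * snd z * snd q)"
    by (simp_all add: hquot_def a_def b_def norm_minus_commute)
  have eq: "hquot p q = hquot z p * hquot z q - (A p, B p) \<bullet> (A q, B q)"
    unfolding i h1 h2 using pos unfolding hquot_def ab n
    by (simp add: field_simps power2_eq_square)
  have "- ((A p, B p) \<bullet> (A q, B q)) \<le> norm (A p, B p) * norm (A q, B q)"
    using Cauchy_Schwarz_ineq2[of "(A p, B p)" "(A q, B q)"] by linarith
  also have "\<dots> = sinh (hdist z p) * sinh (hdist z q)"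
    using assms by (simp add: sinh_hdist A_def B_def)
  finally have "cosh (hdist p q) \<le> cosh (hdist p z + hdist z q)"
    using assms eq by (simp add: cosh_hdist cosh_add hdist_commute[of p z])
  then show ?thesis
    using assms by (subst (asm) cosh_real_nonneg_le_iff) (auto simp: hdist_nonneg)
qed

text \<open>Dropping the horizontal term from \<open>hquot\<close> leaves exactly the cosh of the
  difference of the logarithmic heights.\<close>

lemma hdist_ge_ln:
  assumes "x \<in> S" "y \<in> S"
  shows "\<bar>ln (snd x) - ln (snd y)\<bar> \<le> hdist x y"
proof -
  have pos: "0 < snd x" "0 < snd y" using assms by (auto simp: S_def)
  have "cosh (ln (snd x) - ln (snd y)) = (snd x / snd y + snd y / snd x) / 2"
    using pos by (simp add: cosh_def exp_diff inverse_eq_divide exp_minus)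
  also have "\<dots> = ((snd x)\<^sup>2 + (snd y)\<^sup>2) / (2 * snd x * snd y)"
    using pos by (simp add: field_simps power2_eq_square)
  also have "\<dots> \<le> hquot x y"
    using pos by (simp add: hquot_def divide_right_mono)
  finally have "cosh \<bar>ln (snd x) - ln (snd y)\<bar> \<le> cosh (hdist x y)"
    using assms by (simp add: cosh_hdist)
  then show ?thesis
    using assms by (subst (asm) cosh_real_nonneg_le_iff) (auto simp: hdist_nonneg)
qed

lemma open_S: "open (S :: ('n::finite) pt set)"
  unfolding S_def by (intro open_Collect_less continuous_intros)

lemma continuous_on_hdist:
  assumes "\<And>z. z \<in> A \<Longrightarrow> f z \<in> S" "\<And>z. z \<in> A \<Longrightarrow> g z \<in> S" "continuous_on A f" "continuous_on A g"
  shows "continuous_on A (\<lambda>z. hdist (f z) (g z))"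
proof -
  have 1: "\<And>z. z \<in> A \<Longrightarrow> snd (f z) \<noteq> 0 \<and> snd (g z) \<noteq> 0"
    using assms(1,2) by (force simp: S_def)
  have 2: "\<And>z. z \<in> A \<Longrightarrow> 1 \<le> hquot (f z) (g z)"
    using assms hquot_ge_1 by blast
  show ?thesis
    unfolding hdist_def
    by (rule continuous_on_compose2[OF continuous_on_arcosh[OF order_refl]])
       (use 1 2 in \<open>auto simp: hquot_def intro!: continuous_intros assms(3,4)\<close>)
qed

lemma open_hball:
  assumes "y \<in> S"
  shows "open {x \<in> S. hdist x y < r}"
proof -
  have "continuous_on S (\<lambda>x. hdist x y)"
    by (rule continuous_on_hdist) (use assms in \<open>auto intro: continuous_intros\<close>)
  then have "open (S \<inter> (\<lambda>x. hdist x y) -` {..<r})"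
    by (rule continuous_open_preimage) (auto simp: open_S)
  also have "S \<inter> (\<lambda>x. hdist x y) -` {..<r} = {x \<in> S. hdist x y < r}" by auto
  finally show ?thesis .
qed

section \<open>Elementary bounds for sinh and cosh\<close>

lemma sinh_le_mult_exp: "0 \<le> s \<Longrightarrow> sinh s \<le> s * exp (s::real)"
proof -
  assume "0 \<le> s"
  have "1 - 2 * s \<le> exp (- 2 * s)"
    using exp_ge_add_one_self[of "- 2 * s"] by simp
  then have "exp s * (1 - 2 * s) \<le> exp s * exp (- 2 * s)" by simp
  also have "\<dots> = exp (- s)" by (simp add: exp_add[symmetric])
  finally show ?thesis by (simp add: sinh_def algebra_simps)
qed

lemma cosh_minus_one: "cosh r - 1 = 2 * (sinh (r / 2 :: real))\<^sup>2"
  using cosh_double[of "r / 2"] by (simp add: cosh_square_eq)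

lemma cosh_minus_one_le: "0 \<le> r \<Longrightarrow> cosh r - 1 \<le> r\<^sup>2 * exp r / (2::real)"
proof -
  assume "0 \<le> r"
  then have "(sinh (r / 2))\<^sup>2 \<le> (r / 2 * exp (r / 2))\<^sup>2"
    using sinh_le_mult_exp[of "r / 2"] by (intro power_mono) auto
  also have "\<dots> = r\<^sup>2 * exp r / 4"
    by (simp add: power_mult_distrib power_divide exp_double[symmetric])
  finally show ?thesis by (simp add: cosh_minus_one)
qed

lemma cosh_minus_one_ge: "0 \<le> d \<Longrightarrow> d\<^sup>2 / 2 \<le> cosh d - (1::real)"
proof -
  assume "0 \<le> d"
  then have "(d / 2)\<^sup>2 \<le> (sinh (d / 2))\<^sup>2"
    using real_le_x_sinh[of "d / 2"] by (intro power_mono) (auto simp: sinh_field_def exp_minus)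
  then show ?thesis by (simp add: cosh_minus_one power_divide)
qed

section \<open>Dyadic cubes\<close>

lemma dyadic_interval_nested:
  fixes x :: real
  assumes "j \<le> j'" "of_int k * 2 powi j \<le> x" "x < (of_int k + 1) * 2 powi j"
    "of_int k' * 2 powi j' \<le> x" "x < (of_int k' + 1) * 2 powi j'"
  shows "of_int k' * 2 powi j' \<le> (of_int k * 2 powi j :: real)"
    "(of_int k + 1) * 2 powi j \<le> (of_int k' + 1) * (2 powi j' :: real)"
proof -
  define m :: int where "m = 2 ^ nat (j' - j)"
  have m: "2 powi j' = of_int m * (2 powi j :: real)"
    using assms(1) power_int_add[of "2::real" "j' - j" j]
    by (simp add: m_def power_int_def)
  have "of_int (k' * m) * 2 powi j < (of_int k + 1) * (2 powi j :: real)"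
    using le_less_trans[OF assms(4,3)] unfolding m by (simp only: of_int_mult mult.assoc)
  \<comment> \<open>In units of the finer side length all end points are integers, so the strict
    inequality sharpens to k' m <= k.\<close>
  then have "real_of_int (k' * m) < of_int (k + 1)" by simp
  then have 1: "k' * m \<le> k" by linarith
  have "of_int k * 2 powi j < of_int ((k' + 1) * m) * (2 powi j :: real)"
    using le_less_trans[OF assms(2,5)] unfolding m by (simp only: of_int_mult of_int_add of_int_1 mult.assoc)
  then have "real_of_int k < of_int ((k' + 1) * m)" by simp
  then have 2: "k + 1 \<le> (k' + 1) * m" by linarith
  have "real_of_int (k' * m) \<le> of_int k" "real_of_int (k + 1) \<le> of_int ((k' + 1) * m)"
    using 1 2 by (simp_all only: of_int_le_iff)
  then have "real_of_int (k' * m) * 2 powi j \<le> of_int k * 2 powi j"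
    "real_of_int (k + 1) * 2 powi j \<le> of_int ((k' + 1) * m) * 2 powi j"
    by (intro mult_right_mono; simp)+
  then show "of_int k' * 2 powi j' \<le> (of_int k * 2 powi j :: real)"
    "(of_int k + 1) * 2 powi j \<le> (of_int k' + 1) * (2 powi j' :: real)"
    unfolding m by (simp_all add: mult.assoc)
qed

lemma dyadic_interval_unique:
  fixes x :: real
  assumes "of_int k * 2 powi j \<le> x" "x < (of_int k + 1) * 2 powi j"
    "of_int k' * 2 powi j \<le> x" "x < (of_int k' + 1) * 2 powi j"
  shows "k = k'"
  using dyadic_interval_nested(1)[of j j, OF _ assms] dyadic_interval_nested(1)[of j j, OF _ assms(3,4,1,2)]
  by simp

lemma dyadic_interval_ex:
  fixes x :: real
  shows "of_int \<lfloor>x / 2 powi j\<rfloor> * 2 powi j \<le> x" "x < (of_int \<lfloor>x / 2 powi j\<rfloor> + 1) * 2 powi j"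
  using of_int_floor_le[of "x / 2 powi j"] real_of_int_floor_add_one_gt[of "x / 2 powi j"]
  by (simp_all add: pos_le_divide_eq pos_divide_less_eq del: of_int_floor_le real_of_int_floor_add_one_gt)

lemma dyadic_cube_nested:
  assumes "j \<le> j'" "x \<in> dyadic_cube j k" "x \<in> dyadic_cube j' k'"
  shows "dyadic_cube j k \<subseteq> dyadic_cube j' k'"
proof
  fix y assume y: "y \<in> dyadic_cube j k"
  show "y \<in> dyadic_cube j' k'"
    unfolding dyadic_cube_def
  proof (intro CollectI allI)
    fix i
    have "of_int (k' i) * 2 powi j' \<le> (of_int (k i) * 2 powi j :: real)"
      "(of_int (k i) + 1) * 2 powi j \<le> (of_int (k' i) + 1) * (2 powi j' :: real)"
      by (rule dyadic_interval_nested[of j j' "k i" "x $ i" "k' i"]; use assms in \<open>simp add: dyadic_cube_def\<close>)+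
    moreover have "of_int (k i) * 2 powi j \<le> y $ i" "y $ i < (of_int (k i) + 1) * 2 powi j"
      using y by (auto simp: dyadic_cube_def)
    ultimately show "of_int (k' i) * 2 powi j' \<le> y $ i \<and> y $ i < (of_int (k' i) + 1) * 2 powi j'"
      by linarith
  qed
qed

lemma dyadic_cube_unique:
  assumes "x \<in> dyadic_cube j k" "x \<in> dyadic_cube j k'"
  shows "k = k'"
proof
  fix i
  show "k i = k' i"
    by (rule dyadic_interval_unique[of "k i" j "x $ i"]) (use assms in \<open>auto simp: dyadic_cube_def\<close>)
qed

lemma dyadic_cube_ex: "\<exists>k. x \<in> dyadic_cube j k"
  by (rule exI[of _ "\<lambda>i. \<lfloor>x $ i / 2 powi j\<rfloor>"]) (simp add: dyadic_cube_def dyadic_interval_ex)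

lemma dyadic_cube_nonempty: "dyadic_cube j k \<noteq> {}"
proof -
  have "(\<chi> i. of_int (k i) * 2 powi j) \<in> dyadic_cube j k"
    by (simp add: dyadic_cube_def)
  then show ?thesis by blast
qed

section \<open>Geometry of Calderon-Zygmund sets\<close>

definition cz_lo :: "real \<Rightarrow> real \<Rightarrow> real" where
  "cz_lo a r = (if r < 1 then exp 2 * a * r else a * exp (2 * r))"

definition cz_hi :: "real \<Rightarrow> real \<Rightarrow> real" where
  "cz_hi a r = (if r < 1 then exp 8 * a * r else a * exp (8 * r))"

lemma cz_admissible_iff: "cz_admissible L a r \<longleftrightarrow> cz_lo a r \<le> L \<and> L < cz_hi a r"
  by (auto simp: cz_admissible_def cz_lo_def cz_hi_def)

lemma cz_lo_pos: "0 < a \<Longrightarrow> 0 < r \<Longrightarrow> 0 < cz_lo a r"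
  by (auto simp: cz_lo_def)

lemma exp_ge_power2: "0 \<le> x \<Longrightarrow> 2 ^ n \<le> exp (real n + x)"
proof -
  assume "0 \<le> x"
  have "(2::real) ^ n \<le> exp 1 ^ n"
    using exp_ge_add_one_self[of 1] by (intro power_mono) auto
  also have "\<dots> = exp (real n)" by (simp add: exp_of_nat_mult[symmetric])
  also have "\<dots> \<le> exp (real n + x)" using \<open>0 \<le> x\<close> by simp
  finally show ?thesis .
qed

text \<open>The admissible side lengths for given \<open>a\<close> and \<open>r\<close> span at
  least a factor 2 and hence include a power of 2. This is why every centre and radius can be
  realized over a dyadic base.\<close>

lemma cz_lo_hi:
  assumes "0 < a" "0 < r"
  shows "2 * cz_lo a r \<le> cz_hi a r"
proof -
  have e: "(2::real) \<le> exp 6" using exp_ge_power2[of 5 1] by simp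
  show ?thesis
  proof (cases "r < 1")
    case True
    have "2 * exp 2 \<le> (exp 8 :: real)"
      using mult_right_mono[OF e, of "exp 2"] by (simp add: exp_add[symmetric])
    then have "2 * exp 2 * (a * r) \<le> exp 8 * (a * r)" using assms by (intro mult_right_mono) auto
    then show ?thesis using True by (simp add: cz_lo_def cz_hi_def mult.assoc)
  next
    case False
    have "2 * exp (2 * r) \<le> exp 6 * exp (2 * r)" using e by simp
    also have "\<dots> \<le> exp (8 * r)" using False by (simp add: exp_add[symmetric])
    finally have "a * (2 * exp (2 * r)) \<le> a * exp (8 * r)" using assms by (intro mult_left_mono) auto
    then show ?thesis using False by (simp add: cz_lo_def cz_hi_def mult_ac)
  qed
qed

lemma cz_hi_mono:
  assumes "0 < a" "0 < r" "r \<le> r'"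
  shows "cz_hi a r \<le> cz_hi a r'"
proof -
  have "exp 8 * r \<le> exp (8 * r')" if "r < 1" "1 \<le> r'"
  proof -
    have "exp 8 * r \<le> exp 8 * (1::real)" using that by (intro mult_left_mono) auto
    also have "\<dots> \<le> exp (8 * r')" using that by simp
    finally show ?thesis .
  qed
  then show ?thesis
    using assms by (auto simp: cz_hi_def mult_left_mono mult_ac)
qed

lemma powi_ceiling_log:
  assumes "0 < x"
  shows "x \<le> 2 powi \<lceil>log 2 x\<rceil>" "2 powi \<lceil>log 2 x\<rceil> < 2 * x"
proof -
  have *: "(2::real) powi k = 2 powr of_int k" for k :: int
    by (simp add: powr_real_of_int' )
  have "x = 2 powr (log 2 x)" using assms by simp
  also have "\<dots> \<le> 2 powr of_int \<lceil>log 2 x\<rceil>" by simp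
  finally show "x \<le> 2 powi \<lceil>log 2 x\<rceil>" by (simp add: *)
  have "2 powr of_int \<lceil>log 2 x\<rceil> < 2 powr (log 2 x + 1)"
    using ceiling_correct[of "log 2 x"] by (simp del: ceiling_less_iff)
  also have "\<dots> = 2 * x" using assms by (simp add: powr_add)
  finally show "2 powi \<lceil>log 2 x\<rceil> < 2 * x" by (simp add: *)
qed

lemma cz_setsI: "0 < a \<Longrightarrow> 0 < r \<Longrightarrow> cz_admissible (2 powi j) a r \<Longrightarrow> cz_box j k a r \<in> cz_sets"
  unfolding cz_sets_def by blast

lemma cz_setsE:
  assumes "R \<in> cz_sets"
  obtains j k a r where "R = cz_box j k a r" "0 < a" "0 < r" "cz_admissible (2 powi j) a r" "cz_radius R = r"
  using assms cz_radius_cz_box unfolding cz_sets_def by blast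

lemma cz_radius_pos: "R \<in> cz_sets \<Longrightarrow> 0 < cz_radius R"
  by (elim cz_setsE) simp

lemma cz_box_subset_S: "0 < a \<Longrightarrow> cz_box j k a r \<subseteq> S"
  by (auto simp: cz_box_def S_def intro: less_le_trans[of 0 "a * exp (- r)"])

lemma cz_sets_subset_S: "R \<in> cz_sets \<Longrightarrow> R \<subseteq> S"
  by (elim cz_setsE) (simp add: cz_box_subset_S)

lemma cz_box_nonempty: "0 < a \<Longrightarrow> 0 < r \<Longrightarrow> cz_box j k a r \<noteq> {}"
  using dyadic_cube_nonempty[of j k] by (auto simp: cz_box_def)

lemma cz_sets_nonempty: "R \<in> cz_sets \<Longrightarrow> R \<noteq> {}"
  by (elim cz_setsE) (simp add: cz_box_nonempty)

text \<open>The larger set has the same centre and a dyadic ancestor as base.\<close>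

lemma cz_enlarge:
  assumes R: "R \<in> cz_sets" and r': "cz_radius R \<le> r'"
  obtains R' where "R' \<in> cz_sets" "R \<subseteq> R'" "cz_radius R' = r'"
proof -
  from R obtain j k a r where *: "R = cz_box j k a r" "0 < a" "0 < r"
    "cz_admissible (2 powi j) a r" "cz_radius R = r" by (rule cz_setsE)
  then have r: "r \<le> r'" "0 < r'" using r' by auto
  \<comment> \<open>Two demands: the new base must be an ancestor of the old one, and its side must
    reach \<open>cz_lo a r'\<close>. The larger exponent still stays below
    \<open>cz_hi a r'\<close>, since the old side is below \<open>cz_hi a r\<close> and
    \<open>cz_hi\<close> grows with the radius.\<close>
  define j' where "j' = max j \<lceil>log 2 (cz_lo a r')\<rceil>"
  have "cz_lo a r' \<le> 2 powi \<lceil>log 2 (cz_lo a r')\<rceil>" "2 powi \<lceil>log 2 (cz_lo a r')\<rceil> < cz_hi a r'"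
    using powi_ceiling_log[OF cz_lo_pos[OF *(2) r(2)]] cz_lo_hi[OF *(2) r(2)] by auto
  moreover have "2 powi j < cz_hi a r'"
    using * r cz_hi_mono[of a r r'] by (auto simp: cz_admissible_iff)
  moreover have "2 powi \<lceil>log 2 (cz_lo a r')\<rceil> \<le> (2 powi j' :: real)"
    by (simp add: j'_def powi_2_le_iff)
  ultimately have adm: "cz_admissible (2 powi j') a r'"
    by (auto simp: cz_admissible_iff j'_def max_def)
  obtain x where x: "x \<in> dyadic_cube j k" using dyadic_cube_nonempty by blast
  obtain k' where k': "x \<in> dyadic_cube j' k'" using dyadic_cube_ex by blast
  have "dyadic_cube j k \<subseteq> dyadic_cube j' k'"
    by (rule dyadic_cube_nested[OF _ x k']) (simp add: j'_def)
  moreover have "{a * exp (- r)..<a * exp r} \<subseteq> {a * exp (- r')..<a * exp r'}"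
    using *(2) r by auto
  ultimately have "R \<subseteq> cz_box j' k' a r'"
    unfolding *(1) cz_box_def by blast
  then show thesis
    using that[of "cz_box j' k' a r'"] cz_setsI[OF *(2) r(2) adm] cz_radius_cz_box[OF *(2) r(2) adm] by blast
qed

section \<open>The enlarged sets\<close>

lemma cz_star_eq:
  assumes "R \<in> cz_sets"
  shows "cz_star R = {x \<in> S. \<exists>y\<in>R. hdist x y < cz_radius R}"
proof -
  have "(INF y\<in>R. hdist x y) < cz_radius R \<longleftrightarrow> (\<exists>y\<in>R. hdist x y < cz_radius R)" if "x \<in> S" for x
    by (rule cInf_less_iff[of "hdist x ` R", simplified])
       (use assms that cz_sets_nonempty cz_sets_subset_S in \<open>auto intro!: bdd_belowI2[of _ 0] hdist_nonneg\<close>)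
  then show ?thesis by (auto simp: cz_star_def)
qed

lemma cz_star_subset_S: "cz_star R \<subseteq> S"
  by (auto simp: cz_star_def)

lemma cz_subset_star: "R \<in> cz_sets \<Longrightarrow> R \<subseteq> cz_star R"
proof
  fix x assume R: "R \<in> cz_sets" "x \<in> R"
  then have "x \<in> S" "hdist x x < cz_radius R"
    using cz_sets_subset_S[OF R(1)] cz_radius_pos[OF R(1)] by auto
  then show "x \<in> cz_star R" unfolding cz_star_eq[OF R(1)] using R(2) by blast
qed

lemma open_cz_star:
  assumes "R \<in> cz_sets"
  shows "open (cz_star R)"
proof -
  have "cz_star R = (\<Union>y\<in>R. {x \<in> S. hdist x y < cz_radius R})"
    using assms by (auto simp: cz_star_eq)
  then show ?thesis
    using assms cz_sets_subset_S by (auto intro!: open_UN open_hball)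
qed

lemma hdist_ge_outside_star:
  "R \<in> cz_sets \<Longrightarrow> x \<in> R \<Longrightarrow> y \<in> S \<Longrightarrow> y \<notin> cz_star R \<Longrightarrow> cz_radius R \<le> hdist x y"
  by (force simp: cz_star_eq hdist_commute)

text \<open>The concentric cube of three times the side, taken closed so that its volume is that of
  a \<open>cbox\<close>.\<close>

definition cz_triple :: "int \<Rightarrow> ('n \<Rightarrow> int) \<Rightarrow> (real ^ 'n::finite) set" where
  "cz_triple j k = cbox (\<chi> i. (of_int (k i) - 1) * 2 powi j) (\<chi> i. (of_int (k i) + 2) * 2 powi j)"

text \<open>If \<open>y\<close> has distance less than \<open>r\<close> from a point
  \<open>z\<close> of the box, the logarithmic heights differ by less than \<open>r\<close>, and the
  squared horizontal displacement is at most 2 (cosh r - 1) times the product of the heights. The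
  heights are at most a exp (2 r) and a exp r, and the lower bounds in \<open>cz_admissible\<close>
  are exactly what brings the result below the square of the side.\<close>

lemma cz_star_subset:
  fixes k :: "'n::finite \<Rightarrow> int"
  assumes "0 < a" "0 < r" "cz_admissible (2 powi j) a r"
  shows "cz_star (cz_box j k a r) \<subseteq> cz_triple j k \<times> {a * exp (- 2 * r)..<a * exp (2 * r)}"
proof
  fix y :: "'n pt" assume "y \<in> cz_star (cz_box j k a r)"
  then obtain z where z: "z \<in> cz_box j k a r" "hdist y z < r" "y \<in> S"
    using cz_star_eq[OF cz_setsI[OF assms, where k = k]] cz_radius_cz_box[OF assms, where k = k] by auto
  have zS: "z \<in> S" using z cz_box_subset_S[OF assms(1)] by blast
  have pos: "0 < snd y" "0 < snd z" using zS z(3) by (auto simp: S_def)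
  have zb: "a * exp (- r) \<le> snd z" "snd z < a * exp r" using z(1) by (auto simp: cz_box_def)
  have d: "\<bar>ln (snd y) - ln (snd z)\<bar> < r" using hdist_ge_ln[OF z(3) zS] z(2) by linarith
  have "snd z * exp (- r) < snd y"
  proof -
    have "ln (snd z) - r < ln (snd y)" using d by linarith
    then have "exp (ln (snd z) - r) < exp (ln (snd y))" by (simp only: exp_less_cancel_iff)
    then show ?thesis using pos by (simp add: exp_diff exp_minus field_simps)
  qed
  moreover have "snd y < snd z * exp r"
  proof -
    have "ln (snd y) < ln (snd z) + r" using d by linarith
    then have "exp (ln (snd y)) < exp (ln (snd z) + r)" by (simp only: exp_less_cancel_iff)
    then show ?thesis using pos by (simp add: exp_add)
  qed
  moreover have "a * exp (- 2 * r) \<le> snd z * exp (- r)"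
    using mult_right_mono[OF zb(1), of "exp (- r)"] by (simp add: mult.assoc exp_add[symmetric])
  moreover have "snd z * exp r < a * exp (2 * r)"
    using mult_strict_right_mono[OF zb(2), of "exp r"] by (simp add: mult.assoc exp_add[symmetric])
  ultimately have yb: "a * exp (- 2 * r) \<le> snd y" "snd y < a * exp (2 * r)" by linarith+
  have "hquot y z < cosh r"
    using hdist_less_iff[OF z(3) zS] assms(2) z(2) by simp
  then have "(snd y)\<^sup>2 + (snd z)\<^sup>2 + (norm (fst y - fst z))\<^sup>2 < 2 * snd y * snd z * cosh r"
    using pos by (simp add: hquot_def divide_less_eq mult_ac)
  moreover have "2 * snd y * snd z \<le> (snd y)\<^sup>2 + (snd z)\<^sup>2"
    by (rule sum_squares_bound)
  ultimately have "(norm (fst y - fst z))\<^sup>2 \<le> 2 * (snd y * snd z) * (cosh r - 1)"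
    by (simp add: algebra_simps)
  also have "\<dots> \<le> 2 * (a * exp (2 * r) * (a * exp r)) * (cosh r - 1)"
    using pos yb zb assms cosh_real_ge_1[of r]
    by (intro mult_right_mono mult_left_mono mult_mono) auto
  also have "\<dots> = a\<^sup>2 * exp (3 * r) * (2 * (cosh r - 1))"
  proof -
    have "exp (3 * r) = exp (2 * r) * exp r" by (simp add: exp_add[symmetric])
    then show ?thesis by (simp add: power2_eq_square)
  qed
  \<comment> \<open>For r < 1 the quadratic vanishing of cosh r - 1 produces the square of exp (2 r)
    a r, for r >= 1 its exponential growth produces the square of a exp (2 r).\<close>
  also have "\<dots> \<le> (2 powi j)\<^sup>2"
  proof (cases "r < 1")
    case True
    have "2 * (cosh r - 1) \<le> r\<^sup>2 * exp r" using cosh_minus_one_le[of r] assms(2) by simp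
    then have "a\<^sup>2 * exp (3 * r) * (2 * (cosh r - 1)) \<le> a\<^sup>2 * exp (3 * r) * (r\<^sup>2 * exp r)"
      by (intro mult_left_mono) auto
    also have "\<dots> = (exp (2 * r) * a * r)\<^sup>2"
      by (simp add: power2_eq_square exp_add[symmetric])
    also have "\<dots> \<le> (exp 2 * a * r)\<^sup>2"
      using assms(1,2) True by (intro power_mono mult_right_mono) auto
    also have "\<dots> \<le> (2 powi j)\<^sup>2"
      using assms True by (intro power_mono) (auto simp: cz_admissible_def)
    finally show ?thesis .
  next
    case False
    have "exp (- r) \<le> 1" "1 \<le> exp r" using assms(2) by auto
    moreover have "2 * ((Y + X) / 2 - 1) \<le> Y" if "X \<le> 1" for X Y :: real
      using that by (simp add: field_simps)
    ultimately have "2 * (cosh r - 1) \<le> exp r"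
      unfolding cosh_field_def by blast
    then have "a\<^sup>2 * exp (3 * r) * (2 * (cosh r - 1)) \<le> a\<^sup>2 * exp (3 * r) * exp r"
      by (intro mult_left_mono) auto
    also have "\<dots> = (a * exp (2 * r))\<^sup>2"
      by (simp add: power2_eq_square exp_add[symmetric])
    also have "\<dots> \<le> (2 powi j)\<^sup>2"
      using assms False by (intro power_mono) (auto simp: cz_admissible_def)
    finally show ?thesis .
  qed
  finally have n: "norm (fst y - fst z) \<le> 2 powi j"
    by (rule power2_le_imp_le) simp
  have "fst y \<in> cz_triple j k"
    unfolding cz_triple_def mem_box_cart
  proof (intro allI)
    fix i
    have "\<bar>fst y $ i - fst z $ i\<bar> \<le> 2 powi j"
      using component_le_norm_cart[of "fst y - fst z" i] n by simp
    moreover have "of_int (k i) * 2 powi j \<le> fst z $ i" "fst z $ i < (of_int (k i) + 1) * 2 powi j"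
      using z(1) by (auto simp: cz_box_def dyadic_cube_def)
    ultimately show "(\<chi> i. (of_int (k i) - 1) * 2 powi j) $ i \<le> fst y $ i \<and>
        fst y $ i \<le> (\<chi> i. (of_int (k i) + 2) * 2 powi j) $ i"
      by (auto simp: algebra_simps abs_le_iff)
  qed
  then show "y \<in> cz_triple j k \<times> {a * exp (- 2 * r)..<a * exp (2 * r)}"
    using yb by (simp add: mem_Times_iff)
qed

section \<open>Diameters of Calderon-Zygmund sets\<close>

definition cz_dc :: "'n::finite itself \<Rightarrow> real" where
  "cz_dc _ = 20 + real CARD('n) * exp 10"

lemma cz_dc_ge_1: "1 \<le> cz_dc TYPE('n::finite)"
  by (simp add: cz_dc_def)

text \<open>Here the upper bounds of \<open>cz_admissible\<close> enter; \<open>N\<close> stands for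
  the dimension. For r < 1 the quadratic lower bound for cosh d - 1 gives d^2 <= N exp 20 r^2, hence
  the factor exp 10 in \<open>cz_dc\<close>. For r >= 1 the bound exp d <= 2 cosh d gives d <= 2 + N
  + 18 r, hence the summand 20.\<close>

lemma cz_diam_aux:
  fixes N a r L :: real
  assumes "1 \<le> N" "0 < a" "0 < r" "cz_admissible L a r" "0 \<le> d"
    and d: "cosh d - 1 \<le> ((a * exp r - a * exp (- r))\<^sup>2 + N * L\<^sup>2) / (2 * a\<^sup>2 * exp (- 2 * r))"
  shows "d \<le> (20 + N * exp 10) * r"
proof -
  have e: "(a * exp r - a * exp (- r))\<^sup>2 = a\<^sup>2 * (2 * sinh r)\<^sup>2"
  proof -
    have "a * exp r - a * exp (- r) = a * (2 * sinh r)" by (simp add: sinh_field_def algebra_simps)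
    then show ?thesis by (simp only: power_mult_distrib)
  qed
  have D: "x / (2 * a\<^sup>2 * exp (- 2 * r)) = x / a\<^sup>2 * exp (2 * r) / 2" for x :: real
    by (simp add: exp_minus field_simps)
  show ?thesis
  proof (cases "r < 1")
    case True
    have "(2 * sinh r)\<^sup>2 \<le> (2 * (r * exp 1))\<^sup>2"
      using sinh_le_mult_exp[of r] assms(3) True
      by (intro power_mono mult_left_mono) (auto intro: order_trans mult_left_mono)
    also have "\<dots> = 4 * exp 2 * r\<^sup>2" by (simp add: power_mult_distrib exp_double[symmetric])
    finally have 1: "(2 * sinh r)\<^sup>2 \<le> 4 * exp 2 * r\<^sup>2" .
    have "L\<^sup>2 \<le> (exp 8 * a * r)\<^sup>2"
      using assms True by (intro power_mono) (auto simp: cz_admissible_def intro: order_trans[of 0 "exp 2 * a * r"])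
    also have "\<dots> = a\<^sup>2 * (exp 16 * r\<^sup>2)" by (simp add: power_mult_distrib exp_double[symmetric])
    finally have 2: "L\<^sup>2 \<le> a\<^sup>2 * (exp 16 * r\<^sup>2)" .
    have "N * L\<^sup>2 \<le> N * (a\<^sup>2 * (exp 16 * r\<^sup>2))" using 2 assms(1) by (intro mult_left_mono) auto
    moreover have "a\<^sup>2 * (2 * sinh r)\<^sup>2 \<le> a\<^sup>2 * (4 * exp 2 * r\<^sup>2)" using 1 by (intro mult_left_mono) auto
    ultimately have "a\<^sup>2 * (2 * sinh r)\<^sup>2 + N * L\<^sup>2 \<le> a\<^sup>2 * ((4 * exp 2 + N * exp 16) * r\<^sup>2)"
      by (simp add: algebra_simps)
    then have "(a\<^sup>2 * (2 * sinh r)\<^sup>2 + N * L\<^sup>2) / a\<^sup>2 \<le> (4 * exp 2 + N * exp 16) * r\<^sup>2"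
      using assms(2) by (simp add: divide_le_eq mult_ac)
    then have "(a\<^sup>2 * (2 * sinh r)\<^sup>2 + N * L\<^sup>2) / a\<^sup>2 * exp (2 * r) \<le> (4 * exp 2 + N * exp 16) * r\<^sup>2 * exp 2"
      using assms(1) True by (intro mult_mono) auto
    then have "cosh d - 1 \<le> (4 * exp 2 + N * exp 16) * r\<^sup>2 * exp 2 / 2"
      using d divide_right_mono[of _ _ "2::real"] unfolding e D by (meson order_trans zero_le_numeral)
    then have "d\<^sup>2 \<le> (4 * exp 2 + N * exp 16) * r\<^sup>2 * exp 2"
      using cosh_minus_one_ge[OF assms(5)] by linarith
    also have "\<dots> \<le> (N * exp 18) * r\<^sup>2 * exp 2"
    proof (intro mult_right_mono)
      have a1: "4 * exp 2 \<le> (exp 16 :: real)"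
      proof -
        have "(4::real) \<le> exp 14" using exp_ge_power2[of 12 2] by simp
        then have "4 * exp 2 \<le> exp 14 * (exp 2 :: real)" by (intro mult_right_mono) auto
        then show ?thesis by (simp add: exp_add[symmetric])
      qed
      also have "\<dots> \<le> N * exp 16" using assms(1) by simp
      finally have "4 * exp 2 + N * exp 16 \<le> 2 * (N * exp 16)" by simp
      also have "\<dots> \<le> exp 2 * (N * exp 16)"
        using exp_ge_power2[of 1 1] assms(1) by (intro mult_right_mono) auto
      also have "\<dots> = N * exp 18" by (simp add: exp_add[symmetric])
      finally show "4 * exp 2 + N * exp 16 \<le> N * exp 18" .
    qed auto
    also have "\<dots> \<le> (N * exp 10 * r)\<^sup>2"
    proof -
      have "N * 1 \<le> N * N" using assms(1) by (intro mult_left_mono) auto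
      then have "N * (exp 20 * r\<^sup>2) \<le> N * N * (exp 20 * r\<^sup>2)" by (intro mult_right_mono) auto
      then show ?thesis by (simp add: power_mult_distrib exp_double[symmetric] power2_eq_square exp_add[symmetric] mult_ac)
    qed
    finally have "d \<le> N * exp 10 * r"
      by (rule power2_le_imp_le) (use assms in auto)
    then show ?thesis using assms(3) by (simp add: algebra_simps)
  next
    case False
    have "2 * sinh r \<le> exp r" by (simp add: sinh_field_def)
    then have "(2 * sinh r)\<^sup>2 \<le> (exp r)\<^sup>2" using assms(3) by (intro power_mono) auto
    also have "\<dots> \<le> exp (16 * r)" using assms(3) by (simp add: exp_double[symmetric])
    finally have 1: "(2 * sinh r)\<^sup>2 \<le> exp (16 * r)" .
    have "L\<^sup>2 \<le> (a * exp (8 * r))\<^sup>2"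
      using assms False by (intro power_mono) (auto simp: cz_admissible_def intro: order_trans[of 0 "a * exp (2 * r)"])
    also have "\<dots> = a\<^sup>2 * exp (16 * r)" by (simp add: power_mult_distrib exp_double[symmetric])
    finally have 2: "L\<^sup>2 \<le> a\<^sup>2 * exp (16 * r)" .
    have "N * L\<^sup>2 \<le> N * (a\<^sup>2 * exp (16 * r))" using 2 assms(1) by (intro mult_left_mono) auto
    moreover have "a\<^sup>2 * (2 * sinh r)\<^sup>2 \<le> a\<^sup>2 * exp (16 * r)" using 1 by (intro mult_left_mono) auto
    ultimately have "a\<^sup>2 * (2 * sinh r)\<^sup>2 + N * L\<^sup>2 \<le> a\<^sup>2 * ((1 + N) * exp (16 * r))"
      by (simp add: algebra_simps)
    then have "(a\<^sup>2 * (2 * sinh r)\<^sup>2 + N * L\<^sup>2) / a\<^sup>2 \<le> (1 + N) * exp (16 * r)"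
      using assms(2) by (simp add: divide_le_eq mult_ac)
    then have *: "(a\<^sup>2 * (2 * sinh r)\<^sup>2 + N * L\<^sup>2) / a\<^sup>2 * exp (2 * r) \<le> (1 + N) * exp (16 * r) * exp (2 * r)"
      by (intro mult_right_mono) auto
    have c: "cosh d - 1 \<le> (1 + N) * exp (18 * r) / 2"
    proof -
      have "(1 + N) * exp (16 * r) * exp (2 * r) = (1 + N) * exp (18 * r)"
        by (simp add: mult.assoc exp_add[symmetric])
      then show ?thesis
        using d divide_right_mono[of _ _ "2::real"] * unfolding e D by (metis order_trans zero_le_numeral)
    qed
    have "exp d \<le> 2 * cosh d" by (simp add: cosh_field_def)
    also have "\<dots> \<le> (3 + N) * exp (18 * r)"
    proof -
      have "1 \<le> exp (18 * r)" using assms(3) by simp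
      moreover have "2 * C \<le> (3 + N) * E" if "1 \<le> E" "C - 1 \<le> (1 + N) * E / 2" for C E :: real
        using that by (simp add: algebra_simps)
      ultimately show ?thesis using c by blast
    qed
    also have "\<dots> \<le> exp (2 + N) * exp (18 * r)"
      using exp_ge_add_one_self[of "2 + N"] by (intro mult_right_mono) auto
    also have "\<dots> = exp (2 + N + 18 * r)" by (simp add: exp_add[symmetric])
    finally have "d \<le> 2 + N + 18 * r" by simp
    also have "\<dots> \<le> 2 * r + N * exp 10 * r + 18 * r"
    proof -
      have "N \<le> N * exp 10" using assms(1) by simp
      also have "\<dots> \<le> N * exp 10 * r" using False assms(1) by simp
      finally show ?thesis using False by simp
    qed
    also have "\<dots> = (20 + N * exp 10) * r" by (simp add: algebra_simps)
    finally show ?thesis .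
  qed
qed

lemma cz_diam:
  fixes x y :: "('n::finite) pt"
  assumes "R \<in> cz_sets" "x \<in> R" "y \<in> R"
  shows "hdist x y \<le> cz_dc TYPE('n) * cz_radius R"
proof -
  from assms(1) obtain j k a r where *: "R = cz_box j k a r" "0 < a" "0 < r"
    "cz_admissible (2 powi j) a r" "cz_radius R = r" by (rule cz_setsE)
  have xy: "x \<in> S" "y \<in> S" using assms cz_sets_subset_S by blast+
  then have pos: "0 < snd x" "0 < snd y" by (auto simp: S_def)
  have b: "a * exp (- r) \<le> snd x" "snd x < a * exp r" "a * exp (- r) \<le> snd y" "snd y < a * exp r"
    using assms(2,3) by (auto simp: * cz_box_def)
  have "hquot x y - 1 = ((snd x - snd y)\<^sup>2 + (norm (fst x - fst y))\<^sup>2) / (2 * (snd x * snd y))"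
    using pos by (simp add: hquot_def field_simps power2_eq_square)
  also have "\<dots> \<le> ((a * exp r - a * exp (- r))\<^sup>2 + real CARD('n) * (2 powi j)\<^sup>2) / (2 * (a\<^sup>2 * exp (- 2 * r)))"
  proof (intro frac_le add_mono mult_left_mono)
    have "\<bar>snd x - snd y\<bar>\<^sup>2 \<le> (a * exp r - a * exp (- r))\<^sup>2"
      using b by (intro power_mono) auto
    then show "(snd x - snd y)\<^sup>2 \<le> (a * exp r - a * exp (- r))\<^sup>2" by simp
    have "(norm (fst x - fst y))\<^sup>2 = (\<Sum>i\<in>UNIV. ((fst x - fst y) $ i)\<^sup>2)"
      by (simp add: norm_vec_def L2_set_def sum_nonneg)
    also have "\<dots> \<le> (\<Sum>i\<in>(UNIV::'n set). (2 powi j)\<^sup>2)"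
    proof (rule sum_mono)
      fix i
      have "of_int (k i) * 2 powi j \<le> fst x $ i" "fst x $ i < (of_int (k i) + 1) * 2 powi j"
        "of_int (k i) * 2 powi j \<le> fst y $ i" "fst y $ i < (of_int (k i) + 1) * 2 powi j"
        using assms(2,3) by (auto simp: * cz_box_def dyadic_cube_def)
      then have "\<bar>(fst x - fst y) $ i\<bar> \<le> 2 powi j" by (auto simp: algebra_simps abs_le_iff)
      then show "((fst x - fst y) $ i)\<^sup>2 \<le> (2 powi j)\<^sup>2"
        using power_mono[of "\<bar>(fst x - fst y) $ i\<bar>" "2 powi j" 2] by simp
    qed
    finally show "(norm (fst x - fst y))\<^sup>2 \<le> real CARD('n) * (2 powi j)\<^sup>2" by simp
    have "a\<^sup>2 * exp (- 2 * r) = (a * exp (- r)) * (a * exp (- r))"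
      by (simp add: power2_eq_square exp_add[symmetric])
    also have "\<dots> \<le> snd x * snd y" using b *(2) pos by (intro mult_mono) auto
    finally show "a\<^sup>2 * exp (- 2 * r) \<le> snd x * snd y" .
  qed (use *(2) in auto)
  finally have "cosh (hdist x y) - 1 \<le> ((a * exp r - a * exp (- r))\<^sup>2 + real CARD('n) * (2 powi j)\<^sup>2) / (2 * a\<^sup>2 * exp (- 2 * r))"
    using xy by (simp add: cosh_hdist mult.assoc)
  then have "hdist x y \<le> (20 + real CARD('n) * exp 10) * r"
    by (intro cz_diam_aux[of "real CARD('n)" a r "2 powi j"]) (use * hdist_nonneg[OF xy] in \<open>auto simp: Suc_leI\<close>)
  then show ?thesis unfolding cz_dc_def *(5) .
qed

section \<open>The right Haar measure\<close>

lemma S_borel [measurable]: "S \<in> sets borel"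
  using open_S by (rule borel_open)

lemma inverse_snd_borel: "(\<lambda>x::('n::finite) pt. ennreal (1 / snd x)) \<in> borel_measurable borel"
proof -
  have "(\<lambda>x::'n pt. snd x) \<in> borel_measurable borel"
    by (intro borel_measurable_continuous_onI continuous_intros)
  then show ?thesis
    by (intro measurable_compose[OF _ measurable_ennreal] borel_measurable_divide borel_measurable_const)
qed

lemma space_rho [simp]: "space rho = S"
  by (simp add: rho_def space_restrict_space)

lemma sets_rho [measurable_cong]: "sets rho = sets (restrict_space borel S)"
  by (simp add: rho_def cong: sets_restrict_space_cong)

lemma sets_rho_iff: "A \<in> sets rho \<longleftrightarrow> A \<in> sets borel \<and> A \<subseteq> S"
  by (auto simp: sets_rho sets_restrict_space_iff)

lemma nn_integral_rho:
  assumes "f \<in> borel_measurable rho"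
  shows "(\<integral>\<^sup>+x. f x \<partial>rho) = (\<integral>\<^sup>+x. ennreal (1 / snd x) * f x * indicator S x \<partial>lborel)"
proof -
  have [measurable]: "f \<in> borel_measurable (restrict_space lborel S)"
    using assms by (simp add: rho_def)
  have "(\<lambda>x::'a pt. ennreal (1 / snd x)) \<in> borel_measurable lborel" using inverse_snd_borel by simp
  then have [measurable]: "(\<lambda>x::'a pt. ennreal (1 / snd x)) \<in> borel_measurable (restrict_space lborel S)"
    by (rule measurable_restrict_space1)
  show ?thesis
    unfolding rho_def by (subst nn_integral_density) (auto simp: nn_integral_restrict_space)
qed

lemma emeasure_rho:
  assumes "A \<in> sets rho"
  shows "emeasure rho A = (\<integral>\<^sup>+x\<in>A. ennreal (1 / snd x) \<partial>lborel)"
proof -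
  have "emeasure rho A = (\<integral>\<^sup>+x. indicator A x \<partial>rho)" using assms by simp
  also have "\<dots> = (\<integral>\<^sup>+x. ennreal (1 / snd x) * indicator A x * indicator S x \<partial>lborel)"
    by (rule nn_integral_rho) (use assms in simp)
  also have "\<dots> = (\<integral>\<^sup>+x\<in>A. ennreal (1 / snd x) \<partial>lborel)"
    using assms by (intro nn_integral_cong) (auto simp: sets_rho_iff split: split_indicator)
  finally show ?thesis .
qed

interpretation rho: sigma_finite_measure "rho :: ('n::finite) pt measure"
proof -
  interpret sigma_finite_measure "restrict_space lborel (S :: 'n pt set)"
    by (rule sigma_finite_measure_restrict_space) (auto intro: lborel.sigma_finite_measure_axioms)
  have "(\<lambda>x::'n pt. ennreal (1 / snd x)) \<in> borel_measurable lborel" using inverse_snd_borel by simp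
  then have "(\<lambda>x::'n pt. ennreal (1 / snd x)) \<in> borel_measurable (restrict_space lborel S)"
    by (rule measurable_restrict_space1)
  then show "sigma_finite_measure (rho :: 'n pt measure)"
    unfolding rho_def by (simp add: sigma_finite_iff_density_finite)
qed

interpretation rho_pair: pair_sigma_finite "rho :: ('n::finite) pt measure" "rho :: 'n pt measure" ..

lemma emeasure_rho_singleton [simp]: "emeasure rho {x} = 0"
proof (cases "x \<in> S")
  case True
  then have "emeasure rho {x} = (\<integral>\<^sup>+z\<in>{x}. ennreal (1 / snd z) \<partial>lborel)"
    by (intro emeasure_rho) (auto simp: sets_rho_iff)
  also have "\<dots> = 0" by simp
  finally show ?thesis .
next
  case False
  then show ?thesis by (intro emeasure_notin_sets) (auto simp: sets_rho_iff)
qed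

lemma nn_integral_inverse_Ico:
  assumes "0 < b" "b \<le> c"
  shows "(\<integral>\<^sup>+t\<in>{b..<c}. ennreal (1 / t) \<partial>lborel) = ennreal (ln c - ln b)"
proof -
  have "(\<integral>\<^sup>+t\<in>{b..<c}. ennreal (1 / t) \<partial>lborel) = (\<integral>\<^sup>+t\<in>{b..c}. ennreal (1 / t) \<partial>lborel)"
    by (intro nn_integral_cong_AE) (use AE_lborel_singleton[of c] in \<open>auto split: split_indicator\<close>)
  also have "\<dots> = ennreal (ln c - ln b)"
    by (rule nn_integral_FTC_Icc) (use assms in \<open>auto intro!: derivative_eq_intros simp: inverse_eq_divide\<close>)
  finally show ?thesis .
qed

text \<open>In the coordinate ln t the factor dt / t of \<open>rho\<close> is Lebesgue measure, so
  second factors are measured by their logarithmic length.\<close>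

lemma emeasure_rho_Times:
  fixes A :: "(real ^ 'n::finite) set"
  assumes A: "A \<in> sets borel" and bc: "0 < b" "b \<le> c"
  shows "A \<times> {b..<c} \<in> sets rho" "emeasure rho (A \<times> {b..<c}) = emeasure lborel A * ennreal (ln c - ln b)"
proof -
  show *: "A \<times> {b..<c} \<in> sets rho"
    using assms by (auto simp: sets_rho_iff S_def intro!: borel_Times)
  have "emeasure rho (A \<times> {b..<c}) = (\<integral>\<^sup>+z\<in>A \<times> {b..<c}. ennreal (1 / snd z) \<partial>lborel)"
    by (rule emeasure_rho[OF *])
  also have "\<dots> = (\<integral>\<^sup>+z. (\<lambda>(x, t). indicator A x * (ennreal (1 / t) * indicator {b..<c} t)) z \<partial>(lborel \<Otimes>\<^sub>M lborel))"
    unfolding lborel_prod by (intro nn_integral_cong) (auto simp: indicator_def)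
  also have "\<dots> = (\<integral>\<^sup>+x. (\<integral>\<^sup>+t. indicator A x * (ennreal (1 / t) * indicator {b..<c} t) \<partial>lborel) \<partial>lborel)"
    by (subst lborel.nn_integral_fst[symmetric]) (use A in \<open>auto simp: split_beta'\<close>)
  also have "\<dots> = (\<integral>\<^sup>+x. indicator A x * ennreal (ln c - ln b) \<partial>lborel)"
    by (subst nn_integral_cmult) (auto simp: nn_integral_inverse_Ico[OF bc])
  also have "\<dots> = emeasure lborel A * ennreal (ln c - ln b)"
    using A by (subst nn_integral_multc) auto
  finally show "emeasure rho (A \<times> {b..<c}) = emeasure lborel A * ennreal (ln c - ln b)" .
qed

lemma dyadic_cube_borel [measurable]: "dyadic_cube j k \<in> sets borel"
proof -
  have "dyadic_cube j k = (\<Inter>i. {x. of_int (k i) * 2 powi j \<le> x $ i} \<inter> {x. x $ i < (of_int (k i) + 1) * 2 powi j})"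
    by (auto simp: dyadic_cube_def)
  also have "\<dots> \<in> sets borel"
    by (intro sets.countable_INT'' sets.Int borel_closed borel_open open_Collect_less closed_Collect_le continuous_intros) auto
  finally show ?thesis .
qed

lemma emeasure_lborel_cbox_vec:
  fixes l u :: "real ^ 'n::finite"
  assumes "\<And>i. u $ i - l $ i = s" "0 \<le> s"
  shows "emeasure lborel (cbox l u) = ennreal (s ^ CARD('n))"
proof -
  have "emeasure lborel (cbox l u) = ennreal (\<Prod>b\<in>Basis. (u - l) \<bullet> b)"
  proof (rule emeasure_lborel_cbox)
    fix b :: "real ^ 'n" assume "b \<in> Basis"
    then obtain i where "b = axis i 1" by (auto simp: Basis_vec_def)
    then show "l \<bullet> b \<le> u \<bullet> b" using assms(1)[of i] assms(2) by (simp add: inner_axis)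
  qed
  also have "(\<Prod>b\<in>Basis. (u - l) \<bullet> b) = (\<Prod>b\<in>(Basis :: (real ^ 'n) set). s)"
  proof (rule prod.cong[OF refl])
    fix b :: "real ^ 'n" assume "b \<in> Basis"
    then obtain i where "b = axis i 1" by (auto simp: Basis_vec_def)
    then show "(u - l) \<bullet> b = s" using assms(1)[of i] by (simp add: inner_axis)
  qed
  finally show ?thesis by simp
qed

lemma emeasure_dyadic_cube:
  fixes k :: "'n::finite \<Rightarrow> int"
  shows "emeasure lborel (dyadic_cube j k) = ennreal ((2 powi j) ^ CARD('n))"
proof -
  define l :: "real ^ 'n" where "l = (\<chi> i. of_int (k i) * 2 powi j)"
  define u :: "real ^ 'n" where "u = (\<chi> i. (of_int (k i) + 1) * 2 powi j)"
  have c: "emeasure lborel (cbox l u) = ennreal ((2 powi j) ^ CARD('n))"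
    by (rule emeasure_lborel_cbox_vec) (auto simp: l_def u_def algebra_simps)
  have lu: "\<And>b. b \<in> Basis \<Longrightarrow> l \<bullet> b \<le> u \<bullet> b"
    by (auto simp: Basis_vec_def inner_axis l_def u_def)
  have "emeasure lborel (box l u) = emeasure lborel (cbox l u)"
    using lu by (simp add: emeasure_lborel_box emeasure_lborel_cbox)
  moreover have "emeasure lborel (box l u) \<le> emeasure lborel (dyadic_cube j k)"
    by (rule emeasure_mono) (simp_all add: subset_iff mem_box_cart dyadic_cube_def l_def u_def less_imp_le)
  moreover have "emeasure lborel (dyadic_cube j k) \<le> emeasure lborel (cbox l u)"
    by (rule emeasure_mono) (simp_all add: subset_iff mem_box_cart dyadic_cube_def l_def u_def less_imp_le)
  ultimately show ?thesis using c by simp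
qed

lemma emeasure_cz_triple:
  fixes k :: "'n::finite \<Rightarrow> int"
  shows "emeasure lborel (cz_triple j k) = ennreal (3 ^ CARD('n) * (2 powi j) ^ CARD('n))"
proof -
  have "emeasure lborel (cz_triple j k) = ennreal ((3 * 2 powi j) ^ CARD('n))"
    unfolding cz_triple_def by (rule emeasure_lborel_cbox_vec) (auto simp: algebra_simps)
  then show ?thesis by (simp add: power_mult_distrib)
qed

lemma cz_box_sets_rho: "0 < a \<Longrightarrow> cz_box j k a r \<in> sets rho"
  using cz_box_subset_S[of a j k r] by (auto simp: sets_rho_iff cz_box_def intro!: borel_Times)

lemma emeasure_cz_box:
  fixes k :: "'n::finite \<Rightarrow> int"
  assumes "0 < a" "0 < r"
  shows "emeasure rho (cz_box j k a r) = ennreal (2 * r * (2 powi j) ^ CARD('n))"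
proof -
  have "emeasure rho (cz_box j k a r) =
      emeasure lborel (dyadic_cube j k) * ennreal (ln (a * exp r) - ln (a * exp (- r)))"
    unfolding cz_box_def by (rule emeasure_rho_Times(2)) (use assms in auto)
  also have "ln (a * exp r) - ln (a * exp (- r)) = 2 * r"
    using assms by (simp add: ln_mult)
  finally show ?thesis
    using assms by (simp add: emeasure_dyadic_cube ennreal_mult[symmetric] mult_ac)
qed

lemma cz_sets_rho: "R \<in> cz_sets \<Longrightarrow> R \<in> sets rho"
  by (elim cz_setsE) (simp add: cz_box_sets_rho)

lemma emeasure_cz_pos: "R \<in> cz_sets \<Longrightarrow> 0 < emeasure rho R"
  by (elim cz_setsE) (simp add: emeasure_cz_box)

lemma emeasure_cz_finite: "R \<in> cz_sets \<Longrightarrow> emeasure rho R < \<infinity>"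
  by (elim cz_setsE) (simp add: emeasure_cz_box)

lemma cz_star_sets_rho: "R \<in> cz_sets \<Longrightarrow> cz_star R \<in> sets rho"
  using open_cz_star cz_star_subset_S by (auto simp: sets_rho_iff)

text \<open>The power of 3 comes from \<open>cz_triple\<close>, the factor 2 from the logarithmic
  height, which grows from 2 r to at most 4 r.\<close>

definition cz_cs :: "'n::finite itself \<Rightarrow> real" where
  "cz_cs _ = 2 * 3 ^ CARD('n)"

lemma cz_cs_ge_1: "1 \<le> cz_cs TYPE('n::finite)"
proof -
  have "1 * 1 \<le> 2 * (3::real) ^ CARD('n)" by (intro mult_mono) auto
  then show ?thesis by (simp add: cz_cs_def)
qed

lemma emeasure_cz_star:
  fixes R :: "('n::finite) pt set"
  assumes "R \<in> cz_sets"
  shows "emeasure rho (cz_star R) \<le> ennreal (cz_cs TYPE('n)) * emeasure rho R"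
proof -
  from assms obtain j k a r where *: "R = cz_box j k a r" "0 < a" "0 < r"
    "cz_admissible (2 powi j) a r" "cz_radius R = r" by (rule cz_setsE)
  have m: "cz_triple j k \<in> sets borel" by (simp add: cz_triple_def)
  have l: "0 < a * exp (- 2 * r)" "a * exp (- 2 * r) \<le> a * exp (2 * r)" using *(2,3) by auto
  have "emeasure rho (cz_star R) \<le> emeasure rho (cz_triple j k \<times> {a * exp (- 2 * r)..<a * exp (2 * r)})"
    unfolding *(1) by (intro emeasure_mono cz_star_subset * emeasure_rho_Times m l)
  also have "\<dots> = ennreal (3 ^ CARD('n) * (2 powi j) ^ CARD('n)) * ennreal (4 * r)"
    unfolding emeasure_rho_Times(2)[OF m l] emeasure_cz_triple using *(2) by (simp add: ln_mult)
  also have "\<dots> = ennreal (cz_cs TYPE('n)) * emeasure rho R"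
    using *(2,3) by (simp add: *(1) emeasure_cz_box cz_cs_def ennreal_mult[symmetric] mult_ac)
  finally show ?thesis .
qed

section \<open>Exhaustion of \<open>S\<close> by relatively compact boxes\<close>

definition hbox :: "nat \<Rightarrow> ('n::finite) pt set" where
  "hbox m = ball 0 (real m) \<times> {1 / (real m + 1)<..<real m + 1}"

lemma open_hbox: "open (hbox m)"
  unfolding hbox_def by (intro open_Times) auto

lemma hbox_subset_S: "hbox m \<subseteq> S"
  by (auto simp: hbox_def S_def intro: less_trans[of 0 "1 / (real m + 1)"])

lemma hbox_sets_rho [measurable]: "hbox m \<in> sets rho"
  using borel_open[OF open_hbox] hbox_subset_S by (auto simp: sets_rho_iff)

lemma hbox_mono: "m \<le> m' \<Longrightarrow> hbox m \<subseteq> hbox m'"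
proof -
  assume "m \<le> m'"
  then have "1 / (real m' + 1) \<le> 1 / (real m + 1)" by (simp add: frac_le)
  then show ?thesis using \<open>m \<le> m'\<close> by (auto simp: hbox_def)
qed

lemma hbox_UN: "(\<Union>m. hbox m) = (S :: ('n::finite) pt set)"
proof
  show "(S :: 'n pt set) \<subseteq> (\<Union>m. hbox m)"
  proof
    fix x :: "'n pt" assume "x \<in> S"
    then have p: "0 < snd x" by (simp add: S_def)
    obtain m :: nat where m: "norm (fst x) + snd x + 1 / snd x < real m"
      using reals_Archimedean2 by blast
    have "0 < 1 / snd x" using p by simp
    then have "1 / snd x < real m + 1" using m p norm_ge_zero[of "fst x"] by linarith
    then have "1 / (real m + 1) < snd x" using p by (simp add: field_simps)
    moreover have "norm (fst x) < real m" "snd x < real m + 1"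
      using m p \<open>0 < 1 / snd x\<close> norm_ge_zero[of "fst x"] by linarith+
    ultimately have "x \<in> hbox m" by (simp add: hbox_def mem_Times_iff)
    then show "x \<in> (\<Union>m. hbox m)" by blast
  qed
qed (use hbox_subset_S in blast)

lemma emeasure_hbox: "emeasure rho (hbox m :: ('n::finite) pt set) < \<infinity>"
proof -
  have b: "ball 0 (real m) \<in> sets (borel :: (real ^ 'n) measure)" by simp
  have l: "0 < 1 / (real m + 1)" "1 / (real m + 1) \<le> real m + 1"
    by (auto simp: divide_le_eq algebra_simps)
  have "emeasure rho (hbox m :: 'n pt set) \<le> emeasure rho (ball (0 :: real ^ 'n) (real m) \<times> {1 / (real m + 1)..<real m + 1})"
    by (intro emeasure_mono emeasure_rho_Times(1)[OF b l]) (auto simp: hbox_def)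
  also have "\<dots> = emeasure lborel (ball (0 :: real ^ 'n) (real m)) * ennreal (ln (real m + 1) - ln (1 / (real m + 1)))"
    by (rule emeasure_rho_Times(2)[OF b l])
  also have "\<dots> < \<infinity>"
    using emeasure_bounded_finite[OF bounded_ball, of "0 :: real ^ 'n" "real m"]
    by (simp add: ennreal_mult_less_top)
  finally show ?thesis .
qed

lemma compact_subset_hbox:
  assumes "compact C" "C \<subseteq> S"
  obtains m where "C \<subseteq> hbox m"
proof -
  obtain D where D: "D \<subseteq> range hbox" "finite D" "C \<subseteq> \<Union>D"
  proof (rule compactE[OF assms(1), of "range hbox"])
    show "C \<subseteq> \<Union>(range hbox)" using assms(2) hbox_UN by blast
  qed (use open_hbox in auto)
  then obtain I where I: "finite I" "D = hbox ` I" by (meson finite_subset_image)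
  have "C \<subseteq> hbox (Max (insert 0 I))"
  proof
    fix x assume "x \<in> C"
    then obtain i where i: "i \<in> I" "x \<in> hbox i" using D I by blast
    then have "i \<le> Max (insert 0 I)" using I by simp
    then show "x \<in> hbox (Max (insert 0 I))" using i hbox_mono by blast
  qed
  then show thesis by (rule that)
qed

lemma emeasure_rho_compact:
  assumes "compact C" "C \<subseteq> S"
  shows "emeasure rho C < \<infinity>"
proof -
  obtain m where "C \<subseteq> hbox m" using assms by (rule compact_subset_hbox)
  then show ?thesis
    by (rule order_le_less_trans[OF emeasure_mono[OF _ hbox_sets_rho] emeasure_hbox])
qed

text \<open>\<open>rho\<close> is infinite and lives on the subspace \<open>S\<close>. Its trace on
  \<open>hbox m\<close>, written as a density of \<open>lborel\<close>, is a finite Borel measure on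
  the whole type and so outer regular. The open set found is then cut back to
  \<open>hbox m\<close>.\<close>

lemma rho_outer_regular:
  fixes A :: "('n::finite) pt set"
  assumes A: "A \<in> sets rho" "A \<subseteq> hbox m" and e: "0 < e"
  obtains U where "open U" "A \<subseteq> U" "U \<subseteq> S" "emeasure rho U < emeasure rho A + ennreal e"
proof -
  define \<nu> where "\<nu> = density (lborel :: 'n pt measure) (\<lambda>x. ennreal (1 / snd x) * indicator (hbox m) x)"
  have [measurable]: "hbox m \<in> sets (borel :: 'n pt measure)" by (rule borel_open[OF open_hbox])
  have nu: "emeasure \<nu> B = emeasure rho (B \<inter> hbox m)" if B: "B \<in> sets borel" for B
  proof -
    have "B \<inter> hbox m \<in> sets rho" using B hbox_subset_S by (auto simp: sets_rho_iff)
    then have "emeasure rho (B \<inter> hbox m) = (\<integral>\<^sup>+x\<in>B \<inter> hbox m. ennreal (1 / snd x) \<partial>lborel)"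
      by (rule emeasure_rho)
    also have "\<dots> = emeasure \<nu> B"
      unfolding \<nu>_def using B by (subst emeasure_density) (auto intro!: borel_measurable_times_ennreal inverse_snd_borel nn_integral_cong split: split_indicator)
    finally show ?thesis ..
  qed
  have Ab: "A \<in> sets borel" using A by (simp add: sets_rho_iff)
  have s: "sets \<nu> = sets borel" by (simp add: \<nu>_def)
  have f: "emeasure \<nu> (space \<nu>) \<noteq> \<infinity>"
    using nu[of UNIV] emeasure_hbox[where 'n = 'n, of m] by (simp add: \<nu>_def less_top)
  have AA: "A \<inter> hbox m = A" using A by blast
  have "emeasure \<nu> A = (INF U\<in>{U. A \<subseteq> U \<and> open U}. emeasure \<nu> U)"
    by (rule outer_regular[OF s f]) (use Ab in auto)
  moreover have "emeasure \<nu> A < emeasure \<nu> A + ennreal e"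
  proof -
    have "emeasure \<nu> A < \<infinity>"
      unfolding nu[OF Ab] AA by (rule order_le_less_trans[OF emeasure_mono[OF A(2) hbox_sets_rho] emeasure_hbox])
    then show ?thesis
      using e by (cases "emeasure \<nu> A") (auto simp: ennreal_plus[symmetric] ennreal_less_iff simp del: ennreal_plus)
  qed
  ultimately obtain U where U: "A \<subseteq> U" "open U" "emeasure \<nu> U < emeasure \<nu> A + ennreal e"
    by (auto simp: INF_less_iff)
  have "emeasure rho (U \<inter> hbox m) < emeasure rho A + ennreal e"
    using U nu[of U] nu[OF Ab] AA by simp
  then show thesis
    using that[of "U \<inter> hbox m"] U A(2) hbox_subset_S open_hbox by blast
qed

section \<open>A dyadic system of Calderon-Zygmund sets\<close>

text \<open>In the coordinate \<open>ln t\<close> the second factors are the dyadic intervals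
  \<open>[m 2\<^sup>i, (m + 1) 2\<^sup>i)\<close>. The smallest dyadic side length that is admissible over such an interval is
  monotone under passing to the parent interval, so that the boxes whose side length lies between the
  smallest one for the interval and the smallest one for its parent form a nested family.\<close>

definition dy_a :: "int \<Rightarrow> int \<Rightarrow> real" where
  "dy_a i m = exp ((of_int m + 1 / 2) * 2 powi i)"

definition dy_r :: "int \<Rightarrow> real" where
  "dy_r i = 2 powi i / 2"

definition dy_ell :: "int \<Rightarrow> int \<Rightarrow> int" where
  "dy_ell i m = \<lceil>log 2 (cz_lo (dy_a i m) (dy_r i))\<rceil>"

type_synonym 'n dyi = "int \<times> ('n \<Rightarrow> int) \<times> int \<times> int"

definition dy_idx :: "('n::finite) dyi set" where
  "dy_idx = {(j, k, i, m). dy_ell i m \<le> j \<and> j \<le> dy_ell (i + 1) (m div 2)}"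

fun dy_box :: "('n::finite) dyi \<Rightarrow> 'n pt set" where
  "dy_box (j, k, i, m) = cz_box j k (dy_a i m) (dy_r i)"

text \<open>Passing to the parent raises exactly one of the two exponents by 1, so the sum counts
  generations.\<close>

fun dy_ht :: "('n::finite) dyi \<Rightarrow> int" where
  "dy_ht (j, k, i, m) = i + j"

lemma dy_pos [simp]: "0 < dy_a i m" "0 < dy_r i"
  by (simp_all add: dy_a_def dy_r_def)

text \<open>In logarithmic scale the centre of an interval lies at distance exactly
  \<open>dy_r i\<close> from the centre of its parent, on one side or the other.\<close>

lemma dy_parent_a:
  "dy_a i m \<le> dy_a (i + 1) (m div 2) * exp (dy_r i)" "dy_a (i + 1) (m div 2) \<le> dy_a i m * exp (dy_r i)"
proof -
  define P :: real where "P = 2 powi i"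
  have p: "2 powi (i + 1) = 2 * P" by (simp add: P_def power_int_add_1')
  have "m = 2 * (m div 2) \<or> m = 2 * (m div 2) + 1" by presburger
  then consider "m = 2 * (m div 2)" | "m = 2 * (m div 2) + 1" by blast
  then have "(of_int m + 1 / 2) * 2 powi i - (of_int (m div 2) + 1 / 2) * 2 powi (i + 1) \<in> {- dy_r i, dy_r i}"
  proof cases
    case 1
    then have "real_of_int m = 2 * of_int (m div 2)" by linarith
    then show ?thesis unfolding p dy_r_def P_def[symmetric] by (simp add: field_simps)
  next
    case 2
    then have "real_of_int m = 2 * of_int (m div 2) + 1" by linarith
    then show ?thesis unfolding p dy_r_def P_def[symmetric] by (simp add: field_simps)
  qed
  moreover have "0 < dy_r i" by simp
  moreover have "x \<le> y + r \<and> y \<le> x + r" if "x - y \<in> {- r, r}" "0 < r" for x y r :: real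
    using that by auto
  ultimately have "(of_int m + 1 / 2) * 2 powi i \<le> (of_int (m div 2) + 1 / 2) * 2 powi (i + 1) + dy_r i"
    "(of_int (m div 2) + 1 / 2) * 2 powi (i + 1) \<le> (of_int m + 1 / 2) * 2 powi i + dy_r i"
    by blast+
  then show "dy_a i m \<le> dy_a (i + 1) (m div 2) * exp (dy_r i)"
    "dy_a (i + 1) (m div 2) \<le> dy_a i m * exp (dy_r i)"
    unfolding dy_a_def exp_add[symmetric] by simp_all
qed

lemma dy_parent_r: "dy_r (i + 1) = 2 * dy_r i"
  by (simp add: dy_r_def power_int_add_1')

text \<open>A parent interval has twice the logarithmic half-length, and its centre is lower by a
  factor exp r at worst. This loss is made up by the factor 2 for r < 1/2 and by the doubled
  exponent for r >= 1; the middle case straddles the two branches of \<open>cz_lo\<close>.\<close>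

lemma cz_lo_double:
  assumes "0 < a" "0 < a'" "0 < r" "a \<le> a' * exp r"
  shows "cz_lo a r \<le> cz_lo a' (2 * r)"
proof -
  consider "r < 1 / 2" | "1 / 2 \<le> r" "r < 1" | "1 \<le> r" by linarith
  then show ?thesis
  proof cases
    case 1
    have "exp r \<le> 2"
    proof (rule power2_le_imp_le)
      have "(exp r)\<^sup>2 \<le> exp 1" using 1 by (simp add: exp_double[symmetric])
      also have "\<dots> \<le> 2\<^sup>2" using exp_le by simp
      finally show "(exp r)\<^sup>2 \<le> 2\<^sup>2" .
    qed simp
    then have "a' * exp r \<le> a' * 2" using assms by (intro mult_left_mono) auto
    then have "a * r \<le> a' * 2 * r" using assms(3) order_trans[OF assms(4)] by (intro mult_right_mono) auto
    then have "exp 2 * (a * r) \<le> exp 2 * (a' * 2 * r)" by (intro mult_left_mono) auto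
    then show ?thesis using 1 by (simp add: cz_lo_def mult_ac)
  next
    case 2
    have "r \<le> exp (r - 1)" using exp_ge_add_one_self[of "r - 1"] by simp
    then have "a * r \<le> a' * exp r * exp (r - 1)" using assms by (intro mult_mono) auto
    then have "exp 2 * (a * r) \<le> exp 2 * (a' * exp r * exp (r - 1))" by (intro mult_left_mono) auto
    also have "\<dots> = a' * exp (2 * r + 1)"
    proof -
      have "exp (2 * r + 1) = exp 2 * (exp r * exp (r - 1))" by (simp add: exp_add[symmetric])
      then show ?thesis by (simp only: mult_ac)
    qed
    also have "\<dots> \<le> a' * exp (4 * r)" using assms 2 by simp
    finally show ?thesis using 2 by (simp add: cz_lo_def mult_ac)
  next
    case 3
    have "a * exp (2 * r) \<le> a' * exp r * exp (2 * r)" using assms by (intro mult_right_mono) auto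
    also have "\<dots> = a' * exp (3 * r)" by (simp add: exp_add[symmetric])
    also have "\<dots> \<le> a' * exp (4 * r)" using assms by simp
    finally show ?thesis using 3 by (simp add: cz_lo_def)
  qed
qed

text \<open>The smallest dyadic side over the parent interval, being less than twice the lower bound
  there, is still admissible over the child. This rests on the wide gap between the factors exp 2
  and exp 8, and it makes all sides between the two thresholds in \<open>dy_idx\<close>
  admissible.\<close>

lemma cz_lo_double_hi:
  assumes "0 < a" "0 < a'" "0 < r" "a' \<le> a * exp r"
  shows "2 * cz_lo a' (2 * r) \<le> cz_hi a r"
proof -
  have e: "(4::real) \<le> exp 3" using exp_ge_power2[of 1 2] by simp
  consider "r < 1 / 2" | "1 / 2 \<le> r" "r < 1" | "1 \<le> r" by linarith
  then show ?thesis
  proof cases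
    case 1
    have "4 * (a' * r) \<le> exp 3 * (a * exp r * r)"
      using e assms by (intro mult_mono) auto
    also have "\<dots> = exp (3 + r) * (a * r)" by (simp add: exp_add[symmetric])
    also have "\<dots> \<le> exp 6 * (a * r)" using 1 assms by (intro mult_right_mono) auto
    finally have "exp 2 * (4 * (a' * r)) \<le> exp 2 * (exp 6 * (a * r))" by (intro mult_left_mono) auto
    also have "\<dots> = exp 8 * (a * r)"
    proof -
      have "exp 2 * exp 6 = (exp 8 :: real)" by (simp add: exp_add[symmetric])
      then show ?thesis by (simp flip: mult.assoc)
    qed
    finally show ?thesis using 1 by (simp add: cz_lo_def cz_hi_def mult_ac)
  next
    case 2
    have "2 * (a' * exp (4 * r)) \<le> 2 * (a * exp r * exp (4 * r))" using assms by simp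
    also have "\<dots> = 2 * (a * exp (5 * r))" by (simp add: exp_add[symmetric])
    also have "\<dots> \<le> 2 * (a * exp 5)" using assms 2 by simp
    also have "\<dots> \<le> a * (exp 8 * r)"
    proof -
      have "2 * exp 5 \<le> 4 * (r * exp (5::real))" using 2 by simp
      also have "\<dots> \<le> exp 3 * (r * exp (5::real))" using e assms by (intro mult_right_mono) auto
      also have "\<dots> = exp 8 * r" by (simp add: exp_add[symmetric])
      finally have "a * (2 * exp 5) \<le> a * (exp 8 * r)" using assms by (intro mult_left_mono) auto
      then show ?thesis by simp
    qed
    finally show ?thesis using 2 by (simp add: cz_lo_def cz_hi_def mult_ac)
  next
    case 3
    have "2 * (a' * exp (4 * r)) \<le> 2 * (a * exp r * exp (4 * r))" using assms by simp
    also have "\<dots> = a * (2 * exp (5 * r))" by (simp add: exp_add[symmetric])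
    also have "\<dots> \<le> a * (exp 3 * exp (5 * r))" using assms e by simp
    also have "\<dots> \<le> a * exp (8 * r)" using assms 3 by (simp add: exp_add[symmetric])
    finally show ?thesis using 3 by (simp add: cz_lo_def cz_hi_def)
  qed
qed

lemma dy_ell_mono: "dy_ell i m \<le> dy_ell (i + 1) (m div 2)"
  unfolding dy_ell_def dy_parent_r
  by (intro ceiling_mono log_mono cz_lo_double dy_parent_a cz_lo_pos) auto

lemma dy_idx_admissible:
  assumes "(j, k, i, m) \<in> dy_idx"
  shows "cz_admissible (2 powi j) (dy_a i m) (dy_r i)"
proof -
  have j: "dy_ell i m \<le> j" "j \<le> dy_ell (i + 1) (m div 2)" using assms by (auto simp: dy_idx_def)
  have "cz_lo (dy_a i m) (dy_r i) \<le> 2 powi dy_ell i m"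
    unfolding dy_ell_def by (intro powi_ceiling_log cz_lo_pos) auto
  also have "\<dots> \<le> 2 powi j" using j by (simp add: powi_2_le_iff)
  finally have 1: "cz_lo (dy_a i m) (dy_r i) \<le> 2 powi j" .
  have "2 powi j \<le> (2 powi dy_ell (i + 1) (m div 2) :: real)" using j by (simp add: powi_2_le_iff)
  also have "\<dots> < 2 * cz_lo (dy_a (i + 1) (m div 2)) (2 * dy_r i)"
    unfolding dy_ell_def dy_parent_r by (intro powi_ceiling_log cz_lo_pos) auto
  also have "\<dots> \<le> cz_hi (dy_a i m) (dy_r i)"
    by (intro cz_lo_double_hi dy_parent_a) auto
  finally show ?thesis using 1 by (simp add: cz_admissible_iff)
qed

lemma dy_box_cz: "t \<in> dy_idx \<Longrightarrow> dy_box t \<in> cz_sets"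
  by (cases t) (auto intro!: cz_setsI dy_idx_admissible)

lemma mem_dy_box:
  "x \<in> dy_box (j, k, i, m) \<longleftrightarrow> fst x \<in> dyadic_cube j k \<and> 0 < snd x \<and>
     of_int m * 2 powi i \<le> ln (snd x) \<and> ln (snd x) < (of_int m + 1) * 2 powi i"
proof -
  have 1: "dy_a i m * exp (- dy_r i) = exp (of_int m * 2 powi i)"
    unfolding dy_a_def dy_r_def exp_add[symmetric] by (simp add: algebra_simps)
  have 2: "dy_a i m * exp (dy_r i) = exp ((of_int m + 1) * 2 powi i)"
    unfolding dy_a_def dy_r_def exp_add[symmetric] by (simp add: algebra_simps)
  have "(exp (of_int m * 2 powi i) \<le> snd x \<and> snd x < exp ((of_int m + 1) * 2 powi i)) \<longleftrightarrow>
     0 < snd x \<and> of_int m * 2 powi i \<le> ln (snd x) \<and> ln (snd x) < (of_int m + 1) * 2 powi i"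
  proof (cases "0 < snd x")
    case True
    then show ?thesis by (simp add: ln_ge_iff flip: not_le)
  next
    case False
    then show ?thesis using less_le_trans[OF exp_gt_zero] by blast
  qed
  then show ?thesis
    unfolding dy_box.simps cz_box_def 1 2 by (auto simp: mem_Times_iff)
qed

definition dy_m :: "real \<Rightarrow> int \<Rightarrow> int" where
  "dy_m u i = \<lfloor>u / 2 powi i\<rfloor>"

lemma dy_m_eq: "of_int m * 2 powi i \<le> u \<Longrightarrow> u < (of_int m + 1) * 2 powi i \<Longrightarrow> m = dy_m u i"
  unfolding dy_m_def by (rule dyadic_interval_unique[OF _ _ dyadic_interval_ex])

lemma dy_m_parent: "dy_m u (i + 1) = dy_m u i div 2"
proof -
  have p: "2 powi (i + 1) = 2 powi i * (2::real)" by (simp add: power_int_add_1')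
  show ?thesis
    unfolding dy_m_def p using floor_divide_real_eq_div[of 2 "u / 2 powi i"] by simp
qed

text \<open>The intervals around a fixed \<open>u\<close> form a chain of parents, along which the
  threshold \<open>dy_ell\<close> can only grow.\<close>

lemma dy_ell_chain_mono:
  assumes "i \<le> i'"
  shows "dy_ell i (dy_m u i) \<le> dy_ell i' (dy_m u i')"
  using assms
proof (induction i' rule: int_ge_induct)
  case (step i')
  then show ?case using dy_ell_mono[of i' "dy_m u i'"] by (simp add: dy_m_parent)
qed simp

lemma mem_dy_idx_box:
  assumes "x \<in> dy_box (j, k, i, m)" "(j, k, i, m) \<in> dy_idx"
  shows "m = dy_m (ln (snd x)) i" "dy_ell i (dy_m (ln (snd x)) i) \<le> j"
    "j \<le> dy_ell (i + 1) (dy_m (ln (snd x)) (i + 1))"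
proof -
  show m: "m = dy_m (ln (snd x)) i"
    using assms(1) dy_m_eq by (auto simp only: mem_dy_box)
  show "dy_ell i (dy_m (ln (snd x)) i) \<le> j" "j \<le> dy_ell (i + 1) (dy_m (ln (snd x)) (i + 1))"
    using assms(2) unfolding dy_m_parent m[symmetric] by (auto simp: dy_idx_def)
qed

text \<open>Write e(i) for the threshold \<open>dy_ell\<close> of the interval of scale
  \<open>i\<close> around ln (snd x). A box of scale \<open>i\<close> through \<open>x\<close> has
  e(i) <= j <= e(i + 1), and e is nondecreasing. So i < i' forces j <= j', while i > i' would force
  j' <= j and contradict the assumption on the heights.\<close>

lemma dy_nested_aux:
  assumes "(j, k, i, m) \<in> dy_idx" "(j', k', i', m') \<in> dy_idx"
    "x \<in> dy_box (j, k, i, m)" "x \<in> dy_box (j', k', i', m')" "i + j \<le> i' + j'"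
  shows "i \<le> i' \<and> j \<le> j'"
proof -
  note 1 = mem_dy_idx_box[OF assms(3,1)] and 2 = mem_dy_idx_box[OF assms(4,2)]
  consider "i = i'" | "i + 1 \<le> i'" | "i' + 1 \<le> i" by linarith
  then show ?thesis
  proof cases
    case 2
    then show ?thesis using 1 \<open>dy_ell i' _ \<le> j'\<close> dy_ell_chain_mono[OF 2, of "ln (snd x)"] by linarith
  next
    case 3
    then show ?thesis using 1 2 dy_ell_chain_mono[OF 3, of "ln (snd x)"] assms(5) by linarith
  qed (use assms(5) in auto)
qed

lemma dy_nested:
  assumes "s \<in> dy_idx" "t \<in> dy_idx" "dy_box s \<inter> dy_box t \<noteq> {}" "dy_ht s \<le> dy_ht t"
  shows "dy_box s \<subseteq> dy_box t"
proof -
  obtain j k i m where s: "s = (j, k, i, m)" by (cases s)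
  obtain j' k' i' m' where t: "t = (j', k', i', m')" by (cases t)
  obtain x where x: "x \<in> dy_box s" "x \<in> dy_box t" using assms(3) by blast
  have le: "i \<le> i'" "j \<le> j'"
    using dy_nested_aux[of j k i m j' k' i' m' x] assms x by (auto simp: s t simp del: dy_box.simps)
  have "dyadic_cube j k \<subseteq> dyadic_cube j' k'"
    using dyadic_cube_nested[OF le(2)] x unfolding s t mem_dy_box by blast
  moreover have "of_int m' * 2 powi i' \<le> (of_int m * 2 powi i :: real)"
    "(of_int m + 1) * 2 powi i \<le> (of_int m' + 1) * (2 powi i' :: real)"
    by (rule dyadic_interval_nested[OF le(1), of m "ln (snd x)" m']; use x in \<open>simp add: s t mem_dy_box del: dy_box.simps\<close>)+
  ultimately show ?thesis
    unfolding s t subset_iff mem_dy_box by force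
qed

lemma dy_unique:
  assumes "s \<in> dy_idx" "t \<in> dy_idx" "dy_box s \<inter> dy_box t \<noteq> {}" "dy_ht s = dy_ht t"
  shows "s = t"
proof -
  obtain j k i m where s: "s = (j, k, i, m)" by (cases s)
  obtain j' k' i' m' where t: "t = (j', k', i', m')" by (cases t)
  obtain x where x: "x \<in> dy_box s" "x \<in> dy_box t" using assms(3) by blast
  have eq: "i = i'" "j = j'"
    using dy_nested_aux[of j k i m j' k' i' m' x] dy_nested_aux[of j' k' i' m' j k i m x] assms x
    by (auto simp: s t simp del: dy_box.simps)
  have "m = m'" using mem_dy_idx_box(1)[of x] x assms(1,2) eq unfolding s t by metis
  moreover have "k = k'" using dyadic_cube_unique x eq unfolding s t mem_dy_box by blast
  ultimately show ?thesis using eq s t by simp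
qed

lemma emeasure_dy_box:
  "emeasure rho (dy_box (j, k, i, m) :: ('n::finite) pt set) = ennreal (2 powi i * (2 powi j) ^ CARD('n))"
  by (simp add: emeasure_cz_box dy_r_def)

text \<open>While the side is below the threshold of the parent interval, the parent doubles the
  side of the base and multiplies the measure by 2 to the dimension. At the threshold it doubles the
  logarithmic interval instead. Enlarging one scale at a time in this way keeps the box
  admissible.\<close>

lemma dy_parent:
  fixes t :: "('n::finite) dyi"
  assumes "t \<in> dy_idx"
  obtains s where "s \<in> dy_idx" "dy_box t \<subseteq> dy_box s" "dy_ht s = dy_ht t + 1"
    "emeasure rho (dy_box s) \<le> 2 ^ CARD('n) * emeasure rho (dy_box t)"
proof -
  obtain j k i m where t: "t = (j, k, i, m)" by (cases t)
  have idx: "dy_ell i m \<le> j" "j \<le> dy_ell (i + 1) (m div 2)" using assms by (auto simp: t dy_idx_def)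
  have ne: "dy_box t \<noteq> {}" using dy_box_cz[OF assms] by (rule cz_sets_nonempty)
  obtain x where x: "x \<in> dy_box t" using ne by blast
  have card: "0 < CARD('n)" by simp
  show thesis
  proof (cases "j < dy_ell (i + 1) (m div 2)")
    case True
    obtain k' where k': "fst x \<in> dyadic_cube (j + 1) k'" using dyadic_cube_ex by blast
    define s where "s = (j + 1, k', i, m)"
    have s: "s \<in> dy_idx" using True idx by (auto simp: s_def dy_idx_def)
    have xs: "x \<in> dy_box s" using x k' unfolding s_def t mem_dy_box by blast
    have sub: "dy_box t \<subseteq> dy_box s" by (rule dy_nested[OF assms s]) (use x xs in \<open>auto simp: s_def t\<close>)
    have "emeasure rho (dy_box s) = ennreal (2 ^ CARD('n) * (2 powi i * (2 powi j) ^ CARD('n)))"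
      unfolding s_def emeasure_dy_box by (simp add: power_int_add_1' power_mult_distrib mult_ac)
    also have "\<dots> = 2 ^ CARD('n) * emeasure rho (dy_box t)"
      unfolding t emeasure_dy_box by (simp add: ennreal_mult ennreal_power flip: ennreal_numeral)
    finally show thesis using that[OF s sub] by (simp add: s_def t)
  next
    case False
    then have j: "j = dy_ell (i + 1) (m div 2)" using idx by simp
    define s where "s = (j, k, i + 1, m div 2)"
    have s: "s \<in> dy_idx" using dy_ell_mono[of "i + 1" "m div 2"] by (simp add: s_def dy_idx_def j)
    have m: "m = dy_m (ln (snd x)) i"
      using mem_dy_idx_box(1)[of x] x assms unfolding t by blast
    have xs: "x \<in> dy_box s"
      using x dyadic_interval_ex[of "ln (snd x)" "i + 1"] dy_m_parent[of "ln (snd x)" i]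
      unfolding s_def t mem_dy_box m by (simp add: dy_m_def)
    have sub: "dy_box t \<subseteq> dy_box s" by (rule dy_nested[OF assms s]) (use x xs in \<open>auto simp: s_def t\<close>)
    have "emeasure rho (dy_box s) = ennreal (2 * (2 powi i * (2 powi j) ^ CARD('n)))"
      unfolding s_def emeasure_dy_box by (simp add: power_int_add_1' mult_ac)
    also have "\<dots> = 2 * emeasure rho (dy_box t)"
      unfolding t emeasure_dy_box by (simp add: ennreal_mult)
    also have "\<dots> \<le> 2 ^ CARD('n) * emeasure rho (dy_box t)"
    proof (intro mult_right_mono)
      have "(2::ennreal) ^ 1 \<le> 2 ^ CARD('n)" by (intro power_increasing) (use card in linarith, simp)
      then show "(2::ennreal) \<le> 2 ^ CARD('n)" by simp
    qed simp
    finally show thesis using that[OF s sub] by (simp add: s_def t)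
  qed
qed

text \<open>Each generation at least doubles the measure. This is what bounds ascending chains in a
  family of boxes of bounded measure.\<close>

lemma emeasure_dy_box_growth:
  fixes s t :: "('n::finite) dyi"
  assumes "s \<in> dy_idx" "t \<in> dy_idx" "dy_box s \<subseteq> dy_box t" "dy_ht s \<le> dy_ht t"
  shows "2 ^ nat (dy_ht t - dy_ht s) * emeasure rho (dy_box s) \<le> emeasure rho (dy_box t)"
proof -
  obtain j k i m where s: "s = (j, k, i, m)" by (cases s)
  obtain j' k' i' m' where t: "t = (j', k', i', m')" by (cases t)
  obtain x where x: "x \<in> dy_box s" "x \<in> dy_box t"
    using cz_sets_nonempty[OF dy_box_cz[OF assms(1)]] assms(3) by blast
  have le: "i \<le> i'" "j \<le> j'"
    using dy_nested_aux[of j k i m j' k' i' m' x] assms x by (auto simp: s t simp del: dy_box.simps)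
  define p q where "p = nat (i' - i)" and "q = nat (j' - j)"
  have pi: "i' = i + int p" and qj: "j' = j + int q" using le by (auto simp: p_def q_def)
  have n: "nat (dy_ht t - dy_ht s) = p + q" by (simp add: s t pi qj)
  have "(2::real) ^ q \<le> (2 ^ q) ^ CARD('n)" by (rule self_le_power) auto
  then have "2 ^ (p + q) * (2 powi i * (2 powi j) ^ CARD('n)) \<le>
      2 ^ p * (2 ^ q) ^ CARD('n) * (2 powi i * (2 powi j) ^ CARD('n) :: real)"
    unfolding power_add by (intro mult_right_mono mult_left_mono) auto
  also have "\<dots> = 2 powi i' * (2 powi j') ^ CARD('n)"
    by (simp add: pi qj power_int_add power_mult_distrib)
  finally show ?thesis
    unfolding n unfolding s t emeasure_dy_box
    by (simp add: ennreal_mult[symmetric] ennreal_power flip: ennreal_numeral)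
qed

section \<open>Small boxes around a point\<close>

lemma dist_eq_hdist:
  assumes "x \<in> S" "y \<in> S"
  shows "(dist x y)\<^sup>2 = 2 * snd x * snd y * (cosh (hdist x y) - 1)"
proof -
  have "0 < snd x" "0 < snd y" using assms by (auto simp: S_def)
  moreover have D: "(dist x y)\<^sup>2 = (norm (fst x - fst y))\<^sup>2 + (snd x - snd y)\<^sup>2"
    by (simp add: dist_prod_def dist_norm)
  ultimately show ?thesis
    unfolding D using assms by (simp add: cosh_hdist hquot_def field_simps power2_eq_square)
qed

lemma dist_le_hdist:
  assumes "x \<in> S" "y \<in> S" "hdist x y \<le> 1"
  shows "dist x y \<le> exp 1 * snd x * hdist x y"
proof (rule power2_le_imp_le)
  define d where "d = hdist x y"
  have pos: "0 < snd x" "0 < snd y" using assms by (auto simp: S_def)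
  have d: "0 \<le> d" "d \<le> 1" using assms hdist_nonneg[OF assms(1,2)] by (auto simp: d_def)
  have "ln (snd y) \<le> ln (snd x) + 1" using hdist_ge_ln[OF assms(1,2)] assms(3) by linarith
  then have "exp (ln (snd y)) \<le> exp (ln (snd x) + 1)" by (simp only: exp_le_cancel_iff)
  then have y: "snd y \<le> snd x * exp 1" using pos by (simp add: exp_add)
  have "(dist x y)\<^sup>2 = 2 * snd x * snd y * (cosh d - 1)"
    unfolding d_def by (rule dist_eq_hdist[OF assms(1,2)])
  also have "\<dots> \<le> 2 * snd x * (snd x * exp 1) * (d\<^sup>2 * exp 1 / 2)"
  proof (intro mult_mono)
    have "cosh d - 1 \<le> d\<^sup>2 * exp d / 2" using cosh_minus_one_le[OF d(1)] .
    also have "\<dots> \<le> d\<^sup>2 * exp 1 / 2" using d by (intro divide_right_mono mult_left_mono) auto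
    finally show "cosh d - 1 \<le> d\<^sup>2 * exp 1 / 2" .
  qed (use pos y cosh_real_ge_1 in auto)
  also have "\<dots> = (exp 1 * snd x * d)\<^sup>2" by (simp add: power2_eq_square)
  finally show "(dist x y)\<^sup>2 \<le> (exp 1 * snd x * hdist x y)\<^sup>2" by (simp add: d_def)
next
  show "0 \<le> exp 1 * snd x * hdist x y"
    using assms(1) hdist_nonneg[OF assms(1,2)] by (simp add: S_def)
qed

lemma dy_small:
  fixes x :: "('n::finite) pt"
  assumes "open U" "x \<in> U" "x \<in> S"
  obtains t where "t \<in> dy_idx" "x \<in> dy_box t" "dy_box t \<subseteq> U"
proof -
  obtain e where e: "0 < e" "ball x e \<subseteq> U" using assms(1,2) openE by blast
  have xp: "0 < snd x" using assms by (simp add: S_def)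
  define c where "c = cz_dc TYPE('n)"
  have c: "1 \<le> c" by (simp add: c_def cz_dc_ge_1)
  \<comment> \<open>A box of radius below \<open>e'\<close> has hyperbolic diameter at most 1, so
    that \<open>dist_le_hdist\<close> applies, and its points then have Euclidean distance at most e
    / 2 from \<open>x\<close>.\<close>
  define e' where "e' = min 1 (e / (2 * exp 1 * snd x)) / c"
  have "0 < e'" using e xp c by (simp add: e'_def)
  then obtain N where N: "(1 / 2) ^ N < e'" using real_arch_pow_inv[of e' "1 / 2"] by auto
  define i where "i = - int N"
  have r: "dy_r i < e'" using N \<open>0 < e'\<close> by (simp add: dy_r_def i_def power_int_minus power_one_over inverse_eq_divide)
  define m where "m = dy_m (ln (snd x)) i"
  define j where "j = dy_ell i m"
  obtain k where k: "fst x \<in> dyadic_cube j k" using dyadic_cube_ex by blast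
  define t where "t = (j, k, i, m)"
  have t: "t \<in> dy_idx" using dy_ell_mono[of i m] by (simp add: t_def dy_idx_def j_def)
  have xt: "x \<in> dy_box t"
    using k xp dyadic_interval_ex[of "ln (snd x)" i] unfolding t_def mem_dy_box m_def dy_m_def by simp
  have rad: "cz_radius (dy_box t) = dy_r i"
    using cz_radius_cz_box[OF dy_pos(1) dy_pos(2) dy_idx_admissible] t by (simp add: t_def)
  have "dy_box t \<subseteq> ball x e"
  proof
    fix y assume y: "y \<in> dy_box t"
    have yS: "y \<in> S" using y cz_sets_subset_S[OF dy_box_cz[OF t]] by blast
    have "hdist x y \<le> c * dy_r i"
      using cz_diam[OF dy_box_cz[OF t] xt y] by (simp add: c_def rad)
    also have "\<dots> \<le> c * e'" using r c by (intro mult_left_mono) auto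
    also have "\<dots> = min 1 (e / (2 * exp 1 * snd x))" using c by (simp add: e'_def)
    finally have h: "hdist x y \<le> 1" "hdist x y \<le> e / (2 * exp 1 * snd x)" by auto
    have "dist x y \<le> exp 1 * snd x * hdist x y" by (rule dist_le_hdist[OF assms(3) yS h(1)])
    also have "\<dots> \<le> exp 1 * snd x * (e / (2 * exp 1 * snd x))" using h xp by (intro mult_left_mono) auto
    also have "\<dots> < e" using e xp by (simp add: field_simps)
    finally show "y \<in> ball x e" by simp
  qed
  then show thesis using that[OF t xt] e by blast
qed

section \<open>Calderon-Zygmund decomposition\<close>

lemma nn_integral_UN_countable:
  assumes "countable I" "disjoint_family_on X I" "\<And>i. i \<in> I \<Longrightarrow> X i \<in> sets M" "F \<in> borel_measurable M"
  shows "(\<integral>\<^sup>+x\<in>(\<Union>i\<in>I. X i). F x \<partial>M) = (\<integral>\<^sup>+i. (\<integral>\<^sup>+x\<in>X i. F x \<partial>M) \<partial>count_space I)"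
proof -
  have U: "(\<Union>i\<in>I. X i) \<in> sets M" using assms by auto
  have "(\<integral>\<^sup>+x\<in>(\<Union>i\<in>I. X i). F x \<partial>M) = emeasure (density M F) (\<Union>i\<in>I. X i)"
    by (rule emeasure_density[symmetric, OF assms(4) U])
  also have "\<dots> = (\<integral>\<^sup>+i. emeasure (density M F) (X i) \<partial>count_space I)"
    by (rule emeasure_UN_countable) (use assms in auto)
  also have "\<dots> = (\<integral>\<^sup>+i. (\<integral>\<^sup>+x\<in>X i. F x \<partial>M) \<partial>count_space I)"
    by (intro nn_integral_cong) (use assms in \<open>simp add: emeasure_density\<close>)
  finally show ?thesis .
qed

lemma nn_integral_UN_le:
  assumes "countable I" "disjoint_family_on X I" "\<And>i. i \<in> I \<Longrightarrow> X i \<in> sets M"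
    "F \<in> borel_measurable M" "G \<in> borel_measurable M"
    "\<And>i. i \<in> I \<Longrightarrow> (\<integral>\<^sup>+x\<in>X i. F x \<partial>M) \<le> c * (\<integral>\<^sup>+x\<in>X i. G x \<partial>M)"
  shows "(\<integral>\<^sup>+x\<in>(\<Union>i\<in>I. X i). F x \<partial>M) \<le> c * (\<integral>\<^sup>+x\<in>(\<Union>i\<in>I. X i). G x \<partial>M)"
proof -
  have "(\<integral>\<^sup>+x\<in>(\<Union>i\<in>I. X i). F x \<partial>M) = (\<integral>\<^sup>+i. (\<integral>\<^sup>+x\<in>X i. F x \<partial>M) \<partial>count_space I)"
    by (rule nn_integral_UN_countable) (use assms in auto)
  also have "\<dots> \<le> (\<integral>\<^sup>+i. c * (\<integral>\<^sup>+x\<in>X i. G x \<partial>M) \<partial>count_space I)"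
    by (intro nn_integral_mono) (use assms in auto)
  also have "\<dots> = c * (\<integral>\<^sup>+i. (\<integral>\<^sup>+x\<in>X i. G x \<partial>M) \<partial>count_space I)"
    by (intro nn_integral_cmult) auto
  also have "(\<integral>\<^sup>+i. (\<integral>\<^sup>+x\<in>X i. G x \<partial>M) \<partial>count_space I) = (\<integral>\<^sup>+x\<in>(\<Union>i\<in>I. X i). G x \<partial>M)"
    by (rule nn_integral_UN_countable[symmetric]) (use assms in auto)
  finally show ?thesis .
qed

lemma emeasure_eq_nn_integral_one: "A \<in> sets M \<Longrightarrow> (\<integral>\<^sup>+x\<in>A. 1 \<partial>M) = emeasure M A"
  by simp

lemma countable_dyi: "countable (A :: ('n::finite) dyi set)"
  by (rule countableI_type)

text \<open>\<open>F\<close> collects the boxes of \<open>Q\<close> that are highest among all boxes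
  of \<open>Q\<close> meeting them. Two members of \<open>F\<close> that meet have equal height and
  coincide by \<open>dy_unique\<close>. Above a given box of \<open>Q\<close> the growth of measure
  and the bound \<open>b\<close> leave only finitely many heights, so a highest box exists.\<close>

lemma dy_maximal:
  fixes Q :: "('n::finite) dyi set"
  assumes Q: "Q \<subseteq> dy_idx" and b: "\<And>t. t \<in> Q \<Longrightarrow> emeasure rho (dy_box t) \<le> b" and fin: "b < \<infinity>"
  obtains F where "F \<subseteq> Q" "disjoint_family_on dy_box F" "\<And>t. t \<in> Q \<Longrightarrow> \<exists>s\<in>F. dy_box t \<subseteq> dy_box s"
    "\<And>s t. s \<in> F \<Longrightarrow> t \<in> Q \<Longrightarrow> dy_box s \<inter> dy_box t \<noteq> {} \<Longrightarrow> dy_ht t \<le> dy_ht s"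
proof
  define F where "F = {s \<in> Q. \<forall>t\<in>Q. dy_box s \<inter> dy_box t \<noteq> {} \<longrightarrow> dy_ht t \<le> dy_ht s}"
  show "F \<subseteq> Q" by (auto simp: F_def)
  show "disjoint_family_on dy_box F"
    unfolding disjoint_family_on_def
  proof (intro ballI impI, rule ccontr)
    fix s t assume st: "s \<in> F" "t \<in> F" "s \<noteq> t" "dy_box s \<inter> dy_box t \<noteq> {}"
    then have "dy_ht s = dy_ht t" by (force simp: F_def Int_commute)
    then show False using dy_unique[of s t] st Q by (auto simp: F_def)
  qed
  show "dy_ht t \<le> dy_ht s" if "s \<in> F" "t \<in> Q" "dy_box s \<inter> dy_box t \<noteq> {}" for s t
    using that by (auto simp: F_def)
  show "\<exists>s\<in>F. dy_box t \<subseteq> dy_box s" if t: "t \<in> Q" for t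
  proof -
    have tc: "dy_box t \<in> cz_sets" using t Q dy_box_cz by blast
    define c where "c = emeasure rho (dy_box t)"
    have c: "0 < c" "c < \<infinity>" unfolding c_def by (rule emeasure_cz_pos[OF tc], rule emeasure_cz_finite[OF tc])
    define P where "P n \<longleftrightarrow> (\<exists>s\<in>Q. dy_box t \<subseteq> dy_box s \<and> dy_ht s = dy_ht t + int n)" for n
    obtain N :: nat where N: "b / c < of_nat N"
      using fin c by (metis ennreal_Ex_less_of_nat ennreal_divide_eq_top_iff infinity_ennreal_def less_top not_gr_zero order_less_irrefl)
    have "n \<le> N" if Pn: "P n" for n
    proof -
      obtain s where s: "s \<in> Q" "dy_box t \<subseteq> dy_box s" "dy_ht s = dy_ht t + int n"
        using Pn unfolding P_def by blast
      have "2 ^ n * c \<le> b"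
        using emeasure_dy_box_growth[of t s] b[OF s(1)] s t Q by (auto simp: c_def intro: order_trans)
      then have "2 ^ n * c / c \<le> b / c" by (intro divide_right_mono_ennreal)
      then have "2 ^ n \<le> b / c" using c by (simp add: ennreal_mult_divide_eq less_top)
      then have "(2::ennreal) ^ n < of_nat N" using N by (rule le_less_trans)
      then have "(of_nat (2 ^ n) :: ennreal) < of_nat N" by simp
      then have "2 ^ n < N" by (simp only: of_nat_less_iff)
      then show ?thesis using less_exp[of n] by linarith
    qed
    moreover have "P 0" unfolding P_def using t by auto
    ultimately obtain n where n: "P n" "\<And>m. P m \<Longrightarrow> m \<le> n"
      using Nat.ex_has_greatest_nat[of P 0 N] by blast
    then obtain s where s: "s \<in> Q" "dy_box t \<subseteq> dy_box s" "dy_ht s = dy_ht t + int n"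
      unfolding P_def by blast
    have "dy_ht u \<le> dy_ht s" if u: "u \<in> Q" "dy_box s \<inter> dy_box u \<noteq> {}" for u
    proof (rule ccontr)
      assume "\<not> dy_ht u \<le> dy_ht s"
      then have "dy_ht s \<le> dy_ht u" by simp
      then have "dy_box s \<subseteq> dy_box u" using dy_nested u s(1) Q by blast
      then have "P (nat (dy_ht u - dy_ht t))"
        unfolding P_def using u s \<open>\<not> dy_ht u \<le> dy_ht s\<close> by (intro bexI[of _ u]) auto
      then show False using n(2) s(3) \<open>\<not> dy_ht u \<le> dy_ht s\<close> by force
    qed
    then have "s \<in> F" using s(1) by (auto simp: F_def)
    then show ?thesis using s by blast
  qed
qed

text \<open>A one-sided differentiation theorem without a maximal function. Maximal boxes inside an
  open set \<open>U\<close> slightly larger than \<open>A\<close> are disjoint and cover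
  \<open>A\<close>, and their averages are at most \<open>l\<close>, so that (l + d) rho(A) <= l
  rho(U). For \<open>U\<close> close enough to \<open>A\<close> this forces rho(A) = 0.\<close>

lemma dy_differentiation:
  fixes F :: "('n::finite) pt \<Rightarrow> ennreal"
  assumes F [measurable]: "F \<in> borel_measurable rho" and l: "0 < l"
    and A: "A \<in> sets rho" "A \<subseteq> hbox p"
    and gt: "\<And>x. x \<in> A \<Longrightarrow> ennreal (l + d) \<le> F x" and d: "0 < d"
    and avg: "\<And>x t. x \<in> A \<Longrightarrow> t \<in> dy_idx \<Longrightarrow> x \<in> dy_box t \<Longrightarrow>
      (\<integral>\<^sup>+y\<in>dy_box t. F y \<partial>rho) \<le> ennreal l * emeasure rho (dy_box t)"
  shows "emeasure rho A = 0"
proof (rule ccontr)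
  assume "emeasure rho A \<noteq> 0"
  moreover have "emeasure rho A < \<infinity>"
    by (rule order_le_less_trans[OF emeasure_mono[OF A(2) hbox_sets_rho] emeasure_hbox])
  ultimately obtain a where a: "emeasure rho A = ennreal a" "0 < a"
    by (cases "emeasure rho A") (auto simp: ennreal_eq_0_iff less_le)
  \<comment> \<open>This makes l e equal to d a / 2, against the inequality d a <= l e reached at
    the end.\<close>
  define e where "e = d * a / (2 * l)"
  have e: "0 < e" using d a l by (simp add: e_def)
  obtain U where U: "open U" "A \<subseteq> U" "U \<subseteq> S" "emeasure rho U < emeasure rho A + ennreal e"
    by (rule rho_outer_regular[OF A e])
  have Um: "U \<in> sets rho" using U by (simp add: sets_rho_iff)
  have "emeasure rho A + ennreal e < \<infinity>" by (simp add: a(1))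
  with U(4) have Ufin: "emeasure rho U < \<infinity>" by (rule order_less_trans)
  define Q where "Q = {t \<in> dy_idx. dy_box t \<subseteq> U \<and> dy_box t \<inter> A \<noteq> {}}"
  have Qidx: "Q \<subseteq> dy_idx" by (auto simp: Q_def)
  have Qb: "emeasure rho (dy_box t) \<le> emeasure rho U" if "t \<in> Q" for t
    using that by (intro emeasure_mono Um) (auto simp: Q_def)
  obtain G where G: "G \<subseteq> Q" "disjoint_family_on dy_box G" "\<And>t. t \<in> Q \<Longrightarrow> \<exists>s\<in>G. dy_box t \<subseteq> dy_box s"
    using dy_maximal[OF Qidx Qb Ufin] by metis
  have Gm: "dy_box t \<in> sets rho" if "t \<in> G" for t
    using that G(1) Qidx dy_box_cz cz_sets_rho by blast
  have cov: "A \<subseteq> (\<Union>t\<in>G. dy_box t)"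
  proof
    fix x assume x: "x \<in> A"
    then have "x \<in> U" "x \<in> S" using U by auto
    then obtain t where "t \<in> dy_idx" "x \<in> dy_box t" "dy_box t \<subseteq> U" by (rule dy_small[OF U(1)])
    then show "x \<in> (\<Union>t\<in>G. dy_box t)" using G(3)[of t] x by (auto simp: Q_def)
  qed
  have "ennreal (l + d) * emeasure rho A = (\<integral>\<^sup>+x\<in>A. ennreal (l + d) \<partial>rho)"
    using A by (simp add: nn_integral_cmult_indicator)
  also have "\<dots> \<le> (\<integral>\<^sup>+x\<in>(\<Union>t\<in>G. dy_box t). F x \<partial>rho)"
    using gt cov by (intro nn_integral_mono) (auto split: split_indicator)
  also have "\<dots> \<le> ennreal l * (\<integral>\<^sup>+x\<in>(\<Union>t\<in>G. dy_box t). 1 \<partial>rho)"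
  proof (rule nn_integral_UN_le[OF countable_dyi G(2)])
    fix t assume t: "t \<in> G"
    then show "dy_box t \<in> sets rho" by (rule Gm)
    from t have "t \<in> Q" using G(1) by blast
    then obtain x where "x \<in> A" "x \<in> dy_box t" "t \<in> dy_idx" unfolding Q_def by blast
    then show "(\<integral>\<^sup>+x\<in>dy_box t. F x \<partial>rho) \<le> ennreal l * (\<integral>\<^sup>+x\<in>dy_box t. 1 \<partial>rho)"
      using avg Gm[OF t] by simp
  qed auto
  also have "\<dots> \<le> ennreal l * emeasure rho U"
  proof (intro mult_left_mono)
    have "(\<Union>t\<in>G. dy_box t) \<in> sets rho" using Gm by (intro sets.countable_UN'' countable_dyi) auto
    moreover have "(\<Union>t\<in>G. dy_box t) \<subseteq> U" using G(1) by (auto simp: Q_def)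
    ultimately show "(\<integral>\<^sup>+x\<in>(\<Union>t\<in>G. dy_box t). 1 \<partial>rho) \<le> emeasure rho U"
      using Um by (simp add: emeasure_mono)
  qed simp
  also have "\<dots> \<le> ennreal l * (ennreal a + ennreal e)"
    using U(4) a by (intro mult_left_mono) auto
  finally have "ennreal ((l + d) * a) \<le> ennreal (l * (a + e))"
    using a l d e by (simp add: ennreal_mult ennreal_plus)
  then have "(l + d) * a \<le> l * (a + e)" using a l e by (subst (asm) ennreal_le_iff) auto
  then have "d * a \<le> l * e" by (simp add: algebra_simps)
  also have "l * e = d * a / 2" using l by (simp add: e_def)
  finally have "d * a \<le> d * a / 2" .
  then show False using d a by simp
qed

text \<open>\<open>Q\<close> holds the boxes with average above \<open>l\<close>. Their measure is
  at most the integral of \<open>F\<close> divided by \<open>l\<close>, so maximal ones exist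
  although \<open>rho\<close> is infinite. The parent of a maximal box is no longer in
  \<open>Q\<close> and serves as \<open>P\<close>. A point outside all maximal boxes sees only
  averages up to \<open>l\<close>, and differentiation gives the last claim.\<close>

lemma cz_decomposition:
  fixes F :: "('n::finite) pt \<Rightarrow> ennreal"
  assumes F [measurable]: "F \<in> borel_measurable rho" and fin: "(\<integral>\<^sup>+x. F x \<partial>rho) < \<infinity>" and l: "0 < l"
  obtains G where "countable G" "G \<subseteq> cz_sets" "disjoint G"
    "\<And>R. R \<in> G \<Longrightarrow> ennreal l * emeasure rho R \<le> (\<integral>\<^sup>+x\<in>R. F x \<partial>rho)"
    "\<And>R. R \<in> G \<Longrightarrow> \<exists>P\<in>cz_sets. R \<subseteq> P \<and> emeasure rho P \<le> 2 ^ CARD('n) * emeasure rho R \<and>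
        (\<integral>\<^sup>+x\<in>P. F x \<partial>rho) \<le> ennreal l * emeasure rho P"
    "AE x in rho. x \<notin> \<Union>G \<longrightarrow> F x \<le> ennreal l"
proof -
  define Q where "Q = {t \<in> dy_idx. ennreal l * emeasure rho (dy_box t) < (\<integral>\<^sup>+x\<in>dy_box t. F x \<partial>rho)}"
  have Qidx: "Q \<subseteq> dy_idx" by (auto simp: Q_def)
  define b where "b = (\<integral>\<^sup>+x. F x \<partial>rho) / ennreal l"
  have bfin: "b < \<infinity>" using fin l by (simp add: b_def ennreal_divide_eq_top_iff less_top[symmetric])
  have Qb: "emeasure rho (dy_box t) \<le> b" if "t \<in> Q" for t
  proof -
    have "ennreal l * emeasure rho (dy_box t) \<le> (\<integral>\<^sup>+x\<in>dy_box t. F x \<partial>rho)"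
      using that by (auto simp: Q_def less_imp_le)
    also have "\<dots> \<le> (\<integral>\<^sup>+x. F x \<partial>rho)" by (intro nn_integral_mono) (auto split: split_indicator)
    finally have "ennreal l * emeasure rho (dy_box t) / ennreal l \<le> b"
      unfolding b_def by (rule divide_right_mono_ennreal)
    then show ?thesis using l by (simp add: mult.commute[of "ennreal l"] ennreal_mult_divide_eq)
  qed
  obtain G where G: "G \<subseteq> Q" "disjoint_family_on dy_box G" "\<And>t. t \<in> Q \<Longrightarrow> \<exists>s\<in>G. dy_box t \<subseteq> dy_box s"
    "\<And>s t. s \<in> G \<Longrightarrow> t \<in> Q \<Longrightarrow> dy_box s \<inter> dy_box t \<noteq> {} \<Longrightarrow> dy_ht t \<le> dy_ht s"
    using dy_maximal[OF Qidx Qb bfin] by metis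
  have Gidx: "G \<subseteq> dy_idx" using G(1) Qidx by blast
  define W where "W = \<Union>(dy_box ` G)"
  have Wm [measurable]: "W \<in> sets rho"
    unfolding W_def using Gidx dy_box_cz cz_sets_rho by (intro sets.countable_UN'' countable_dyi) blast+
  have avg: "(\<integral>\<^sup>+y\<in>dy_box t. F y \<partial>rho) \<le> ennreal l * emeasure rho (dy_box t)"
    if "t \<in> dy_idx" "x \<in> dy_box t" "x \<notin> W" for x t
  proof (rule ccontr)
    assume "\<not> ?thesis"
    then have "t \<in> Q" using that by (auto simp: Q_def)
    then show False using G(3)[of t] that unfolding W_def by blast
  qed
  have ae: "AE x in rho. x \<notin> W \<longrightarrow> F x \<le> ennreal l"
  proof -
    \<comment> \<open>The exceptional set is split into countably many pieces, each inside one
      \<open>hbox\<close> and with a definite excess over \<open>l\<close>, as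
      \<open>dy_differentiation\<close> requires.\<close>
    define A where "A p q = {x \<in> hbox p. x \<notin> W \<and> ennreal (l + 1 / Suc q) \<le> F x}" for p q :: nat
    have Am: "A p q \<in> sets rho" for p q
    proof -
      have "{x \<in> space rho. x \<notin> W \<and> ennreal (l + 1 / Suc q) \<le> F x} \<in> sets rho" by measurable
      then have "hbox p \<inter> {x \<in> space rho. x \<notin> W \<and> ennreal (l + 1 / Suc q) \<le> F x} \<in> sets rho" by auto
      also have "hbox p \<inter> {x \<in> space rho. x \<notin> W \<and> ennreal (l + 1 / Suc q) \<le> F x} = A p q"
        using hbox_subset_S by (auto simp: A_def)
      finally show ?thesis .
    qed
    have "emeasure rho (A p q) = 0" for p q
      by (rule dy_differentiation[OF F l Am, of p q p "1 / Suc q"]) (auto simp: A_def intro: avg)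
    then have "A p q \<in> null_sets rho" for p q using Am by auto
    then have N: "(\<Union>p. \<Union>q. A p q) \<in> null_sets rho" by auto
    show ?thesis
    proof (rule AE_I'[OF N], rule subsetI)
      fix x assume "x \<in> {x \<in> space rho. \<not> (x \<notin> W \<longrightarrow> F x \<le> ennreal l)}"
      then have x: "x \<in> space rho" "x \<notin> W" "\<not> F x \<le> ennreal l" by blast+
      then have "x \<in> (\<Union>p. hbox p)" by (simp add: hbox_UN)
      then obtain p where p: "x \<in> hbox p" by blast
      obtain c where c: "l < c" "ennreal c < F x"
      proof -
        have "ennreal l < F x" using x by simp
        then obtain y where y: "ennreal l < y" "y < F x" using dense by blast
        then obtain c where "y = ennreal c" "0 \<le> c" by (cases y) auto
        then show thesis using that[of c] y l by (auto simp: ennreal_less_iff)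
      qed
      obtain q where q: "1 / Suc q < c - l"
        using c reals_Archimedean[of "c - l"] by (auto simp: inverse_eq_divide)
      have "ennreal (l + 1 / Suc q) \<le> ennreal c" using q by (intro ennreal_leI) simp
      then have "x \<in> A p q" using p x c by (auto simp: A_def)
      then show "x \<in> (\<Union>p. \<Union>q. A p q)" by blast
    qed
  qed
  show thesis
  proof (rule that[of "dy_box ` G"])
    show "countable (dy_box ` G)" by (intro countable_image countable_dyi)
    show "dy_box ` G \<subseteq> cz_sets" using Gidx dy_box_cz by blast
    show "disjoint (dy_box ` G)" using G(2) by (rule disjoint_family_on_disjoint_image)
    show "AE x in rho. x \<notin> \<Union> (dy_box ` G) \<longrightarrow> F x \<le> ennreal l" using ae by (simp add: W_def)
    show "ennreal l * emeasure rho R \<le> (\<integral>\<^sup>+x\<in>R. F x \<partial>rho)" if "R \<in> dy_box ` G" for R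
      using that G(1) by (auto simp: Q_def)
    show "\<exists>P\<in>cz_sets. R \<subseteq> P \<and> emeasure rho P \<le> 2 ^ CARD('n) * emeasure rho R \<and>
        (\<integral>\<^sup>+x\<in>P. F x \<partial>rho) \<le> ennreal l * emeasure rho P" if "R \<in> dy_box ` G" for R
    proof -
      from that obtain t where t: "t \<in> G" "R = dy_box t" by blast
      then have ti: "t \<in> dy_idx" using Gidx by blast
      obtain s where s: "s \<in> dy_idx" "dy_box t \<subseteq> dy_box s" "dy_ht s = dy_ht t + 1"
        "emeasure rho (dy_box s) \<le> 2 ^ CARD('n) * emeasure rho (dy_box t)"
        by (rule dy_parent[OF ti])
      have "dy_box t \<noteq> {}" using cz_sets_nonempty dy_box_cz ti by blast
      \<comment> \<open>The parent contains the selected box and is strictly higher, so membership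
        in \<open>Q\<close> would contradict the maximality of \<open>t\<close>.\<close>
      then have "s \<notin> Q" using G(4)[OF t(1), of s] s by auto
      then have "(\<integral>\<^sup>+x\<in>dy_box s. F x \<partial>rho) \<le> ennreal l * emeasure rho (dy_box s)"
        using s(1) by (auto simp: Q_def)
      then show ?thesis using s t dy_box_cz by blast
    qed
  qed
qed

section \<open>A covering lemma\<close>

text \<open>For two intersecting Calderon-Zygmund sets, the radius of the one with the smaller base is bounded
  by a multiple of the radius of the other one: the selection can be made by the side length alone.\<close>

definition cz_rc :: real where
  "cz_rc = 9 * exp 8"

text \<open>The chain cz_lo a r <= L <= L' < cz_hi a' r' is compared after taking logarithms, where
  the centres differ by at most r + r'. Two large radii give the factor 9, two small ones the factor
  exp 8. In the extreme case r >= 1 and r' < 1 one has r <= 9 and 1 <= exp 8 r', which accounts for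
  the product in \<open>cz_rc\<close>.\<close>

lemma cz_radius_compare:
  assumes "0 < a" "0 < r" "cz_admissible L a r" "0 < a'" "0 < r'" "cz_admissible L' a' r'"
    and "L \<le> L'" and near: "\<bar>ln a - ln a'\<bar> \<le> r + r'"
  shows "r \<le> cz_rc * r'"
proof -
  have e: "(1::real) \<le> exp 8" by simp
  have C: "9 \<le> cz_rc" using e by (simp add: cz_rc_def)
  have l: "cz_lo a r < cz_hi a' r'"
    using assms by (auto simp: cz_admissible_iff)
  have lo1: "ln (cz_lo a r) = ln a + 2 * r" if "1 \<le> r" using that assms by (simp add: cz_lo_def ln_mult)
  have lo2: "ln (cz_lo a r) = ln a + 2 + ln r" if "r < 1" using that assms by (simp add: cz_lo_def ln_mult)
  have hi1: "ln (cz_hi a' r') = ln a' + 8 * r'" if "1 \<le> r'" using that assms by (simp add: cz_hi_def ln_mult)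
  have hi2: "ln (cz_hi a' r') = ln a' + 8 + ln r'" if "r' < 1" using that assms by (simp add: cz_hi_def ln_mult)
  have pos: "0 < cz_hi a' r'" using less_trans[OF cz_lo_pos[OF assms(1,2)] l] .
  have ll: "ln (cz_lo a r) < ln (cz_hi a' r')"
    using l cz_lo_pos[OF assms(1,2)] pos by simp
  consider "1 \<le> r" "1 \<le> r'" | "1 \<le> r" "r' < 1" | "r < 1" "1 \<le> r'" | "r < 1" "r' < 1" by linarith
  then show ?thesis
  proof cases
    case 1
    then have "r \<le> 9 * r'" using ll lo1 hi1 near by auto
    also have "\<dots> \<le> cz_rc * r'" using C assms by (intro mult_right_mono) auto
    finally show ?thesis .
  next
    case 2
    have *: "ln a + 2 * r < ln a' + 8 + ln r'" using ll lo1 hi2 2 by simp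
    have "ln r' \<le> r' - 1" using assms by (intro ln_le_minus_one) auto
    then have r9: "r \<le> 9" using * near 2 by (auto simp: abs_le_iff)
    have "r - 8 - r' < ln r'" using * near by (auto simp: abs_le_iff)
    then have "- 8 \<le> ln r'" using 2 by linarith
    then have "exp (- 8) \<le> exp (ln r')" by (simp only: exp_le_cancel_iff)
    then have "exp (- 8) \<le> r'" using assms by simp
    then have "exp 8 * exp (- 8) \<le> exp 8 * r'" by (intro mult_left_mono) auto
    then have "1 \<le> exp 8 * r'" by (simp add: exp_add[symmetric])
    then show ?thesis using r9 by (simp add: cz_rc_def)
  next
    case 3
    then have "r \<le> 1 * r'" by simp
    also have "\<dots> \<le> cz_rc * r'" using C assms by (intro mult_right_mono) auto
    finally show ?thesis .
  next
    case 4
    have "ln a + 2 + ln r < ln a' + 8 + ln r'" using ll lo2 hi2 4 by simp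
    then have "ln r \<le> 8 + ln r'" using near 4 by (auto simp: abs_le_iff)
    then have "exp (ln r) \<le> exp (8 + ln r')" by (simp only: exp_le_cancel_iff)
    then have "r \<le> exp 8 * r'" using assms by (simp add: exp_add)
    also have "\<dots> \<le> cz_rc * r'" using assms by (simp add: cz_rc_def)
    finally show ?thesis .
  qed
qed

text \<open>Parameters are used instead of sets, since the selection compares sides and the
  fattening stretches the logarithmic interval about its centre.\<close>

type_synonym 'n czp = "int \<times> ('n \<Rightarrow> int) \<times> real \<times> real"

fun czp_box :: "('n::finite) czp \<Rightarrow> 'n pt set" where
  "czp_box (j, k, a, r) = cz_box j k a r"

text \<open>Only the logarithmic interval is stretched: dyadic bases that meet are nested, so the
  larger base already contains the smaller one.\<close>

fun czp_fat :: "real \<Rightarrow> ('n::finite) czp \<Rightarrow> 'n pt set" where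
  "czp_fat s (j, k, a, r) = dyadic_cube j k \<times> {a * exp (- s * r)..<a * exp (s * r)}"

definition czp_ok :: "('n::finite) czp set" where
  "czp_ok = {(j, k, a, r). 0 < a \<and> 0 < r \<and> cz_admissible (2 powi j) a r}"

lemma czp_box_cz: "p \<in> czp_ok \<Longrightarrow> czp_box p \<in> cz_sets"
  by (cases p) (auto simp: czp_ok_def intro: cz_setsI)

lemma czp_fat_rho:
  assumes "p \<in> czp_ok" "0 < s"
  shows "czp_fat s p \<in> sets rho" "emeasure rho (czp_fat s p) = ennreal s * emeasure rho (czp_box p)"
proof -
  obtain j k a r where p: "p = (j, k, a, r)" by (cases p)
  have pos: "0 < a" "0 < r" using assms(1) by (auto simp: p czp_ok_def)
  have l: "0 < a * exp (- s * r)" "a * exp (- s * r) \<le> a * exp (s * r)" using pos assms(2) by auto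
  note m = emeasure_rho_Times[OF dyadic_cube_borel[of j k] l]
  show "czp_fat s p \<in> sets rho" using m(1) by (simp add: p)
  have "emeasure rho (czp_fat s p) = ennreal ((2 powi j) ^ CARD('a)) * ennreal (2 * (s * r))"
    unfolding p czp_fat.simps m(2) emeasure_dyadic_cube using pos by (simp add: ln_mult mult_ac)
  then show "emeasure rho (czp_fat s p) = ennreal s * emeasure rho (czp_box p)"
    using pos assms(2) by (simp add: p emeasure_cz_box ennreal_mult[symmetric] mult_ac)
qed

text \<open>The logarithmic centres differ by at most r + r', so the doubled interval of
  \<open>p\<close> reaches at most 3 r + r' away from the centre of \<open>q\<close>. With r <=
  cz_rc r' this is the factor 3 cz_rc + 1.\<close>

lemma czp_fat_subset:
  assumes p: "p \<in> czp_ok" and q: "q \<in> czp_ok" and le: "fst p \<le> fst q"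
    and meet: "czp_box p \<inter> czp_box q \<noteq> {}"
  shows "czp_fat 2 p \<subseteq> czp_fat (3 * cz_rc + 1) q"
proof -
  obtain j k a r where pe: "p = (j, k, a, r)" by (cases p)
  obtain j' k' a' r' where qe: "q = (j', k', a', r')" by (cases q)
  have P: "0 < a" "0 < r" "cz_admissible (2 powi j) a r" using p by (auto simp: pe czp_ok_def)
  have Q: "0 < a'" "0 < r'" "cz_admissible (2 powi j') a' r'" using q by (auto simp: qe czp_ok_def)
  obtain x where x: "x \<in> cz_box j k a r" "x \<in> cz_box j' k' a' r'" using meet by (auto simp: pe qe)
  have jj: "j \<le> j'" using le by (simp add: pe qe)
  have cube: "dyadic_cube j k \<subseteq> dyadic_cube j' k'"
    by (rule dyadic_cube_nested[OF jj, of "fst x"]) (use x in \<open>auto simp: cz_box_def\<close>)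
  have ln_le: "\<bar>ln (snd x) - ln b\<bar> \<le> s" if "0 < b" "b * exp (- s) \<le> snd x" "snd x < b * exp s" for b s
  proof -
    have xp: "0 < snd x" using less_le_trans[OF _ that(2), of 0] that(1) by simp
    have "ln (b * exp (- s)) \<le> ln (snd x)" "ln (snd x) \<le> ln (b * exp s)"
      using that xp by (subst ln_le_cancel_iff; simp)+
    then show ?thesis using that(1) by (simp add: ln_mult abs_le_iff)
  qed
  have "\<bar>ln (snd x) - ln a\<bar> \<le> r" "\<bar>ln (snd x) - ln a'\<bar> \<le> r'"
    by (rule ln_le; use x P(1) Q(1) in \<open>auto simp: cz_box_def\<close>)+
  then have near: "\<bar>ln a - ln a'\<bar> \<le> r + r'" by linarith
  have r: "r \<le> cz_rc * r'"
    by (rule cz_radius_compare[OF P Q _ near]) (use jj in \<open>simp add: powi_2_le_iff\<close>)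
  define s where "s = (3 * cz_rc + 1) * r'"
  have s: "3 * r + r' \<le> s" using r by (simp add: s_def algebra_simps)
  have "ln a' - s \<le> ln a - 2 * r" "ln a + 2 * r \<le> ln a' + s" using s near by (auto simp: abs_le_iff)
  then have "exp (ln a' - s) \<le> exp (ln a - 2 * r)" "exp (ln a + 2 * r) \<le> exp (ln a' + s)"
    by (simp_all only: exp_le_cancel_iff)
  then have "a' * exp (- s) \<le> a * exp (- 2 * r)" "a * exp (2 * r) \<le> a' * exp s"
    using P(1) Q(1) by (simp_all add: exp_add exp_diff exp_minus divide_inverse)
  moreover have "- (3 * cz_rc + 1) * r' = - s" "(3 * cz_rc + 1) * r' = s"
    by (simp_all add: s_def algebra_simps)
  ultimately have "{a * exp (- 2 * r)..<a * exp (2 * r)} \<subseteq> {a' * exp (- (3 * cz_rc + 1) * r')..<a' * exp ((3 * cz_rc + 1) * r')}"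
    by auto
  then show ?thesis using cube by (auto simp: pe qe)
qed

text \<open>Greedy selection of Vitali type: a box with the largest side is kept, every box meeting
  it is absorbed by its fattened copy, and the induction continues with the boxes disjoint from
  it.\<close>

lemma czp_finite_selection:
  assumes "finite P" "P \<subseteq> czp_ok"
  shows "\<exists>D\<subseteq>P. disjoint_family_on czp_box D \<and> (\<Union>p\<in>P. czp_fat 2 p) \<subseteq> (\<Union>q\<in>D. czp_fat (3 * cz_rc + 1) q)"
  using assms
proof (induction "card P" arbitrary: P rule: less_induct)
  case less
  show ?case
  proof (cases "P = {}")
    case False
    have "Max (fst ` P) \<in> fst ` P" using less.prems False by (intro Max_in) auto
    then obtain q where q: "q \<in> P" "fst q = Max (fst ` P)" by auto
    have qmax: "fst p \<le> fst q" if "p \<in> P" for p using that less.prems q by simp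
    define P' where "P' = {p \<in> P. czp_box p \<inter> czp_box q = {}}"
    have qok: "q \<in> czp_ok" using q less.prems by blast
    have "q \<notin> P'" using cz_sets_nonempty[OF czp_box_cz[OF qok]] by (simp add: P'_def)
    then have "P' \<subset> P" using q by (auto simp: P'_def)
    then have "card P' < card P" using less.prems by (intro psubset_card_mono) auto
    moreover have "finite P'" "P' \<subseteq> czp_ok" using less.prems by (auto simp: P'_def)
    ultimately obtain D where D: "D \<subseteq> P'" "disjoint_family_on czp_box D"
      "(\<Union>p\<in>P'. czp_fat 2 p) \<subseteq> (\<Union>q\<in>D. czp_fat (3 * cz_rc + 1) q)"
      using less.hyps by blast
    show ?thesis
    proof (intro exI conjI)
      show "insert q D \<subseteq> P" using D q by (auto simp: P'_def)
      show "disjoint_family_on czp_box (insert q D)"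
        using D(1,2) unfolding disjoint_family_on_def P'_def by blast
      show "(\<Union>p\<in>P. czp_fat 2 p) \<subseteq> (\<Union>q\<in>insert q D. czp_fat (3 * cz_rc + 1) q)"
      proof (intro UN_least)
        fix p assume p: "p \<in> P"
        show "czp_fat 2 p \<subseteq> (\<Union>q\<in>insert q D. czp_fat (3 * cz_rc + 1) q)"
        proof (cases "p \<in> P'")
          case True
          then show ?thesis using D(3) by blast
        next
          case False
          then have "czp_fat 2 p \<subseteq> czp_fat (3 * cz_rc + 1) q"
            using p less.prems qok qmax by (intro czp_fat_subset) (auto simp: P'_def)
          then show ?thesis by blast
        qed
      qed
    qed
  qed (auto simp: disjoint_family_on_def)
qed

definition cz_cov :: real where
  "cz_cov = 3 * cz_rc + 1"

lemma cz_cov_pos: "1 \<le> cz_cov"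
  by (simp add: cz_cov_def cz_rc_def)

lemma czp_finite_covering:
  fixes P :: "('n::finite) czp set"
  assumes "finite P" "P \<subseteq> czp_ok" and G [measurable]: "G \<in> borel_measurable rho"
    and avg: "\<And>p. p \<in> P \<Longrightarrow> emeasure rho (czp_box p) \<le> c * (\<integral>\<^sup>+x\<in>czp_box p. G x \<partial>rho)"
  shows "emeasure rho (\<Union>p\<in>P. czp_fat 2 p) \<le> ennreal cz_cov * (c * (\<integral>\<^sup>+x. G x \<partial>rho))"
proof -
  obtain D where D: "D \<subseteq> P" "disjoint_family_on czp_box D"
    "(\<Union>p\<in>P. czp_fat 2 p) \<subseteq> (\<Union>q\<in>D. czp_fat cz_cov q)"
    using czp_finite_selection[OF assms(1,2)] unfolding cz_cov_def by blast
  have fD: "finite D" using D(1) assms(1) finite_subset by blast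
  have m: "czp_box p \<in> sets rho" if "p \<in> D" for p
    using that D(1) assms(2) czp_box_cz cz_sets_rho by blast
  have fat: "czp_fat cz_cov p \<in> sets rho"
     "emeasure rho (czp_fat cz_cov p) = ennreal cz_cov * emeasure rho (czp_box p)" if "p \<in> D" for p
    using czp_fat_rho[of p cz_cov] that D(1) assms(2) cz_cov_pos by auto
  have "emeasure rho (\<Union>p\<in>P. czp_fat 2 p) \<le> emeasure rho (\<Union>q\<in>D. czp_fat cz_cov q)"
    by (intro emeasure_mono D(3) sets.finite_UN fD fat(1))
  also have "\<dots> \<le> (\<Sum>q\<in>D. emeasure rho (czp_fat cz_cov q))"
    by (intro emeasure_subadditive_finite fD) (use fat in blast)
  also have "\<dots> = ennreal cz_cov * (\<Sum>q\<in>D. emeasure rho (czp_box q))"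
    by (simp add: fat sum_distrib_left)
  also have "(\<Sum>q\<in>D. emeasure rho (czp_box q)) = emeasure rho (\<Union>q\<in>D. czp_box q)"
    by (rule sum_emeasure) (use m D(2) fD in auto)
  also have "\<dots> = (\<integral>\<^sup>+x\<in>(\<Union>q\<in>D. czp_box q). 1 \<partial>rho)"
    by (rule emeasure_eq_nn_integral_one[symmetric]) (use m fD in auto)
  also have "\<dots> \<le> c * (\<integral>\<^sup>+x\<in>(\<Union>q\<in>D. czp_box q). G x \<partial>rho)"
    by (rule nn_integral_UN_le) (use m D avg fD in \<open>auto intro: countable_finite\<close>)
  also have "\<dots> \<le> c * (\<integral>\<^sup>+x. G x \<partial>rho)"
    by (intro mult_left_mono nn_integral_mono) (auto split: split_indicator)
  finally show ?thesis by (simp add: mult_left_mono)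
qed

lemma czp_countable_covering:
  fixes P :: "('n::finite) czp set"
  assumes "countable P" "P \<subseteq> czp_ok" and G [measurable]: "G \<in> borel_measurable rho"
    and avg: "\<And>p. p \<in> P \<Longrightarrow> emeasure rho (czp_box p) \<le> c * (\<integral>\<^sup>+x\<in>czp_box p. G x \<partial>rho)"
  shows "(\<Union>p\<in>P. czp_fat 2 p) \<in> sets rho"
    "emeasure rho (\<Union>p\<in>P. czp_fat 2 p) \<le> ennreal cz_cov * (c * (\<integral>\<^sup>+x. G x \<partial>rho))"
proof -
  have fat: "czp_fat 2 p \<in> sets rho" if "p \<in> P" for p
    using czp_fat_rho(1)[of p 2] that assms(2) by auto
  then show "(\<Union>p\<in>P. czp_fat 2 p) \<in> sets rho" using assms(1) by (intro sets.countable_UN'') auto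
  show "emeasure rho (\<Union>p\<in>P. czp_fat 2 p) \<le> ennreal cz_cov * (c * (\<integral>\<^sup>+x. G x \<partial>rho))"
  proof (cases "P = {}")
    case False
    define A where "A N = (\<Union>p\<in>from_nat_into P ` {..N}. czp_fat 2 p)" for N :: nat
    have sub: "from_nat_into P ` {..N} \<subseteq> P" for N
      using from_nat_into[OF False] by blast
    have Am: "A N \<in> sets rho" for N
    proof -
      have "czp_fat 2 p \<in> sets rho" if "p \<in> from_nat_into P ` {..N}" for p using that sub fat by blast
      then show ?thesis unfolding A_def by (intro sets.finite_UN) auto
    qed
    have inc: "incseq A"
      unfolding incseq_def A_def by (intro allI impI UN_mono image_mono) auto
    have "(\<Union>N. A N) = (\<Union>p\<in>P. czp_fat 2 p)"
    proof
      show "(\<Union>p\<in>P. czp_fat 2 p) \<subseteq> (\<Union>N. A N)"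
      proof (intro UN_least)
        fix p assume "p \<in> P"
        then obtain N where "p = from_nat_into P N" using from_nat_into_surj[OF assms(1)] by metis
        then have "czp_fat 2 p \<subseteq> A N" by (auto simp: A_def)
        then show "czp_fat 2 p \<subseteq> (\<Union>N. A N)" by blast
      qed
      show "(\<Union>N. A N) \<subseteq> (\<Union>p\<in>P. czp_fat 2 p)" unfolding A_def using sub by blast
    qed
    then have "emeasure rho (\<Union>p\<in>P. czp_fat 2 p) = (SUP N. emeasure rho (A N))"
      using SUP_emeasure_incseq[of A rho, OF image_subsetI inc] Am by simp
    also have "\<dots> \<le> ennreal cz_cov * (c * (\<integral>\<^sup>+x. G x \<partial>rho))"
    proof (rule SUP_least)
      fix N
      have "from_nat_into P ` {..N} \<subseteq> czp_ok" using sub assms(2) by blast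
      moreover have "emeasure rho (czp_box p) \<le> c * (\<integral>\<^sup>+x\<in>czp_box p. G x \<partial>rho)"
        if "p \<in> from_nat_into P ` {..N}" for p
        using that sub avg by blast
      ultimately show "emeasure rho (A N) \<le> ennreal cz_cov * (c * (\<integral>\<^sup>+x. G x \<partial>rho))"
        unfolding A_def by (intro czp_finite_covering G) auto
    qed
    finally show ?thesis .
  qed simp
qed

text \<open>The fattened sets are needed since the union of an uncountable family need not be the union of
  a countable subfamily.\<close>

lemma cz_covering:
  fixes F :: "('n::finite) pt set set"
  assumes F: "F \<subseteq> cz_sets" and G: "G \<in> borel_measurable rho"
    and avg: "\<And>R. R \<in> F \<Longrightarrow> emeasure rho R \<le> c * (\<integral>\<^sup>+x\<in>R. G x \<partial>rho)"
  obtains W where "W \<in> sets rho" "\<Union>F \<subseteq> W" "emeasure rho W \<le> ennreal cz_cov * (c * (\<integral>\<^sup>+x. G x \<partial>rho))"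
proof -
  define P where "P = {p \<in> czp_ok. czp_box p \<in> F}"
  define I where "I j k = {(a, r). (j, k, a, r) \<in> P}" for j :: int and k :: "'n \<Rightarrow> int"
  define J where "J = (\<lambda>(a, r). {a * exp (- 2 * r)<..<a * exp (2 * r :: real)})"
  \<comment> \<open>There are only countably many bases, and over each of them the open doubled
    intervals on the line have a countable subcover by the Lindelof property.\<close>
  have "\<exists>C\<subseteq>I j k. countable C \<and> \<Union>(J ` C) = \<Union>(J ` I j k)" for j k
  proof -
    have "\<And>S. S \<in> J ` I j k \<Longrightarrow> open S" by (auto simp: J_def)
    then obtain F' where F': "F' \<subseteq> J ` I j k" "countable F'" "\<Union>F' = \<Union>(J ` I j k)"
      by (rule Lindelof)
    then obtain C where "C \<subseteq> I j k" "countable C" "F' = J ` C"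
      using countable_subset_image[of F' J "I j k"] by auto
    then show ?thesis using F' by auto
  qed
  then obtain C where C: "\<And>j k. C j k \<subseteq> I j k" "\<And>j k. countable (C j k)"
    "\<And>j k. \<Union>(J ` C j k) = \<Union>(J ` I j k)" by metis
  define P' where "P' = (\<Union>j. \<Union>k. (\<lambda>(a, r). (j, k, a, r)) ` C j k)"
  have P'P: "P' \<subseteq> P" using C(1) by (fastforce simp: P'_def I_def)
  have cnt: "countable P'"
    unfolding P'_def using C(2) by (intro countable_UN countable_image countableI_type) auto
  have cov: "\<Union>F \<subseteq> (\<Union>p\<in>P'. czp_fat 2 p)"
  proof (intro Union_least)
    fix R assume R: "R \<in> F"
    then obtain j k a r where *: "R = cz_box j k a r" "0 < a" "0 < r" "cz_admissible (2 powi j) a r"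
      using F cz_setsE by (metis subsetD)
    then have ar: "(a, r) \<in> I j k" using R by (simp add: I_def P_def czp_ok_def)
    show "R \<subseteq> (\<Union>p\<in>P'. czp_fat 2 p)"
    proof
      fix x assume x: "x \<in> R"
      have "a * exp (- 2 * r) < a * exp (- r)" "a * exp r < a * exp (2 * r)" using * by auto
      moreover have "a * exp (- r) \<le> snd x" "snd x < a * exp r" using x by (auto simp: * cz_box_def)
      ultimately have "a * exp (- 2 * r) < snd x" "snd x < a * exp (2 * r)" by linarith+
      then have "snd x \<in> J (a, r)" by (simp add: J_def)
      then have "snd x \<in> \<Union>(J ` C j k)" using ar C(3) by blast
      then obtain a' r' where ar': "(a', r') \<in> C j k" "snd x \<in> J (a', r')" by auto
      then have "x \<in> czp_fat 2 (j, k, a', r')"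
        using x by (auto simp: * cz_box_def J_def mem_Times_iff)
      moreover have "(j, k, a', r') \<in> P'" using ar' by (force simp: P'_def)
      ultimately show "x \<in> (\<Union>p\<in>P'. czp_fat 2 p)" by blast
    qed
  qed
  have ok: "P' \<subseteq> czp_ok" using P'P by (auto simp: P_def)
  have av: "emeasure rho (czp_box p) \<le> c * (\<integral>\<^sup>+x\<in>czp_box p. G x \<partial>rho)" if "p \<in> P'" for p
    using that P'P avg by (auto simp: P_def)
  show thesis
    by (rule that[OF czp_countable_covering(1)[OF cnt ok G av] cov czp_countable_covering(2)[OF cnt ok G av]])
qed

section \<open>Bounded functions of compact support\<close>

text \<open>By the Lindelof property the union of all open sets on which \<open>f\<close> vanishes
  almost everywhere is a union of countably many of them.\<close>

lemma AE_zero_off_ess_supp: "AE x in rho. x \<notin> ess_supp f \<longrightarrow> f x = 0"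
proof -
  define \<U> where "\<U> = {U. open U \<and> (AE z in rho. z \<in> U \<longrightarrow> f z = 0)}"
  obtain \<V> where V: "\<V> \<subseteq> \<U>" "countable \<V>" "\<Union>\<V> = \<Union>\<U>"
    by (rule Lindelof[of \<U>]) (auto simp: \<U>_def)
  have "AE x in rho. \<forall>U\<in>\<V>. x \<in> U \<longrightarrow> f x = 0"
    using V(1,2) by (subst AE_ball_countable) (auto simp: \<U>_def)
  then show ?thesis
  proof (rule AE_mp, intro AE_I2 impI)
    fix x assume x: "x \<in> space rho" "\<forall>U\<in>\<V>. x \<in> U \<longrightarrow> f x = 0" "x \<notin> ess_supp f"
    then obtain U where "open U" "x \<in> U" "AE z in rho. z \<in> U \<longrightarrow> f z = 0"
      by (auto simp: ess_supp_def)
    then have "x \<in> \<Union>\<U>" by (auto simp: \<U>_def)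
    then show "f x = 0" using V(3) x(2) by blast
  qed
qed

definition hbar :: "nat \<Rightarrow> ('n::finite) pt set" where
  "hbar m = cball 0 (real m) \<times> {1 / (real m + 1)..real m + 1}"

lemma compact_hbar: "compact (hbar m)"
  unfolding hbar_def by (intro compact_Times) auto

lemma hbar_subset_S: "hbar m \<subseteq> S"
  by (auto simp: hbar_def S_def intro: less_le_trans[of 0 "1 / (real m + 1)"])

lemma hbox_subset_hbar: "hbox m \<subseteq> hbar m"
  by (auto simp: hbar_def hbox_def)

lemma linf_norm_finite_iff:
  assumes "f \<in> borel_measurable rho"
  shows "linf_norm f < \<infinity> \<longleftrightarrow> (\<exists>a::real. AE x in rho. norm (f x) \<le> a)"
proof
  assume "linf_norm f < \<infinity>"
  then obtain a where a: "linf_norm f = ennreal a" "0 \<le> a" by (cases "linf_norm f") auto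
  have "AE x in rho. ennreal (norm (f x)) \<le> ennreal a"
    using esssup_AE[of "\<lambda>x. ennreal (norm (f x))" rho] a by (simp add: linf_norm_def)
  then show "\<exists>a::real. AE x in rho. norm (f x) \<le> a" using a(2) by auto
next
  assume "\<exists>a::real. AE x in rho. norm (f x) \<le> a"
  then obtain a where "AE x in rho. norm (f x) \<le> a" by blast
  then have "AE x in rho. ennreal (norm (f x)) \<le> ennreal a" by eventually_elim (rule ennreal_leI)
  then have "linf_norm f \<le> ennreal a"
    unfolding linf_norm_def using assms by (intro esssup_I) auto
  then show "linf_norm f < \<infinity>" by (rule order_le_less_trans) simp
qed

text \<open>Compactness of the support is traded for vanishing almost everywhere off some
  \<open>hbox m\<close>, a condition that passes at once to sums and to dominated functions.
  Conversely, such a condition exhibits the support as the compact \<open>hbar m\<close> minus an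
  open set.\<close>

lemma linf_c_iff:
  "f \<in> linf_c \<longleftrightarrow> f \<in> borel_measurable rho \<and> (\<exists>a::real. AE x in rho. norm (f x) \<le> a) \<and>
     (\<exists>m. AE x in rho. x \<notin> hbox m \<longrightarrow> f x = 0)"
proof -
  have "compact (ess_supp f) \<longleftrightarrow> (\<exists>m. AE x in rho. x \<notin> hbox m \<longrightarrow> f x = 0)" for f :: "'a pt \<Rightarrow> complex"
  proof
    assume "compact (ess_supp f)"
    moreover have "ess_supp f \<subseteq> S" by (auto simp: ess_supp_def)
    ultimately obtain m where m: "ess_supp f \<subseteq> hbox m" by (rule compact_subset_hbox)
    have "AE x in rho. x \<notin> hbox m \<longrightarrow> f x = 0"
      using AE_zero_off_ess_supp[of f] by eventually_elim (use m in blast)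
    then show "\<exists>m. AE x in rho. x \<notin> hbox m \<longrightarrow> f x = 0" by blast
  next
    assume "\<exists>m. AE x in rho. x \<notin> hbox m \<longrightarrow> f x = 0"
    then obtain m where m: "AE x in rho. x \<notin> hbox m \<longrightarrow> f x = 0" by blast
    define V where "V = \<Union>{U. open U \<and> (AE z in rho. z \<in> U \<longrightarrow> f z = 0)}"
    have "- hbar m \<subseteq> V"
    proof -
      have "open (- hbar m :: 'a pt set)" using compact_hbar compact_imp_closed by blast
      moreover have "AE z in rho. z \<in> - hbar m \<longrightarrow> f z = 0"
        using m by eventually_elim (use hbox_subset_hbar in blast)
      ultimately show ?thesis unfolding V_def by blast
    qed
    moreover have "ess_supp f = S - V" by (auto simp: ess_supp_def V_def)
    ultimately have "ess_supp f = hbar m - V" using hbar_subset_S by blast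
    moreover have "open V" unfolding V_def by auto
    ultimately show "compact (ess_supp f)" by (simp add: compact_diff compact_hbar)
  qed
  then show ?thesis using linf_norm_finite_iff unfolding linf_c_def by blast
qed

lemma linf_c_measurable: "f \<in> linf_c \<Longrightarrow> f \<in> borel_measurable rho"
  by (simp add: linf_c_def)

lemma linf_c_bound:
  assumes "f \<in> linf_c"
  obtains a where "0 < a" "AE x in rho. norm (f x) \<le> a"
proof -
  obtain a where a: "AE x in rho. norm (f x) \<le> a" using assms by (auto simp: linf_c_iff)
  have "AE x in rho. norm (f x) \<le> max 1 a" using a by eventually_elim auto
  then show thesis by (intro that[of "max 1 a"]) auto
qed

lemma linf_c_mono:
  assumes f: "f \<in> linf_c" and g: "g \<in> borel_measurable rho" and le: "\<And>x. x \<in> S \<Longrightarrow> norm (g x) \<le> c * norm (f x)"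
    and c: "0 \<le> c"
  shows "g \<in> linf_c"
proof -
  obtain a m where a: "AE x in rho. norm (f x) \<le> a" and m: "AE x in rho. x \<notin> hbox m \<longrightarrow> f x = 0"
    using f by (auto simp: linf_c_iff)
  have "AE x in rho. norm (g x) \<le> c * a"
    using a AE_space by eventually_elim (use le c in \<open>metis mult_left_mono order_trans space_rho\<close>)
  moreover have "AE x in rho. x \<notin> hbox m \<longrightarrow> g x = 0"
    using m AE_space by eventually_elim (use le in \<open>metis mult_zero_right norm_le_zero_iff norm_zero space_rho\<close>)
  ultimately show ?thesis using g by (auto simp: linf_c_iff)
qed

definition res :: "('n::finite) pt set \<Rightarrow> ('n pt \<Rightarrow> complex) \<Rightarrow> 'n pt \<Rightarrow> complex" where
  "res A f = (\<lambda>x. indicator A x *\<^sub>R f x)"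

lemma res_measurable: "A \<in> sets rho \<Longrightarrow> f \<in> borel_measurable rho \<Longrightarrow> res A f \<in> borel_measurable rho"
  unfolding res_def by (intro borel_measurable_scaleR borel_measurable_indicator)

lemma norm_res: "norm (res A f x) = indicator A x * norm (f x)"
  by (simp add: res_def split: split_indicator)

lemma res_linf_c: "A \<in> sets rho \<Longrightarrow> f \<in> linf_c \<Longrightarrow> res A f \<in> linf_c"
  by (rule linf_c_mono[of f _ 1]) (auto simp: res_measurable linf_c_measurable norm_res split: split_indicator)

lemma add_linf_c:
  assumes "f \<in> linf_c" "g \<in> linf_c"
  shows "(\<lambda>x. f x + g x) \<in> linf_c"
proof -
  obtain a m where a: "AE x in rho. norm (f x) \<le> a" and m: "AE x in rho. x \<notin> hbox m \<longrightarrow> f x = 0"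
    using assms(1) by (auto simp: linf_c_iff)
  obtain b k where b: "AE x in rho. norm (g x) \<le> b" and k: "AE x in rho. x \<notin> hbox k \<longrightarrow> g x = 0"
    using assms(2) by (auto simp: linf_c_iff)
  have "AE x in rho. norm (f x + g x) \<le> a + b"
    using a b by eventually_elim (rule norm_triangle_mono)
  moreover have "AE x in rho. x \<notin> hbox (max m k) \<longrightarrow> f x + g x = 0"
    using m k by eventually_elim (use hbox_mono[of m "max m k"] hbox_mono[of k "max m k"] in auto)
  moreover have "(\<lambda>x. f x + g x) \<in> borel_measurable rho"
    using assms linf_c_measurable by (intro borel_measurable_add) auto
  ultimately show ?thesis by (auto simp: linf_c_iff)
qed

lemma cmult_linf_c: "f \<in> linf_c \<Longrightarrow> (\<lambda>x. c * f x) \<in> linf_c"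
  by (rule linf_c_mono[of f _ "norm c"]) (auto simp: norm_mult intro: borel_measurable_times linf_c_measurable)

lemma linf_c_nn_integral:
  fixes f :: "('n::finite) pt \<Rightarrow> complex"
  assumes "f \<in> linf_c" "0 < p"
  shows "(\<integral>\<^sup>+x. ennreal (norm (f x) powr p) \<partial>rho) < \<infinity>"
proof -
  obtain a where a: "0 < a" "AE x in rho. norm (f x) \<le> a" using assms(1) by (rule linf_c_bound)
  obtain m where m: "AE x in rho. x \<notin> hbox m \<longrightarrow> f x = 0" using assms(1) by (auto simp: linf_c_iff)
  have "(\<integral>\<^sup>+x. ennreal (norm (f x) powr p) \<partial>rho) \<le> (\<integral>\<^sup>+x. ennreal (a powr p) * indicator (hbox m) x \<partial>(rho :: 'n pt measure))"
  proof (rule nn_integral_mono_AE)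
    show "AE x in rho. ennreal (norm (f x) powr p) \<le> ennreal (a powr p) * indicator (hbox m) x"
      using a(2) m by eventually_elim (use assms(2) in \<open>auto split: split_indicator intro!: ennreal_leI powr_mono2\<close>)
  qed
  also have "\<dots> = ennreal (a powr p) * emeasure rho (hbox m :: 'n pt set)"
    by (rule nn_integral_cmult_indicator) simp
  also have "\<dots> < \<infinity>" using emeasure_hbox[where 'n = 'n, of m] by (simp add: ennreal_mult_less_top)
  finally show ?thesis .
qed

lemma powr_2_norm: "norm x powr 2 = (norm x)\<^sup>2"
  by (cases "norm x = 0") (auto simp: powr_numeral)

lemma linf_c_nn_integral_norm:
  assumes "f \<in> linf_c"
  shows "(\<integral>\<^sup>+x. ennreal (norm (f x)) \<partial>rho) < \<infinity>" "(\<integral>\<^sup>+x. ennreal ((norm (f x))\<^sup>2) \<partial>rho) < \<infinity>"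
  using linf_c_nn_integral[OF assms, of 1] linf_c_nn_integral[OF assms, of 2] by (simp_all add: powr_2_norm)

lemma linf_c_integrable: "f \<in> linf_c \<Longrightarrow> integrable rho f"
  using linf_c_nn_integral_norm(1) linf_c_measurable by (intro integrableI_bounded) auto

text \<open>Removes the roots by taking p-th powers. As the integral of \<open>g\<close> is finite,
  the value infinity can only occur on the left, and then both inequalities fail.\<close>

lemma lp_norm_le_iff:
  fixes f g :: "('n::finite) pt \<Rightarrow> complex"
  assumes "0 < p" "0 \<le> C" "(\<integral>\<^sup>+x. ennreal (norm (g x) powr p) \<partial>rho) < \<infinity>"
  shows "lp_norm p f \<le> ennreal C * lp_norm p g \<longleftrightarrow>
    (\<integral>\<^sup>+x. ennreal (norm (f x) powr p) \<partial>rho) \<le> ennreal (C powr p) * (\<integral>\<^sup>+x. ennreal (norm (g x) powr p) \<partial>rho)"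
proof -
  define I where "I f = (\<integral>\<^sup>+x. ennreal (norm (f x) powr p) \<partial>rho)" for f :: "'n pt \<Rightarrow> complex"
  obtain b where b: "I g = ennreal b" "0 \<le> b" using assms(3) by (cases "I g") (auto simp: I_def)
  have g: "lp_norm p g = ennreal (b powr (1 / p))"
    using b by (simp add: lp_norm_def Let_def I_def[symmetric])
  show ?thesis
    unfolding I_def[symmetric]
  proof (cases "I f")
    case (real a)
    then have f: "lp_norm p f = ennreal (a powr (1 / p))"
      by (simp add: lp_norm_def Let_def I_def[symmetric])
    have "a powr (1 / p) \<le> C * b powr (1 / p) \<longleftrightarrow> a \<le> C powr p * b"
    proof
      assume "a powr (1 / p) \<le> C * b powr (1 / p)"
      then have "(a powr (1 / p)) powr p \<le> (C * b powr (1 / p)) powr p"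
        using assms by (intro powr_mono2) auto
      then show "a \<le> C powr p * b" using assms real b by (simp add: powr_powr powr_mult)
    next
      assume "a \<le> C powr p * b"
      then have "a powr (1 / p) \<le> (C powr p * b) powr (1 / p)"
        using assms real by (intro powr_mono2) auto
      then show "a powr (1 / p) \<le> C * b powr (1 / p)" using assms real b by (simp add: powr_powr powr_mult)
    qed
    then show "lp_norm p f \<le> ennreal C * lp_norm p g \<longleftrightarrow> I f \<le> ennreal (C powr p) * I g"
      using real b assms by (simp add: f g ennreal_mult[symmetric])
  next
    case top
    then have "lp_norm p f = \<infinity>" by (simp add: lp_norm_def Let_def I_def[symmetric])
    then show "lp_norm p f \<le> ennreal C * lp_norm p g \<longleftrightarrow> I f \<le> ennreal (C powr p) * I g"
      using top b assms by (simp add: g ennreal_mult[symmetric] top_unique)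
  qed
qed

lemma hdist_measurable [measurable]:
  assumes "x \<in> S"
  shows "hdist x \<in> borel_measurable rho"
proof -
  have "continuous_on S (\<lambda>y. hdist x y)"
    by (rule continuous_on_hdist) (use assms in \<open>auto intro: continuous_intros\<close>)
  then have "hdist x \<in> borel_measurable (restrict_space borel S)"
    by (rule borel_measurable_continuous_on_restrict)
  then show ?thesis by (simp cong: measurable_cong_sets add: sets_rho)
qed

lemma set_nn_integral_mono_set: "X \<subseteq> Y \<Longrightarrow> (\<integral>\<^sup>+x\<in>X. f x \<partial>M) \<le> (\<integral>\<^sup>+x\<in>Y. f x \<partial>M)"
  by (intro nn_integral_mono) (auto split: split_indicator)

section \<open>Truncated singular integrals\<close>

text \<open>The hypotheses in the form in which they are applied. \<open>hoermander1\<close> varies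
  the second argument of the kernel and serves the cancellation of the bad part;
  \<open>hoermander2\<close> varies the first one and serves the oscillation of truncations. Of the
  operator only its behaviour on \<open>linf_c\<close> is kept.\<close>

locale cz_op =
  fixes K :: "('n::finite) pt \<Rightarrow> 'n pt \<Rightarrow> complex" and T :: "('n pt \<Rightarrow> complex) \<Rightarrow> 'n pt \<Rightarrow> complex"
    and A H B :: real
  assumes pos: "0 < A" "0 < H" "0 < B"
    and K_meas: "case_prod K \<in> borel_measurable (rho \<Otimes>\<^sub>M rho)"
    and size: "x \<in> S \<Longrightarrow> 0 < r \<Longrightarrow>
      (\<integral>\<^sup>+y\<in>{y \<in> S. r < hdist x y \<and> hdist x y \<le> 2 * r}. ennreal (norm (K x y)) \<partial>rho) \<le> ennreal A"
    and hoermander1: "R \<in> cz_sets \<Longrightarrow> y \<in> R \<Longrightarrow> y' \<in> R \<Longrightarrow>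
      (\<integral>\<^sup>+x\<in>S - cz_star R. ennreal (norm (K x y - K x y')) \<partial>rho) \<le> ennreal H"
    and hoermander2: "R \<in> cz_sets \<Longrightarrow> y \<in> R \<Longrightarrow> y' \<in> R \<Longrightarrow>
      (\<integral>\<^sup>+x\<in>S - cz_star R. ennreal (norm (K y x - K y' x)) \<partial>rho) \<le> ennreal H"
    and T_meas: "f \<in> linf_c \<Longrightarrow> T f \<in> borel_measurable rho"
    and T_bound: "f \<in> linf_c \<Longrightarrow>
      (\<integral>\<^sup>+x. ennreal ((norm (T f x))\<^sup>2) \<partial>rho) \<le> ennreal B * (\<integral>\<^sup>+x. ennreal ((norm (f x))\<^sup>2) \<partial>rho)"
    and T_add: "f \<in> linf_c \<Longrightarrow> g \<in> linf_c \<Longrightarrow> AE x in rho. T (\<lambda>z. f z + g z) x = T f x + T g x"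
    and T_kernel: "has_kernel T K"
begin

lemma K1_meas: "x \<in> S \<Longrightarrow> K x \<in> borel_measurable rho"
  using measurable_compose[OF measurable_Pair1' K_meas] by simp

lemma K2_meas: "y \<in> S \<Longrightarrow> (\<lambda>x. K x y) \<in> borel_measurable rho"
  using measurable_compose[OF measurable_Pair2' K_meas] by simp

lemma size_annuli:
  assumes "x \<in> S" "0 < r"
  shows "(\<integral>\<^sup>+y\<in>{y \<in> S. r < hdist x y \<and> hdist x y \<le> 2 ^ N * r}. ennreal (norm (K x y)) \<partial>rho) \<le> of_nat N * ennreal A"
proof (induction N)
  case (Suc N)
  note [measurable] = K1_meas[OF assms(1)] hdist_measurable[OF assms(1)]
  have m: "{y \<in> S. s < hdist x y \<and> hdist x y \<le> t} \<in> sets rho" for s t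
  proof -
    have "{y \<in> space rho. s < hdist x y \<and> hdist x y \<le> t} \<in> sets rho" by measurable
    then show ?thesis by simp
  qed
  let ?X = "{y \<in> S. r < hdist x y \<and> hdist x y \<le> 2 ^ N * r}"
  let ?Y = "{y \<in> S. 2 ^ N * r < hdist x y \<and> hdist x y \<le> 2 * (2 ^ N * r)}"
  have "(\<integral>\<^sup>+y\<in>{y \<in> S. r < hdist x y \<and> hdist x y \<le> 2 ^ Suc N * r}. ennreal (norm (K x y)) \<partial>rho) \<le>
      (\<integral>\<^sup>+y. ennreal (norm (K x y)) * indicator ?X y + ennreal (norm (K x y)) * indicator ?Y y \<partial>rho)"
    by (intro nn_integral_mono) (auto simp: mult_ac split: split_indicator)
  also have "\<dots> = (\<integral>\<^sup>+y\<in>?X. ennreal (norm (K x y)) \<partial>rho) + (\<integral>\<^sup>+y\<in>?Y. ennreal (norm (K x y)) \<partial>rho)"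
    using m by (intro nn_integral_add) auto
  also have "\<dots> \<le> of_nat N * ennreal A + ennreal A"
    using assms by (intro add_mono Suc size) auto
  finally show ?case by (simp add: algebra_simps)
qed (auto simp: not_less)

text \<open>\<open>size\<close> concerns half-open annuli of ratio 2. To catch the closed inner
  boundary the covering starts at radius s / 2, so that powers of 2 have to exhaust the ratio 2
  M.\<close>

definition annuli :: "real \<Rightarrow> real" where
  "annuli M = real (nat \<lceil>log 2 (2 * M)\<rceil>) * A"

lemma size_annulus:
  assumes "x \<in> S" "0 < s" "1 \<le> M"
  shows "(\<integral>\<^sup>+y\<in>{y \<in> S. s \<le> hdist x y \<and> hdist x y \<le> M * s}. ennreal (norm (K x y)) \<partial>rho) \<le> ennreal (annuli M)"
proof -
  define N where "N = nat \<lceil>log 2 (2 * M)\<rceil>"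
  have "2 * M = 2 powr (log 2 (2 * M))" using assms by simp
  also have "\<dots> \<le> 2 powr (real N)" unfolding N_def by (intro powr_mono) linarith+
  also have "\<dots> = 2 ^ N" by (simp add: powr_realpow)
  finally have N: "M * s \<le> 2 ^ N * (s / 2)" using assms(2) by simp
  have "(\<integral>\<^sup>+y\<in>{y \<in> S. s \<le> hdist x y \<and> hdist x y \<le> M * s}. ennreal (norm (K x y)) \<partial>rho) \<le>
     (\<integral>\<^sup>+y\<in>{y \<in> S. s / 2 < hdist x y \<and> hdist x y \<le> 2 ^ N * (s / 2)}. ennreal (norm (K x y)) \<partial>rho)"
  proof (intro set_nn_integral_mono_set subsetI)
    fix y assume "y \<in> {y \<in> S. s \<le> hdist x y \<and> hdist x y \<le> M * s}"
    then have "y \<in> S" "s \<le> hdist x y" "hdist x y \<le> M * s" by auto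
    moreover from this have "s / 2 < hdist x y" "hdist x y \<le> 2 ^ N * (s / 2)" using N assms(2) by linarith+
    ultimately show "y \<in> {y \<in> S. s / 2 < hdist x y \<and> hdist x y \<le> 2 ^ N * (s / 2)}" by blast
  qed
  also have "\<dots> \<le> of_nat N * ennreal A"
    by (rule size_annuli) (use assms in auto)
  also have "\<dots> = ennreal (annuli M)"
    using pos by (simp add: annuli_def N_def ennreal_mult ennreal_of_nat_eq_real_of_nat)
  finally show ?thesis .
qed

definition tr :: "('n pt \<Rightarrow> complex) \<Rightarrow> 'n pt set \<Rightarrow> 'n pt \<Rightarrow> complex" where
  "tr f R x = (LINT y:(S - cz_star R)|rho. K x y * f y)"

lemma compl_star_sets: "R \<in> cz_sets \<Longrightarrow> S - cz_star R \<in> sets rho"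
  using sets.compl_sets[OF cz_star_sets_rho, of R] by simp

lemma far_sets: "x \<in> S \<Longrightarrow> {y \<in> S. s \<le> hdist x y} \<in> sets rho"
proof -
  assume x: "x \<in> S"
  note [measurable] = hdist_measurable[OF x]
  have "{y \<in> space rho. s \<le> hdist x y} \<in> sets rho" by measurable
  then show ?thesis by simp
qed

text \<open>Up to a null set \<open>f\<close> lives on a compact set, whose points have bounded
  distance from \<open>x\<close>. This reduces the unbounded region to an annulus, where the size
  condition applies.\<close>

lemma far_integrable:
  assumes f: "f \<in> linf_c" and x: "x \<in> S" and s: "0 < s"
  shows "set_integrable rho {y \<in> S. s \<le> hdist x y} (\<lambda>y. K x y * f y)"
proof -
  obtain a where a: "0 < a" "AE x in rho. norm (f x) \<le> a" using f by (rule linf_c_bound)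
  obtain m where m: "AE x in rho. x \<notin> hbox m \<longrightarrow> f x = 0" using f by (auto simp: linf_c_iff)
  note [measurable] = K1_meas[OF x] linf_c_measurable[OF f] far_sets[OF x]
  have "continuous_on (hbar m) (\<lambda>y. hdist x y)"
    by (rule continuous_on_hdist) (use x hbar_subset_S in \<open>auto intro: continuous_intros\<close>)
  then have "compact ((\<lambda>y. hdist x y) ` hbar m)" using compact_hbar by (rule compact_continuous_image)
  then obtain D where D: "\<And>y. y \<in> hbar m \<Longrightarrow> \<bar>hdist x y\<bar> \<le> D"
    using compact_imp_bounded bounded_real by (metis imageI)
  define M where "M = max 1 (D / s)"
  have M: "1 \<le> M" "D \<le> M * s" using s by (auto simp: M_def max_def field_simps)
  have "(\<integral>\<^sup>+y. ennreal (norm (indicator {y \<in> S. s \<le> hdist x y} y *\<^sub>R (K x y * f y))) \<partial>rho) \<le>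
      (\<integral>\<^sup>+y. ennreal a * (ennreal (norm (K x y)) * indicator {y \<in> S. s \<le> hdist x y \<and> hdist x y \<le> M * s} y) \<partial>rho)"
  proof (rule nn_integral_mono_AE)
    show "AE y in rho. ennreal (norm (indicator {y \<in> S. s \<le> hdist x y} y *\<^sub>R (K x y * f y))) \<le>
       ennreal a * (ennreal (norm (K x y)) * indicator {y \<in> S. s \<le> hdist x y \<and> hdist x y \<le> M * s} y)"
      using a(2) m AE_space
    proof eventually_elim
      fix y assume y: "norm (f y) \<le> a" "y \<notin> hbox m \<longrightarrow> f y = 0" "y \<in> space rho"
      show "ennreal (norm (indicator {y \<in> S. s \<le> hdist x y} y *\<^sub>R (K x y * f y))) \<le>
       ennreal a * (ennreal (norm (K x y)) * indicator {y \<in> S. s \<le> hdist x y \<and> hdist x y \<le> M * s} y)"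
      proof (cases "y \<in> S \<and> s \<le> hdist x y \<and> f y \<noteq> 0")
        case True
        then have "y \<in> hbar m" using y(2) hbox_subset_hbar by blast
        then have "hdist x y \<le> M * s" using D M(2) by fastforce
        moreover have "norm (K x y) * norm (f y) \<le> a * norm (K x y)"
          using y(1) by (simp add: mult.commute mult_right_mono)
        ultimately show ?thesis
          using True a(1) by (simp add: norm_mult ennreal_mult[symmetric])
      qed auto
    qed
  qed
  also have "\<dots> = ennreal a * (\<integral>\<^sup>+y\<in>{y \<in> S. s \<le> hdist x y \<and> hdist x y \<le> M * s}. ennreal (norm (K x y)) \<partial>rho)"
  proof (rule nn_integral_cmult)
    note [measurable] = hdist_measurable[OF x]
    have "{y \<in> space rho. s \<le> hdist x y \<and> hdist x y \<le> M * s} \<in> sets rho" by measurable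
    then show "(\<lambda>y. ennreal (norm (K x y)) * indicator {y \<in> S. s \<le> hdist x y \<and> hdist x y \<le> M * s} y) \<in> borel_measurable rho"
      by simp
  qed
  also have "\<dots> \<le> ennreal a * ennreal (annuli M)"
    by (intro mult_left_mono size_annulus x s M) simp
  also have "\<dots> < \<infinity>" by (simp add: ennreal_mult_less_top)
  finally show ?thesis
    unfolding set_integrable_def by (intro integrableI_bounded) auto
qed

lemma tr_integrable:
  assumes f: "f \<in> linf_c" and R: "R \<in> cz_sets" "x \<in> R"
  shows "set_integrable rho (S - cz_star R) (\<lambda>y. K x y * f y)"
proof (rule set_integrable_subset[OF far_integrable[OF f _ cz_radius_pos[OF R(1)]]])
  show "x \<in> S" using R cz_sets_subset_S by blast
  show "S - cz_star R \<in> sets rho" by (rule compl_star_sets[OF R(1)])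
  show "S - cz_star R \<subseteq> {y \<in> S. cz_radius R \<le> hdist x y}"
    using hdist_ge_outside_star[OF R] by blast
qed

lemma tr_add:
  assumes "f \<in> linf_c" "g \<in> linf_c" "R \<in> cz_sets" "x \<in> R"
  shows "tr (\<lambda>y. f y + g y) R x = tr f R x + tr g R x"
  using tr_integrable[OF assms(1,3,4)] tr_integrable[OF assms(2,3,4)]
  by (simp add: tr_def distrib_left set_integral_add)

lemma max_sing_eq: "max_sing K f x = (SUP R\<in>{R \<in> cz_sets. x \<in> R}. ennreal (norm (tr f R x)))"
  by (simp add: max_sing_def tr_def)

lemma max_sing_add:
  assumes "f \<in> linf_c" "g \<in> linf_c"
  shows "max_sing K (\<lambda>y. f y + g y) x \<le> max_sing K f x + max_sing K g x"
  unfolding max_sing_eq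
proof (rule SUP_least)
  fix R assume R: "R \<in> {R \<in> cz_sets. x \<in> R}"
  have "ennreal (norm (tr (\<lambda>y. f y + g y) R x)) \<le> ennreal (norm (tr f R x)) + ennreal (norm (tr g R x))"
    using assms R by (simp add: tr_add norm_triangle_ineq ennreal_plus[symmetric] ennreal_leI del: ennreal_plus)
  also have "\<dots> \<le> (SUP R\<in>{R \<in> cz_sets. x \<in> R}. ennreal (norm (tr f R x))) + (SUP R\<in>{R \<in> cz_sets. x \<in> R}. ennreal (norm (tr g R x)))"
    by (intro add_mono SUP_upper R)
  finally show "ennreal (norm (tr (\<lambda>y. f y + g y) R x)) \<le> \<dots>" .
qed

text \<open>Both truncations integrate over the same set, the complement of
  \<open>cz_star R\<close>, so only differences of the kernel in its first argument appear.\<close>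

lemma tr_diff:
  assumes f: "f \<in> linf_c" "AE x in rho. norm (f x) \<le> a" and R: "R \<in> cz_sets" "x \<in> R" "z \<in> R" and a: "0 \<le> a"
  shows "norm (tr f R x - tr f R z) \<le> a * H"
proof -
  have xz: "x \<in> S" "z \<in> S" using R cz_sets_subset_S by blast+
  note [measurable] = K1_meas[OF xz(1)] K1_meas[OF xz(2)] linf_c_measurable[OF f(1)] compl_star_sets[OF R(1)]
  note i = tr_integrable[OF f(1) R(1,2)] tr_integrable[OF f(1) R(1,3)]
  have "ennreal (norm (tr f R x - tr f R z)) = ennreal (norm (LINT y:(S - cz_star R)|rho. K x y * f y - K z y * f y))"
    unfolding tr_def set_integral_diff(2)[OF i] ..
  also have "\<dots> \<le>
      (\<integral>\<^sup>+y. ennreal (norm (indicator (S - cz_star R) y *\<^sub>R (K x y * f y - K z y * f y))) \<partial>rho)"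
    unfolding set_lebesgue_integral_def
    by (rule integral_norm_bound_ennreal) (use set_integral_diff(1)[OF i] in \<open>simp add: set_integrable_def\<close>)
  also have "\<dots> \<le>
      (\<integral>\<^sup>+y. ennreal a * (ennreal (norm (K x y - K z y)) * indicator (S - cz_star R) y) \<partial>rho)"
  proof (rule nn_integral_mono_AE)
    show "AE y in rho. ennreal (norm (indicator (S - cz_star R) y *\<^sub>R (K x y * f y - K z y * f y))) \<le>
      ennreal a * (ennreal (norm (K x y - K z y)) * indicator (S - cz_star R) y)"
      using f(2)
    proof eventually_elim
      fix y assume y: "norm (f y) \<le> a"
      have "norm (K x y * f y - K z y * f y) = norm (f y) * norm (K x y - K z y)"
        by (simp add: norm_mult[symmetric] algebra_simps)
      also have "\<dots> \<le> a * norm (K x y - K z y)" using y by (intro mult_right_mono) auto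
      finally show "ennreal (norm (indicator (S - cz_star R) y *\<^sub>R (K x y * f y - K z y * f y))) \<le>
      ennreal a * (ennreal (norm (K x y - K z y)) * indicator (S - cz_star R) y)"
        using a by (auto split: split_indicator simp: ennreal_mult[symmetric] intro: ennreal_leI)
    qed
  qed
  also have "\<dots> = ennreal a * (\<integral>\<^sup>+y\<in>S - cz_star R. ennreal (norm (K x y - K z y)) \<partial>rho)"
    by (rule nn_integral_cmult) measurable
  also have "\<dots> \<le> ennreal a * ennreal H"
    by (intro mult_left_mono hoermander2 R) simp
  finally have "ennreal (norm (tr f R x - tr f R z)) \<le> ennreal a * ennreal H" .
  then show ?thesis using a pos by (simp add: ennreal_mult[symmetric])
qed

text \<open>\<open>cz_star R\<close> is open and contains \<open>R\<close>, so the points of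
  \<open>R\<close> are outside the support of the part of \<open>f\<close> off
  \<open>cz_star R\<close>. For that part the kernel formula gives \<open>T\<close>, and additivity
  leaves \<open>T f\<close> minus \<open>T\<close> of the near part.\<close>

lemma tr_eq_T:
  assumes f: "f \<in> linf_c" and R: "R \<in> cz_sets"
  shows "AE z in rho. z \<in> R \<longrightarrow> tr f R z = T f z - T (res (cz_star R) f) z"
proof -
  define f1 where "f1 = res (cz_star R) f"
  define f2 where "f2 = res (S - cz_star R) f"
  have f12: "f1 \<in> linf_c" "f2 \<in> linf_c"
    unfolding f1_def f2_def using f R by (auto intro!: res_linf_c cz_star_sets_rho compl_star_sets)
  have ker: "AE z in rho. z \<notin> ess_supp f2 \<longrightarrow> T f2 z = (LINT y|rho. K z y * f2 y)"
    using T_kernel f12(2) by (auto simp: has_kernel_def)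
  have out: "z \<notin> ess_supp f2" if "z \<in> R" for z
  proof -
    have "AE y in rho. y \<in> cz_star R \<longrightarrow> f2 y = 0" by (intro AE_I2) (auto simp: f2_def res_def)
    then show ?thesis
      using that open_cz_star[OF R] cz_subset_star[OF R] unfolding ess_supp_def by blast
  qed
  define g where "g = (\<lambda>y. f1 y + f2 y)"
  have add: "AE z in rho. T g z = T f1 z + T f2 z"
    unfolding g_def by (rule T_add[OF f12])
  \<comment> \<open>The two functions agree only on \<open>S\<close>, while \<open>T\<close> acts on
    representatives. Their difference \<open>h\<close> has L2 norm zero, so the L2 bound makes
    \<open>T h\<close> vanish almost everywhere.\<close>
  have T_cong: "AE z in rho. T f z = T g z"
  proof -
    define h where "h = (\<lambda>y. f y + (- 1) * g y)"
    have gl: "g \<in> linf_c" unfolding g_def by (rule add_linf_c[OF f12])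
    have hl: "h \<in> linf_c" unfolding h_def by (intro add_linf_c f cmult_linf_c gl)
    have fe: "f = (\<lambda>y. g y + h y)" by (auto simp: h_def)
    have h0: "h y = 0" if "y \<in> S" for y
      using that cz_star_subset_S[of R] by (auto simp: h_def g_def f1_def f2_def res_def split: split_indicator)
    have "(\<integral>\<^sup>+x. ennreal ((norm (T h x))\<^sup>2) \<partial>rho) \<le> ennreal B * (\<integral>\<^sup>+x. ennreal ((norm (h x))\<^sup>2) \<partial>rho)"
      by (rule T_bound[OF hl])
    also have "(\<integral>\<^sup>+x. ennreal ((norm (h x))\<^sup>2) \<partial>rho) = (\<integral>\<^sup>+x. 0 \<partial>(rho :: 'n pt measure))"
      by (rule nn_integral_cong) (simp add: h0)
    finally have "(\<integral>\<^sup>+x. ennreal ((norm (T h x))\<^sup>2) \<partial>rho) = 0" by simp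
    then have "AE x in rho. T h x = 0"
      using T_meas[OF hl] by (subst (asm) nn_integral_0_iff_AE) auto
    moreover have "AE x in rho. T f x = T g x + T h x"
      using T_add[OF gl hl] fe by simp
    ultimately show ?thesis by eventually_elim simp
  qed
  show ?thesis
    using ker add T_cong
  proof eventually_elim
    fix z assume z: "z \<notin> ess_supp f2 \<longrightarrow> T f2 z = (LINT y|rho. K z y * f2 y)" "T g z = T f1 z + T f2 z"
      "T f z = T g z"
    show "z \<in> R \<longrightarrow> tr f R z = T f z - T (res (cz_star R) f) z"
    proof
      assume "z \<in> R"
      then have "T f2 z = (LINT y|rho. K z y * f2 y)" using z(1) out by blast
      also have "\<dots> = tr f R z"
        unfolding tr_def set_lebesgue_integral_def f2_def res_def by (simp add: mult_ac)
      finally show "tr f R z = T f z - T (res (cz_star R) f) z" using z by (simp add: f1_def)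
    qed
  qed
qed

end

section \<open>Sequences of stopping sets and their boundedness\<close>

lemma norm_set_integral_UN_le:
  fixes h :: "'a \<Rightarrow> complex" and A :: "nat \<Rightarrow> 'a set"
  assumes A: "\<And>n. A n \<in> sets M" "disjoint_family A" and h: "set_integrable M (\<Union>n. A n) h"
  shows "ennreal (norm (LINT x:(\<Union>n. A n)|M. h x)) \<le> (\<Sum>n. ennreal (norm (LINT x:A n|M. h x)))"
proof (cases "(\<Sum>n. ennreal (norm (LINT x:A n|M. h x))) = top")
  case False
  then have s: "summable (\<lambda>n. norm (LINT x:A n|M. h x))"
    by (intro summable_suminf_not_top) auto
  have "(LINT x:(\<Union>n. A n)|M. h x) = (\<Sum>n. (LINT x:A n|M. h x))"
    by (rule lebesgue_integral_countable_add[OF A(1) _ h]) (use A(2) in \<open>auto simp: disjoint_family_on_def\<close>)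
  then have "norm (LINT x:(\<Union>n. A n)|M. h x) \<le> (\<Sum>n. norm (LINT x:A n|M. h x))"
    using summable_norm[OF s] by simp
  then have "ennreal (norm (LINT x:(\<Union>n. A n)|M. h x)) \<le> ennreal (\<Sum>n. norm (LINT x:A n|M. h x))"
    by (rule ennreal_leI)
  also have "\<dots> = (\<Sum>n. ennreal (norm (LINT x:A n|M. h x)))"
    by (rule suminf_ennreal2[symmetric]) (use s in auto)
  finally show ?thesis .
qed simp

text \<open>Empty sets as padding turn the family into a sequence, so that sums over it become
  series in \<open>ennreal\<close>. The upper bound for the averages over \<open>A n\<close> is
  inherited from the set \<open>P\<close> of comparable measure.\<close>

lemma cz_decomposition_seq:
  fixes F :: "('n::finite) pt \<Rightarrow> ennreal"
  assumes F: "F \<in> borel_measurable rho" "(\<integral>\<^sup>+x. F x \<partial>rho) < \<infinity>" and l: "0 < l"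
  obtains A :: "nat \<Rightarrow> 'n pt set" where "\<And>n. A n \<in> cz_sets \<or> A n = {}" "disjoint_family A"
    "\<And>n. ennreal l * emeasure rho (A n) \<le> (\<integral>\<^sup>+x\<in>A n. F x \<partial>rho)"
    "\<And>n. (\<integral>\<^sup>+x\<in>A n. F x \<partial>rho) \<le> ennreal (2 ^ CARD('n) * l) * emeasure rho (A n)"
    "\<And>n. A n \<in> cz_sets \<Longrightarrow> \<exists>P\<in>cz_sets. A n \<subseteq> P \<and> emeasure rho P \<le> 2 ^ CARD('n) * emeasure rho (A n) \<and>
        (\<integral>\<^sup>+x\<in>P. F x \<partial>rho) \<le> ennreal l * emeasure rho P"
    "AE x in rho. x \<notin> (\<Union>n. A n) \<longrightarrow> F x \<le> ennreal l"
proof -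
  obtain G where G: "countable G" "G \<subseteq> cz_sets" "disjoint G"
    "\<And>R. R \<in> G \<Longrightarrow> ennreal l * emeasure rho R \<le> (\<integral>\<^sup>+x\<in>R. F x \<partial>rho)"
    "\<And>R. R \<in> G \<Longrightarrow> \<exists>P\<in>cz_sets. R \<subseteq> P \<and> emeasure rho P \<le> 2 ^ CARD('n) * emeasure rho R \<and>
        (\<integral>\<^sup>+x\<in>P. F x \<partial>rho) \<le> ennreal l * emeasure rho P"
    "AE x in rho. x \<notin> \<Union>G \<longrightarrow> F x \<le> ennreal l"
    using cz_decomposition[OF F l] by blast
  define I where "I = to_nat_on G ` G"
  define A where "A n = (if n \<in> I then from_nat_into G n else {})" for n
  have AG: "A n \<in> G" if "n \<in> I" for n
    using that G(1) by (auto simp: A_def I_def from_nat_into_to_nat_on)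
  have A0: "A n = {}" if "n \<notin> I" for n using that by (simp add: A_def)
  have UN: "(\<Union>n. A n) = \<Union>G"
  proof
    show "(\<Union>n. A n) \<subseteq> \<Union>G" using AG A0 by blast
    show "\<Union>G \<subseteq> (\<Union>n. A n)"
    proof (intro Union_least)
      fix R assume "R \<in> G"
      then have "R = A (to_nat_on G R)" using G(1) by (simp add: A_def I_def from_nat_into_to_nat_on)
      then show "R \<subseteq> (\<Union>n. A n)" by blast
    qed
  qed
  have P: "\<exists>P\<in>cz_sets. A n \<subseteq> P \<and> emeasure rho P \<le> 2 ^ CARD('n) * emeasure rho (A n) \<and>
        (\<integral>\<^sup>+x\<in>P. F x \<partial>rho) \<le> ennreal l * emeasure rho P" if "A n \<noteq> {}" for n
  proof (rule G(5))
    have "n \<in> I" using that A0 by blast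
    then show "A n \<in> G" by (rule AG)
  qed
  show thesis
  proof (rule that[of A])
    show "A n \<in> cz_sets \<or> A n = {}" for n using AG A0 G(2) by blast
    show "disjoint_family A"
      unfolding disjoint_family_on_def
    proof (intro ballI impI)
      fix m n :: nat assume mn: "m \<noteq> n"
      show "A m \<inter> A n = {}"
      proof (cases "m \<in> I \<and> n \<in> I")
        case True
        then have "A m \<noteq> A n" using mn G(1) by (auto simp: A_def I_def from_nat_into_to_nat_on)
        then show ?thesis using G(3) AG True by (auto simp: pairwise_def disjnt_def)
      qed (auto simp: A_def)
    qed
    show "ennreal l * emeasure rho (A n) \<le> (\<integral>\<^sup>+x\<in>A n. F x \<partial>rho)" for n
      using G(4) AG A0 by (cases "n \<in> I") auto
    show "(\<integral>\<^sup>+x\<in>A n. F x \<partial>rho) \<le> ennreal (2 ^ CARD('n) * l) * emeasure rho (A n)" for n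
    proof (cases "A n = {}")
      case False
      then obtain P where P: "A n \<subseteq> P" "emeasure rho P \<le> 2 ^ CARD('n) * emeasure rho (A n)"
        "(\<integral>\<^sup>+x\<in>P. F x \<partial>rho) \<le> ennreal l * emeasure rho P" using P by blast
      have "(\<integral>\<^sup>+x\<in>A n. F x \<partial>rho) \<le> ennreal l * emeasure rho P"
        using set_nn_integral_mono_set[OF P(1)] P(3) by (rule order_trans)
      also have "\<dots> \<le> ennreal l * (2 ^ CARD('n) * emeasure rho (A n))" using P(2) by (rule mult_left_mono) simp
      also have "\<dots> = ennreal (2 ^ CARD('n) * l) * emeasure rho (A n)"
        using l by (simp add: ennreal_mult ennreal_power[symmetric] mult_ac)
      finally show ?thesis .
    qed simp
    show "AE x in rho. x \<notin> (\<Union>n. A n) \<longrightarrow> F x \<le> ennreal l" using G(6) by (simp add: UN)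
  qed (use P cz_sets_nonempty in blast)
qed

lemma ennreal_absorb:
  assumes "ennreal p * ennreal v \<le> ennreal c + ennreal q * ennreal v" "0 \<le> p" "0 \<le> q" "0 \<le> v" "0 \<le> c"
  shows "p * v \<le> c + q * v"
  using assms by (simp add: ennreal_mult[symmetric] ennreal_plus[symmetric] del: ennreal_plus)

lemma le_one_plus_square: "0 \<le> q \<Longrightarrow> q \<le> (1 + q)\<^sup>2" for q :: real
  using zero_le_power2[of q] by (simp add: power2_sum)

text \<open>By the triangle inequality the distance of \<open>y\<close> from the point (0, 1) stays
  bounded. It controls the logarithm of the height by \<open>hdist_ge_ln\<close> and the horizontal
  part through its cosh.\<close>

lemma hbox_hball_subset: "\<exists>m'. \<forall>x\<in>hbox m. \<forall>y\<in>S. hdist x y \<le> D \<longrightarrow> y \<in> (hbox m' :: ('n::finite) pt set)"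
proof -
  define e :: "'n pt" where "e = (0, 1)"
  have eS: "e \<in> S" by (simp add: e_def S_def)
  have "continuous_on (hbar m) (\<lambda>y. hdist e y)"
    by (rule continuous_on_hdist) (use eS hbar_subset_S in \<open>auto intro: continuous_intros\<close>)
  then have "compact ((\<lambda>y. hdist e y) ` hbar m)" using compact_hbar by (rule compact_continuous_image)
  then obtain D0 where D0: "\<And>y. y \<in> hbar m \<Longrightarrow> \<bar>hdist e y\<bar> \<le> D0"
    using compact_imp_bounded bounded_real by (metis imageI)
  define E where "E = max 0 (D0 + D)"
  define c where "c = exp E + 2 * exp E * cosh E"
  obtain m' :: nat where m': "c < real m'" using reals_Archimedean2 by blast
  show ?thesis
  proof (intro exI[of _ m'] ballI impI)
    fix x y :: "'n pt" assume x: "x \<in> hbox m" and y: "y \<in> S" and d: "hdist x y \<le> D"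
    have xS: "x \<in> S" using x hbox_subset_S by blast
    have yp: "0 < snd y" using y by (simp add: S_def)
    have "hdist e y \<le> hdist e x + hdist x y" by (rule hdist_triangle[OF eS xS y])
    also have "\<dots> \<le> E"
    proof -
      have "x \<in> hbar m" using x hbox_subset_hbar by blast
      then have "\<bar>hdist e x\<bar> \<le> D0" by (rule D0)
      then show ?thesis using d unfolding E_def by linarith
    qed
    finally have dE: "hdist e y \<le> E" .
    then have "\<bar>ln (snd y)\<bar> \<le> E" using hdist_ge_ln[OF eS y] by (simp add: e_def)
    then have "ln (snd y) \<le> E" "- E \<le> ln (snd y)" by linarith+
    then have "exp (ln (snd y)) \<le> exp E" "exp (- E) \<le> exp (ln (snd y))" by (simp_all only: exp_le_cancel_iff)
    then have t: "snd y \<le> exp E" "exp (- E) \<le> snd y" using yp by simp_all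
    have cc: "cosh (hdist e y) \<le> cosh E"
      using dE hdist_nonneg[OF eS y] by (intro cosh_real_nonneg_le_iff[THEN iffD2]) (auto simp: E_def)
    have "(norm (fst y))\<^sup>2 \<le> 1 + (snd y)\<^sup>2 + (norm (fst y))\<^sup>2" by simp
    also have "\<dots> = cosh (hdist e y) * (2 * snd y)"
      unfolding cosh_hdist[OF eS y] unfolding hquot_def e_def using yp by simp
    also have "\<dots> \<le> cosh E * (2 * exp E)"
      using cc t yp cosh_real_ge_1[of E] by (intro mult_mono) auto
    finally have n2: "(norm (fst y))\<^sup>2 \<le> 2 * exp E * cosh E" by (simp add: mult_ac)
    have "norm (fst y) \<le> 1 + 2 * exp E * cosh E"
    proof (rule power2_le_imp_le)
      have "0 \<le> 2 * exp E * cosh E" using cosh_real_ge_1[of E] by simp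
      then have "2 * exp E * cosh E \<le> (1 + 2 * exp E * cosh E)\<^sup>2"
        by (rule le_one_plus_square)
      then show "(norm (fst y))\<^sup>2 \<le> (1 + 2 * exp E * cosh E)\<^sup>2" using n2 by linarith
      show "0 \<le> 1 + 2 * exp E * cosh E" using cosh_real_ge_1[of E] by simp
    qed
    also have "1 \<le> exp E" by (simp add: E_def)
    finally have "norm (fst y) \<le> c" by (simp add: c_def)
    moreover have ec: "exp E \<le> c" using cosh_real_ge_1[of E] by (simp add: c_def)
    moreover have "1 / (real m' + 1) < snd y"
    proof -
      have "exp E < real m' + 1" using ec m' by linarith
      then have "1 / (real m' + 1) < 1 / exp E" by (intro divide_strict_left_mono) (auto intro: add_nonneg_pos)
      also have "\<dots> = exp (- E)" by (simp add: exp_minus inverse_eq_divide)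
      finally show ?thesis using t by linarith
    qed
    ultimately show "y \<in> hbox m'" using m' t by (auto simp: hbox_def mem_Times_iff)
  qed
qed

text \<open>Serves to show that the good part has compact support. A large radius forces a large
  measure: for r >= 1 the side is at least a exp (2 r), and this is at least 1 / (m + 1) because the
  box meets \<open>hbox m\<close>. So the bound on the measure bounds the radius, and with it the
  diameter.\<close>

lemma cz_meet_bounded:
  "\<exists>m'. \<forall>R\<in>cz_sets. R \<inter> hbox m \<noteq> {} \<longrightarrow> emeasure rho R \<le> ennreal b \<longrightarrow> R \<subseteq> (hbox m' :: ('n::finite) pt set)"
proof -
  define M where "M = max 1 (b * (real m + 1) ^ CARD('n))"
  define D where "D = cz_dc TYPE('n) * M"
  obtain m' where m': "\<And>x y. x \<in> (hbox m :: 'n pt set) \<Longrightarrow> y \<in> S \<Longrightarrow> hdist x y \<le> D \<Longrightarrow> y \<in> (hbox m' :: 'n pt set)"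
    using hbox_hball_subset by metis
  have "R \<subseteq> hbox m'" if R: "R \<in> cz_sets" "R \<inter> hbox m \<noteq> {}" "emeasure rho R \<le> ennreal b" for R :: "'n pt set"
  proof -
    obtain j k a r where *: "R = cz_box j k a r" "0 < a" "0 < r"
      "cz_admissible (2 powi j) a r" "cz_radius R = r" using R(1) by (rule cz_setsE)
    obtain x where x: "x \<in> R" "x \<in> hbox m" using R(2) by blast
    have rM: "r \<le> M"
    proof (cases "r < 1")
      case False
      have "ennreal (2 * r * (2 powi j) ^ CARD('n)) \<le> ennreal b"
        using R(3) * by (simp add: emeasure_cz_box)
      moreover have "0 < 2 * r * (2 powi j) ^ CARD('n)" using *(3) by simp
      ultimately have v: "2 * r * (2 powi j) ^ CARD('n) \<le> b"
        by (simp only: ennreal_le_iff2) linarith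
      have xt: "1 / (real m + 1) < snd x" "snd x < a * exp r" using x by (auto simp: hbox_def * cz_box_def)
      then have "1 / (real m + 1) \<le> a * exp r" by linarith
      also have "\<dots> \<le> a * exp (2 * r)" using * by simp
      also have "\<dots> \<le> 2 powi j" using *(4) False by (simp add: cz_admissible_def)
      finally have "(1 / (real m + 1)) ^ CARD('n) \<le> (2 powi j) ^ CARD('n)" by (intro power_mono) auto
      then have "2 * r * (1 / (real m + 1)) ^ CARD('n) \<le> b"
        using v *(3) by (intro order_trans[OF mult_left_mono v]) auto
      then have "2 * r \<le> b * (real m + 1) ^ CARD('n)"
        by (simp add: power_one_over field_simps)
      then show ?thesis using *(3) by (simp add: M_def)
    qed (simp add: M_def)
    show ?thesis
    proof
      fix y assume y: "y \<in> R"
      have "hdist x y \<le> cz_dc TYPE('n) * r" using cz_diam[OF R(1) x(1) y] *(5) by simp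
      also have "\<dots> \<le> D" unfolding D_def using rM cz_dc_ge_1[where 'n = 'n] by (intro mult_left_mono) auto
      finally show "y \<in> hbox m'" using m' x(2) y cz_sets_subset_S[OF R(1)] by blast
    qed
  qed
  then show ?thesis by blast
qed

section \<open>Level sets of the maximal operator for bounded functions\<close>

context cz_op begin

text \<open>The summand 2 H keeps the oscillation of a truncation over its box within l / 2. The
  other summand makes the mean square of \<open>T\<close> of the near part at most l^2 / 16; there 1
  + q stands in for a square root of q, by \<open>le_one_plus_square\<close>.\<close>

definition cotlar_c0 :: real where
  "cotlar_c0 = 2 * H + 4 * (1 + B * cz_cs TYPE('n))"

definition cotlar_c1 :: real where
  "cotlar_c1 = 16 * B * cz_cov"

lemma cotlar_c_pos: "0 < cotlar_c0" "0 < cotlar_c1"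
  using pos cz_cs_ge_1[where 'n = 'n] cz_cov_pos by (auto simp: cotlar_c0_def cotlar_c1_def add_pos_pos)

text \<open>On all of \<open>R\<close> the truncation is at least l / 2 in absolute value, and it
  equals \<open>T f\<close> minus \<open>T f1\<close> almost everywhere, \<open>f1\<close> being the
  part of \<open>f\<close> on \<open>cz_star R\<close>. After squaring and integrating over
  \<open>R\<close>, the L2 bound and the comparable measure of \<open>cz_star R\<close> make the
  term with \<open>f1\<close> absorbable.\<close>

lemma cotlar_set:
  assumes f: "f \<in> linf_c" "AE x in rho. norm (f x) \<le> a" and a: "0 < a" "cotlar_c0 * a \<le> l"
    and R: "R \<in> cz_sets" "x \<in> R" "l < norm (tr f R x)"
  shows "emeasure rho R \<le> ennreal (16 / l\<^sup>2) * (\<integral>\<^sup>+z\<in>R. ennreal ((norm (T f z))\<^sup>2) \<partial>rho)"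
proof -
  define Cs where "Cs = cz_cs TYPE('n)"
  have Cs: "1 \<le> Cs" by (simp add: Cs_def cz_cs_ge_1)
  have l: "0 < l" using a cotlar_c_pos by (meson less_le_trans mult_pos_pos)
  have l2: "2 * (a * H) \<le> l" "4 * (1 + B * Cs) * a \<le> l"
  proof -
    have "cotlar_c0 * a = 2 * (a * H) + 4 * (1 + B * Cs) * a" by (simp add: cotlar_c0_def Cs_def algebra_simps)
    moreover have "0 \<le> 2 * (a * H)" "0 \<le> 4 * (1 + B * Cs) * a" using pos a Cs by auto
    ultimately show "2 * (a * H) \<le> l" "4 * (1 + B * Cs) * a \<le> l" using a(2) by linarith+
  qed
  define f1 where "f1 = res (cz_star R) f"
  have f1: "f1 \<in> linf_c" unfolding f1_def by (intro res_linf_c cz_star_sets_rho R f)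
  note [measurable] = T_meas[OF f(1)] T_meas[OF f1] cz_sets_rho[OF R(1)]
  have ae: "AE z in rho. z \<in> R \<longrightarrow> ennreal (l\<^sup>2 / 8) \<le> ennreal ((norm (T f z))\<^sup>2) + ennreal ((norm (T f1 z))\<^sup>2)"
    using tr_eq_T[OF f(1) R(1)]
  proof eventually_elim
    fix z assume z: "z \<in> R \<longrightarrow> tr f R z = T f z - T (res (cz_star R) f) z"
    show "z \<in> R \<longrightarrow> ennreal (l\<^sup>2 / 8) \<le> ennreal ((norm (T f z))\<^sup>2) + ennreal ((norm (T f1 z))\<^sup>2)"
    proof
      assume zR: "z \<in> R"
      have "norm (tr f R x - tr f R z) \<le> a * H" by (rule tr_diff[OF f R(1,2) zR]) (use a in simp)
      moreover have "norm (tr f R x) \<le> norm (tr f R x - tr f R z) + norm (tr f R z)"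
        by (metis diff_add_cancel norm_triangle_ineq)
      moreover have "norm (tr f R z) \<le> norm (T f z) + norm (T f1 z)"
        using z zR norm_triangle_ineq4 by (simp add: f1_def)
      ultimately have "l / 2 \<le> norm (T f z) + norm (T f1 z)" using R(3) l2(1) by linarith
      then have "(l / 2)\<^sup>2 \<le> (norm (T f z) + norm (T f1 z))\<^sup>2" using l by (intro power_mono) auto
      also have "\<dots> \<le> 2 * ((norm (T f z))\<^sup>2 + (norm (T f1 z))\<^sup>2)"
        using sum_squares_bound[of "norm (T f z)" "norm (T f1 z)"] by (simp add: power2_sum)
      finally have "l\<^sup>2 / 8 \<le> (norm (T f z))\<^sup>2 + (norm (T f1 z))\<^sup>2" by (simp add: power_divide)
      then show "ennreal (l\<^sup>2 / 8) \<le> ennreal ((norm (T f z))\<^sup>2) + ennreal ((norm (T f1 z))\<^sup>2)"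
        by (simp add: ennreal_plus[symmetric] ennreal_leI del: ennreal_plus)
    qed
  qed
  have i1: "(\<integral>\<^sup>+z. ennreal ((norm (T f1 z))\<^sup>2) \<partial>rho) \<le> ennreal (l\<^sup>2 / 16) * emeasure rho R"
  proof -
    have "(\<integral>\<^sup>+z. ennreal ((norm (f1 z))\<^sup>2) \<partial>rho) \<le> (\<integral>\<^sup>+z. ennreal (a\<^sup>2) * indicator (cz_star R) z \<partial>rho)"
    proof (rule nn_integral_mono_AE)
      show "AE z in rho. ennreal ((norm (f1 z))\<^sup>2) \<le> ennreal (a\<^sup>2) * indicator (cz_star R) z"
        using f(2) by eventually_elim
          (auto simp: f1_def norm_res split: split_indicator intro!: ennreal_leI power_mono)
    qed
    also have "\<dots> = ennreal (a\<^sup>2) * emeasure rho (cz_star R)"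
      by (rule nn_integral_cmult_indicator[OF cz_star_sets_rho[OF R(1)]])
    also have "\<dots> \<le> ennreal (a\<^sup>2) * (ennreal Cs * emeasure rho R)"
      unfolding Cs_def by (intro mult_left_mono emeasure_cz_star R) simp
    finally have "ennreal B * (\<integral>\<^sup>+z. ennreal ((norm (f1 z))\<^sup>2) \<partial>rho) \<le>
        ennreal B * (ennreal (a\<^sup>2) * (ennreal Cs * emeasure rho R))" by (rule mult_left_mono) simp
    also have "\<dots> = ennreal (B * (a\<^sup>2 * Cs)) * emeasure rho R"
      using pos Cs by (simp add: ennreal_mult mult_ac)
    also have "\<dots> \<le> ennreal (l\<^sup>2 / 16) * emeasure rho R"
    proof (intro mult_right_mono ennreal_leI)
      have BC: "0 \<le> B * Cs" using pos Cs by simp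
      then have "B * Cs \<le> (1 + B * Cs)\<^sup>2" by (rule le_one_plus_square)
      then have "B * Cs * (16 * a\<^sup>2) \<le> (1 + B * Cs)\<^sup>2 * (16 * a\<^sup>2)" by (intro mult_right_mono) auto
      also have "\<dots> = (4 * (1 + B * Cs) * a)\<^sup>2"
      proof -
        have "q\<^sup>2 * (16 * a\<^sup>2) = (4 * q * a)\<^sup>2" for q :: real by (simp add: power_mult_distrib)
        then show ?thesis .
      qed
      also have "\<dots> \<le> l\<^sup>2" using l2(2) a BC by (intro power_mono) auto
      finally show "B * (a\<^sup>2 * Cs) \<le> l\<^sup>2 / 16" by (simp add: mult_ac)
    qed simp
    finally show ?thesis using T_bound[OF f1] by (rule order_trans[rotated])
  qed
  define X where "X = (\<integral>\<^sup>+z\<in>R. ennreal ((norm (T f z))\<^sup>2) \<partial>rho)"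
  have "ennreal (l\<^sup>2 / 8) * emeasure rho R = (\<integral>\<^sup>+z\<in>R. ennreal (l\<^sup>2 / 8) \<partial>rho)"
    by (simp add: nn_integral_cmult_indicator)
  also have "\<dots> \<le> (\<integral>\<^sup>+z. ennreal ((norm (T f z))\<^sup>2) * indicator R z + ennreal ((norm (T f1 z))\<^sup>2) \<partial>rho)"
  proof (rule nn_integral_mono_AE)
    show "AE z in rho. ennreal (l\<^sup>2 / 8) * indicator R z \<le> ennreal ((norm (T f z))\<^sup>2) * indicator R z + ennreal ((norm (T f1 z))\<^sup>2)"
      using ae by eventually_elim (auto split: split_indicator)
  qed
  also have "\<dots> = X + (\<integral>\<^sup>+z. ennreal ((norm (T f1 z))\<^sup>2) \<partial>rho)"
    unfolding X_def by (rule nn_integral_add) measurable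
  also have "\<dots> \<le> X + ennreal (l\<^sup>2 / 16) * emeasure rho R" by (intro add_left_mono i1)
  finally have le: "ennreal (l\<^sup>2 / 8) * emeasure rho R \<le> X + ennreal (l\<^sup>2 / 16) * emeasure rho R" .
  \<comment> \<open>Absorbing the last term is legitimate because the measure of \<open>R\<close> is
    finite.\<close>
  obtain v where v: "emeasure rho R = ennreal v" "0 \<le> v"
    using emeasure_cz_finite[OF R(1)] by (cases "emeasure rho R") auto
  show ?thesis
    unfolding X_def[symmetric]
  proof (cases X)
    case (real c)
    then have "l\<^sup>2 / 8 * v \<le> c + l\<^sup>2 / 16 * v"
      using le v by (intro ennreal_absorb) auto
    then have "v \<le> 16 / l\<^sup>2 * c" using l by (simp add: field_simps)
    then show "emeasure rho R \<le> ennreal (16 / l\<^sup>2) * X"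
      using v real by (simp add: ennreal_mult[symmetric] ennreal_leI)
  next
    case top
    then show "emeasure rho R \<le> ennreal (16 / l\<^sup>2) * X" using l by (simp add: ennreal_mult_top)
  qed
qed

text \<open>The boxes with a large truncation satisfy the averaging hypothesis of
  \<open>cz_covering\<close> with the square of |T f| as weight. An enclosing set \<open>W\<close>
  is given because the level set itself is not yet known to be measurable.\<close>

lemma cotlar:
  assumes f: "f \<in> linf_c" "AE x in rho. norm (f x) \<le> a" and a: "0 < a" "cotlar_c0 * a \<le> l"
  obtains W where "W \<in> sets rho" "{x \<in> S. ennreal l < max_sing K f x} \<subseteq> W"
    "emeasure rho W \<le> ennreal (cotlar_c1 / l\<^sup>2) * (\<integral>\<^sup>+x. ennreal ((norm (f x))\<^sup>2) \<partial>rho)"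
proof -
  have l: "0 < l" using a cotlar_c_pos by (meson less_le_trans mult_pos_pos)
  note [measurable] = T_meas[OF f(1)]
  define F where "F = {R \<in> cz_sets. \<exists>x\<in>R. l < norm (tr f R x)}"
  have F: "F \<subseteq> cz_sets" by (auto simp: F_def)
  have avg: "emeasure rho R \<le> ennreal (16 / l\<^sup>2) * (\<integral>\<^sup>+z\<in>R. ennreal ((norm (T f z))\<^sup>2) \<partial>rho)" if "R \<in> F" for R
    using that cotlar_set[OF f a] by (auto simp: F_def)
  have m: "(\<lambda>z. ennreal ((norm (T f z))\<^sup>2)) \<in> borel_measurable rho" by measurable
  obtain W where W: "W \<in> sets rho" "\<Union>F \<subseteq> W"
    "emeasure rho W \<le> ennreal cz_cov * (ennreal (16 / l\<^sup>2) * (\<integral>\<^sup>+x. ennreal ((norm (T f x))\<^sup>2) \<partial>rho))"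
    by (rule cz_covering[OF F m avg])
  have "{x \<in> S. ennreal l < max_sing K f x} \<subseteq> W"
  proof
    fix x assume "x \<in> {x \<in> S. ennreal l < max_sing K f x}"
    then obtain R where R: "R \<in> cz_sets" "x \<in> R" "ennreal l < ennreal (norm (tr f R x))"
      unfolding max_sing_eq by (auto simp: less_SUP_iff)
    then have "l < norm (tr f R x)" using l by (simp add: ennreal_less_iff)
    then show "x \<in> W" using W(2) R by (auto simp: F_def)
  qed
  moreover have "emeasure rho W \<le> ennreal (cotlar_c1 / l\<^sup>2) * (\<integral>\<^sup>+x. ennreal ((norm (f x))\<^sup>2) \<partial>rho)"
  proof -
    note W(3)
    also have "ennreal cz_cov * (ennreal (16 / l\<^sup>2) * (\<integral>\<^sup>+x. ennreal ((norm (T f x))\<^sup>2) \<partial>rho)) \<le>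
        ennreal cz_cov * (ennreal (16 / l\<^sup>2) * (ennreal B * (\<integral>\<^sup>+x. ennreal ((norm (f x))\<^sup>2) \<partial>rho)))"
      by (intro mult_left_mono T_bound f) auto
    also have "\<dots> = ennreal (cz_cov * (16 / l\<^sup>2 * B)) * (\<integral>\<^sup>+x. ennreal ((norm (f x))\<^sup>2) \<partial>rho)"
      using pos cz_cov_pos by (simp only: ennreal_mult mult.assoc ennreal_mult' divide_nonneg_nonneg zero_le_power2 zero_le_numeral order_trans[OF zero_le_one] less_imp_le mult_nonneg_nonneg)
    also have "cz_cov * (16 / l\<^sup>2 * B) = cotlar_c1 / l\<^sup>2" by (simp add: cotlar_c1_def)
    finally show ?thesis .
  qed
  ultimately show thesis using that W(1) by blast
qed

end

section \<open>The weak type (1,1) estimate\<close>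

text \<open>No integrability is assumed: the Bochner integral of a function that is not integrable
  is 0.\<close>

lemma norm_set_integral_le_nn_integral:
  fixes g :: "'a \<Rightarrow> complex"
  shows "ennreal (norm (LINT x:X|M. g x)) \<le> (\<integral>\<^sup>+x\<in>X. ennreal (norm (g x)) \<partial>M)"
proof (cases "set_integrable M X g")
  case True
  have "ennreal (norm (LINT x:X|M. g x)) \<le> (\<integral>\<^sup>+x. ennreal (norm (indicator X x *\<^sub>R g x)) \<partial>M)"
    unfolding set_lebesgue_integral_def
    by (rule integral_norm_bound_ennreal) (use True in \<open>simp add: set_integrable_def\<close>)
  also have "\<dots> = (\<integral>\<^sup>+x\<in>X. ennreal (norm (g x)) \<partial>M)"
    by (intro nn_integral_cong) (auto split: split_indicator)
  finally show ?thesis .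
next
  case False
  then show ?thesis
    by (simp add: set_integrable_def set_lebesgue_integral_def not_integrable_integral_eq)
qed

text \<open>As \<open>x\<close> is outside \<open>cz_star Q\<close>, the radius of \<open>Q\<close>
  is at most the distance from \<open>x\<close> to any point of \<open>Q\<close>, so these distances
  are all comparable up to the factor 1 + c with c the diameter constant. For the radius r of
  \<open>R\<close>, one point of \<open>Q\<close> has distance at least r from \<open>x\<close> and
  another one at most (1 + c) r. The bounds are written as s and M s with M = (1 + c)^3 to fit
  \<open>size_annulus\<close>.\<close>

lemma star_boundary_annulus:
  fixes Q R :: "('n::finite) pt set"
  assumes Q: "Q \<in> cz_sets" and R: "R \<in> cz_sets" "x \<in> R" and x: "x \<notin> cz_star Q"
    and meet: "Q \<inter> cz_star R \<noteq> {}" "\<not> Q \<subseteq> cz_star R"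
  shows "Q \<subseteq> {y \<in> S. cz_radius R / (1 + cz_dc TYPE('n)) \<le> hdist x y \<and>
    hdist x y \<le> (1 + cz_dc TYPE('n)) ^ 3 * (cz_radius R / (1 + cz_dc TYPE('n)))}"
proof
  fix y assume y: "y \<in> Q"
  define c where "c = cz_dc TYPE('n)"
  define r where "r = cz_radius R"
  define q where "q = cz_radius Q"
  have c: "1 \<le> c" by (simp add: c_def cz_dc_ge_1)
  have r: "0 < r" unfolding r_def by (rule cz_radius_pos[OF R(1)])
  have xS: "x \<in> S" using R cz_sets_subset_S by blast
  have QS: "z \<in> S" if "z \<in> Q" for z using that Q cz_sets_subset_S by blast
  have q: "q \<le> hdist x z" if "z \<in> Q" for z
    using hdist_ge_outside_star[OF Q that xS x] by (simp add: q_def hdist_commute)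
  have diam: "hdist z z' \<le> c * q" if "z \<in> Q" "z' \<in> Q" for z z'
    using cz_diam[OF Q that] by (simp add: c_def q_def)
  obtain y1 where y1: "y1 \<in> Q" "y1 \<notin> cz_star R" using meet(2) by blast
  have "r \<le> hdist x y1" unfolding r_def by (rule hdist_ge_outside_star[OF R QS[OF y1(1)] y1(2)])
  also have "\<dots> \<le> hdist x y + hdist y y1" by (rule hdist_triangle[OF xS QS[OF y] QS[OF y1(1)]])
  also have "\<dots> \<le> hdist x y + c * hdist x y"
    using diam[OF y y1(1)] q[OF y] c mult_left_mono[of q "hdist x y" c] by linarith
  finally have "r \<le> (1 + c) * hdist x y" by (simp add: algebra_simps)
  then have lo: "r / (1 + c) \<le> hdist x y" using c by (simp add: divide_le_eq mult.commute)
  obtain y0 where y0: "y0 \<in> Q" "y0 \<in> cz_star R" using meet(1) by blast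
  then obtain z where z: "z \<in> R" "hdist y0 z < r" unfolding cz_star_eq[OF R(1)] r_def by blast
  have zS: "z \<in> S" using z R cz_sets_subset_S by blast
  have "hdist x y0 \<le> hdist x z + hdist z y0" by (rule hdist_triangle[OF xS zS QS[OF y0(1)]])
  also have "\<dots> \<le> c * r + r"
    using cz_diam[OF R z(1)] z(2) by (simp add: c_def r_def hdist_commute[of z])
  finally have xy0: "hdist x y0 \<le> (1 + c) * r" by (simp add: algebra_simps)
  have "hdist x y \<le> hdist x y0 + hdist y0 y" by (rule hdist_triangle[OF xS QS[OF y0(1)] QS[OF y]])
  also have "\<dots> \<le> (1 + c) * r + c * ((1 + c) * r)"
    using diam[OF y0(1) y] q[OF y0(1)] xy0 c mult_left_mono[of q "(1 + c) * r" c] by linarith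
  also have "\<dots> = (1 + c) ^ 3 * (r / (1 + c))"
  proof -
    have "d ^ 3 * (r / d) = d * (d * r)" if "d \<noteq> 0" for d using that by (simp add: power3_eq_cube)
    from this[of "1 + c"] show ?thesis using c by (simp add: algebra_simps)
  qed
  finally have hi: "hdist x y \<le> (1 + c) ^ 3 * (r / (1 + c))" .
  show "y \<in> {y \<in> S. cz_radius R / (1 + cz_dc TYPE('n)) \<le> hdist x y \<and>
    hdist x y \<le> (1 + cz_dc TYPE('n)) ^ 3 * (cz_radius R / (1 + cz_dc TYPE('n)))}"
    using lo hi QS[OF y] by (simp add: c_def r_def)
qed

context cz_op begin

definition ann :: "'n pt set \<Rightarrow> 'n pt \<Rightarrow> 'n pt set" where
  "ann R x = {y \<in> S. cz_radius R / (1 + cz_dc TYPE('n)) \<le> hdist x y \<and>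
    hdist x y \<le> (1 + cz_dc TYPE('n)) ^ 3 * (cz_radius R / (1 + cz_dc TYPE('n)))}"

definition annc :: real where
  "annc = annuli ((1 + cz_dc TYPE('n)) ^ 3)"

lemma annc_nonneg: "0 \<le> annc"
  using pos by (simp add: annc_def annuli_def)

lemma ann_sets: "x \<in> S \<Longrightarrow> ann R x \<in> sets rho"
proof -
  assume x: "x \<in> S"
  note [measurable] = hdist_measurable[OF x]
  have "{y \<in> space rho. cz_radius R / (1 + cz_dc TYPE('n)) \<le> hdist x y \<and>
    hdist x y \<le> (1 + cz_dc TYPE('n)) ^ 3 * (cz_radius R / (1 + cz_dc TYPE('n)))} \<in> sets rho" by measurable
  then show ?thesis unfolding ann_def space_rho .
qed

lemma ann_integral:
  assumes "x \<in> S" "R \<in> cz_sets"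
  shows "(\<integral>\<^sup>+y\<in>ann R x. ennreal (norm (K x y)) \<partial>rho) \<le> ennreal annc"
proof -
  have c: "1 \<le> cz_dc TYPE('n)" by (rule cz_dc_ge_1)
  show ?thesis
    unfolding ann_def annc_def
    by (rule size_annulus) (use assms c cz_radius_pos[OF assms(2)] in \<open>auto intro!: one_le_power divide_pos_pos\<close>)
qed

text \<open>The term with |b| is the usual cancellation estimate for a piece of mean zero. The term
  with \<open>h\<close> arises for pieces at the boundary, when |K x c| is replaced by |K x
  y|.\<close>

definition osc :: "'n pt set \<Rightarrow> 'n pt \<Rightarrow> ('n pt \<Rightarrow> complex) \<Rightarrow> real \<Rightarrow> 'n pt \<Rightarrow> ennreal" where
  "osc Q c b h x = (\<integral>\<^sup>+y\<in>Q. ennreal (norm (K x y - K x c) * (norm (b y) + h)) \<partial>rho)"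

lemma osc_kernel_meas:
  assumes "Q \<in> sets rho" "c \<in> S" "b \<in> borel_measurable rho"
  shows "(\<lambda>(x, y). ennreal (norm (K x y - K x c) * (norm (b y) + h)) * indicator Q y) \<in> borel_measurable (rho \<Otimes>\<^sub>M rho)"
proof -
  have [measurable]: "(\<lambda>z. K (fst z) (snd z)) \<in> borel_measurable (rho \<Otimes>\<^sub>M rho)"
    using K_meas by (simp add: case_prod_beta')
  have [measurable]: "(\<lambda>z. K (fst z) c) \<in> borel_measurable (rho \<Otimes>\<^sub>M rho)"
    by (rule measurable_compose[OF measurable_fst K2_meas[OF assms(2)]])
  have [measurable]: "(\<lambda>z. b (snd z)) \<in> borel_measurable (rho \<Otimes>\<^sub>M rho)"
    by (rule measurable_compose[OF measurable_snd assms(3)])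
  have [measurable]: "(\<lambda>z. indicator Q (snd z) :: ennreal) \<in> borel_measurable (rho \<Otimes>\<^sub>M rho)"
    by (rule measurable_compose[OF measurable_snd]) (use assms(1) in simp)
  show ?thesis
    unfolding case_prod_beta' by measurable
qed

lemma osc_meas:
  assumes "Q \<in> sets rho" "c \<in> S" "b \<in> borel_measurable rho"
  shows "osc Q c b h \<in> borel_measurable rho"
proof -
  have "(\<lambda>x. \<integral>\<^sup>+y. ennreal (norm (K x y - K x c) * (norm (b y) + h)) * indicator Q y \<partial>rho) \<in> borel_measurable rho"
    by (rule rho.borel_measurable_nn_integral) (use osc_kernel_meas[OF assms] in simp)
  then show ?thesis by (simp add: osc_def[abs_def])
qed

text \<open>After exchanging the integrals, the inner one is the Hoermander integral in
  \<open>x\<close> off \<open>cz_star Q\<close> for the pair \<open>y\<close>, \<open>c\<close> of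
  points of \<open>Q\<close>.\<close>

lemma osc_integral:
  assumes Q: "Q \<in> cz_sets" "c \<in> Q" and b: "b \<in> borel_measurable rho" and h: "0 \<le> h"
  shows "(\<integral>\<^sup>+x\<in>S - cz_star Q. osc Q c b h x \<partial>rho) \<le> ennreal H * (\<integral>\<^sup>+y\<in>Q. ennreal (norm (b y) + h) \<partial>rho)"
proof -
  have cS: "c \<in> S" using Q cz_sets_subset_S by blast
  note [measurable] = cz_sets_rho[OF Q(1)] compl_star_sets[OF Q(1)] b
  define k where "k x y = ennreal (norm (K x y - K x c) * (norm (b y) + h)) * indicator Q y" for x y
  have k: "case_prod k \<in> borel_measurable (rho \<Otimes>\<^sub>M rho)"
    unfolding k_def using osc_kernel_meas[OF cz_sets_rho[OF Q(1)] cS b] by simp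
  have kS: "(\<lambda>(x, y). k x y * indicator (S - cz_star Q) x) \<in> borel_measurable (rho \<Otimes>\<^sub>M rho)"
  proof -
    have [measurable]: "(\<lambda>z. k (fst z) (snd z)) \<in> borel_measurable (rho \<Otimes>\<^sub>M rho)"
      using k by (simp add: case_prod_beta')
    have [measurable]: "(\<lambda>z. indicator (S - cz_star Q) (fst z) :: ennreal) \<in> borel_measurable (rho \<Otimes>\<^sub>M rho)"
      by (rule measurable_compose[OF measurable_fst]) simp
    show ?thesis unfolding case_prod_beta' by measurable
  qed
  have "(\<integral>\<^sup>+x\<in>S - cz_star Q. osc Q c b h x \<partial>rho) = (\<integral>\<^sup>+x. (\<integral>\<^sup>+y. k x y * indicator (S - cz_star Q) x \<partial>rho) \<partial>rho)"
    unfolding osc_def k_def[symmetric] by (intro nn_integral_cong) (simp split: split_indicator)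
  also have "\<dots> = (\<integral>\<^sup>+y. (\<integral>\<^sup>+x. k x y * indicator (S - cz_star Q) x \<partial>rho) \<partial>rho)"
    by (rule rho_pair.Fubini'[OF kS, symmetric])
  also have "\<dots> \<le> (\<integral>\<^sup>+y. ennreal H * (ennreal (norm (b y) + h) * indicator Q y) \<partial>rho)"
  proof (rule nn_integral_mono)
    fix y :: "'n pt" assume "y \<in> space rho"
    then have yS: "y \<in> S" by simp
    show "(\<integral>\<^sup>+x. k x y * indicator (S - cz_star Q) x \<partial>rho) \<le> ennreal H * (ennreal (norm (b y) + h) * indicator Q y)"
    proof (cases "y \<in> Q")
      case True
      note [measurable] = K2_meas[OF yS] K2_meas[OF cS]
      have "(\<integral>\<^sup>+x. k x y * indicator (S - cz_star Q) x \<partial>rho) =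
          (\<integral>\<^sup>+x. ennreal (norm (b y) + h) * (ennreal (norm (K x y - K x c)) * indicator (S - cz_star Q) x) \<partial>rho)"
        using True h by (intro nn_integral_cong) (simp add: k_def ennreal_mult mult_ac)
      also have "\<dots> = ennreal (norm (b y) + h) * (\<integral>\<^sup>+x\<in>S - cz_star Q. ennreal (norm (K x y - K x c)) \<partial>rho)"
        by (rule nn_integral_cmult) measurable
      also have "\<dots> \<le> ennreal (norm (b y) + h) * ennreal H"
        by (intro mult_left_mono hoermander1 Q True) simp
      finally show ?thesis using True by (simp add: mult_ac)
    qed (simp add: k_def)
  qed
  also have "\<dots> = ennreal H * (\<integral>\<^sup>+y\<in>Q. ennreal (norm (b y) + h) \<partial>rho)"
    by (rule nn_integral_cmult) measurable
  finally show ?thesis .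
qed

text \<open>There are three positions of \<open>Q\<close> relative to \<open>cz_star R\<close>. If
  \<open>Q\<close> is inside, nothing is integrated; if it is disjoint, the vanishing mean of
  \<open>b\<close> permits subtracting K x c. If it crosses the boundary, cancellation is lost, but
  then \<open>Q\<close> lies in the annulus of \<open>star_boundary_annulus\<close>, and |b| can be
  traded for its average bound \<open>h\<close>.\<close>

lemma bad_piece:
  assumes Q: "Q \<in> cz_sets" "c \<in> Q" and R: "R \<in> cz_sets" "x \<in> R" and x: "x \<notin> cz_star Q"
    and b: "b \<in> linf_c" "(LINT y:Q|rho. b y) = 0" and h: "0 \<le> h"
      "(\<integral>\<^sup>+y\<in>Q. ennreal (norm (b y)) \<partial>rho) \<le> ennreal h * emeasure rho Q"
  shows "ennreal (norm (LINT y:Q \<inter> (S - cz_star R)|rho. K x y * b y)) \<le>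
    osc Q c b h x + ennreal h * (\<integral>\<^sup>+y\<in>Q \<inter> ann R x. ennreal (norm (K x y)) \<partial>rho)"
proof -
  have xS: "x \<in> S" using R cz_sets_subset_S by blast
  have QS: "Q \<subseteq> S" using Q cz_sets_subset_S by blast
  note [measurable] = K1_meas[OF xS] linf_c_measurable[OF b(1)] cz_sets_rho[OF Q(1)]
  consider "Q \<subseteq> cz_star R" | "Q \<inter> cz_star R = {}" | "Q \<inter> cz_star R \<noteq> {}" "\<not> Q \<subseteq> cz_star R" by blast
  then show ?thesis
  proof cases
    case 1
    then have "Q \<inter> (S - cz_star R) = {}" by blast
    then show ?thesis by (simp add: set_lebesgue_integral_def)
  next
    case 2
    then have e: "Q \<inter> (S - cz_star R) = Q" using QS by blast
    have i1: "set_integrable rho Q (\<lambda>y. K x y * b y)"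
      by (rule set_integrable_subset[OF tr_integrable[OF b(1) R]]) (use e in auto)
    have "set_integrable rho Q b"
      using integrable_mult_indicator[OF cz_sets_rho[OF Q(1)] linf_c_integrable[OF b(1)]]
      by (simp add: set_integrable_def)
    then have i2: "set_integrable rho Q (\<lambda>y. K x c * b y)"
      by (rule set_integrable_mult_right)
    have "(LINT y:Q|rho. K x y * b y) = (LINT y:Q|rho. K x y * b y - K x c * b y)"
      using b(2) by (simp add: set_integral_diff(2)[OF i1 i2])
    then have "ennreal (norm (LINT y:Q \<inter> (S - cz_star R)|rho. K x y * b y)) =
       ennreal (norm (LINT y:Q|rho. K x y * b y - K x c * b y))" by (simp only: e)
    also have "\<dots> \<le> (\<integral>\<^sup>+y\<in>Q. ennreal (norm (K x y * b y - K x c * b y)) \<partial>rho)"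
      by (rule norm_set_integral_le_nn_integral)
    also have "\<dots> \<le> osc Q c b h x"
      unfolding osc_def
    proof (intro nn_integral_mono mult_right_mono ennreal_leI)
      fix y
      have "norm (K x y * b y - K x c * b y) = norm (K x y - K x c) * norm (b y)"
        by (simp add: norm_mult[symmetric] algebra_simps)
      then show "norm (K x y * b y - K x c * b y) \<le> norm (K x y - K x c) * (norm (b y) + h)"
        using h by (simp add: mult_left_mono)
    qed simp
    finally show ?thesis by (simp add: add_increasing2)
  next
    case 3
    have Qa: "Q \<inter> ann R x = Q"
      using star_boundary_annulus[OF Q(1) R x 3] by (auto simp: ann_def)
    have "ennreal (norm (LINT y:Q \<inter> (S - cz_star R)|rho. K x y * b y)) \<le>
       (\<integral>\<^sup>+y\<in>Q \<inter> (S - cz_star R). ennreal (norm (K x y * b y)) \<partial>rho)"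
      by (rule norm_set_integral_le_nn_integral)
    also have "\<dots> \<le> (\<integral>\<^sup>+y\<in>Q. ennreal (norm (K x y * b y)) \<partial>rho)"
      by (rule set_nn_integral_mono_set) blast
    also have "\<dots> \<le> (\<integral>\<^sup>+y. ennreal (norm (K x y - K x c) * norm (b y)) * indicator Q y +
        ennreal (norm (K x c)) * (ennreal (norm (b y)) * indicator Q y) \<partial>rho)"
    proof (rule nn_integral_mono)
      fix y
      have "norm (K x y * b y) \<le> norm (K x y - K x c) * norm (b y) + norm (K x c) * norm (b y)"
        using mult_right_mono[OF norm_triangle_ineq[of "K x y - K x c" "K x c"], of "norm (b y)"]
        by (simp add: norm_mult algebra_simps)
      then have "ennreal (norm (K x y * b y)) \<le> ennreal (norm (K x y - K x c) * norm (b y)) + ennreal (norm (K x c)) * ennreal (norm (b y))"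
        by (simp add: ennreal_mult[symmetric] ennreal_plus[symmetric] ennreal_leI del: ennreal_plus)
      then show "ennreal (norm (K x y * b y)) * indicator Q y \<le> ennreal (norm (K x y - K x c) * norm (b y)) * indicator Q y +
        ennreal (norm (K x c)) * (ennreal (norm (b y)) * indicator Q y)"
        by (auto split: split_indicator)
    qed
    also have "\<dots> = (\<integral>\<^sup>+y\<in>Q. ennreal (norm (K x y - K x c) * norm (b y)) \<partial>rho) +
        ennreal (norm (K x c)) * (\<integral>\<^sup>+y\<in>Q. ennreal (norm (b y)) \<partial>rho)"
      by (subst nn_integral_add) (auto simp: nn_integral_cmult)
    also have "ennreal (norm (K x c)) * (\<integral>\<^sup>+y\<in>Q. ennreal (norm (b y)) \<partial>rho) \<le>
        ennreal (norm (K x c)) * (ennreal h * emeasure rho Q)"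
      by (intro mult_left_mono h(2)) simp
    \<comment> \<open>The product with rho(Q) is read as the integral of a constant over
      \<open>Q\<close>, in which |K x c| can be replaced by |K x y| at the cost of a difference
      covered by \<open>osc\<close>.\<close>
    also have "\<dots> = (\<integral>\<^sup>+y\<in>Q. ennreal h * ennreal (norm (K x c)) \<partial>rho)"
      by (subst nn_integral_cmult_indicator) (auto simp: mult_ac)
    also have "\<dots> \<le> (\<integral>\<^sup>+y. ennreal (norm (K x y - K x c) * h) * indicator Q y + ennreal h * (ennreal (norm (K x y)) * indicator Q y) \<partial>rho)"
    proof (rule nn_integral_mono)
      fix y
      have "norm (K x c) \<le> norm (K x y - K x c) + norm (K x y)"
        by (metis norm_minus_commute norm_triangle_sub add.commute)
      then have "h * norm (K x c) \<le> norm (K x y - K x c) * h + h * norm (K x y)"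
        using mult_left_mono[of "norm (K x c)" "norm (K x y - K x c) + norm (K x y)" h] h(1)
        by (simp add: algebra_simps)
      then have "ennreal h * ennreal (norm (K x c)) \<le> ennreal (norm (K x y - K x c) * h) + ennreal h * ennreal (norm (K x y))"
        using h(1) by (simp add: ennreal_mult[symmetric] ennreal_plus[symmetric] ennreal_leI del: ennreal_plus)
      then show "ennreal h * ennreal (norm (K x c)) * indicator Q y \<le> ennreal (norm (K x y - K x c) * h) * indicator Q y + ennreal h * (ennreal (norm (K x y)) * indicator Q y)"
        by (auto split: split_indicator)
    qed
    also have "\<dots> = (\<integral>\<^sup>+y\<in>Q. ennreal (norm (K x y - K x c) * h) \<partial>rho) + ennreal h * (\<integral>\<^sup>+y\<in>Q. ennreal (norm (K x y)) \<partial>rho)"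
      by (subst nn_integral_add) (auto simp: nn_integral_cmult)
    finally have "ennreal (norm (LINT y:Q \<inter> (S - cz_star R)|rho. K x y * b y)) \<le>
      ((\<integral>\<^sup>+y\<in>Q. ennreal (norm (K x y - K x c) * norm (b y)) \<partial>rho) +
       (\<integral>\<^sup>+y\<in>Q. ennreal (norm (K x y - K x c) * h) \<partial>rho)) + ennreal h * (\<integral>\<^sup>+y\<in>Q. ennreal (norm (K x y)) \<partial>rho)"
      by (simp add: add.assoc add_left_mono)
    also have "(\<integral>\<^sup>+y\<in>Q. ennreal (norm (K x y - K x c) * norm (b y)) \<partial>rho) + (\<integral>\<^sup>+y\<in>Q. ennreal (norm (K x y - K x c) * h) \<partial>rho)
       = (\<integral>\<^sup>+y. ennreal (norm (K x y - K x c) * norm (b y)) * indicator Q y + ennreal (norm (K x y - K x c) * h) * indicator Q y \<partial>rho)"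
      by (rule nn_integral_add[symmetric]) auto
    also have "\<dots> = osc Q c b h x"
      unfolding osc_def using h(1)
      by (intro nn_integral_cong) (simp add: ring_distribs ennreal_plus split: split_indicator)
    finally show ?thesis by (simp add: Qa)
  qed
qed

text \<open>The boundary pieces are disjoint subsets of one annulus, so together they contribute at
  most h annc. Neither this nor the sum of the \<open>osc\<close> terms depends on \<open>R\<close>,
  so the bound passes to the supremum.\<close>

lemma bad_sum:
  fixes Q :: "nat \<Rightarrow> 'n pt set"
  assumes Q: "\<And>n. Q n \<in> cz_sets \<or> Q n = {}" "disjoint_family Q" "\<And>n. Q n \<noteq> {} \<Longrightarrow> c n \<in> Q n"
    and R: "R \<in> cz_sets" "x \<in> R" and x: "\<And>n. Q n \<noteq> {} \<Longrightarrow> x \<notin> cz_star (Q n)"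
    and b: "b \<in> linf_c" "\<And>n. (LINT y:Q n|rho. b y) = 0" "\<And>y. y \<in> S \<Longrightarrow> y \<notin> (\<Union>n. Q n) \<Longrightarrow> b y = 0"
    and h: "0 \<le> h" "\<And>n. (\<integral>\<^sup>+y\<in>Q n. ennreal (norm (b y)) \<partial>rho) \<le> ennreal h * emeasure rho (Q n)"
  shows "ennreal (norm (tr b R x)) \<le> (\<Sum>n. osc (Q n) (c n) b h x) + ennreal (h * annc)"
proof -
  have xS: "x \<in> S" using R cz_sets_subset_S by blast
  have Qm [measurable]: "Q n \<in> sets rho" for n using Q(1)[of n] cz_sets_rho by auto
  note [measurable] = K1_meas[OF xS] linf_c_measurable[OF b(1)] ann_sets[OF xS] compl_star_sets[OF R(1)]
  define X where "X n = Q n \<inter> (S - cz_star R)" for n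
  have Xm [measurable]: "X n \<in> sets rho" for n unfolding X_def by measurable
  have Xd: "disjoint_family X" using Q(2) by (auto simp: X_def disjoint_family_on_def)
  have "set_integrable rho (\<Union>n. X n) (\<lambda>y. K x y * b y)"
    by (rule set_integrable_subset[OF tr_integrable[OF b(1) R]]) (auto simp: X_def)
  note le = norm_set_integral_UN_le[OF Xm Xd this]
  have "tr b R x = (LINT y:(\<Union>n. X n)|rho. K x y * b y)"
    unfolding tr_def set_lebesgue_integral_def
    by (rule Bochner_Integration.integral_cong) (use b(3) in \<open>auto simp: X_def split: split_indicator\<close>)
  then have "ennreal (norm (tr b R x)) \<le> (\<Sum>n. ennreal (norm (LINT y:X n|rho. K x y * b y)))"
    using le by simp
  also have "\<dots> \<le> (\<Sum>n. osc (Q n) (c n) b h x + ennreal h * (\<integral>\<^sup>+y\<in>Q n \<inter> ann R x. ennreal (norm (K x y)) \<partial>rho))"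
  proof (intro suminf_le summableI)
    fix n
    show "ennreal (norm (LINT y:X n|rho. K x y * b y)) \<le>
        osc (Q n) (c n) b h x + ennreal h * (\<integral>\<^sup>+y\<in>Q n \<inter> ann R x. ennreal (norm (K x y)) \<partial>rho)"
    proof (cases "Q n = {}")
      case True
      then show ?thesis by (simp add: X_def set_lebesgue_integral_def)
    next
      case False
      then show ?thesis
        unfolding X_def using Q x by (intro bad_piece R b h) auto
    qed
  qed
  also have "\<dots> = (\<Sum>n. osc (Q n) (c n) b h x) + (\<Sum>n. ennreal h * (\<integral>\<^sup>+y\<in>Q n \<inter> ann R x. ennreal (norm (K x y)) \<partial>rho))"
    by (rule suminf_add[symmetric]) auto
  also have "(\<Sum>n. ennreal h * (\<integral>\<^sup>+y\<in>Q n \<inter> ann R x. ennreal (norm (K x y)) \<partial>rho)) =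
     ennreal h * (\<Sum>n. (\<integral>\<^sup>+y\<in>Q n \<inter> ann R x. ennreal (norm (K x y)) \<partial>rho))"
    by (rule ennreal_suminf_cmult)
  also have "(\<Sum>n. (\<integral>\<^sup>+y\<in>Q n \<inter> ann R x. ennreal (norm (K x y)) \<partial>rho)) =
     (\<integral>\<^sup>+y\<in>(\<Union>n. Q n \<inter> ann R x). ennreal (norm (K x y)) \<partial>rho)"
    by (rule nn_integral_disjoint_family[symmetric]) (use Q(2) in \<open>auto simp: disjoint_family_on_def\<close>)
  also have "\<dots> \<le> (\<integral>\<^sup>+y\<in>ann R x. ennreal (norm (K x y)) \<partial>rho)" by (rule set_nn_integral_mono_set) blast
  also have "\<dots> \<le> ennreal annc" by (rule ann_integral[OF xS R(1)])
  finally show ?thesis using h(1) annc_nonneg by (simp add: ennreal_mult add_left_mono mult_left_mono)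
qed

end

section \<open>Good and bad part\<close>

context cz_op begin

text \<open>\<open>wk_n\<close> bounds the growth of measure from a stopping box to its parent, so
  averages of |f| over stopping boxes at height l = wk_g \<alpha> are at most wk_n l.
  \<open>wk_g\<close> is so small that \<open>cotlar\<close> applies to the good part at height
  \<alpha> / 2 and the boundary pieces contribute at most \<alpha> / 4. The terms of
  \<open>wk_c\<close> belong to the good part, the enlarged stopping boxes and the bad part outside
  them.\<close>

definition wk_n :: real where "wk_n = 2 ^ CARD('n)"
definition wk_g :: real where "wk_g = 1 / (2 * wk_n * (4 * annc + cotlar_c0))"
definition wk_c :: real where
  "wk_c = 4 * cotlar_c1 * (wk_n * wk_g) + cz_cs TYPE('n) / wk_g + 4 * H * (2 + 2 * wk_n)"

lemma wk_pos: "1 \<le> wk_n" "0 < wk_g" "0 < wk_c"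
proof -
  show n: "1 \<le> wk_n" by (simp add: wk_n_def)
  show g: "0 < wk_g"
    unfolding wk_g_def using n annc_nonneg cotlar_c_pos by (intro divide_pos_pos mult_pos_pos add_nonneg_pos) auto
  show "0 < wk_c"
    unfolding wk_c_def using n g cotlar_c_pos cz_cs_ge_1[where 'n = 'n] pos
    by (intro add_pos_pos mult_pos_pos divide_pos_pos) auto
qed

lemma wk_g_bounds: "2 * wk_n * wk_g * annc \<le> 1 / 4" "cotlar_c0 * (wk_n * wk_g) \<le> 1 / 2"
proof -
  define D where "D = 4 * annc + cotlar_c0"
  have D: "0 < D" "4 * annc \<le> D" "cotlar_c0 \<le> D"
    using annc_nonneg cotlar_c_pos by (auto simp: D_def)
  have "wk_g = 1 / (2 * wk_n * D)" by (simp only: wk_g_def D_def)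
  then have e: "2 * wk_n * wk_g = 1 / D" "wk_n * wk_g = 1 / (2 * D)"
    using wk_pos(1) by auto
  show "2 * wk_n * wk_g * annc \<le> 1 / 4" unfolding e using D by (simp add: field_simps)
  show "cotlar_c0 * (wk_n * wk_g) \<le> 1 / 2" unfolding e using D by (simp add: field_simps)
qed

text \<open>The good part of the decomposition of \<open>f\<close> along the sets \<open>Q n\<close>; these are disjoint, so that \<open>THE\<close> is
  meaningful.\<close>

definition avgs :: "(nat \<Rightarrow> 'n pt set) \<Rightarrow> ('n pt \<Rightarrow> complex) \<Rightarrow> 'n pt \<Rightarrow> complex" where
  "avgs Q f x = (if x \<in> (\<Union>n. Q n) then cz_mean f (Q (THE n. x \<in> Q n)) else f x)"

lemma avgs_in:
  assumes "disjoint_family Q" "x \<in> Q n"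
  shows "avgs Q f x = cz_mean f (Q n)"
proof -
  have "(THE n. x \<in> Q n) = n"
    using assms by (intro the_equality) (auto simp: disjoint_family_on_def)
  then show ?thesis using assms(2) by (auto simp: avgs_def)
qed

lemma avgs_out: "x \<notin> (\<Union>n. Q n) \<Longrightarrow> avgs Q f x = f x"
  by (simp add: avgs_def)

lemma avgs_measurable:
  assumes "disjoint_family Q" "\<And>n. Q n \<in> sets rho" "f \<in> borel_measurable rho"
  shows "avgs Q f \<in> borel_measurable rho"
proof (rule measurable_piecewise_restrict2[where A = "\<lambda>i. case i of 0 \<Rightarrow> S - (\<Union>n. Q n) | Suc n \<Rightarrow> Q n"])
  show "(case n of 0 \<Rightarrow> S - (\<Union>n. Q n) | Suc n \<Rightarrow> Q n) \<in> sets rho" for n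
    using assms(2) sets.compl_sets[of "\<Union>n. Q n" rho] by (cases n) auto
  have QS: "Q n \<subseteq> S" for n using assms(2)[of n] by (simp add: sets_rho_iff)
  show "space rho = (\<Union>n. case n of 0 \<Rightarrow> S - (\<Union>n. Q n) | Suc n \<Rightarrow> Q n)"
  proof
    show "space rho \<subseteq> (\<Union>n. case n of 0 \<Rightarrow> S - (\<Union>n. Q n) | Suc n \<Rightarrow> Q n)"
    proof
      fix x :: "'n pt" assume x: "x \<in> space rho"
      show "x \<in> (\<Union>n. case n of 0 \<Rightarrow> S - (\<Union>n. Q n) | Suc n \<Rightarrow> Q n)"
      proof (cases "x \<in> (\<Union>n. Q n)")
        case True
        then obtain n where "x \<in> Q n" by blast
        then show ?thesis by (intro UN_I[of "Suc n"]) auto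
      next
        case False
        then show ?thesis using x by (intro UN_I[of 0]) auto
      qed
    qed
    show "(\<Union>n. case n of 0 \<Rightarrow> S - (\<Union>n. Q n) | Suc n \<Rightarrow> Q n) \<subseteq> space rho"
      by (auto split: nat.splits intro: subsetD[OF QS])
  qed
  show "\<exists>h\<in>borel_measurable rho. \<forall>x\<in>case n of 0 \<Rightarrow> S - (\<Union>n. Q n) | Suc n \<Rightarrow> Q n. avgs Q f x = h x" for n
  proof (cases n)
    case 0
    then show ?thesis using assms(3) by (intro bexI[of _ f]) (auto simp: avgs_out)
  next
    case (Suc m)
    then show ?thesis using avgs_in[OF assms(1)] by (intro bexI[of _ "\<lambda>_. cz_mean f (Q m)"]) auto
  qed
qed

lemma norm_cz_mean:
  assumes R: "R \<in> cz_sets"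
  shows "ennreal (norm (cz_mean f R)) * emeasure rho R \<le> (\<integral>\<^sup>+x\<in>R. ennreal (norm (f x)) \<partial>rho)"
proof -
  have m: "emeasure rho R = ennreal (measure rho R)"
    using emeasure_cz_finite[OF R] by (simp add: emeasure_eq_ennreal_measure less_top)
  then have mp: "0 < measure rho R" using emeasure_cz_pos[OF R] by simp
  have "norm (cz_mean f R) * measure rho R = norm (LINT x:R|rho. f x)"
    using mp by (simp add: cz_mean_def norm_divide)
  then have "ennreal (norm (cz_mean f R)) * emeasure rho R = ennreal (norm (LINT x:R|rho. f x))"
    by (simp add: m ennreal_mult[symmetric])
  then show ?thesis using norm_set_integral_le_nn_integral by metis
qed

text \<open>The good part has to lie in \<open>linf_c\<close> again. Every stopping box meets the
  region where \<open>f\<close> lives and has measure at most the L1 norm of \<open>f\<close>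
  divided by \<open>l\<close>, so \<open>cz_meet_bounded\<close> confines all of them to one
  \<open>hbox\<close>.\<close>

lemma weak11_decomposition:
  assumes f: "f \<in> linf_c" and l: "0 < l"
  obtains Q :: "nat \<Rightarrow> 'n pt set" where "\<And>n. Q n \<in> cz_sets \<or> Q n = {}" "disjoint_family Q"
    "\<And>n. ennreal l * emeasure rho (Q n) \<le> (\<integral>\<^sup>+x\<in>Q n. ennreal (norm (f x)) \<partial>rho)"
    "\<And>n. (\<integral>\<^sup>+x\<in>Q n. ennreal (norm (f x)) \<partial>rho) \<le> ennreal (wk_n * l) * emeasure rho (Q n)"
    "avgs Q f \<in> linf_c" "AE x in rho. norm (avgs Q f x) \<le> wk_n * l"
    "(\<integral>\<^sup>+x. ennreal (norm (avgs Q f x)) \<partial>rho) \<le> (\<integral>\<^sup>+x. ennreal (norm (f x)) \<partial>rho)"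
proof -
  define F where "F = (\<lambda>x. ennreal (norm (f x)))"
  note fm [measurable] = linf_c_measurable[OF f]
  have Fm [measurable]: "F \<in> borel_measurable rho" unfolding F_def by measurable
  have Ffin: "(\<integral>\<^sup>+x. F x \<partial>rho) < \<infinity>" unfolding F_def by (rule linf_c_nn_integral_norm[OF f])
  obtain Q :: "nat \<Rightarrow> 'n pt set" where Q: "\<And>n. Q n \<in> cz_sets \<or> Q n = {}" "disjoint_family Q"
    "\<And>n. ennreal l * emeasure rho (Q n) \<le> (\<integral>\<^sup>+x\<in>Q n. F x \<partial>rho)"
    "\<And>n. (\<integral>\<^sup>+x\<in>Q n. F x \<partial>rho) \<le> ennreal (2 ^ CARD('n) * l) * emeasure rho (Q n)"
    "AE x in rho. x \<notin> (\<Union>n. Q n) \<longrightarrow> F x \<le> ennreal l"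
  proof (rule cz_decomposition_seq[OF Fm Ffin l])
    fix A :: "nat \<Rightarrow> 'n pt set"
    assume A: "\<And>n. A n \<in> cz_sets \<or> A n = {}" "disjoint_family A"
      "\<And>n. ennreal l * emeasure rho (A n) \<le> (\<integral>\<^sup>+x\<in>A n. F x \<partial>rho)"
      "\<And>n. (\<integral>\<^sup>+x\<in>A n. F x \<partial>rho) \<le> ennreal (2 ^ CARD('n) * l) * emeasure rho (A n)"
      "AE x in rho. x \<notin> (\<Union>n. A n) \<longrightarrow> F x \<le> ennreal l"
    show thesis by (rule that[of A]) (fact A)+
  qed
  define g where "g = avgs Q f"
  have Qm [measurable]: "Q n \<in> sets rho" for n using Q(1)[of n] cz_sets_rho by auto
  have gm [measurable]: "g \<in> borel_measurable rho" unfolding g_def by (rule avgs_measurable[OF Q(2) Qm fm])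
  have mean1: "ennreal (norm (cz_mean f (Q n))) * emeasure rho (Q n) \<le> (\<integral>\<^sup>+x\<in>Q n. F x \<partial>rho)" for n
    using norm_cz_mean[of "Q n" f] Q(1)[of n] unfolding F_def by auto
  have mean2: "norm (cz_mean f (Q n)) \<le> wk_n * l" if "Q n \<noteq> {}" for n
  proof -
    have cz: "Q n \<in> cz_sets" using Q(1)[of n] that by blast
    obtain v where v: "emeasure rho (Q n) = ennreal v" "0 \<le> v"
      using emeasure_cz_finite[OF cz] by (cases "emeasure rho (Q n)") auto
    then have vp: "0 < v" using emeasure_cz_pos[OF cz] by simp
    have "ennreal (norm (cz_mean f (Q n))) * ennreal v \<le> ennreal (wk_n * l) * ennreal v"
      using order_trans[OF mean1[of n] Q(4)[of n]] v(1) by (simp add: wk_n_def)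
    then have "norm (cz_mean f (Q n)) * v \<le> wk_n * l * v"
      using wk_pos(1) l v by (simp add: ennreal_mult[symmetric])
    then show ?thesis using vp by simp
  qed
  have gb: "AE x in rho. norm (g x) \<le> wk_n * l"
    using Q(5)
  proof eventually_elim
    fix x assume x: "x \<notin> (\<Union>n. Q n) \<longrightarrow> F x \<le> ennreal l"
    show "norm (g x) \<le> wk_n * l"
    proof (cases "x \<in> (\<Union>n. Q n)")
      case True
      then obtain n where n: "x \<in> Q n" by blast
      then show ?thesis using avgs_in[OF Q(2) n] mean2[of n] by (auto simp: g_def)
    next
      case False
      then have "norm (f x) \<le> l" using x l by (simp add: F_def)
      also have "\<dots> \<le> wk_n * l" using wk_pos(1) l by simp
      finally show ?thesis using avgs_out[OF False] by (simp add: g_def)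
    qed
  qed
  define Om where "Om = (\<Union>n. Q n)"
  have Omm [measurable]: "Om \<in> sets rho" unfolding Om_def by measurable
  have gi: "(\<integral>\<^sup>+x. ennreal (norm (g x)) \<partial>rho) \<le> (\<integral>\<^sup>+x. F x \<partial>rho)"
  proof -
    have split: "(\<integral>\<^sup>+x. u x \<partial>rho) = (\<integral>\<^sup>+x\<in>Om. u x \<partial>rho) + (\<integral>\<^sup>+x\<in>S - Om. u x \<partial>rho)"
      if [measurable]: "u \<in> borel_measurable rho" for u :: "'n pt \<Rightarrow> ennreal"
    proof -
      have [measurable]: "S - Om \<in> sets rho" using sets.compl_sets[OF Omm] by simp
      have "(\<integral>\<^sup>+x. u x \<partial>rho) = (\<integral>\<^sup>+x. u x * indicator Om x + u x * indicator (S - Om) x \<partial>rho)"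
        by (intro nn_integral_cong) (auto split: split_indicator)
      also have "\<dots> = (\<integral>\<^sup>+x\<in>Om. u x \<partial>rho) + (\<integral>\<^sup>+x\<in>S - Om. u x \<partial>rho)"
        by (rule nn_integral_add) measurable
      finally show ?thesis .
    qed
    have "(\<integral>\<^sup>+x\<in>Om. ennreal (norm (g x)) \<partial>rho) \<le> 1 * (\<integral>\<^sup>+x\<in>Om. F x \<partial>rho)"
      unfolding Om_def
    proof (rule nn_integral_UN_le[OF _ Q(2) Qm])
      show "(\<integral>\<^sup>+x\<in>Q n. ennreal (norm (g x)) \<partial>rho) \<le> 1 * (\<integral>\<^sup>+x\<in>Q n. F x \<partial>rho)" for n
      proof -
        have "(\<integral>\<^sup>+x\<in>Q n. ennreal (norm (g x)) \<partial>rho) = (\<integral>\<^sup>+x\<in>Q n. ennreal (norm (cz_mean f (Q n))) \<partial>rho)"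
          using avgs_in[OF Q(2), of _ n f] by (intro nn_integral_cong) (auto simp: g_def split: split_indicator)
        also have "\<dots> = ennreal (norm (cz_mean f (Q n))) * emeasure rho (Q n)"
          by (rule nn_integral_cmult_indicator[OF Qm])
        finally show ?thesis using mean1[of n] by simp
      qed
    qed auto
    moreover have "(\<integral>\<^sup>+x\<in>S - Om. ennreal (norm (g x)) \<partial>rho) = (\<integral>\<^sup>+x\<in>S - Om. F x \<partial>rho)"
      by (intro nn_integral_cong) (auto simp: g_def F_def Om_def avgs_out split: split_indicator)
    ultimately show ?thesis
      using split[of "\<lambda>x. ennreal (norm (g x))"] split[OF Fm] by (simp add: add_right_mono)
  qed
  have gl: "g \<in> linf_c"
  proof -
    obtain m where m: "AE x in rho. x \<notin> hbox m \<longrightarrow> f x = 0" using f by (auto simp: linf_c_iff)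
    obtain I1 where I1: "(\<integral>\<^sup>+x. F x \<partial>rho) = ennreal I1" "0 \<le> I1"
      using Ffin by (cases "\<integral>\<^sup>+x. F x \<partial>rho") auto
    obtain m' where m': "\<And>R. R \<in> cz_sets \<Longrightarrow> R \<inter> hbox m \<noteq> {} \<Longrightarrow> emeasure rho R \<le> ennreal (I1 / l) \<Longrightarrow> R \<subseteq> (hbox m' :: 'n pt set)"
      using cz_meet_bounded[of m "I1 / l"] by blast
    have sub: "Q n \<subseteq> hbox m'" for n
    proof (cases "Q n = {}")
      case False
      then have cz: "Q n \<in> cz_sets" using Q(1)[of n] by blast
      have le: "ennreal l * emeasure rho (Q n) \<le> ennreal I1"
        using Q(3)[of n] set_nn_integral_mono_set[of "Q n" UNIV rho F] I1(1) by simp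
      obtain v where v: "emeasure rho (Q n) = ennreal v" "0 \<le> v"
        using emeasure_cz_finite[OF cz] by (cases "emeasure rho (Q n)") auto
      have "l * v \<le> I1" using le v I1 l by (simp add: ennreal_mult[symmetric])
      then have "emeasure rho (Q n) \<le> ennreal (I1 / l)"
        using l by (simp add: v field_simps ennreal_leI)
      \<comment> \<open>On a box that misses \<open>hbox m\<close> the average of |f| would be 0,
        contrary to the stopping rule.\<close>
      moreover have "Q n \<inter> hbox m \<noteq> {}"
      proof
        assume e: "Q n \<inter> hbox m = {}"
        have "(\<integral>\<^sup>+x\<in>Q n. F x \<partial>rho) = (\<integral>\<^sup>+x. 0 \<partial>(rho :: 'n pt measure))"
          by (rule nn_integral_cong_AE) (use m in eventually_elim, use e in \<open>auto simp: F_def split: split_indicator\<close>)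
        then have "ennreal l * emeasure rho (Q n) = 0" using Q(3)[of n] by simp
        then show False using emeasure_cz_pos[OF cz] l by simp
      qed
      ultimately show ?thesis using m'[OF cz] by blast
    qed simp
    have "AE x in rho. x \<notin> hbox (max m m') \<longrightarrow> g x = 0"
      using m
    proof eventually_elim
      fix x assume x: "x \<notin> hbox m \<longrightarrow> f x = 0"
      show "x \<notin> hbox (max m m') \<longrightarrow> g x = 0"
      proof
        assume "x \<notin> hbox (max m m')"
        then have "x \<notin> hbox m" "x \<notin> hbox m'" using hbox_mono[of m "max m m'"] hbox_mono[of m' "max m m'"] by auto
        then show "g x = 0" using x sub avgs_out[of x Q f] by (auto simp: g_def)
      qed
    qed
    then show ?thesis using gb gm by (auto simp: linf_c_iff)
  qed
  show thesis
    by (rule that[of Q, OF Q(1-3)[unfolded F_def] Q(4)[unfolded F_def wk_n_def[symmetric]]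
      gl[unfolded g_def] gb[unfolded g_def] gi[unfolded g_def F_def]])
qed

text \<open>\<open>V\<close> is the union of the enlarged stopping boxes. Off \<open>V\<close> every
  truncation of the bad part is at most D + h annc with a function \<open>D\<close> that does not
  depend on the box, and the integral of \<open>D\<close> there is at most a multiple of the L1 norm
  of \<open>f\<close>. Markov's inequality at height \<open>d\<close> finishes.\<close>

lemma weak11_bad:
  fixes Q :: "nat \<Rightarrow> 'n pt set"
  assumes f: "f \<in> linf_c" and l: "0 < l"
    and Q: "\<And>n. Q n \<in> cz_sets \<or> Q n = {}" "disjoint_family Q"
      "\<And>n. ennreal l * emeasure rho (Q n) \<le> (\<integral>\<^sup>+x\<in>Q n. ennreal (norm (f x)) \<partial>rho)"
      "\<And>n. (\<integral>\<^sup>+x\<in>Q n. ennreal (norm (f x)) \<partial>rho) \<le> ennreal (wk_n * l) * emeasure rho (Q n)"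
    and g: "avgs Q f \<in> linf_c" and d: "0 < d"
  obtains W where "W \<in> sets rho"
    "{x \<in> S. ennreal (d + 2 * wk_n * l * annc) < max_sing K (\<lambda>x. f x + (- 1) * avgs Q f x) x} \<subseteq> W"
    "emeasure rho W \<le> ennreal (cz_cs TYPE('n) / l + H * (2 + 2 * wk_n) / d) * (\<integral>\<^sup>+x. ennreal (norm (f x)) \<partial>rho)"
proof -
  define b where "b = (\<lambda>x. f x + (- 1) * avgs Q f x)"
  define h where "h = 2 * wk_n * l"
  define I where "I n = (\<integral>\<^sup>+x\<in>Q n. ennreal (norm (f x)) \<partial>rho)" for n
  have h: "0 \<le> h" using l wk_pos(1) by (simp add: h_def)
  have bl: "b \<in> linf_c" unfolding b_def by (intro add_linf_c f cmult_linf_c g)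
  note [measurable] = linf_c_measurable[OF f] linf_c_measurable[OF bl]
  have Qm [measurable]: "Q n \<in> sets rho" for n using Q(1)[of n] cz_sets_rho by auto
  have bin: "b x = f x - cz_mean f (Q n)" if "x \<in> Q n" for x n
    using avgs_in[OF Q(2) that] by (simp add: b_def)
  have b0: "b x = 0" if "x \<notin> (\<Union>n. Q n)" for x using avgs_out[OF that] by (simp add: b_def)
  have bmean: "(LINT y:Q n|rho. b y) = 0" for n
  proof (cases "Q n = {}")
    case False
    then have cz: "Q n \<in> cz_sets" using Q(1)[of n] by blast
    have fin: "emeasure rho (Q n) < \<infinity>" by (rule emeasure_cz_finite[OF cz])
    have mp: "0 < measure rho (Q n)"
      using emeasure_cz_pos[OF cz] fin by (simp add: emeasure_eq_ennreal_measure less_top)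
    have i1: "set_integrable rho (Q n) f"
      using integrable_mult_indicator[OF Qm linf_c_integrable[OF f]] by (simp add: set_integrable_def)
    have i2: "set_integrable rho (Q n) (\<lambda>_. cz_mean f (Q n))"
      using fin by (simp add: set_integrable_def integrable_indicator_iff)
    have "(LINT y:Q n|rho. b y) = (LINT y:Q n|rho. f y - cz_mean f (Q n))"
      unfolding set_lebesgue_integral_def
      by (rule Bochner_Integration.integral_cong) (auto simp: bin split: split_indicator)
    also have "\<dots> = (LINT y:Q n|rho. f y) - (LINT y:Q n|rho. cz_mean f (Q n))"
      by (rule set_integral_diff(2)[OF i1 i2])
    also have "(LINT y:Q n|rho. cz_mean f (Q n)) = of_real (measure rho (Q n)) * cz_mean f (Q n)"
    proof -
      have "Q n \<inter> S = Q n" using cz_sets_subset_S[OF cz] by blast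
      then show ?thesis using fin by (simp add: set_lebesgue_integral_def scaleR_conv_of_real)
    qed
    also have "\<dots> = (LINT y:Q n|rho. f y)" using mp by (simp add: cz_mean_def)
    finally show ?thesis by simp
  qed (simp add: set_lebesgue_integral_def)
  have bint: "(\<integral>\<^sup>+y\<in>Q n. ennreal (norm (b y)) \<partial>rho) \<le> 2 * I n" for n
  proof (cases "Q n = {}")
    case False
    then have cz: "Q n \<in> cz_sets" using Q(1)[of n] by blast
    have "(\<integral>\<^sup>+y\<in>Q n. ennreal (norm (b y)) \<partial>rho) \<le>
       (\<integral>\<^sup>+y. ennreal (norm (f y)) * indicator (Q n) y + ennreal (norm (cz_mean f (Q n))) * indicator (Q n) y \<partial>rho)"
    proof (rule nn_integral_mono)
      fix y
      show "ennreal (norm (b y)) * indicator (Q n) y \<le> ennreal (norm (f y)) * indicator (Q n) y + ennreal (norm (cz_mean f (Q n))) * indicator (Q n) y"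
        using bin[of y n] norm_triangle_ineq4[of "f y" "cz_mean f (Q n)"]
        by (auto split: split_indicator simp: ennreal_plus[symmetric] ennreal_leI simp del: ennreal_plus)
    qed
    also have "\<dots> = I n + ennreal (norm (cz_mean f (Q n))) * emeasure rho (Q n)"
      unfolding I_def by (subst nn_integral_add) (auto simp: nn_integral_cmult_indicator)
    also have "\<dots> \<le> I n + I n" unfolding I_def by (intro add_left_mono norm_cz_mean cz)
    finally show ?thesis by (simp add: mult_2)
  qed simp
  have bh: "(\<integral>\<^sup>+y\<in>Q n. ennreal (norm (b y)) \<partial>rho) \<le> ennreal h * emeasure rho (Q n)" for n
  proof -
    have "2 * I n \<le> 2 * (ennreal (wk_n * l) * emeasure rho (Q n))"
      unfolding I_def by (intro mult_left_mono Q(4)) simp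
    also have "\<dots> = ennreal h * emeasure rho (Q n)"
      using l wk_pos(1) by (simp add: h_def ennreal_mult mult.assoc)
    finally show ?thesis using bint order_trans by blast
  qed
  have IS: "(\<Sum>n. I n) \<le> (\<integral>\<^sup>+x. ennreal (norm (f x)) \<partial>rho)"
  proof -
    have "(\<Sum>n. I n) = (\<integral>\<^sup>+x\<in>(\<Union>n. Q n). ennreal (norm (f x)) \<partial>rho)"
      unfolding I_def by (rule nn_integral_disjoint_family[symmetric]) (use Q(2) in auto)
    also have "\<dots> \<le> (\<integral>\<^sup>+x. ennreal (norm (f x)) \<partial>rho)"
      using set_nn_integral_mono_set[of "\<Union>n. Q n" UNIV] by simp
    finally show ?thesis .
  qed
  define st where "st n = (if Q n = {} then {} else cz_star (Q n))" for n
  have stm [measurable]: "st n \<in> sets rho" for n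
    using Q(1)[of n] cz_star_sets_rho by (auto simp: st_def)
  define V where "V = (\<Union>n. st n)"
  have Vm [measurable]: "V \<in> sets rho" unfolding V_def by measurable
  have Vb: "emeasure rho V \<le> ennreal (cz_cs TYPE('n) / l) * (\<integral>\<^sup>+x. ennreal (norm (f x)) \<partial>rho)"
  proof -
    have "emeasure rho (st n) \<le> ennreal (cz_cs TYPE('n) / l) * I n" for n
    proof (cases "Q n = {}")
      case False
      then have cz: "Q n \<in> cz_sets" using Q(1)[of n] by blast
      have "emeasure rho (st n) \<le> ennreal (cz_cs TYPE('n)) * emeasure rho (Q n)"
        using False emeasure_cz_star[OF cz] by (simp add: st_def)
      also have "\<dots> = ennreal (cz_cs TYPE('n) / l) * (ennreal l * emeasure rho (Q n))"
        using l cz_cs_ge_1[where 'n = 'n] by (simp add: ennreal_mult[symmetric] mult.assoc[symmetric])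
      also have "\<dots> \<le> ennreal (cz_cs TYPE('n) / l) * I n"
        unfolding I_def by (intro mult_left_mono Q(3)) simp
      finally show ?thesis .
    qed (simp add: st_def)
    then have "(\<Sum>n. emeasure rho (st n)) \<le> (\<Sum>n. ennreal (cz_cs TYPE('n) / l) * I n)"
      by (intro suminf_le summableI) auto
    also have "\<dots> = ennreal (cz_cs TYPE('n) / l) * (\<Sum>n. I n)" by (rule ennreal_suminf_cmult)
    also have "\<dots> \<le> ennreal (cz_cs TYPE('n) / l) * (\<integral>\<^sup>+x. ennreal (norm (f x)) \<partial>rho)"
      by (intro mult_left_mono IS) simp
    finally show ?thesis
      unfolding V_def using emeasure_subadditive_countably[of st rho] stm
      by (meson image_subsetI order_trans)
  qed
  define c where "c n = (SOME y. y \<in> Q n)" for n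
  have c: "c n \<in> Q n" if "Q n \<noteq> {}" for n unfolding c_def using that some_in_eq by blast
  \<comment> \<open>If \<open>Q n\<close> is empty, \<open>c n\<close> is arbitrary and may lie
    outside \<open>S\<close>, so that \<open>osc_meas\<close> does not apply. The value 0 agrees
    with \<open>osc\<close> over the empty set.\<close>
  define D where "D x = (\<Sum>n. if Q n = {} then 0 else osc (Q n) (c n) b h x)" for x
  have osc_m: "(\<lambda>x. if Q n = {} then 0 else osc (Q n) (c n) b h x) \<in> borel_measurable rho" for n
  proof (cases "Q n = {}")
    case False
    then have "c n \<in> S" using c[of n] Q(1)[of n] cz_sets_subset_S by blast
    then show ?thesis using False osc_meas[OF Qm _ linf_c_measurable[OF bl]] by simp
  qed simp
  have Dm [measurable]: "D \<in> borel_measurable rho"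
    unfolding D_def[abs_def] by (rule borel_measurable_suminf_order[OF osc_m])
  have SV [measurable]: "S - V \<in> sets rho" using sets.compl_sets[OF Vm] by simp
  have Db: "(\<integral>\<^sup>+x\<in>S - V. D x \<partial>rho) \<le> ennreal (H * (2 + 2 * wk_n)) * (\<integral>\<^sup>+x. ennreal (norm (f x)) \<partial>rho)"
  proof -
    have piece: "(\<integral>\<^sup>+x\<in>S - V. (if Q n = {} then 0 else osc (Q n) (c n) b h x) \<partial>rho) \<le> ennreal (H * (2 + 2 * wk_n)) * I n" for n
    proof (cases "Q n = {}")
      case False
      then have cz: "Q n \<in> cz_sets" using Q(1)[of n] by blast
      have "(\<integral>\<^sup>+x\<in>S - V. (if Q n = {} then 0 else osc (Q n) (c n) b h x) \<partial>rho) \<le> (\<integral>\<^sup>+x\<in>S - cz_star (Q n). osc (Q n) (c n) b h x \<partial>rho)"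
        using False by (simp, intro set_nn_integral_mono_set) (auto simp: V_def st_def split: if_splits)
      also have "\<dots> \<le> ennreal H * (\<integral>\<^sup>+y\<in>Q n. ennreal (norm (b y) + h) \<partial>rho)"
        by (rule osc_integral[OF cz c[OF False] _ h]) measurable
      also have "(\<integral>\<^sup>+y\<in>Q n. ennreal (norm (b y) + h) \<partial>rho) = (\<integral>\<^sup>+y. ennreal (norm (b y)) * indicator (Q n) y + ennreal h * indicator (Q n) y \<partial>rho)"
        using h by (intro nn_integral_cong) (auto simp: ennreal_plus split: split_indicator)
      also have "\<dots> = (\<integral>\<^sup>+y\<in>Q n. ennreal (norm (b y)) \<partial>rho) + ennreal h * emeasure rho (Q n)"
        by (subst nn_integral_add) (auto simp: nn_integral_cmult_indicator)
      also have "\<dots> \<le> 2 * I n + ennreal (2 * wk_n) * I n"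
      proof (intro add_mono bint)
        have "ennreal h * emeasure rho (Q n) = ennreal (2 * wk_n) * (ennreal l * emeasure rho (Q n))"
          using l wk_pos(1) by (simp add: h_def ennreal_mult mult.assoc)
        also have "\<dots> \<le> ennreal (2 * wk_n) * I n" unfolding I_def by (intro mult_left_mono Q(3)) simp
        finally show "ennreal h * emeasure rho (Q n) \<le> ennreal (2 * wk_n) * I n" .
      qed
      also have "\<dots> = ennreal (2 + 2 * wk_n) * I n"
        using wk_pos(1) by (simp add: ennreal_plus ring_distribs)
      finally show ?thesis
        using pos wk_pos(1) by (simp add: ennreal_mult mult.assoc mult_left_mono)
    qed simp
    have "(\<integral>\<^sup>+x\<in>S - V. D x \<partial>rho) = (\<integral>\<^sup>+x. (\<Sum>n. (if Q n = {} then 0 else osc (Q n) (c n) b h x) * indicator (S - V) x) \<partial>rho)"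
      unfolding D_def by (simp add: ennreal_suminf_multc)
    also have "\<dots> = (\<Sum>n. (\<integral>\<^sup>+x\<in>S - V. (if Q n = {} then 0 else osc (Q n) (c n) b h x) \<partial>rho))"
      by (rule nn_integral_suminf) (use osc_m in measurable)
    also have "\<dots> \<le> (\<Sum>n. ennreal (H * (2 + 2 * wk_n)) * I n)"
      by (intro suminf_le summableI piece)
    also have "\<dots> = ennreal (H * (2 + 2 * wk_n)) * (\<Sum>n. I n)" by (rule ennreal_suminf_cmult)
    also have "\<dots> \<le> ennreal (H * (2 + 2 * wk_n)) * (\<integral>\<^sup>+x. ennreal (norm (f x)) \<partial>rho)"
      by (intro mult_left_mono IS) simp
    finally show ?thesis .
  qed
  define U where "U = {x \<in> S - V. 1 \<le> ennreal (1 / d) * D x}"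
  have Um: "U \<in> sets rho"
  proof -
    have "{x \<in> space rho. x \<in> S - V \<and> 1 \<le> ennreal (1 / d) * D x} \<in> sets rho" by measurable
    also have "{x \<in> space rho. x \<in> S - V \<and> 1 \<le> ennreal (1 / d) * D x} = U" by (auto simp: U_def)
    finally show ?thesis .
  qed
  have "emeasure rho U \<le> ennreal (1 / d) * (\<integral>\<^sup>+x\<in>S - V. D x \<partial>rho)"
    unfolding U_def by (rule nn_integral_Markov_inequality) measurable
  also have "\<dots> \<le> ennreal (1 / d) * (ennreal (H * (2 + 2 * wk_n)) * (\<integral>\<^sup>+x. ennreal (norm (f x)) \<partial>rho))"
    by (intro mult_left_mono Db) simp
  also have "\<dots> = ennreal (H * (2 + 2 * wk_n) / d) * (\<integral>\<^sup>+x. ennreal (norm (f x)) \<partial>rho)"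
    using d pos wk_pos(1) by (simp add: mult.assoc[symmetric] ennreal_mult[symmetric])
  finally have Ub: "emeasure rho U \<le> ennreal (H * (2 + 2 * wk_n) / d) * (\<integral>\<^sup>+x. ennreal (norm (f x)) \<partial>rho)" .
  show thesis
  proof (rule that[of "V \<union> U"])
    show "V \<union> U \<in> sets rho" using Vm Um by simp
    have "emeasure rho (V \<union> U) \<le> emeasure rho V + emeasure rho U"
      by (rule emeasure_subadditive[OF Vm Um])
    also have "\<dots> \<le> ennreal (cz_cs TYPE('n) / l) * (\<integral>\<^sup>+x. ennreal (norm (f x)) \<partial>rho) +
       ennreal (H * (2 + 2 * wk_n) / d) * (\<integral>\<^sup>+x. ennreal (norm (f x)) \<partial>rho)"
      by (intro add_mono Vb Ub)
    also have "\<dots> = ennreal (cz_cs TYPE('n) / l + H * (2 + 2 * wk_n) / d) * (\<integral>\<^sup>+x. ennreal (norm (f x)) \<partial>rho)"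
      using d pos wk_pos(1) l cz_cs_ge_1[where 'n = 'n] by (simp add: ennreal_plus ring_distribs)
    finally show "emeasure rho (V \<union> U) \<le> \<dots>" .
    show "{x \<in> S. ennreal (d + 2 * wk_n * l * annc) < max_sing K (\<lambda>x. f x + (- 1) * avgs Q f x) x} \<subseteq> V \<union> U"
    proof
      fix x assume "x \<in> {x \<in> S. ennreal (d + 2 * wk_n * l * annc) < max_sing K (\<lambda>x. f x + (- 1) * avgs Q f x) x}"
      then have x: "x \<in> S" "ennreal (d + h * annc) < max_sing K b x" by (auto simp: h_def b_def)
      show "x \<in> V \<union> U"
      proof (cases "x \<in> V")
        case False
        then have xn: "x \<notin> cz_star (Q n)" if "Q n \<noteq> {}" for n using that by (auto simp: V_def st_def)
        have oe: "osc (Q n) (c n) b h x = (if Q n = {} then 0 else osc (Q n) (c n) b h x)" for n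
          by (simp add: osc_def)
        have "max_sing K b x \<le> D x + ennreal (h * annc)"
          unfolding max_sing_eq
        proof (rule SUP_least)
          fix R assume "R \<in> {R \<in> cz_sets. x \<in> R}"
          then have R: "R \<in> cz_sets" "x \<in> R" by auto
          have "ennreal (norm (tr b R x)) \<le> (\<Sum>n. osc (Q n) (c n) b h x) + ennreal (h * annc)"
            by (rule bad_sum[OF Q(1,2) c R xn bl bmean b0 h bh])
          then show "ennreal (norm (tr b R x)) \<le> D x + ennreal (h * annc)"
            unfolding D_def oe[symmetric] .
        qed
        then have "ennreal d + ennreal (h * annc) < D x + ennreal (h * annc)"
          using x(2) d h annc_nonneg by (simp add: ennreal_plus[symmetric] del: ennreal_plus)
        then have dD: "ennreal d < D x" by (metis add_mono le_less_trans linorder_not_le order_less_irrefl order_refl)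
        have "1 = ennreal (1 / d) * ennreal d" using d by (simp add: ennreal_mult[symmetric])
        also have "\<dots> \<le> ennreal (1 / d) * D x" using dD by (intro mult_left_mono) auto
        finally show ?thesis using x(1) False by (simp add: U_def)
      qed simp
    qed
  qed
qed

text \<open>The height is spent as \<alpha> / 2 on the good part \<open>g\<close> and as \<alpha> /
  4 each on the oscillation terms and the boundary pieces of the bad part. The L2 bound of
  \<open>cotlar\<close> becomes an L1 bound because the square of |g| is at most wk_n l |g|.\<close>

theorem weak11:
  assumes f: "f \<in> linf_c" and al: "0 < \<alpha>"
  obtains W where "W \<in> sets rho" "{x \<in> S. ennreal \<alpha> < max_sing K f x} \<subseteq> W"
    "emeasure rho W \<le> ennreal (wk_c / \<alpha>) * (\<integral>\<^sup>+x. ennreal (norm (f x)) \<partial>rho)"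
proof -
  define l where "l = wk_g * \<alpha>"
  have l: "0 < l" using al wk_pos by (simp add: l_def)
  obtain Q :: "nat \<Rightarrow> 'n pt set" where Q: "\<And>n. Q n \<in> cz_sets \<or> Q n = {}" "disjoint_family Q"
    "\<And>n. ennreal l * emeasure rho (Q n) \<le> (\<integral>\<^sup>+x\<in>Q n. ennreal (norm (f x)) \<partial>rho)"
    "\<And>n. (\<integral>\<^sup>+x\<in>Q n. ennreal (norm (f x)) \<partial>rho) \<le> ennreal (wk_n * l) * emeasure rho (Q n)"
    and g: "avgs Q f \<in> linf_c" "AE x in rho. norm (avgs Q f x) \<le> wk_n * l"
    "(\<integral>\<^sup>+x. ennreal (norm (avgs Q f x)) \<partial>rho) \<le> (\<integral>\<^sup>+x. ennreal (norm (f x)) \<partial>rho)"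
    by (rule weak11_decomposition[OF f l, of thesis]) (rule that)
  define g where "g = avgs Q f"
  define b where "b = (\<lambda>x. f x + (- 1) * g x)"
  define I where "I = (\<integral>\<^sup>+x. ennreal (norm (f x)) \<partial>rho)"
  have bl: "b \<in> linf_c" unfolding b_def g_def by (intro add_linf_c f cmult_linf_c g)
  have fe: "f = (\<lambda>x. g x + b x)" by (auto simp: b_def)
  have wl: "0 < wk_n * l" using l wk_pos(1) by simp
  have c0: "cotlar_c0 * (wk_n * l) \<le> \<alpha> / 2"
    using mult_right_mono[OF wk_g_bounds(2), of \<alpha>] al by (simp add: l_def mult_ac)
  obtain W1 where W1: "W1 \<in> sets rho" "{x \<in> S. ennreal (\<alpha> / 2) < max_sing K g x} \<subseteq> W1"
    "emeasure rho W1 \<le> ennreal (cotlar_c1 / (\<alpha> / 2)\<^sup>2) * (\<integral>\<^sup>+x. ennreal ((norm (g x))\<^sup>2) \<partial>rho)"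
    unfolding g_def by (rule cotlar[OF g(1,2) wl c0])
  obtain W2 where W2: "W2 \<in> sets rho"
    "{x \<in> S. ennreal (\<alpha> / 4 + 2 * wk_n * l * annc) < max_sing K b x} \<subseteq> W2"
    "emeasure rho W2 \<le> ennreal (cz_cs TYPE('n) / l + H * (2 + 2 * wk_n) / (\<alpha> / 4)) * I"
    unfolding b_def g_def I_def by (rule weak11_bad[OF f l Q g(1), of "\<alpha> / 4"]) (use al in auto)
  have W1b: "emeasure rho W1 \<le> ennreal (4 * cotlar_c1 * (wk_n * wk_g) / \<alpha>) * I"
  proof -
    have "(\<integral>\<^sup>+x. ennreal ((norm (g x))\<^sup>2) \<partial>rho) \<le> (\<integral>\<^sup>+x. ennreal (wk_n * l) * ennreal (norm (g x)) \<partial>rho)"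
    proof (rule nn_integral_mono_AE)
      show "AE x in rho. ennreal ((norm (g x))\<^sup>2) \<le> ennreal (wk_n * l) * ennreal (norm (g x))"
        using g(2)
      proof eventually_elim
        fix x assume "norm (avgs Q f x) \<le> wk_n * l"
        then have "(norm (g x))\<^sup>2 \<le> wk_n * l * norm (g x)"
          by (simp add: g_def power2_eq_square mult_right_mono)
        then show "ennreal ((norm (g x))\<^sup>2) \<le> ennreal (wk_n * l) * ennreal (norm (g x))"
          using wl by (simp add: ennreal_mult[symmetric] ennreal_leI)
      qed
    qed
    also have "\<dots> = ennreal (wk_n * l) * (\<integral>\<^sup>+x. ennreal (norm (g x)) \<partial>rho)"
      using linf_c_measurable[OF g(1)] by (intro nn_integral_cmult) (simp add: g_def)
    also have "\<dots> \<le> ennreal (wk_n * l) * I" unfolding I_def g_def by (intro mult_left_mono g(3)) simp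
    finally have "emeasure rho W1 \<le> ennreal (cotlar_c1 / (\<alpha> / 2)\<^sup>2) * (ennreal (wk_n * l) * I)"
      using W1(3) by (meson mult_left_mono order_trans zero_le)
    also have "\<dots> = ennreal (cotlar_c1 / (\<alpha> / 2)\<^sup>2 * (wk_n * l)) * I"
      using wl cotlar_c_pos by (subst ennreal_mult) (auto simp: mult.assoc)
    also have "cotlar_c1 / (\<alpha> / 2)\<^sup>2 * (wk_n * l) = 4 * cotlar_c1 * (wk_n * wk_g) / \<alpha>"
      using al by (simp add: l_def power2_eq_square)
    finally show ?thesis .
  qed
  show thesis
  proof (rule that[of "W1 \<union> W2"])
    show "W1 \<union> W2 \<in> sets rho" using W1(1) W2(1) by simp
    show "{x \<in> S. ennreal \<alpha> < max_sing K f x} \<subseteq> W1 \<union> W2"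
    proof (rule ccontr)
      assume "\<not> ?thesis"
      then obtain x where x: "x \<in> S" "ennreal \<alpha> < max_sing K f x" "x \<notin> W1" "x \<notin> W2" by blast
      have 1: "max_sing K g x \<le> ennreal (\<alpha> / 2)" using x W1(2) by (auto simp: not_less)
      have "max_sing K b x \<le> ennreal (\<alpha> / 4 + 2 * wk_n * l * annc)" using x W2(2) by (auto simp: not_less)
      also have "\<dots> \<le> ennreal (\<alpha> / 2)"
      proof (rule ennreal_leI)
        show "\<alpha> / 4 + 2 * wk_n * l * annc \<le> \<alpha> / 2"
        proof -
          have "2 * wk_n * l * annc = 2 * wk_n * wk_g * annc * \<alpha>" by (simp add: l_def)
          also have "\<dots> \<le> 1 / 4 * \<alpha>" by (intro mult_right_mono wk_g_bounds) (use al in simp)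
          finally show ?thesis by simp
        qed
      qed
      finally have 2: "max_sing K b x \<le> ennreal (\<alpha> / 2)" .
      have "max_sing K f x \<le> max_sing K g x + max_sing K b x"
        by (subst fe, rule max_sing_add) (use g(1) bl in \<open>auto simp: g_def\<close>)
      also have "\<dots> \<le> ennreal (\<alpha> / 2) + ennreal (\<alpha> / 2)" by (intro add_mono 1 2)
      also have "\<dots> = ennreal \<alpha>" using al by (simp add: ennreal_plus[symmetric] del: ennreal_plus)
      finally show False using x(2) by simp
    qed
    have "emeasure rho (W1 \<union> W2) \<le> emeasure rho W1 + emeasure rho W2"
      by (rule emeasure_subadditive[OF W1(1) W2(1)])
    also have "\<dots> \<le> ennreal (4 * cotlar_c1 * (wk_n * wk_g) / \<alpha>) * I + ennreal (cz_cs TYPE('n) / l + H * (2 + 2 * wk_n) / (\<alpha> / 4)) * I"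
      by (intro add_mono W1b W2(3))
    also have "\<dots> = ennreal (4 * cotlar_c1 * (wk_n * wk_g) / \<alpha> + (cz_cs TYPE('n) / l + H * (2 + 2 * wk_n) / (\<alpha> / 4))) * I"
      using al l pos wk_pos cotlar_c_pos cz_cs_ge_1[where 'n = 'n]
      by (subst ennreal_plus) (auto simp: distrib_right intro!: add_nonneg_nonneg mult_nonneg_nonneg divide_nonneg_nonneg)
    also have "4 * cotlar_c1 * (wk_n * wk_g) / \<alpha> + (cz_cs TYPE('n) / l + H * (2 + 2 * wk_n) / (\<alpha> / 4)) = wk_c / \<alpha>"
      using al wk_pos by (simp add: wk_c_def l_def add_divide_distrib mult_ac)
    finally show "emeasure rho (W1 \<union> W2) \<le> ennreal (wk_c / \<alpha>) * (\<integral>\<^sup>+x. ennreal (norm (f x)) \<partial>rho)"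
      by (simp add: I_def)
  qed
qed

end

section \<open>Measurability of the maximal operator\<close>

text \<open>The sets containing \<open>x\<close> are parametrized relative to the height \<open>t\<close> of \<open>x\<close>: the second factor
  is \<open>[t exp (- \<beta>), t exp \<gamma>)\<close>.\<close>

definition rel_a :: "real \<Rightarrow> real \<Rightarrow> real \<Rightarrow> real" where
  "rel_a t \<beta> \<gamma> = t * exp ((\<gamma> - \<beta>) / 2)"

definition rel_r :: "real \<Rightarrow> real \<Rightarrow> real" where
  "rel_r \<beta> \<gamma> = (\<beta> + \<gamma>) / 2"

definition rel_ok :: "int \<Rightarrow> ('n \<Rightarrow> int) \<Rightarrow> real \<Rightarrow> real \<Rightarrow> ('n::finite) pt \<Rightarrow> bool" where
  "rel_ok j k \<beta> \<gamma> x \<longleftrightarrow> fst x \<in> dyadic_cube j k \<and> 0 < snd x \<and> 0 \<le> \<beta> \<and> 0 < \<gamma> \<and>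
     cz_admissible (2 powi j) (rel_a (snd x) \<beta> \<gamma>) (rel_r \<beta> \<gamma>)"

definition rel_box :: "int \<Rightarrow> ('n \<Rightarrow> int) \<Rightarrow> real \<Rightarrow> real \<Rightarrow> ('n::finite) pt \<Rightarrow> 'n pt set" where
  "rel_box j k \<beta> \<gamma> x = cz_box j k (rel_a (snd x) \<beta> \<gamma>) (rel_r \<beta> \<gamma>)"

lemma rel_box_eq: "rel_box j k \<beta> \<gamma> x = dyadic_cube j k \<times> {snd x * exp (- \<beta>)..<snd x * exp \<gamma>}"
proof -
  have "rel_a (snd x) \<beta> \<gamma> * exp (- rel_r \<beta> \<gamma>) = snd x * exp (- \<beta>)"
    "rel_a (snd x) \<beta> \<gamma> * exp (rel_r \<beta> \<gamma>) = snd x * exp \<gamma>"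
    unfolding rel_a_def rel_r_def mult.assoc exp_add[symmetric] by (simp_all add: field_simps)
  then show ?thesis by (simp add: rel_box_def cz_box_def)
qed

lemma rel_box_cz:
  assumes "rel_ok j k \<beta> \<gamma> x"
  shows "rel_box j k \<beta> \<gamma> x \<in> cz_sets" "x \<in> rel_box j k \<beta> \<gamma> x" "cz_radius (rel_box j k \<beta> \<gamma> x) = rel_r \<beta> \<gamma>"
proof -
  have a: "0 < rel_a (snd x) \<beta> \<gamma>" "0 < rel_r \<beta> \<gamma>" "cz_admissible (2 powi j) (rel_a (snd x) \<beta> \<gamma>) (rel_r \<beta> \<gamma>)"
    using assms by (auto simp: rel_ok_def rel_a_def rel_r_def)
  show "rel_box j k \<beta> \<gamma> x \<in> cz_sets" unfolding rel_box_def by (rule cz_setsI[OF a])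
  show "cz_radius (rel_box j k \<beta> \<gamma> x) = rel_r \<beta> \<gamma>" unfolding rel_box_def by (rule cz_radius_cz_box[OF a])
  show "x \<in> rel_box j k \<beta> \<gamma> x" using assms by (auto simp: rel_box_eq rel_ok_def mem_Times_iff)
qed

lemma rel_ex:
  assumes "R \<in> cz_sets" "x \<in> R"
  obtains j k \<beta> \<gamma> where "R = rel_box j k \<beta> \<gamma> x" "rel_ok j k \<beta> \<gamma> x"
proof -
  obtain j k a r where *: "R = cz_box j k a r" "0 < a" "0 < r"
    "cz_admissible (2 powi j) a r" "cz_radius R = r" using assms(1) by (rule cz_setsE)
  have xS: "0 < snd x" using assms cz_sets_subset_S by (force simp: S_def)
  define u where "u = ln (snd x)"
  have t: "snd x = exp u" using xS by (simp add: u_def)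
  define \<alpha> where "\<alpha> = ln a"
  have a: "a = exp \<alpha>" using *(2) by (simp add: \<alpha>_def)
  have b: "a * exp (- r) \<le> snd x" "snd x < a * exp r" "fst x \<in> dyadic_cube j k"
    using assms(2) by (auto simp: * cz_box_def)
  then have b': "\<alpha> - r \<le> u" "u < \<alpha> + r" unfolding a t exp_add[symmetric] by auto
  define \<beta> \<gamma> where "\<beta> = u - \<alpha> + r" and "\<gamma> = \<alpha> + r - u"
  have ra: "rel_a (snd x) \<beta> \<gamma> = a" "rel_r \<beta> \<gamma> = r"
    unfolding rel_a_def rel_r_def a t exp_add[symmetric] \<beta>_def \<gamma>_def by (simp_all add: field_simps)
  show thesis
  proof (rule that[of j k \<beta> \<gamma>])
    show "R = rel_box j k \<beta> \<gamma> x" unfolding rel_box_def ra by (rule *(1))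
    have "0 \<le> \<beta>" "0 < \<gamma>" using b' by (auto simp: \<beta>_def \<gamma>_def)
    then show "rel_ok j k \<beta> \<gamma> x" unfolding rel_ok_def ra using * b xS by blast
  qed
qed

lemma cz_lo_eq: "cz_lo a r = a * cz_lo 1 r" and cz_hi_eq: "cz_hi a r = a * cz_hi 1 r"
  by (auto simp: cz_lo_def cz_hi_def)

lemma cz_lo_1_mono:
  assumes "0 < r" "r \<le> r'"
  shows "cz_lo 1 r \<le> cz_lo 1 r'"
proof -
  have "exp 2 * r \<le> exp (2 * r')" if "r < 1" "1 \<le> r'"
  proof -
    have "exp 2 * r \<le> exp 2 * (1::real)" using that by (intro mult_left_mono) auto
    also have "\<dots> \<le> exp (2 * r')" using that by simp
    finally show ?thesis .
  qed
  then show ?thesis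
    using assms by (auto simp: cz_lo_def mult_left_mono mult_ac)
qed

lemma continuous_on_cz_lo_hi: "continuous_on UNIV (cz_lo 1)" "continuous_on UNIV (cz_hi 1)"
proof -
  have 1: "cz_lo 1 = (\<lambda>r. if r \<le> 1 then exp 2 * r else exp (2 * r))"
    by (rule ext) (auto simp: cz_lo_def)
  have 2: "cz_hi 1 = (\<lambda>r. if r \<le> 1 then exp 8 * r else exp (8 * r))"
    by (rule ext) (auto simp: cz_hi_def)
  show "continuous_on UNIV (cz_lo 1)" "continuous_on UNIV (cz_hi 1)"
    unfolding 1 2 by (intro continuous_on_cases_le continuous_intros; simp)+
qed

text \<open>Both parameters are approximated from below, so that the boxes shrink. The lower bound
  for the side may hold with equality; \<gamma> is therefore lowered first and strictly, which makes
  that bound strict. Then both bounds are open conditions and survive a small change of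
  \<beta>.\<close>

lemma rel_rational_approx:
  assumes ok: "rel_ok j k \<beta> \<gamma> x" and e: "0 < e"
  obtains p q :: rat where "of_rat p \<le> \<beta>" "\<beta> - e < of_rat p" "of_rat q \<le> \<gamma>" "\<gamma> - e < of_rat q"
    "rel_ok j k (of_rat p) (of_rat q) x"
proof -
  define t where "t = snd x"
  define L :: real where "L = 2 powi j"
  have x: "fst x \<in> dyadic_cube j k" "0 < t" "0 \<le> \<beta>" "0 < \<gamma>"
    and adm: "cz_lo (rel_a t \<beta> \<gamma>) (rel_r \<beta> \<gamma>) \<le> L" "L < cz_hi (rel_a t \<beta> \<gamma>) (rel_r \<beta> \<gamma>)"
    using ok by (auto simp: rel_ok_def t_def L_def cz_admissible_iff)
  define lo hi where "lo b c = rel_a t b c * cz_lo 1 (rel_r b c)" and "hi b c = rel_a t b c * cz_hi 1 (rel_r b c)" for b c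
  have lohi: "cz_lo (rel_a t b c) (rel_r b c) = lo b c" "cz_hi (rel_a t b c) (rel_r b c) = hi b c" for b c
    unfolding lo_def hi_def by (rule cz_lo_eq, rule cz_hi_eq)
  note co = continuous_on_compose2[OF continuous_on_cz_lo_hi(1)] continuous_on_compose2[OF continuous_on_cz_lo_hi(2)]
  have "continuous_on UNIV (\<lambda>c. hi \<beta> c)"
    unfolding hi_def rel_a_def rel_r_def by (intro co continuous_intros; simp)
  then have c1: "isCont (\<lambda>c. hi \<beta> c) \<gamma>" by (simp add: continuous_on_eq_continuous_at)
  have "continuous_on UNIV (\<lambda>b. hi b c)" for c
    unfolding hi_def rel_a_def rel_r_def by (intro co continuous_intros; simp)
  moreover have "continuous_on UNIV (\<lambda>b. lo b c)" for c
    unfolding lo_def rel_a_def rel_r_def by (intro co continuous_intros; simp)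
  ultimately have c2: "isCont (\<lambda>b. lo b c) \<beta>" "isCont (\<lambda>b. hi b c) \<beta>" for c
    by (simp_all add: continuous_on_eq_continuous_at)
  have "eventually (\<lambda>c. L < hi \<beta> c) (at \<gamma>)"
    using c1 adm(2) unfolding lohi isCont_def by (rule order_tendstoD)
  then obtain d where d: "0 < d" "\<And>c. c \<noteq> \<gamma> \<Longrightarrow> dist c \<gamma> < d \<Longrightarrow> L < hi \<beta> c"
    by (auto simp: eventually_at)
  have "max 0 (\<gamma> - min d e) < \<gamma>" using x d e by auto
  then obtain q where q: "max 0 (\<gamma> - min d e) < of_rat q" "of_rat q < \<gamma>" using of_rat_dense by blast
  have q': "0 < (of_rat q :: real)" "\<gamma> - e < of_rat q" "L < hi \<beta> (of_rat q)"
    using q d(2)[of "of_rat q"] by (auto simp: dist_real_def)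
  have lq: "lo \<beta> (of_rat q) < L"
  proof -
    have "rel_a t \<beta> (of_rat q) < rel_a t \<beta> \<gamma>" using q x by (simp add: rel_a_def)
    moreover have rp: "0 < rel_r \<beta> (of_rat q)" unfolding rel_r_def by (rule half_gt_zero[OF add_nonneg_pos[OF x(3) q'(1)]])
    moreover have "cz_lo 1 (rel_r \<beta> (of_rat q)) \<le> cz_lo 1 (rel_r \<beta> \<gamma>)"
      by (rule cz_lo_1_mono[OF rp]) (use q(2) in \<open>simp add: rel_r_def\<close>)
    moreover have "0 < cz_lo 1 (rel_r \<beta> (of_rat q))" by (rule cz_lo_pos[OF zero_less_one rp])
    moreover have "0 < rel_a t \<beta> \<gamma>" using x by (simp add: rel_a_def)
    ultimately have "lo \<beta> (of_rat q) < lo \<beta> \<gamma>"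
      unfolding lo_def by (intro mult_less_le_imp_less) (auto simp: rel_a_def less_imp_le[OF x(2)])
    then show ?thesis using adm(1) by (simp add: lohi)
  qed
  have "eventually (\<lambda>b. lo b (of_rat q) < L) (at \<beta>)" "eventually (\<lambda>b. L < hi b (of_rat q)) (at \<beta>)"
    using order_tendstoD(2)[OF c2(1)[unfolded isCont_def] lq] order_tendstoD(1)[OF c2(2)[unfolded isCont_def] q'(3)] by auto
  then have "eventually (\<lambda>b. lo b (of_rat q) < L \<and> L < hi b (of_rat q)) (at \<beta>)" by (rule eventually_conj)
  then obtain d' where d': "0 < d'" "\<And>b. b \<noteq> \<beta> \<Longrightarrow> dist b \<beta> < d' \<Longrightarrow> lo b (of_rat q) < L \<and> L < hi b (of_rat q)"
    unfolding eventually_at by blast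
  \<comment> \<open>The value \<beta> = 0 leaves no room below it but is itself rational.\<close>
  obtain p where p: "0 \<le> (of_rat p :: real)" "of_rat p \<le> \<beta>" "\<beta> - min d' e < of_rat p"
  proof (cases "\<beta> = 0")
    case True
    then show thesis using that[of 0] d' e by auto
  next
    case False
    then have "max 0 (\<beta> - min d' e) < \<beta>" using x d' e by auto
    then obtain p where "max 0 (\<beta> - min d' e) < of_rat p" "of_rat p < \<beta>" using of_rat_dense by blast
    then show thesis using that[of p] by auto
  qed
  have "lo (of_rat p) (of_rat q) < L \<and> L < hi (of_rat p) (of_rat q)"
    using d'(2)[of "of_rat p"] lq q'(3) p by (cases "of_rat p = \<beta>") (auto simp: dist_real_def)
  then have "rel_ok j k (of_rat p) (of_rat q) x"
    using x p q' lohi by (auto simp: rel_ok_def cz_admissible_iff t_def L_def)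
  then show thesis using that[of p q] p q q' by auto
qed

lemma rel_ok_measurable: "{x \<in> space rho. rel_ok j k \<beta> \<gamma> x} \<in> sets (rho :: ('n::finite) pt measure)"
proof -
  define C :: "'n pt set" where "C = dyadic_cube j k \<times> UNIV"
  have C: "C \<in> sets borel" unfolding C_def by (intro borel_Times) auto
  have m: "(\<lambda>x::'n pt. rel_a (snd x) \<beta> \<gamma>) \<in> borel_measurable borel"
    unfolding rel_a_def by (intro borel_measurable_continuous_onI continuous_intros)
  have "(\<lambda>x::'n pt. cz_lo (rel_a (snd x) \<beta> \<gamma>) (rel_r \<beta> \<gamma>)) \<in> borel_measurable borel"
    "(\<lambda>x::'n pt. cz_hi (rel_a (snd x) \<beta> \<gamma>) (rel_r \<beta> \<gamma>)) \<in> borel_measurable borel"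
    unfolding cz_lo_eq[of "rel_a _ _ _"] cz_hi_eq[of "rel_a _ _ _"] using m by (intro borel_measurable_times borel_measurable_const; simp)+
  then have "{x. cz_lo (rel_a (snd x) \<beta> \<gamma>) (rel_r \<beta> \<gamma>) \<le> 2 powi j} \<in> sets (borel :: 'n pt measure)"
    "{x. 2 powi j < cz_hi (rel_a (snd x) \<beta> \<gamma>) (rel_r \<beta> \<gamma>)} \<in> sets (borel :: 'n pt measure)"
    using borel_measurable_le[of _ borel "\<lambda>_. 2 powi j"] borel_measurable_less[of "\<lambda>_. 2 powi j" borel] by auto
  moreover have "{x \<in> space rho. rel_ok j k \<beta> \<gamma> x} =
     (if 0 \<le> \<beta> \<and> 0 < \<gamma> then S \<inter> C \<inter> {x. cz_lo (rel_a (snd x) \<beta> \<gamma>) (rel_r \<beta> \<gamma>) \<le> 2 powi j} \<inter>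
       {x. 2 powi j < cz_hi (rel_a (snd x) \<beta> \<gamma>) (rel_r \<beta> \<gamma>)} else {})"
    by (auto simp: rel_ok_def cz_admissible_iff C_def S_def)
  ultimately show ?thesis using C by (auto simp: sets_rho_iff)
qed

lemma open_rho_pair:
  fixes G :: "(('n::finite) pt \<times> 'n pt) set"
  assumes "open G"
  shows "G \<inter> (S \<times> S) \<in> sets (rho \<Otimes>\<^sub>M rho)"
proof -
  have b: "(\<lambda>x. x) \<in> rho \<rightarrow>\<^sub>M (borel :: 'n pt measure)"
    by (rule measurableI) (auto simp: sets_rho_iff Int_commute)
  have "(\<lambda>z. (fst z, snd z)) \<in> rho \<Otimes>\<^sub>M rho \<rightarrow>\<^sub>M (borel :: 'n pt measure) \<Otimes>\<^sub>M (borel :: 'n pt measure)"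
    by (intro measurable_Pair measurable_compose[OF measurable_fst b] measurable_compose[OF measurable_snd b])
  then have "(\<lambda>z. z) \<in> rho \<Otimes>\<^sub>M rho \<rightarrow>\<^sub>M (borel :: ('n pt \<times> 'n pt) measure)"
    by (simp add: borel_prod)
  then have "(\<lambda>z. z) -` G \<inter> space (rho \<Otimes>\<^sub>M rho) \<in> sets (rho \<Otimes>\<^sub>M (rho :: 'n pt measure))"
    by (rule measurable_sets) (use assms in auto)
  then show ?thesis by (simp add: space_pair_measure)
qed

text \<open>The relation that \<open>y\<close> lies in the star of the box at \<open>x\<close>, as a
  subset of the product. With points of the box written as (\<xi>, s snd x), the condition is
  continuous in both points for fixed \<xi> and s, so the relation is a union of open sets.\<close>

definition rel_star :: "int \<Rightarrow> ('n \<Rightarrow> int) \<Rightarrow> real \<Rightarrow> real \<Rightarrow> (('n::finite) pt \<times> 'n pt) set" where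
  "rel_star j k \<beta> \<gamma> = {(x, y). x \<in> S \<and> y \<in> S \<and>
     (\<exists>\<xi>\<in>dyadic_cube j k. \<exists>s\<in>{exp (- \<beta>)..<exp \<gamma>}. hdist y (\<xi>, s * snd x) < rel_r \<beta> \<gamma>)}"

lemma rel_star_sets: "rel_star j k \<beta> \<gamma> \<in> sets (rho \<Otimes>\<^sub>M (rho :: ('n::finite) pt measure))"
proof -
  have op: "open {z. z \<in> S \<times> S \<and> hdist (snd z) (\<xi>, s * snd (fst z)) < r}"
    if s: "0 < s" for \<xi> :: "real ^ 'n" and s r :: real
  proof -
    have "continuous_on (S \<times> S) (\<lambda>z. hdist (snd z) (\<xi>, s * snd (fst z)))"
      by (rule continuous_on_hdist) (use s in \<open>auto simp: S_def intro!: continuous_intros\<close>)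
    then have "open (S \<times> S \<inter> (\<lambda>z. hdist (snd z) (\<xi>, s * snd (fst z))) -` {..<r})"
      by (rule continuous_open_preimage) (auto simp: open_S open_Times)
    also have "S \<times> S \<inter> (\<lambda>z. hdist (snd z) (\<xi>, s * snd (fst z))) -` {..<r} =
        {z. z \<in> S \<times> S \<and> hdist (snd z) (\<xi>, s * snd (fst z)) < r}" by auto
    finally show ?thesis .
  qed
  have "rel_star j k \<beta> \<gamma> = (\<Union>\<xi>\<in>dyadic_cube j k. \<Union>s\<in>{exp (- \<beta>)..<exp \<gamma>}.
      {z. z \<in> S \<times> S \<and> hdist (snd z) (\<xi>, s * snd (fst z)) < rel_r \<beta> \<gamma>})"
  proof (rule set_eqI)
    fix z :: "'n pt \<times> 'n pt"
    obtain x y where z: "z = (x, y)" by (cases z)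
    show "z \<in> rel_star j k \<beta> \<gamma> \<longleftrightarrow> z \<in> (\<Union>\<xi>\<in>dyadic_cube j k. \<Union>s\<in>{exp (- \<beta>)..<exp \<gamma>}.
      {z. z \<in> S \<times> S \<and> hdist (snd z) (\<xi>, s * snd (fst z)) < rel_r \<beta> \<gamma>})"
      by (simp add: z rel_star_def)
  qed
  moreover have "open \<dots>"
    by (intro open_UN ballI op) (auto intro: less_le_trans[OF exp_gt_zero])
  ultimately have "open (rel_star j k \<beta> \<gamma> :: ('n pt \<times> 'n pt) set)" by simp
  moreover have "rel_star j k \<beta> \<gamma> \<inter> (S \<times> S) = (rel_star j k \<beta> \<gamma> :: ('n pt \<times> 'n pt) set)"
    by (auto simp: rel_star_def)
  ultimately show ?thesis using open_rho_pair by metis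
qed

lemma rel_star_iff:
  assumes "rel_ok j k \<beta> \<gamma> x" "y \<in> S"
  shows "(x, y) \<in> rel_star j k \<beta> \<gamma> \<longleftrightarrow> y \<in> cz_star (rel_box j k \<beta> \<gamma> x)"
proof -
  note cz = rel_box_cz[OF assms(1)]
  have x: "0 < snd x" "x \<in> S" using assms(1) by (auto simp: rel_ok_def S_def)
  have "(\<exists>\<xi>\<in>dyadic_cube j k. \<exists>s\<in>{exp (- \<beta>)..<exp \<gamma>}. hdist y (\<xi>, s * snd x) < rel_r \<beta> \<gamma>) \<longleftrightarrow>
    (\<exists>z\<in>rel_box j k \<beta> \<gamma> x. hdist y z < rel_r \<beta> \<gamma>)"
  proof
    assume "\<exists>\<xi>\<in>dyadic_cube j k. \<exists>s\<in>{exp (- \<beta>)..<exp \<gamma>}. hdist y (\<xi>, s * snd x) < rel_r \<beta> \<gamma>"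
    then obtain \<xi> s where "\<xi> \<in> dyadic_cube j k" "exp (- \<beta>) \<le> s" "s < exp \<gamma>" "hdist y (\<xi>, s * snd x) < rel_r \<beta> \<gamma>"
      by auto
    then show "\<exists>z\<in>rel_box j k \<beta> \<gamma> x. hdist y z < rel_r \<beta> \<gamma>"
      using x by (intro bexI[of _ "(\<xi>, s * snd x)"]) (auto simp: rel_box_eq mult.commute)
  next
    assume "\<exists>z\<in>rel_box j k \<beta> \<gamma> x. hdist y z < rel_r \<beta> \<gamma>"
    then obtain z where z: "fst z \<in> dyadic_cube j k" "snd x * exp (- \<beta>) \<le> snd z" "snd z < snd x * exp \<gamma>"
      "hdist y z < rel_r \<beta> \<gamma>" by (auto simp: rel_box_eq mem_Times_iff)
    then show "\<exists>\<xi>\<in>dyadic_cube j k. \<exists>s\<in>{exp (- \<beta>)..<exp \<gamma>}. hdist y (\<xi>, s * snd x) < rel_r \<beta> \<gamma>"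
      using x by (intro bexI[of _ "fst z"] bexI[of _ "snd z / snd x"]) (auto simp: field_simps)
  qed
  then show ?thesis using assms(2) x by (simp add: rel_star_def cz_star_eq[OF cz(1)] cz(3))
qed

lemma cz_star_mono:
  assumes "R \<in> cz_sets" "R' \<in> cz_sets" "R \<subseteq> R'" "cz_radius R \<le> cz_radius R'"
  shows "cz_star R \<subseteq> cz_star R'"
  using assms unfolding cz_star_eq[OF assms(1)] cz_star_eq[OF assms(2)] by force

text \<open>The witness for \<open>y\<close> may lie on the closed lower edge of the box, which the
  approximating boxes need not contain. Moved up a little, it keeps the strict distance bound by
  continuity and lies strictly inside, hence in almost all approximating boxes.\<close>

lemma rel_star_limit:
  fixes y :: "('n::finite) pt"
  assumes ok: "rel_ok j k \<beta> \<gamma> x" and okn: "\<And>n. rel_ok j k (b n) (c n) x"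
    and lim: "b \<longlonglongrightarrow> \<beta>" "c \<longlonglongrightarrow> \<gamma>" and y: "y \<in> cz_star (rel_box j k \<beta> \<gamma> x)"
  shows "eventually (\<lambda>n. y \<in> cz_star (rel_box j k (b n) (c n) x)) sequentially"
proof -
  note cz = rel_box_cz[OF ok]
  define t where "t = snd x"
  have t: "0 < t" using ok by (simp add: rel_ok_def t_def)
  have yS: "y \<in> S" using y cz_star_subset_S by blast
  obtain z where z: "fst z \<in> dyadic_cube j k" "t * exp (- \<beta>) \<le> snd z" "snd z < t * exp \<gamma>" "hdist y z < rel_r \<beta> \<gamma>"
    using y unfolding cz_star_eq[OF cz(1)] cz(3) by (auto simp: rel_box_eq t_def)
  define A :: "real set" where "A = {0<..<t * exp \<gamma>}"
  have zA: "snd z \<in> A" using z t by (auto simp: A_def intro: less_le_trans[OF _ z(2)])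
  have "continuous_on A (\<lambda>s. hdist y (fst z, s))"
    by (rule continuous_on_hdist) (use yS in \<open>auto simp: S_def A_def intro!: continuous_intros\<close>)
  moreover have "open A" by (simp add: A_def)
  ultimately have "open (A \<inter> (\<lambda>s. hdist y (fst z, s)) -` {..<rel_r \<beta> \<gamma>})"
    by (intro continuous_open_preimage) auto
  moreover have "snd z \<in> A \<inter> (\<lambda>s. hdist y (fst z, s)) -` {..<rel_r \<beta> \<gamma>}" using zA z(4) by simp
  ultimately obtain e where e: "0 < e" "ball (snd z) e \<subseteq> A \<inter> (\<lambda>s. hdist y (fst z, s)) -` {..<rel_r \<beta> \<gamma>}"
    by (rule openE)
  define s where "s = snd z + e / 2"
  have "s \<in> ball (snd z) e" using e(1) by (simp add: s_def dist_real_def)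
  then have s: "s < t * exp \<gamma>" "hdist y (fst z, s) < rel_r \<beta> \<gamma>" using e(2) by (auto simp: A_def)
  have s': "t * exp (- \<beta>) < s" using z(2) e(1) by (simp add: s_def)
  have l1: "(\<lambda>n. t * exp (- b n)) \<longlonglongrightarrow> t * exp (- \<beta>)" by (intro tendsto_intros lim)
  have l2: "(\<lambda>n. t * exp (c n)) \<longlonglongrightarrow> t * exp \<gamma>" by (intro tendsto_intros lim)
  have l3: "(\<lambda>n. rel_r (b n) (c n)) \<longlonglongrightarrow> rel_r \<beta> \<gamma>" unfolding rel_r_def by (intro tendsto_intros lim) simp
  show ?thesis
    using order_tendstoD(2)[OF l1 s'] order_tendstoD(1)[OF l2 s(1)] order_tendstoD(1)[OF l3 s(2)]
  proof eventually_elim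
    case (elim n)
    note czn = rel_box_cz[OF okn[of n]]
    have "(fst z, s) \<in> rel_box j k (b n) (c n) x" using elim z(1) by (simp add: rel_box_eq t_def)
    then show ?case using yS elim unfolding cz_star_eq[OF czn(1)] czn(3) by blast
  qed
qed

context cz_op begin

text \<open>Defined for every \<open>x\<close>, also where the parameters are not admissible, so
  that joint measurability of the integrand gives measurability in \<open>x\<close>.\<close>

definition rel_tr :: "('n pt \<Rightarrow> complex) \<Rightarrow> int \<Rightarrow> ('n \<Rightarrow> int) \<Rightarrow> real \<Rightarrow> real \<Rightarrow> 'n pt \<Rightarrow> complex" where
  "rel_tr f j k \<beta> \<gamma> x = (LINT y|rho. (if (x, y) \<in> rel_star j k \<beta> \<gamma> then 0 else K x y * f y))"

lemma rel_tr_eq: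
  assumes "rel_ok j k \<beta> \<gamma> x"
  shows "rel_tr f j k \<beta> \<gamma> x = tr f (rel_box j k \<beta> \<gamma> x) x"
  unfolding rel_tr_def tr_def set_lebesgue_integral_def
  by (rule Bochner_Integration.integral_cong) (auto simp: rel_star_iff[OF assms] split: split_indicator)

lemma rel_tr_measurable:
  assumes "f \<in> linf_c"
  shows "rel_tr f j k \<beta> \<gamma> \<in> borel_measurable rho"
proof -
  have [measurable]: "(\<lambda>z. K (fst z) (snd z)) \<in> borel_measurable (rho \<Otimes>\<^sub>M rho)"
    using K_meas by (simp add: case_prod_beta')
  have [measurable]: "(\<lambda>z. f (snd z)) \<in> borel_measurable (rho \<Otimes>\<^sub>M rho)"
    by (rule measurable_compose[OF measurable_snd linf_c_measurable[OF assms]])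
  have [measurable]: "rel_star j k \<beta> \<gamma> \<in> sets (rho \<Otimes>\<^sub>M rho)" by (rule rel_star_sets)
  have "(\<lambda>z. if z \<in> rel_star j k \<beta> \<gamma> then 0 else K (fst z) (snd z) * f (snd z)) \<in> borel_measurable (rho \<Otimes>\<^sub>M rho)"
    by measurable
  then have "(\<lambda>(x, y). if (x, y) \<in> rel_star j k \<beta> \<gamma> then 0 else K x y * f y) \<in> borel_measurable (rho \<Otimes>\<^sub>M rho)"
    by (simp add: case_prod_beta')
  then have "(\<lambda>x. LINT y|rho. (if (x, y) \<in> rel_star j k \<beta> \<gamma> then 0 else K x y * f y)) \<in> borel_measurable rho"
    by (rule rho.borel_measurable_lebesgue_integral)
  then show ?thesis by (simp add: rel_tr_def[abs_def])
qed

text \<open>The stars of the approximating boxes are contained in that of the limit box and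
  eventually contain each of its points. Their radii eventually exceed half the limiting radius, so
  the truncations stay away from \<open>x\<close> by a fixed distance, and dominated convergence
  applies by \<open>far_integrable\<close>.\<close>

lemma tr_rational_approx:
  assumes f: "f \<in> linf_c" and ok: "rel_ok j k \<beta> \<gamma> x"
    and b: "\<And>p q :: rat. rel_ok j k (of_rat p) (of_rat q) x \<Longrightarrow> ennreal (norm (rel_tr f j k (of_rat p) (of_rat q) x)) \<le> M"
  shows "ennreal (norm (tr f (rel_box j k \<beta> \<gamma> x) x)) \<le> M"
proof -
  have xS: "x \<in> S" using ok by (simp add: rel_ok_def S_def)
  have "\<exists>p q :: rat. of_rat p \<le> \<beta> \<and> \<beta> - 1 / Suc n < of_rat p \<and> of_rat q \<le> \<gamma> \<and> \<gamma> - 1 / Suc n < of_rat q \<and>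
    rel_ok j k (of_rat p) (of_rat q) x" for n
    by (rule rel_rational_approx[OF ok, of "1 / Suc n"]) auto
  then obtain p q :: "nat \<Rightarrow> rat" where pq: "\<And>n. of_rat (p n) \<le> \<beta>" "\<And>n. \<beta> - 1 / Suc n < of_rat (p n)"
    "\<And>n. of_rat (q n) \<le> \<gamma>" "\<And>n. \<gamma> - 1 / Suc n < of_rat (q n)" "\<And>n. rel_ok j k (of_rat (p n)) (of_rat (q n)) x"
    by metis
  define u v :: "nat \<Rightarrow> real" where "u n = of_rat (p n)" and "v n = of_rat (q n)" for n
  have z: "(\<lambda>n. 1 / real (Suc n)) \<longlonglongrightarrow> 0" using LIMSEQ_inverse_real_of_nat by (simp add: inverse_eq_divide)
  have lu: "u \<longlonglongrightarrow> \<beta>"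
  proof (rule tendsto_sandwich[where f = "\<lambda>n. \<beta> - 1 / Suc n" and h = "\<lambda>n. \<beta>"])
    show "(\<lambda>n. \<beta> - 1 / Suc n) \<longlonglongrightarrow> \<beta>" using tendsto_diff[OF tendsto_const z, of \<beta>] by simp
  qed (use pq in \<open>auto simp: u_def less_imp_le\<close>)
  have lv: "v \<longlonglongrightarrow> \<gamma>"
  proof (rule tendsto_sandwich[where f = "\<lambda>n. \<gamma> - 1 / Suc n" and h = "\<lambda>n. \<gamma>"])
    show "(\<lambda>n. \<gamma> - 1 / Suc n) \<longlonglongrightarrow> \<gamma>" using tendsto_diff[OF tendsto_const z, of \<gamma>] by simp
  qed (use pq in \<open>auto simp: v_def less_imp_le\<close>)
  have okn: "rel_ok j k (u n) (v n) x" for n using pq by (simp add: u_def v_def)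
  define R where "R = rel_box j k \<beta> \<gamma> x"
  define Rn where "Rn n = rel_box j k (u n) (v n) x" for n
  note cz = rel_box_cz[OF ok, folded R_def] and czn = rel_box_cz[OF okn, folded Rn_def]
  have r: "0 < rel_r \<beta> \<gamma>" using cz_radius_pos[OF cz(1)] cz(3) by simp
  have lr: "(\<lambda>n. rel_r (u n) (v n)) \<longlonglongrightarrow> rel_r \<beta> \<gamma>" unfolding rel_r_def by (intro tendsto_intros lu lv) simp
  have sub: "cz_star (Rn n) \<subseteq> cz_star R" for n
  proof (rule cz_star_mono[OF czn(1) cz(1)])
    have "0 < snd x" using xS by (simp add: S_def)
    moreover have "u n \<le> \<beta>" "v n \<le> \<gamma>" using pq by (auto simp: u_def v_def)
    ultimately have "snd x * exp (- \<beta>) \<le> snd x * exp (- u n)" "snd x * exp (v n) \<le> snd x * exp \<gamma>" by auto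
    then show "Rn n \<subseteq> R" by (auto simp: Rn_def R_def rel_box_eq)
    show "cz_radius (Rn n) \<le> cz_radius R"
      unfolding czn(3) cz(3) rel_r_def using pq(1,3)[of n] by (auto simp: u_def v_def)
  qed
  obtain N where N: "\<And>n. N \<le> n \<Longrightarrow> rel_r \<beta> \<gamma> / 2 < rel_r (u n) (v n)"
    using order_tendstoD(1)[OF lr, of "rel_r \<beta> \<gamma> / 2"] r by (auto simp: eventually_sequentially)
  have "(\<lambda>n. tr f (Rn n) x) \<longlonglongrightarrow> tr f R x"
  proof (rule LIMSEQ_offset[where k = N])
    note [measurable] = linf_c_measurable[OF f] K1_meas[OF xS] compl_star_sets[OF cz(1)] compl_star_sets[OF czn(1)]
    show "(\<lambda>n. tr f (Rn (n + N)) x) \<longlonglongrightarrow> tr f R x"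
      unfolding tr_def set_lebesgue_integral_def
    proof (rule integral_dominated_convergence)
      show "integrable rho (\<lambda>y. norm (indicator {y \<in> S. rel_r \<beta> \<gamma> / 2 \<le> hdist x y} y *\<^sub>R (K x y * f y)))"
        by (rule integrable_norm[OF far_integrable[OF f xS, unfolded set_integrable_def]]) (use r in simp)
      show "AE y in rho. (\<lambda>n. indicat_real (S - cz_star (Rn (n + N))) y *\<^sub>R (K x y * f y)) \<longlonglongrightarrow>
         indicat_real (S - cz_star R) y *\<^sub>R (K x y * f y)"
      proof (intro AE_I2)
        fix y :: "'n pt" assume "y \<in> space rho"
        then have yS: "y \<in> S" by simp
        have "eventually (\<lambda>n. y \<in> cz_star (Rn n) \<longleftrightarrow> y \<in> cz_star R) sequentially"
        proof (cases "y \<in> cz_star R")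
          case True
          have "eventually (\<lambda>n. y \<in> cz_star (Rn n)) sequentially"
            unfolding Rn_def by (rule rel_star_limit[OF ok okn lu lv]) (use True in \<open>simp add: R_def\<close>)
          then show ?thesis using True by simp
        next
          case False
          then show ?thesis using sub by (intro always_eventually) blast
        qed
        then have "eventually (\<lambda>n. y \<in> cz_star (Rn (n + N)) \<longleftrightarrow> y \<in> cz_star R) sequentially"
          by (rule sequentially_offset)
        then have "eventually (\<lambda>n. indicat_real (S - cz_star (Rn (n + N))) y *\<^sub>R (K x y * f y) =
          indicat_real (S - cz_star R) y *\<^sub>R (K x y * f y)) sequentially"
          by eventually_elim (auto split: split_indicator)
        then show "(\<lambda>n. indicat_real (S - cz_star (Rn (n + N))) y *\<^sub>R (K x y * f y)) \<longlonglongrightarrow>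
         indicat_real (S - cz_star R) y *\<^sub>R (K x y * f y)"
          by (rule tendsto_eventually)
      qed
      show "AE y in rho. norm (indicat_real (S - cz_star (Rn (n + N))) y *\<^sub>R (K x y * f y)) \<le>
         norm (indicator {y \<in> S. rel_r \<beta> \<gamma> / 2 \<le> hdist x y} y *\<^sub>R (K x y * f y))" for n
      proof (intro AE_I2)
        fix y :: "'n pt" assume "y \<in> space rho"
        have "rel_r \<beta> \<gamma> / 2 \<le> hdist x y" if "y \<in> S - cz_star (Rn (n + N))"
        proof -
          have "rel_r (u (n + N)) (v (n + N)) \<le> hdist x y"
            using hdist_ge_outside_star[OF czn(1)[of "n + N"] czn(2)[of "n + N"], of y] that by (simp add: czn(3))
          then show ?thesis using N[of "n + N"] by simp
        qed
        then show "norm (indicat_real (S - cz_star (Rn (n + N))) y *\<^sub>R (K x y * f y)) \<le>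
         norm (indicator {y \<in> S. rel_r \<beta> \<gamma> / 2 \<le> hdist x y} y *\<^sub>R (K x y * f y))"
          by (auto split: split_indicator)
      qed
    qed measurable
  qed
  then have L: "(\<lambda>n. ennreal (norm (tr f (Rn n) x))) \<longlonglongrightarrow> ennreal (norm (tr f R x))"
    by (intro tendsto_ennrealI tendsto_norm)
  have Mb: "ennreal (norm (tr f (Rn n) x)) \<le> M" for n
    using b[OF pq(5), of n] rel_tr_eq[OF pq(5), of f n] by (simp add: Rn_def u_def v_def)
  have "ennreal (norm (tr f R x)) \<le> M"
    by (rule LIMSEQ_le_const2[OF L]) (use Mb in blast)
  then show ?thesis by (simp add: R_def)
qed

text \<open>By the approximation, the supremum over all boxes containing \<open>x\<close> equals the
  one over the countable set of dyadic bases with rational \<beta> and \<gamma>.\<close>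

theorem max_sing_measurable:
  assumes f: "f \<in> linf_c"
  shows "max_sing K f \<in> borel_measurable rho"
proof -
  define I :: "(int \<times> ('n \<Rightarrow> int) \<times> rat \<times> rat) set" where "I = UNIV"
  define h where "h = (\<lambda>(j, k, p, q) x. if rel_ok j k (of_rat p) (of_rat q) x then ennreal (norm (rel_tr f j k (of_rat p) (of_rat q) x)) else 0)"
  have hm: "h i \<in> borel_measurable rho" for i
  proof -
    obtain j k p q where i: "i = (j, k, p, q)" by (cases i)
    note [measurable] = rel_tr_measurable[OF f, of j k "of_rat p" "of_rat q"]
    have [measurable]: "Measurable.pred rho (rel_ok j k (of_rat p) (of_rat q))"
      using rel_ok_measurable[of j k "of_rat p" "of_rat q"] by (simp add: pred_def)
    show ?thesis unfolding i h_def by simp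
  qed
  have "max_sing K f x = (SUP i\<in>I. h i x)" for x
  proof (rule antisym)
    show "max_sing K f x \<le> (SUP i\<in>I. h i x)"
      unfolding max_sing_eq
    proof (rule SUP_least)
      fix R assume "R \<in> {R \<in> cz_sets. x \<in> R}"
      then have R: "R \<in> cz_sets" "x \<in> R" by auto
      obtain j k \<beta> \<gamma> where r: "R = rel_box j k \<beta> \<gamma> x" "rel_ok j k \<beta> \<gamma> x" by (rule rel_ex[OF R])
      show "ennreal (norm (tr f R x)) \<le> (SUP i\<in>I. h i x)"
        unfolding r(1)
      proof (rule tr_rational_approx[OF f r(2)])
        fix p q :: rat assume "rel_ok j k (of_rat p) (of_rat q) x"
        then have "ennreal (norm (rel_tr f j k (of_rat p) (of_rat q) x)) = h (j, k, p, q) x" by (simp add: h_def)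
        also have "\<dots> \<le> (SUP i\<in>I. h i x)" by (rule SUP_upper) (simp add: I_def)
        finally show "ennreal (norm (rel_tr f j k (of_rat p) (of_rat q) x)) \<le> (SUP i\<in>I. h i x)" .
      qed
    qed
    show "(SUP i\<in>I. h i x) \<le> max_sing K f x"
    proof (rule SUP_least)
      fix i :: "int \<times> ('n \<Rightarrow> int) \<times> rat \<times> rat"
      obtain j k p q where i: "i = (j, k, p, q)" by (cases i)
      show "h i x \<le> max_sing K f x"
      proof (cases "rel_ok j k (of_rat p) (of_rat q) x")
        case True
        then show ?thesis
          unfolding max_sing_eq i h_def using rel_box_cz[OF True]
          by (auto simp: rel_tr_eq[OF True] intro!: SUP_upper)
      qed (simp add: i h_def)
    qed
  qed
  moreover have "(\<lambda>x. SUP i\<in>I. h i x) \<in> borel_measurable rho"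
    by (rule borel_measurable_SUP) (auto simp: I_def hm intro: countableI_type)
  ultimately show ?thesis by (simp cong: measurable_cong)
qed

end

section \<open>Exponential decay for bounded functions\<close>

lemma ennreal_scale: "0 \<le> a \<Longrightarrow> ennreal a * (ennreal b * X) = ennreal (a * b) * X"
  by (simp add: ennreal_mult' mult.assoc)

context cz_op begin

lemma max_sing_cong:
  assumes "\<And>y. y \<in> S \<Longrightarrow> f y = g y"
  shows "max_sing K f x = max_sing K g x"
proof -
  have "tr f R x = tr g R x" for R
    unfolding tr_def set_lebesgue_integral_def
    by (rule Bochner_Integration.integral_cong) (use assms in auto)
  then show ?thesis by (simp add: max_sing_eq)
qed

lemma max_sing_uminus: "max_sing K (\<lambda>y. (- 1) * f y) x = max_sing K f x"
proof -
  have "norm (tr (\<lambda>y. (- 1) * f y) R x) = norm (tr f R x)" for R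
    by (simp add: tr_def set_lebesgue_integral_def)
  then show ?thesis by (simp add: max_sing_eq)
qed

definition far_c :: real where
  "far_c = H + annuli (1 + cz_dc TYPE('n))"

lemma far_c_pos: "0 < far_c"
  using pos by (simp add: far_c_def annuli_def add_pos_nonneg)

text \<open>Two truncations around the same point at comparable scales differ by an integral over an
  annulus, which the size condition controls.\<close>

lemma max_sing_far:
  assumes f: "f \<in> linf_c" "AE x in rho. norm (f x) \<le> a" and a: "0 \<le> a"
    and R0: "R0 \<in> cz_sets" "x \<in> R0" "x' \<in> R0"
  shows "max_sing K (res (S - cz_star R0) f) x \<le> max_sing K (res (S - cz_star R0) f) x' + ennreal (a * far_c)"
  unfolding max_sing_eq[of _ x]
proof (rule SUP_least)
  define f2 where "f2 = res (S - cz_star R0) f"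
  fix R assume "R \<in> {R \<in> cz_sets. x \<in> R}"
  then have R: "R \<in> cz_sets" "x \<in> R" by auto
  define c where "c = cz_dc TYPE('n)"
  have c: "1 \<le> c" by (simp add: c_def cz_dc_ge_1)
  define r where "r = cz_radius R"
  have r: "0 < r" unfolding r_def by (rule cz_radius_pos[OF R(1)])
  have xS: "x \<in> S" using R cz_sets_subset_S by blast
  have f2l: "f2 \<in> linf_c" unfolding f2_def by (intro res_linf_c compl_star_sets R0 f)
  have f2b: "AE x in rho. norm (f2 x) \<le> a"
    using f(2) by eventually_elim (use a in \<open>auto simp: f2_def norm_res split: split_indicator\<close>)
  have near: "hdist x y \<le> (1 + c) * cz_radius Q" if Q: "Q \<in> cz_sets" "x \<in> Q" "y \<in> cz_star Q" for Q y
  proof -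
    obtain z where z: "z \<in> Q" "hdist y z < cz_radius Q" "y \<in> S"
      using Q(3) unfolding cz_star_eq[OF Q(1)] by blast
    have zS: "z \<in> S" using z Q cz_sets_subset_S by blast
    have "hdist x y \<le> hdist x z + hdist z y" by (rule hdist_triangle[OF xS zS z(3)])
    also have "\<dots> \<le> c * cz_radius Q + cz_radius Q"
      using cz_diam[OF Q(1,2) z(1)] z(2) by (simp add: c_def hdist_commute[of z])
    finally show ?thesis by (simp add: algebra_simps)
  qed
  \<comment> \<open>\<open>R'\<close> contains both points and has at least the radius of
    \<open>R\<close>: it is \<open>R0\<close> if that is large enough, and otherwise an enlargement
    of \<open>R0\<close> to the radius \<open>r\<close>.\<close>
  obtain R' where R': "R' \<in> cz_sets" "x \<in> R'" "x' \<in> R'" "r \<le> cz_radius R'"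
    and R'': "R' = R0 \<or> cz_radius R' = r"
  proof (cases "r \<le> cz_radius R0")
    case True
    then show thesis using that[of R0] R0 by blast
  next
    case False
    then obtain P where "P \<in> cz_sets" "R0 \<subseteq> P" "cz_radius P = r"
      by (metis cz_enlarge[OF R0(1)] linear)
    then show thesis using that[of P] R0 by blast
  qed
  define An where "An = {y \<in> S. r \<le> hdist x y \<and> hdist x y \<le> (1 + c) * r}"
  \<comment> \<open>\<open>f2\<close> vanishes on \<open>cz_star R0\<close>, so only points off that
    set matter. A point in just one of the two stars has distance at least \<open>r\<close> from
    \<open>x\<close> because of the star that it avoids, and at most (1 + c) r because of the other
    one, which belongs to a box of radius \<open>r\<close>: in the case R' = R0 it cannot be
    \<open>cz_star R'\<close>.\<close>
  have An: "y \<in> An" if y: "y \<in> S" "y \<notin> cz_star R0" and d: "(y \<in> cz_star R) \<noteq> (y \<in> cz_star R')" for y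
  proof (cases "y \<in> cz_star R")
    case True
    then have "y \<notin> cz_star R'" using d by blast
    then have "r \<le> hdist x y" using hdist_ge_outside_star[OF R'(1,2) y(1)] R'(4) by linarith
    then show ?thesis using near[OF R True] y(1) by (simp add: An_def r_def)
  next
    case False
    then have y': "y \<in> cz_star R'" using d by blast
    then have "cz_radius R' = r" using R'' y(2) by blast
    then show ?thesis
      using near[OF R'(1,2) y'] hdist_ge_outside_star[OF R y(1) False] y(1) by (simp add: An_def r_def)
  qed
  have "norm (tr f2 R x - tr f2 R' x) \<le> a * annuli (1 + c)"
  proof -
    note [measurable] = K1_meas[OF xS] linf_c_measurable[OF f2l] hdist_measurable[OF xS]
    note i = tr_integrable[OF f2l R, unfolded set_integrable_def] tr_integrable[OF f2l R'(1,2), unfolded set_integrable_def]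
    have Anm [measurable]: "An \<in> sets rho"
    proof -
      have "{y \<in> space rho. r \<le> hdist x y \<and> hdist x y \<le> (1 + c) * r} \<in> sets rho" by measurable
      then show ?thesis by (simp add: An_def)
    qed
    have "ennreal (norm (tr f2 R x - tr f2 R' x)) = ennreal (norm (LINT y|rho. indicator (S - cz_star R) y *\<^sub>R (K x y * f2 y) -
        indicator (S - cz_star R') y *\<^sub>R (K x y * f2 y)))"
      unfolding tr_def set_lebesgue_integral_def by (subst Bochner_Integration.integral_diff[OF i]) simp
    also have "\<dots> \<le> (\<integral>\<^sup>+y. ennreal (norm (indicator (S - cz_star R) y *\<^sub>R (K x y * f2 y) -
        indicator (S - cz_star R') y *\<^sub>R (K x y * f2 y))) \<partial>rho)"
      by (rule integral_norm_bound_ennreal) (use i in auto)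
    also have "\<dots> \<le> (\<integral>\<^sup>+y. ennreal a * (ennreal (norm (K x y)) * indicator An y) \<partial>rho)"
    proof (rule nn_integral_mono_AE)
      show "AE y in rho. ennreal (norm (indicator (S - cz_star R) y *\<^sub>R (K x y * f2 y) -
        indicator (S - cz_star R') y *\<^sub>R (K x y * f2 y))) \<le> ennreal a * (ennreal (norm (K x y)) * indicator An y)"
        using f2b AE_space
      proof eventually_elim
        fix y assume y: "norm (f2 y) \<le> a" "y \<in> space rho"
        show "ennreal (norm (indicator (S - cz_star R) y *\<^sub>R (K x y * f2 y) -
          indicator (S - cz_star R') y *\<^sub>R (K x y * f2 y))) \<le> ennreal a * (ennreal (norm (K x y)) * indicator An y)"
        proof (cases "f2 y \<noteq> 0 \<and> (y \<in> cz_star R) \<noteq> (y \<in> cz_star R')")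
          case True
          then have "y \<notin> cz_star R0" by (auto simp: f2_def res_def split: split_indicator_asm)
          then have yA: "y \<in> An" using An True y(2) by simp
          have "norm (indicator (S - cz_star R) y *\<^sub>R (K x y * f2 y) - indicator (S - cz_star R') y *\<^sub>R (K x y * f2 y)) \<le> norm (K x y) * norm (f2 y)"
            by (auto simp: norm_mult split: split_indicator)
          also have "\<dots> \<le> a * norm (K x y)" using y(1) by (simp add: mult.commute mult_right_mono)
          finally show ?thesis using yA a by (simp add: ennreal_mult[symmetric] ennreal_leI)
        next
          case False
          then show ?thesis by (auto split: split_indicator)
        qed
      qed
    qed
    also have "\<dots> = ennreal a * (\<integral>\<^sup>+y\<in>An. ennreal (norm (K x y)) \<partial>rho)"
      by (rule nn_integral_cmult) measurable
    also have "\<dots> \<le> ennreal a * ennreal (annuli (1 + c))"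
      unfolding An_def by (intro mult_left_mono size_annulus xS r) (use c in auto)
    finally have "ennreal (norm (tr f2 R x - tr f2 R' x)) \<le> ennreal (a * annuli (1 + c))"
      using a by (simp add: ennreal_mult')
    moreover have "0 \<le> a * annuli (1 + c)" using a pos by (simp add: annuli_def)
    ultimately show ?thesis by simp
  qed
  moreover have "norm (tr f2 R' x - tr f2 R' x') \<le> a * H" by (rule tr_diff[OF f2l f2b R'(1-3) a])
  moreover have "norm (tr f2 R x) \<le> norm (tr f2 R' x') + norm (tr f2 R x - tr f2 R' x) + norm (tr f2 R' x - tr f2 R' x')"
  proof -
    have "tr f2 R x = tr f2 R' x' + (tr f2 R x - tr f2 R' x) + (tr f2 R' x - tr f2 R' x')" by simp
    then show ?thesis by (metis norm_triangle_ineq norm_triangle_le add_right_mono order_trans)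
  qed
  ultimately have "norm (tr f2 R x) \<le> norm (tr f2 R' x') + a * far_c"
    by (simp add: far_c_def c_def algebra_simps)
  then have "ennreal (norm (tr f2 R x)) \<le> ennreal (norm (tr f2 R' x') + a * far_c)" by (rule ennreal_leI)
  also have "\<dots> = ennreal (norm (tr f2 R' x')) + ennreal (a * far_c)"
    using a far_c_pos by (simp add: ennreal_plus)
  also have "\<dots> \<le> max_sing K f2 x' + ennreal (a * far_c)"
    unfolding max_sing_eq by (intro add_right_mono SUP_upper) (use R' in auto)
  finally show "ennreal (norm (tr f2 R x)) \<le> max_sing K f2 x' + ennreal (a * far_c)" .
qed

lemma max_sing_near_far:
  assumes f: "f \<in> linf_c" and R0: "R0 \<in> cz_sets"
  shows "max_sing K f x \<le> max_sing K (res (cz_star R0) f) x + max_sing K (res (S - cz_star R0) f) x"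
    "max_sing K (res (S - cz_star R0) f) x \<le> max_sing K f x + max_sing K (res (cz_star R0) f) x"
proof -
  have l: "res (cz_star R0) f \<in> linf_c" "res (S - cz_star R0) f \<in> linf_c"
    by (intro res_linf_c cz_star_sets_rho compl_star_sets R0 f)+
  have "max_sing K f x = max_sing K (\<lambda>y. res (cz_star R0) f y + res (S - cz_star R0) f y) x"
    by (rule max_sing_cong) (auto simp: res_def split: split_indicator)
  also have "\<dots> \<le> max_sing K (res (cz_star R0) f) x + max_sing K (res (S - cz_star R0) f) x"
    by (rule max_sing_add[OF l])
  finally show "max_sing K f x \<le> max_sing K (res (cz_star R0) f) x + max_sing K (res (S - cz_star R0) f) x" .
  have "max_sing K (res (S - cz_star R0) f) x = max_sing K (\<lambda>y. f y + (- 1) * res (cz_star R0) f y) x"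
    by (rule max_sing_cong) (auto simp: res_def split: split_indicator)
  also have "\<dots> \<le> max_sing K f x + max_sing K (\<lambda>y. (- 1) * res (cz_star R0) f y) x"
    by (rule max_sing_add[OF f cmult_linf_c[OF l(1)]])
  finally show "max_sing K (res (S - cz_star R0) f) x \<le> max_sing K f x + max_sing K (res (cz_star R0) f) x"
    by (simp only: max_sing_uminus)
qed

section \<open>Halving of the level sets\<close>

definition level :: "('n pt \<Rightarrow> complex) \<Rightarrow> real \<Rightarrow> 'n pt set" where
  "level f l = {x \<in> S. ennreal l < max_sing K f x}"

lemma level_sets: "f \<in> linf_c \<Longrightarrow> level f l \<in> sets rho"
proof -
  assume "f \<in> linf_c"
  note [measurable] = max_sing_measurable[OF this]
  have "{x \<in> space rho. ennreal l < max_sing K f x} \<in> sets rho" by measurable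
  then show ?thesis by (simp add: level_def)
qed

lemma level_antimono: "l \<le> l' \<Longrightarrow> level f l' \<subseteq> level f l"
  by (auto simp: level_def intro: order_le_less_trans[OF ennreal_leI])

lemma level_weak11:
  assumes "f \<in> linf_c" "0 < l"
  shows "emeasure rho (level f l) \<le> ennreal (wk_c / l) * (\<integral>\<^sup>+x. ennreal (norm (f x)) \<partial>rho)"
proof -
  obtain W where "W \<in> sets rho" "{x \<in> S. ennreal l < max_sing K f x} \<subseteq> W"
    "emeasure rho W \<le> ennreal (wk_c / l) * (\<integral>\<^sup>+x. ennreal (norm (f x)) \<partial>rho)"
    by (rule weak11[OF assms])
  then show ?thesis unfolding level_def[symmetric] using emeasure_mono order_trans by metis
qed

lemma res_star_integral:
  fixes f :: "'n pt \<Rightarrow> complex"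
  assumes "AE x in rho. norm (f x) \<le> 1" "P \<in> cz_sets"
  shows "(\<integral>\<^sup>+x. ennreal (norm (res (cz_star P) f x)) \<partial>rho) \<le> ennreal (cz_cs TYPE('n)) * emeasure rho P"
proof -
  have "(\<integral>\<^sup>+x. ennreal (norm (res (cz_star P) f x)) \<partial>rho) \<le> (\<integral>\<^sup>+x. indicator (cz_star P) x \<partial>rho)"
  proof (rule nn_integral_mono_AE)
    show "AE x in rho. ennreal (norm (res (cz_star P) f x)) \<le> indicator (cz_star P) x"
      using assms(1) by eventually_elim (auto simp: norm_res split: split_indicator)
  qed
  also have "\<dots> = emeasure rho (cz_star P)" using cz_star_sets_rho[OF assms(2)] by simp
  also have "\<dots> \<le> ennreal (cz_cs TYPE('n)) * emeasure rho P" by (rule emeasure_cz_star[OF assms(2)])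
  finally show ?thesis .
qed

text \<open>For \<open>f\<close> bounded by 1 and restricted to \<open>cz_star P\<close>, the weak
  type bound at height \<open>jn_t\<close> leaves measure at most rho(P) / (4 wk_n). In
  \<open>jn_b\<close> this height occurs twice, for the near parts at the two points that are
  compared, and \<open>far_c\<close> accounts for the far part.\<close>

definition jn_t :: real where "jn_t = 4 * wk_n * wk_c * cz_cs TYPE('n)"
definition jn_b :: real where "jn_b = 2 * jn_t + far_c"

lemma jn_pos: "0 < jn_t" "0 < jn_b"
  using wk_pos cz_cs_ge_1[where 'n = 'n] far_c_pos by (auto simp: jn_t_def jn_b_def intro!: add_pos_pos)

text \<open>The two exceptional sets take at most three quarters of \<open>P\<close>, so some
  \<open>x'\<close> in \<open>P\<close> has maximal function at most \<open>l\<close> and a small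
  near part. Comparison of the far parts at \<open>x\<close> and \<open>x'\<close> shows that in
  \<open>Q\<close> the height l + jn_b is exceeded only where the near part is large.\<close>

lemma jn_local:
  assumes f: "f \<in> linf_c" "AE x in rho. norm (f x) \<le> 1" and l: "0 < l"
    and P: "P \<in> cz_sets" "Q \<subseteq> P" "Q \<in> sets rho" "emeasure rho P \<le> ennreal wk_n * emeasure rho Q"
      "emeasure rho (P \<inter> level f l) \<le> ennreal (1 / 2) * emeasure rho P"
  shows "emeasure rho (Q \<inter> level f (l + jn_b)) \<le> ennreal (1 / 4) * emeasure rho Q"
proof -
  define f1 where "f1 = res (cz_star P) f"
  define f2 where "f2 = res (S - cz_star P) f"
  have f1: "f1 \<in> linf_c" unfolding f1_def by (intro res_linf_c cz_star_sets_rho P f)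
  obtain v where v: "emeasure rho P = ennreal v" "0 \<le> v"
    using emeasure_cz_finite[OF P(1)] by (cases "emeasure rho P") auto
  have vp: "0 < v" using emeasure_cz_pos[OF P(1)] v by simp
  have Cs: "1 \<le> cz_cs TYPE('n)" by (rule cz_cs_ge_1)
  have m: "level f1 jn_t \<in> sets rho" "level f l \<in> sets rho" "P \<in> sets rho"
    using level_sets f1 f cz_sets_rho P by auto
  have W: "emeasure rho (level f1 jn_t) \<le> ennreal (1 / (4 * wk_n)) * emeasure rho P"
  proof -
    have "emeasure rho (level f1 jn_t) \<le> ennreal (wk_c / jn_t) * (\<integral>\<^sup>+x. ennreal (norm (f1 x)) \<partial>rho)"
      by (rule level_weak11[OF f1 jn_pos(1)])
    also have "\<dots> \<le> ennreal (wk_c / jn_t) * (ennreal (cz_cs TYPE('n)) * emeasure rho P)"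
      unfolding f1_def by (intro mult_left_mono res_star_integral f P) simp
    also have "\<dots> = ennreal (wk_c / jn_t * cz_cs TYPE('n)) * emeasure rho P"
      by (rule ennreal_scale) (use wk_pos jn_pos in simp)
    also have "wk_c / jn_t * cz_cs TYPE('n) = 1 / (4 * wk_n)"
      using wk_pos Cs by (simp add: jn_t_def)
    finally show ?thesis .
  qed
  have "\<exists>x'. x' \<in> P \<and> x' \<notin> level f l \<and> x' \<notin> level f1 jn_t"
  proof (rule ccontr)
    assume "\<not> ?thesis"
    then have "P \<subseteq> (P \<inter> level f l) \<union> level f1 jn_t" by blast
    then have "emeasure rho P \<le> emeasure rho ((P \<inter> level f l) \<union> level f1 jn_t)"
      using m by (intro emeasure_mono) auto
    also have "\<dots> \<le> emeasure rho (P \<inter> level f l) + emeasure rho (level f1 jn_t)"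
      using m by (intro emeasure_subadditive) auto
    also have "\<dots> \<le> ennreal (1 / 2) * ennreal v + ennreal (1 / (4 * wk_n)) * ennreal v"
      using P(5) W by (intro add_mono) (simp_all add: v)
    also have "\<dots> \<le> ennreal (1 / 2) * ennreal v + ennreal (1 / 4) * ennreal v"
      using wk_pos(1) by (intro add_left_mono mult_right_mono ennreal_leI) (auto simp: field_simps)
    also have "\<dots> = ennreal (1 / 2 * v + 1 / 4 * v)"
    proof -
      have "ennreal (1 / 2 * v) = ennreal (1 / 2) * ennreal v" "ennreal (1 / 4 * v) = ennreal (1 / 4) * ennreal v"
        by (rule ennreal_mult'; simp)+
      moreover have "ennreal (1 / 2 * v + 1 / 4 * v) = ennreal (1 / 2 * v) + ennreal (1 / 4 * v)"
        by (rule ennreal_plus) (use v(2) in auto)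
      ultimately show ?thesis by (simp only:)
    qed
    finally have "v \<le> 1 / 2 * v + 1 / 4 * v" using v by (subst (asm) v(1)) simp
    then show False using vp by simp
  qed
  then obtain x' where x': "x' \<in> P" "x' \<notin> level f l" "x' \<notin> level f1 jn_t" by blast
  have x'S: "x' \<in> S" using x' P cz_sets_subset_S by blast
  have 1: "max_sing K f x' \<le> ennreal l" "max_sing K f1 x' \<le> ennreal jn_t"
    using x' x'S by (auto simp: level_def not_less)
  have "Q \<inter> level f (l + jn_b) \<subseteq> level f1 jn_t"
  proof (rule subsetI, rule ccontr)
    fix x assume x: "x \<in> Q \<inter> level f (l + jn_b)" "x \<notin> level f1 jn_t"
    have xP: "x \<in> P" "x \<in> S" using x P cz_sets_subset_S by blast+
    have "max_sing K f x \<le> max_sing K f1 x + max_sing K f2 x"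
      unfolding f1_def f2_def by (rule max_sing_near_far[OF f(1) P(1)])
    also have "max_sing K f2 x \<le> max_sing K f2 x' + ennreal (1 * far_c)"
      unfolding f2_def by (rule max_sing_far[OF f _ P(1) xP(1) x'(1)]) simp
    also have "max_sing K f2 x' \<le> max_sing K f x' + max_sing K f1 x'"
      unfolding f1_def f2_def by (rule max_sing_near_far[OF f(1) P(1)])
    also have "\<dots> \<le> ennreal l + ennreal jn_t" by (intro add_mono 1)
    finally have "max_sing K f x \<le> max_sing K f1 x + (ennreal l + ennreal jn_t + ennreal (1 * far_c))"
      by (simp add: add_left_mono add_right_mono)
    also have "max_sing K f1 x \<le> ennreal jn_t" using x xP by (auto simp: level_def not_less)
    finally have "max_sing K f x \<le> ennreal jn_t + (ennreal l + ennreal jn_t + ennreal (1 * far_c))"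
      by (simp add: add_right_mono)
    also have "\<dots> = ennreal (l + jn_b)"
      using l jn_pos(1) far_c_pos by (simp add: jn_b_def ennreal_plus[symmetric] del: ennreal_plus)
    finally show False using x(1) by (auto simp: level_def not_less[symmetric])
  qed
  then have "emeasure rho (Q \<inter> level f (l + jn_b)) \<le> emeasure rho (level f1 jn_t)"
    by (intro emeasure_mono m)
  also have "\<dots> \<le> ennreal (1 / (4 * wk_n)) * (ennreal wk_n * emeasure rho Q)"
    using W mult_left_mono[OF P(4)] by (rule order_trans) simp
  also have "\<dots> = ennreal (1 / 4) * emeasure rho Q"
    using wk_pos(1) by (subst ennreal_scale) auto
  finally show ?thesis .
qed

text \<open>The indicator of the level set \<open>E\<close> is decomposed at height 1/2. At least
  half of each \<open>A n\<close> lies in \<open>E\<close>, but at most half of a comparable box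
  \<open>P\<close>. So \<open>jn_local\<close> leaves at most a quarter of \<open>A n\<close>, which
  is at most half of \<open>A n \<inter> E\<close>.\<close>

lemma jn_step:
  assumes f: "f \<in> linf_c" "AE x in rho. norm (f x) \<le> 1" and l: "0 < l"
  shows "emeasure rho (level f (l + jn_b)) \<le> ennreal (1 / 2) * emeasure rho (level f l)"
proof -
  define E where "E = level f l"
  define E' where "E' = level f (l + jn_b)"
  have Em [measurable]: "E \<in> sets rho" "E' \<in> sets rho" unfolding E_def E'_def by (rule level_sets[OF f(1)])+
  have sub: "E' \<subseteq> E" unfolding E_def E'_def using jn_pos by (intro level_antimono) simp
  have "emeasure rho E \<le> ennreal (wk_c / l) * (\<integral>\<^sup>+x. ennreal (norm (f x)) \<partial>rho)"
    unfolding E_def by (rule level_weak11[OF f(1) l])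
  also have "\<dots> < \<infinity>" using linf_c_nn_integral_norm(1)[OF f(1)] by (simp add: ennreal_mult_less_top)
  finally have fin: "(\<integral>\<^sup>+x. indicator E x \<partial>rho) < \<infinity>" by simp
  have mE: "(\<lambda>x. indicator E x :: ennreal) \<in> borel_measurable rho" by measurable
  have half: "0 < (1 / 2 :: real)" by simp
  obtain A :: "nat \<Rightarrow> 'n pt set" where A: "\<And>n. A n \<in> cz_sets \<or> A n = {}" "disjoint_family A"
    "\<And>n. ennreal (1 / 2) * emeasure rho (A n) \<le> (\<integral>\<^sup>+x\<in>A n. indicator E x \<partial>rho)"
    "\<And>n. A n \<in> cz_sets \<Longrightarrow> \<exists>P\<in>cz_sets. A n \<subseteq> P \<and> emeasure rho P \<le> 2 ^ CARD('n) * emeasure rho (A n) \<and>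
        (\<integral>\<^sup>+x\<in>P. indicator E x \<partial>rho) \<le> ennreal (1 / 2) * emeasure rho P"
    "AE x in rho. x \<notin> (\<Union>n. A n) \<longrightarrow> indicator E x \<le> ennreal (1 / 2)"
    by (rule cz_decomposition_seq[OF mE fin half, of thesis]) (rule that)
  have Am [measurable]: "A n \<in> sets rho" for n using A(1)[of n] cz_sets_rho by auto
  have ind: "(\<integral>\<^sup>+x\<in>X. indicator E x \<partial>rho) = emeasure rho (X \<inter> E)" if "X \<in> sets rho" for X
  proof -
    have "(\<integral>\<^sup>+x\<in>X. indicator E x \<partial>rho) = (\<integral>\<^sup>+x. indicator (X \<inter> E) x \<partial>rho)"
      by (intro nn_integral_cong) (auto split: split_indicator)
    then show ?thesis using that by simp
  qed
  have piece: "emeasure rho (A n \<inter> E') \<le> ennreal (1 / 2) * emeasure rho (A n \<inter> E)" for n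
  proof (cases "A n = {}")
    case False
    then have cz: "A n \<in> cz_sets" using A(1)[of n] by blast
    obtain P where P: "P \<in> cz_sets" "A n \<subseteq> P" "emeasure rho P \<le> 2 ^ CARD('n) * emeasure rho (A n)"
      "(\<integral>\<^sup>+x\<in>P. indicator E x \<partial>rho) \<le> ennreal (1 / 2) * emeasure rho P" using A(4)[OF cz] by blast
    have "emeasure rho (A n \<inter> E') \<le> ennreal (1 / 4) * emeasure rho (A n)"
      unfolding E'_def
    proof (rule jn_local[OF f l P(1,2) Am])
      show "emeasure rho P \<le> ennreal wk_n * emeasure rho (A n)"
        using P(3) by (simp add: wk_n_def ennreal_power[symmetric])
      show "emeasure rho (P \<inter> level f l) \<le> ennreal (1 / 2) * emeasure rho P"
        using P(4) ind[OF cz_sets_rho[OF P(1)]] by (simp add: E_def)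
    qed
    also have "\<dots> = ennreal (1 / 2) * (ennreal (1 / 2) * emeasure rho (A n))"
      by (subst ennreal_scale) auto
    also have "\<dots> \<le> ennreal (1 / 2) * emeasure rho (A n \<inter> E)"
      using A(3)[of n] ind[OF Am] by (intro mult_left_mono) auto
    finally show ?thesis .
  qed simp
  have "AE x in rho. indicator E' x \<le> (indicator (\<Union>n. A n \<inter> E') x :: ennreal)"
    using A(5)
  proof eventually_elim
    fix x assume x: "x \<notin> (\<Union>n. A n) \<longrightarrow> indicator E x \<le> ennreal (1 / 2)"
    \<comment> \<open>An indicator value that is at most 1/2 is 0, so almost all of \<open>E\<close>
      is covered by the sets \<open>A n\<close>.\<close>
    have "ennreal (1 / 2) < ennreal 1" by (rule ennreal_lessI) auto
    then have "\<not> (1::ennreal) \<le> ennreal (1 / 2)" unfolding ennreal_1 by (simp only: not_le)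
    then have "x \<in> (\<Union>n. A n)" if "x \<in> E'" using x that sub by auto
    then show "indicator E' x \<le> (indicator (\<Union>n. A n \<inter> E') x :: ennreal)" by (auto split: split_indicator)
  qed
  then have "emeasure rho E' \<le> emeasure rho (\<Union>n. A n \<inter> E')"
    using nn_integral_mono_AE[of "indicator E'" "indicator (\<Union>n. A n \<inter> E')" rho] by simp
  also have "\<dots> \<le> (\<Sum>n. emeasure rho (A n \<inter> E'))"
    by (rule emeasure_subadditive_countably) auto
  also have "\<dots> \<le> (\<Sum>n. ennreal (1 / 2) * emeasure rho (A n \<inter> E))"
    by (intro suminf_le summableI piece)
  also have "\<dots> = ennreal (1 / 2) * (\<Sum>n. emeasure rho (A n \<inter> E))" by (rule ennreal_suminf_cmult)
  also have "(\<Sum>n. emeasure rho (A n \<inter> E)) = emeasure rho (\<Union>n. A n \<inter> E)"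
    by (rule suminf_emeasure) (use A(2) in \<open>auto simp: disjoint_family_on_def\<close>)
  also have "\<dots> \<le> emeasure rho E" by (rule emeasure_mono) auto
  finally show ?thesis unfolding E_def E'_def by (simp add: mult_left_mono)
qed

lemma jn_iterate:
  assumes f: "f \<in> linf_c" "AE x in rho. norm (f x) \<le> 1"
  shows "emeasure rho (level f (1 + real n * jn_b)) \<le> ennreal (wk_c / 2 ^ n) * (\<integral>\<^sup>+x. ennreal (norm (f x)) \<partial>rho)"
proof (induction n)
  case 0
  then show ?case using level_weak11[OF f(1), of 1] by simp
next
  case (Suc n)
  have "emeasure rho (level f (1 + real (Suc n) * jn_b)) = emeasure rho (level f (1 + real n * jn_b + jn_b))"
    by (simp add: algebra_simps)
  also have "\<dots> \<le> ennreal (1 / 2) * emeasure rho (level f (1 + real n * jn_b))"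
    by (rule jn_step[OF f]) (use jn_pos in \<open>simp add: add_pos_nonneg\<close>)
  also have "\<dots> \<le> ennreal (1 / 2) * (ennreal (wk_c / 2 ^ n) * (\<integral>\<^sup>+x. ennreal (norm (f x)) \<partial>rho))"
    by (intro mult_left_mono Suc) simp
  also have "\<dots> = ennreal (wk_c / 2 ^ Suc n) * (\<integral>\<^sup>+x. ennreal (norm (f x)) \<partial>rho)"
    by (subst ennreal_scale) auto
  finally show ?case .
qed

text \<open>The iterated halving is exponential decay in l / a. It is recorded as decay of an
  arbitrary fixed order \<open>m\<close>, which suffices to make the later sums geometric. Bounds
  other than 1 are reached by homogeneity.\<close>

lemma jn_decay:
  obtains C where "0 \<le> C" "\<And>f a l. f \<in> linf_c \<Longrightarrow> 0 < a \<Longrightarrow> (AE x in rho. norm (f x) \<le> a) \<Longrightarrow> a \<le> l \<Longrightarrow>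
    emeasure rho (level f l) \<le> ennreal (C * (a / l) ^ m / a) * (\<integral>\<^sup>+x. ennreal (norm (f x)) \<partial>rho)"
proof -
  \<comment> \<open>With this rate, 2^n is of the order of exp (s t) when n is about t /
    jn_b.\<close>
  define s where "s = ln 2 / jn_b"
  have s: "0 < s" using jn_pos by (simp add: s_def)
  define C where "C = wk_c * (2 * (fact m * exp s / s ^ m))"
  have C0: "0 \<le> C" using wk_pos s by (simp add: C_def)
  have bound: "wk_c / 2 ^ n \<le> C / t ^ m" if t: "1 \<le> t" and n: "n = nat \<lfloor>(t - 1) / jn_b\<rfloor>" for t n
  proof -
    have "0 \<le> (t - 1) / jn_b" using t jn_pos by simp
    then have "(t - 1) / jn_b < real n + 1" unfolding n by linarith
    then have "(t - 1) / jn_b * ln 2 < (real n + 1) * ln 2" by (rule mult_strict_right_mono) simp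
    then have "(t - 1) * s < (real n + 1) * ln 2" by (simp add: s_def)
    then have "exp ((t - 1) * s) < exp ((real n + 1) * ln 2)" by simp
    also have "\<dots> = 2 ^ n * 2"
      by (simp add: exp_add distrib_right exp_of_nat_mult)
    finally have e: "exp ((t - 1) * s) < 2 ^ n * 2" .
    \<comment> \<open>One term of the exponential series supplies the power of order
      \<open>m\<close>.\<close>
    have "(t * s) ^ m / fact m \<le> exp (t * s)"
    proof -
      have "0 \<le> t * s" using t s by simp
      have "(t * s) ^ m / fact m = (\<Sum>k\<in>{m}. (t * s) ^ k /\<^sub>R fact k)" by (simp add: divide_inverse mult.commute)
      also have "\<dots> \<le> (\<Sum>k. (t * s) ^ k /\<^sub>R fact k)"
        by (rule sum_le_suminf[OF summable_exp_generic]) (use \<open>0 \<le> t * s\<close> in auto)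
      finally show ?thesis by (simp add: exp_def)
    qed
    also have "exp (t * s) = exp ((t - 1) * s) * exp s" by (simp add: exp_add[symmetric] algebra_simps)
    also have "\<dots> \<le> 2 ^ n * 2 * exp s" using e by (intro mult_right_mono) auto
    finally have "t ^ m * s ^ m \<le> 2 ^ n * (2 * (fact m * exp s))"
      by (simp add: field_simps power_mult_distrib)
    then have "t ^ m \<le> 2 ^ n * (2 * (fact m * exp s / s ^ m))" using s by (simp add: field_simps)
    then have "wk_c * t ^ m \<le> wk_c * (2 ^ n * (2 * (fact m * exp s / s ^ m)))"
      using wk_pos by (intro mult_left_mono) auto
    also have "\<dots> = C * 2 ^ n" by (simp add: C_def)
    finally show ?thesis using t by (simp add: field_simps)
  qed
  show thesis
  proof (rule that[OF C0])
    fix f :: "'n pt \<Rightarrow> complex" and a l :: real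
    assume f: "f \<in> linf_c" and a: "0 < a" and b: "AE x in rho. norm (f x) \<le> a" and l: "a \<le> l"
    define g where "g = (\<lambda>x. complex_of_real (1 / a) * f x)"
    have g: "g \<in> linf_c" unfolding g_def by (rule cmult_linf_c[OF f])
    have gb: "AE x in rho. norm (g x) \<le> 1"
      using b by eventually_elim (use a in \<open>simp add: g_def norm_divide\<close>)
    define t where "t = l / a"
    have t: "1 \<le> t" using l a by (simp add: t_def)
    define n where "n = nat \<lfloor>(t - 1) / jn_b\<rfloor>"
    have tn: "1 + real n * jn_b \<le> t"
    proof -
      have "0 \<le> (t - 1) / jn_b" using t jn_pos by simp
      then have "real n \<le> (t - 1) / jn_b" unfolding n_def by linarith
      then have "real n * jn_b \<le> t - 1" using jn_pos by (simp add: le_divide_eq)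
      then show ?thesis by linarith
    qed
    have trg: "norm (tr g R x) = norm (tr f R x) / a" for R x
    proof -
      have "tr g R x = complex_of_real (1 / a) * tr f R x"
        unfolding tr_def g_def set_integral_mult_right[symmetric] by (simp add: mult_ac)
      then show ?thesis using a by (simp add: norm_mult norm_divide)
    qed
    have "level f l \<subseteq> level g t"
    proof
      fix x assume "x \<in> level f l"
      then obtain R where R: "R \<in> cz_sets" "x \<in> R" "ennreal l < ennreal (norm (tr f R x))" "x \<in> S"
        unfolding level_def max_sing_eq by (auto simp: less_SUP_iff)
      then have "l < norm (tr f R x)" using a l by (simp add: ennreal_less_iff)
      then have "t < norm (tr g R x)" using a by (simp add: trg t_def divide_strict_right_mono)
      then have "ennreal t < ennreal (norm (tr g R x))" using t by (simp add: ennreal_less_iff)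
      also have "\<dots> \<le> max_sing K g x" unfolding max_sing_eq by (rule SUP_upper) (use R in auto)
      finally show "x \<in> level g t" using R by (simp add: level_def)
    qed
    also have "\<dots> \<subseteq> level g (1 + real n * jn_b)" by (rule level_antimono[OF tn])
    finally have "emeasure rho (level f l) \<le> emeasure rho (level g (1 + real n * jn_b))"
      by (intro emeasure_mono level_sets[OF g])
    also have "\<dots> \<le> ennreal (wk_c / 2 ^ n) * (\<integral>\<^sup>+x. ennreal (norm (g x)) \<partial>rho)" by (rule jn_iterate[OF g gb])
    also have "\<dots> \<le> ennreal (C / t ^ m) * (\<integral>\<^sup>+x. ennreal (norm (g x)) \<partial>rho)"
      by (intro mult_right_mono ennreal_leI bound[OF t n_def]) simp
    also have "(\<integral>\<^sup>+x. ennreal (norm (g x)) \<partial>rho) = (\<integral>\<^sup>+x. ennreal (1 / a) * ennreal (norm (f x)) \<partial>rho)"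
      using a by (intro nn_integral_cong) (simp add: g_def norm_divide ennreal_mult[symmetric])
    also have "\<dots> = ennreal (1 / a) * (\<integral>\<^sup>+x. ennreal (norm (f x)) \<partial>rho)"
      using linf_c_measurable[OF f] by (intro nn_integral_cmult) simp
    also have "ennreal (C / t ^ m) * (ennreal (1 / a) * (\<integral>\<^sup>+x. ennreal (norm (f x)) \<partial>rho)) =
        ennreal (C * (a / l) ^ m / a) * (\<integral>\<^sup>+x. ennreal (norm (f x)) \<partial>rho)"
      using a t C0 by (simp add: mult.assoc[symmetric] ennreal_mult[symmetric] t_def power_divide)
    finally show "emeasure rho (level f l) \<le> ennreal (C * (a / l) ^ m / a) * (\<integral>\<^sup>+x. ennreal (norm (f x)) \<partial>rho)" .
  qed
qed

end

section \<open>Integration of the distribution function\<close>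

interpretation lborel_rho: pair_sigma_finite "lborel :: real measure" "rho :: ('n::finite) pt measure" ..

definition pw :: "real \<Rightarrow> real \<Rightarrow> ennreal" where
  "pw q \<alpha> = ennreal (q * \<alpha> powr (q - 1)) * indicator {0<..} \<alpha>"

lemma pw_measurable [measurable]: "pw q \<in> borel_measurable lborel"
  unfolding pw_def[abs_def] by measurable

lemma pw_integral:
  assumes "0 < q" "0 \<le> v"
  shows "(\<integral>\<^sup>+\<alpha>. pw q \<alpha> * indicator {\<alpha>. \<alpha> < v} \<alpha> \<partial>lborel) = ennreal (v powr q)"
proof -
  have i: "((\<lambda>\<alpha>. q * \<alpha> powr (q - 1)) has_integral (q * (v powr (q - 1 + 1) / (q - 1 + 1)))) {0..v}"
    by (rule has_integral_mult_right, rule has_integral_powr_from_0) (use assms in auto)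
  have "(\<integral>\<^sup>+\<alpha>. pw q \<alpha> * indicator {\<alpha>. \<alpha> < v} \<alpha> \<partial>lborel) = (\<integral>\<^sup>+\<alpha>. ennreal (q * \<alpha> powr (q - 1)) * indicator {0..v} \<alpha> \<partial>lborel)"
  proof (rule nn_integral_cong_AE)
    show "AE \<alpha> in lborel. pw q \<alpha> * indicator {\<alpha>. \<alpha> < v} \<alpha> = ennreal (q * \<alpha> powr (q - 1)) * indicator {0..v} \<alpha>"
      using AE_lborel_singleton[of 0] AE_lborel_singleton[of v]
      by eventually_elim (auto simp: pw_def split: split_indicator)
  qed
  also have "\<dots> = ennreal (q * (v powr (q - 1 + 1) / (q - 1 + 1)))"
    by (rule nn_integral_has_integral_lebesgue'[OF _ i]) (use assms in auto)
  also have "q * (v powr (q - 1 + 1) / (q - 1 + 1)) = v powr q" using assms by simp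
  finally show ?thesis .
qed

text \<open>The layer cake formula with a weight \<open>u\<close>. It is applied with u = 1 to the
  maximal function and the layers, and with u = |f| to the contribution of the weak type
  bound.\<close>

lemma pw_fubini:
  fixes h :: "('n::finite) pt \<Rightarrow> real" and u :: "'n pt \<Rightarrow> ennreal"
  assumes h: "h \<in> borel_measurable rho" and u: "u \<in> borel_measurable rho" and q: "0 < q" "\<And>x. 0 \<le> h x"
  shows "(\<integral>\<^sup>+\<alpha>. pw q \<alpha> * (\<integral>\<^sup>+x. u x * indicator {x. \<alpha> < h x} x \<partial>rho) \<partial>lborel) = (\<integral>\<^sup>+x. u x * ennreal (h x powr q) \<partial>rho)"
    "(\<lambda>\<alpha>. \<integral>\<^sup>+x. u x * indicator {x. \<alpha> < h x} x \<partial>rho) \<in> borel_measurable lborel"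
proof -
  have [measurable]: "(\<lambda>z. h (snd z)) \<in> borel_measurable (lborel \<Otimes>\<^sub>M rho)"
    by (rule measurable_compose[OF measurable_snd h])
  have [measurable]: "(\<lambda>z. u (snd z)) \<in> borel_measurable (lborel \<Otimes>\<^sub>M rho)"
    by (rule measurable_compose[OF measurable_snd u])
  have [measurable]: "(\<lambda>z. pw q (fst z)) \<in> borel_measurable (lborel \<Otimes>\<^sub>M (rho :: 'n pt measure))"
    by (rule measurable_compose[OF measurable_fst pw_measurable])
  have [measurable]: "(\<lambda>z. fst z) \<in> borel_measurable ((lborel :: real measure) \<Otimes>\<^sub>M (rho :: 'n pt measure))"
    using measurable_fst by (simp cong: measurable_cong_sets)
  have e: "(\<lambda>z. indicator {x. fst z < h x} (snd z) :: ennreal) = (\<lambda>z. if fst z < h (snd z) then 1 else 0)"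
    by (auto simp: indicator_def)
  have [measurable]: "(\<lambda>z. indicator {x. fst z < h x} (snd z) :: ennreal) \<in> borel_measurable (lborel \<Otimes>\<^sub>M rho)"
    unfolding e by measurable
  have m1: "(\<lambda>(\<alpha>, x). u x * indicator {x. \<alpha> < h x} x) \<in> borel_measurable (lborel \<Otimes>\<^sub>M rho)"
    unfolding case_prod_beta' by measurable
  have m2: "(\<lambda>(\<alpha>, x). pw q \<alpha> * (u x * indicator {x. \<alpha> < h x} x)) \<in> borel_measurable (lborel \<Otimes>\<^sub>M rho)"
    unfolding case_prod_beta' by measurable
  show "(\<lambda>\<alpha>. \<integral>\<^sup>+x. u x * indicator {x. \<alpha> < h x} x \<partial>rho) \<in> borel_measurable lborel"
    by (rule rho.borel_measurable_nn_integral[OF m1])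
  have meas: "(\<lambda>x. u x * indicator {x. \<alpha> < h x} x) \<in> borel_measurable rho" for \<alpha>
  proof -
    note [measurable] = h
    have "{x \<in> space rho. \<alpha> < h x} \<in> sets rho" by measurable
    also have "{x \<in> space rho. \<alpha> < h x} = {x. \<alpha> < h x} \<inter> space rho" by blast
    finally show ?thesis by (intro borel_measurable_times_ennreal u) (simp only: borel_measurable_indicator_iff)
  qed
  have "(\<integral>\<^sup>+\<alpha>. pw q \<alpha> * (\<integral>\<^sup>+x. u x * indicator {x. \<alpha> < h x} x \<partial>rho) \<partial>lborel) =
     (\<integral>\<^sup>+\<alpha>. (\<integral>\<^sup>+x. pw q \<alpha> * (u x * indicator {x. \<alpha> < h x} x) \<partial>rho) \<partial>lborel)"
    by (intro nn_integral_cong nn_integral_cmult[symmetric] meas)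
  also have "\<dots> = (\<integral>\<^sup>+x. (\<integral>\<^sup>+\<alpha>. pw q \<alpha> * (u x * indicator {x. \<alpha> < h x} x) \<partial>lborel) \<partial>rho)"
    by (rule lborel_rho.Fubini'[OF m2, symmetric])
  also have "\<dots> = (\<integral>\<^sup>+x. u x * ennreal (h x powr q) \<partial>rho)"
  proof (rule nn_integral_cong)
    fix x
    have "(\<integral>\<^sup>+\<alpha>. pw q \<alpha> * (u x * indicator {x. \<alpha> < h x} x) \<partial>lborel) =
       (\<integral>\<^sup>+\<alpha>. u x * (pw q \<alpha> * indicator {\<alpha>. \<alpha> < h x} \<alpha>) \<partial>lborel)"
      by (intro nn_integral_cong) (auto simp: mult_ac split: split_indicator)
    also have "\<dots> = u x * (\<integral>\<^sup>+\<alpha>. pw q \<alpha> * indicator {\<alpha>. \<alpha> < h x} \<alpha> \<partial>lborel)"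
      by (rule nn_integral_cmult) measurable
    also have "\<dots> = u x * ennreal (h x powr q)" using pw_integral[OF q] by simp
    finally show "(\<integral>\<^sup>+\<alpha>. pw q \<alpha> * (u x * indicator {x. \<alpha> < h x} x) \<partial>lborel) = u x * ennreal (h x powr q)" .
  qed
  finally show "(\<integral>\<^sup>+\<alpha>. pw q \<alpha> * (\<integral>\<^sup>+x. u x * indicator {x. \<alpha> < h x} x \<partial>rho) \<partial>lborel) = (\<integral>\<^sup>+x. u x * ennreal (h x powr q) \<partial>rho)" .
qed

section \<open>The strong type (p,p) estimate\<close>

context cz_op begin

text \<open>Sizes drop by the factor 4 from layer to layer, while the heights allotted to the layers
  in \<open>level_layers\<close> drop by 2. Size divided by height is 1 / 2^k, so decay of order
  \<open>m\<close> gains the factor 1 / 2^(k m).\<close>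

definition shell :: "('n pt \<Rightarrow> complex) \<Rightarrow> real \<Rightarrow> nat \<Rightarrow> 'n pt set" where
  "shell f \<alpha> k = {x \<in> S. \<alpha> / 4 ^ (k + 2) < norm (f x) \<and> norm (f x) \<le> \<alpha> / 4 ^ (k + 1)}"

definition below :: "('n pt \<Rightarrow> complex) \<Rightarrow> real \<Rightarrow> nat \<Rightarrow> 'n pt set" where
  "below f \<alpha> k = {x \<in> S. norm (f x) \<le> \<alpha> / 4 ^ (k + 1)}"

definition above :: "('n pt \<Rightarrow> complex) \<Rightarrow> real \<Rightarrow> 'n pt set" where
  "above f s = {x \<in> S. s < norm (f x)}"

lemma shell_sets:
  assumes "f \<in> linf_c"
  shows "shell f \<alpha> k \<in> sets rho" "below f \<alpha> k \<in> sets rho" "above f s \<in> sets rho"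
proof -
  note [measurable] = linf_c_measurable[OF assms]
  have "{x \<in> space rho. \<alpha> / 4 ^ (k + 2) < norm (f x) \<and> norm (f x) \<le> \<alpha> / 4 ^ (k + 1)} \<in> sets rho"
    "{x \<in> space rho. norm (f x) \<le> \<alpha> / 4 ^ (k + 1)} \<in> sets rho" "{x \<in> space rho. s < norm (f x)} \<in> sets rho"
    by measurable
  then show "shell f \<alpha> k \<in> sets rho" "below f \<alpha> k \<in> sets rho" "above f s \<in> sets rho"
    unfolding shell_def below_def above_def space_rho .
qed

lemma max_sing_layers:
  assumes f: "f \<in> linf_c" and a: "0 < \<alpha>"
  shows "max_sing K f x \<le> max_sing K (res (above f (\<alpha> / 4)) f) x +
    (\<Sum>k<N. max_sing K (res (shell f \<alpha> k) f) x) + max_sing K (res (below f \<alpha> N) f) x"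
proof (induction N)
  case 0
  have "max_sing K f x = max_sing K (\<lambda>y. res (above f (\<alpha> / 4)) f y + res (below f \<alpha> 0) f y) x"
    by (rule max_sing_cong) (auto simp: res_def above_def below_def split: split_indicator)
  also have "\<dots> \<le> max_sing K (res (above f (\<alpha> / 4)) f) x + max_sing K (res (below f \<alpha> 0) f) x"
    by (intro max_sing_add res_linf_c shell_sets f)
  finally show ?case by simp
next
  case (Suc N)
  have le: "\<alpha> / 4 ^ (Suc N + 1) \<le> \<alpha> / 4 ^ (N + 1)" using a by (simp add: field_simps)
  have "max_sing K (res (below f \<alpha> N) f) x = max_sing K (\<lambda>y. res (shell f \<alpha> N) f y + res (below f \<alpha> (Suc N)) f y) x"
    by (rule max_sing_cong) (use le in \<open>auto simp: res_def shell_def below_def split: split_indicator\<close>)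
  also have "\<dots> \<le> max_sing K (res (shell f \<alpha> N) f) x + max_sing K (res (below f \<alpha> (Suc N)) f) x"
    by (intro max_sing_add res_linf_c shell_sets f)
  finally have "max_sing K (res (below f \<alpha> N) f) x \<le> \<dots>" .
  then have "max_sing K (res (above f (\<alpha> / 4)) f) x +
    (\<Sum>k<N. max_sing K (res (shell f \<alpha> k) f) x) + max_sing K (res (below f \<alpha> N) f) x \<le>
    max_sing K (res (above f (\<alpha> / 4)) f) x +
    (\<Sum>k<N. max_sing K (res (shell f \<alpha> k) f) x) + (max_sing K (res (shell f \<alpha> N) f) x + max_sing K (res (below f \<alpha> (Suc N)) f) x)"
    by (rule add_left_mono)
  with Suc show ?case by (simp add: add_ac order_trans)
qed

text \<open>The heights add up to at most \<alpha>: a quarter of it each for the large values and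
  for the small remainder, and \<alpha> / 2^(k + 2) for the layers, with sum below \<alpha> /
  2.\<close>

lemma level_layers:
  assumes f: "f \<in> linf_c" and a: "0 < \<alpha>"
  shows "level f \<alpha> \<subseteq> level (res (above f (\<alpha> / 4)) f) (\<alpha> / 4) \<union>
    (\<Union>k<N. level (res (shell f \<alpha> k) f) (\<alpha> / 2 ^ (k + 2))) \<union> level (res (below f \<alpha> N) f) (\<alpha> / 4)"
proof (rule subsetI, rule ccontr)
  fix x assume x: "x \<in> level f \<alpha>" "x \<notin> level (res (above f (\<alpha> / 4)) f) (\<alpha> / 4) \<union>
    (\<Union>k<N. level (res (shell f \<alpha> k) f) (\<alpha> / 2 ^ (k + 2))) \<union> level (res (below f \<alpha> N) f) (\<alpha> / 4)"
  have xS: "x \<in> S" using x(1) by (simp add: level_def)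
  have 1: "max_sing K (res (above f (\<alpha> / 4)) f) x \<le> ennreal (\<alpha> / 4)" "max_sing K (res (below f \<alpha> N) f) x \<le> ennreal (\<alpha> / 4)"
    using x(2) xS by (auto simp: level_def not_less)
  have 2: "max_sing K (res (shell f \<alpha> k) f) x \<le> ennreal (\<alpha> / 2 ^ (k + 2))" if "k < N" for k
    using x(2) xS that by (auto simp: level_def not_less)
  have "(\<Sum>k<N. \<alpha> / 2 ^ (k + 2)) = \<alpha> / 2 - \<alpha> / 2 ^ (N + 1)"
    by (induction N) (auto simp: field_simps)
  also have "\<dots> \<le> \<alpha> / 2" using a by simp
  finally have s: "(\<Sum>k<N. \<alpha> / 2 ^ (k + 2)) \<le> \<alpha> / 2" .
  have "(\<Sum>k<N. max_sing K (res (shell f \<alpha> k) f) x) \<le> (\<Sum>k<N. ennreal (\<alpha> / 2 ^ (k + 2)))"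
    by (rule sum_mono) (use 2 in auto)
  also have "\<dots> = ennreal (\<Sum>k<N. \<alpha> / 2 ^ (k + 2))" using a by (subst sum_ennreal) auto
  also have "\<dots> \<le> ennreal (\<alpha> / 2)" by (rule ennreal_leI[OF s])
  finally have 3: "(\<Sum>k<N. max_sing K (res (shell f \<alpha> k) f) x) \<le> ennreal (\<alpha> / 2)" .
  have "max_sing K f x \<le> ennreal (\<alpha> / 4) + ennreal (\<alpha> / 2) + ennreal (\<alpha> / 4)"
    by (rule order_trans[OF max_sing_layers[OF f a, of x N]]) (intro add_mono 1 3)
  also have "\<dots> = ennreal \<alpha>" using a by (simp add: ennreal_plus[symmetric] del: ennreal_plus)
  finally show False using x(1) by (auto simp: level_def not_less[symmetric])
qed

text \<open>Only finitely many layers are split off. The remainder is bounded by \<alpha> / 4^(N +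
  1), and its level set has measure at most a constant depending on \<open>f\<close> times 4^(-N);
  \<open>N\<close> is taken so large that this is at most \<open>e\<close>. The finite sum is then
  estimated by the full series.\<close>

lemma distribution_bound:
  assumes C: "0 \<le> C" "\<And>f a l. f \<in> linf_c \<Longrightarrow> 0 < a \<Longrightarrow> (AE x in rho. norm (f x) \<le> a) \<Longrightarrow> a \<le> l \<Longrightarrow>
    emeasure rho (level f l) \<le> ennreal (C * (a / l) ^ m / a) * (\<integral>\<^sup>+x. ennreal (norm (f x)) \<partial>rho)"
    and m: "2 \<le> m" and f: "f \<in> linf_c" and a: "0 < \<alpha>"
  shows "emeasure rho (level f \<alpha>) \<le> ennreal (4 * wk_c / \<alpha>) * (\<integral>\<^sup>+x\<in>above f (\<alpha> / 4). ennreal (norm (f x)) \<partial>rho) +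
    (\<Sum>k. ennreal (C / 2 ^ (k * m)) * emeasure rho (above f (\<alpha> / 4 ^ (k + 2))))"
proof (rule ennreal_le_epsilon)
  fix e :: real assume e: "0 < e"
  note [measurable] = linf_c_measurable[OF f]
  obtain i where i: "(\<integral>\<^sup>+x. ennreal (norm (f x)) \<partial>rho) = ennreal i" "0 \<le> i"
    using linf_c_nn_integral_norm(1)[OF f] by (cases "\<integral>\<^sup>+x. ennreal (norm (f x)) \<partial>rho") auto
  define D where "D = C * 4 / \<alpha> * i"
  have D: "0 \<le> D" using C(1) a i by (simp add: D_def)
  obtain N where "(1 / 4) ^ N < e / (D + 1)" using real_arch_pow_inv[of "e / (D + 1)" "1 / 4"] e D by auto
  then have N: "D * (1 / 4) ^ N \<le> e"
  proof -
    assume "(1 / 4) ^ N < e / (D + 1)"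
    then have "D * (1 / 4) ^ N \<le> D * (e / (D + 1))" using D by (intro mult_left_mono) auto
    also have "\<dots> \<le> e" using D e by (simp add: field_simps)
    finally show ?thesis .
  qed
  have resint: "(\<integral>\<^sup>+x. ennreal (norm (res X f x)) \<partial>rho) = (\<integral>\<^sup>+x\<in>X. ennreal (norm (f x)) \<partial>rho)" for X
    by (intro nn_integral_cong) (auto simp: norm_res split: split_indicator)
  have hi: "emeasure rho (level (res (above f (\<alpha> / 4)) f) (\<alpha> / 4)) \<le> ennreal (4 * wk_c / \<alpha>) * (\<integral>\<^sup>+x\<in>above f (\<alpha> / 4). ennreal (norm (f x)) \<partial>rho)"
    using level_weak11[OF res_linf_c[OF shell_sets(3)[OF f] f], of "\<alpha> / 4" "\<alpha> / 4"] a by (simp add: resint mult.commute)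
  have sh: "emeasure rho (level (res (shell f \<alpha> k) f) (\<alpha> / 2 ^ (k + 2))) \<le> ennreal (C / 2 ^ (k * m)) * emeasure rho (above f (\<alpha> / 4 ^ (k + 2)))" for k
  proof -
    define b where "b = \<alpha> / 4 ^ (k + 1)"
    define l where "l = \<alpha> / 2 ^ (k + 2)"
    have four: "(4::real) ^ j = 2 ^ j * 2 ^ j" for j :: nat by (simp flip: power_mult_distrib)
    have b: "0 < b" "b / l = 1 / 2 ^ k" "b \<le> l"
    proof -
      show "0 < b" using a by (simp add: b_def)
      show bl: "b / l = 1 / 2 ^ k" using a by (simp add: b_def l_def four field_simps)
      have "0 < l" using a by (simp add: l_def)
      have "b / l \<le> 1" unfolding bl by simp
      then show "b \<le> l" using \<open>0 < l\<close> by (simp add: divide_le_eq)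
    qed
    have rl: "res (shell f \<alpha> k) f \<in> linf_c" by (intro res_linf_c shell_sets f)
    have rb: "AE x in rho. norm (res (shell f \<alpha> k) f x) \<le> b"
      using b(1) by (intro AE_I2) (auto simp: norm_res shell_def b_def split: split_indicator)
    have "emeasure rho (level (res (shell f \<alpha> k) f) l) \<le> ennreal (C * (b / l) ^ m / b) * (\<integral>\<^sup>+x. ennreal (norm (res (shell f \<alpha> k) f x)) \<partial>rho)"
      by (rule C(2)[OF rl b(1) rb b(3)])
    also have "\<dots> \<le> ennreal (C * (b / l) ^ m / b) * (ennreal b * emeasure rho (above f (\<alpha> / 4 ^ (k + 2))))"
    proof (intro mult_left_mono)
      have "(\<integral>\<^sup>+x. ennreal (norm (res (shell f \<alpha> k) f x)) \<partial>rho) \<le> (\<integral>\<^sup>+x. ennreal b * indicator (above f (\<alpha> / 4 ^ (k + 2))) x \<partial>rho)"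
        by (intro nn_integral_mono) (auto simp: norm_res shell_def above_def b_def intro!: ennreal_leI split: split_indicator)
      also have "\<dots> = ennreal b * emeasure rho (above f (\<alpha> / 4 ^ (k + 2)))"
        by (rule nn_integral_cmult_indicator[OF shell_sets(3)[OF f]])
      finally show "(\<integral>\<^sup>+x. ennreal (norm (res (shell f \<alpha> k) f x)) \<partial>rho) \<le> \<dots>" .
    qed simp
    also have "\<dots> = ennreal (C * (b / l) ^ m / b * b) * emeasure rho (above f (\<alpha> / 4 ^ (k + 2)))"
    proof (rule ennreal_scale)
      show "0 \<le> C * (b / l) ^ m / b" using C(1) b unfolding b(2) by auto
    qed
    also have "C * (b / l) ^ m / b * b = C / 2 ^ (k * m)" using b(1) unfolding b(2) by (simp add: power_one_over power_mult[symmetric] power_divide)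
    finally show ?thesis by (simp add: l_def)
  qed
  have lo: "emeasure rho (level (res (below f \<alpha> N) f) (\<alpha> / 4)) \<le> ennreal e"
  proof -
    define b where "b = \<alpha> / 4 ^ (N + 1)"
    have b: "0 < b" "b / (\<alpha> / 4) = (1 / 4) ^ N" "b \<le> \<alpha> / 4"
      using a by (auto simp: b_def field_simps)
    have rl: "res (below f \<alpha> N) f \<in> linf_c" by (intro res_linf_c shell_sets f)
    have rb: "AE x in rho. norm (res (below f \<alpha> N) f x) \<le> b"
      using b(1) by (intro AE_I2) (auto simp: norm_res below_def b_def split: split_indicator)
    have "emeasure rho (level (res (below f \<alpha> N) f) (\<alpha> / 4)) \<le> ennreal (C * (b / (\<alpha> / 4)) ^ m / b) * (\<integral>\<^sup>+x. ennreal (norm (res (below f \<alpha> N) f x)) \<partial>rho)"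
      by (rule C(2)[OF rl b(1) rb b(3)])
    also have "\<dots> \<le> ennreal (C * (b / (\<alpha> / 4)) ^ m / b) * ennreal i"
      unfolding i(1)[symmetric] by (intro mult_left_mono nn_integral_mono) (auto simp: norm_res split: split_indicator)
    also have "\<dots> = ennreal (C * (b / (\<alpha> / 4)) ^ m / b * i)" by (rule ennreal_mult''[symmetric]) (rule i(2))
    also have "\<dots> \<le> ennreal e"
    proof (rule ennreal_leI)
      \<comment> \<open>The division by \<open>b\<close> costs a factor of order 4^N, so an exponent
        of at least 2 is what leaves a decaying factor.\<close>
      have "((1 / 4 :: real) ^ N) ^ m \<le> ((1 / 4) ^ N) ^ 2" by (rule power_decreasing[OF m]) (auto simp: power_le_one)
      then have "C * ((1 / 4) ^ N) ^ m / b * i \<le> C * ((1 / 4) ^ N) ^ 2 / b * i"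
        using C(1) b(1) i(2) by (intro mult_right_mono divide_right_mono mult_left_mono) auto
      also have "\<dots> = D * (1 / 4) ^ N"
        using a by (simp add: D_def b_def power2_eq_square power_one_over field_simps)
      finally show "C * (b / (\<alpha> / 4)) ^ m / b * i \<le> e" using N unfolding b(2) by linarith
    qed
    finally show ?thesis .
  qed
  have ls: "level (res X f) l \<in> sets rho" if "X \<in> sets rho" for X l
    by (intro level_sets res_linf_c that f)
  have "emeasure rho (level f \<alpha>) \<le> emeasure rho (level (res (above f (\<alpha> / 4)) f) (\<alpha> / 4) \<union>
    (\<Union>k<N. level (res (shell f \<alpha> k) f) (\<alpha> / 2 ^ (k + 2))) \<union> level (res (below f \<alpha> N) f) (\<alpha> / 4))"
    by (intro emeasure_mono level_layers f a sets.Un sets.finite_UN ls shell_sets) auto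
  also have "\<dots> \<le> emeasure rho (level (res (above f (\<alpha> / 4)) f) (\<alpha> / 4) \<union>
    (\<Union>k<N. level (res (shell f \<alpha> k) f) (\<alpha> / 2 ^ (k + 2)))) + emeasure rho (level (res (below f \<alpha> N) f) (\<alpha> / 4))"
    by (intro emeasure_subadditive sets.Un sets.finite_UN ls shell_sets f) auto
  also have "\<dots> \<le> (emeasure rho (level (res (above f (\<alpha> / 4)) f) (\<alpha> / 4)) +
    emeasure rho (\<Union>k<N. level (res (shell f \<alpha> k) f) (\<alpha> / 2 ^ (k + 2)))) + ennreal e"
    by (intro add_mono lo emeasure_subadditive sets.finite_UN ls shell_sets f) auto
  also have "\<dots> \<le> (ennreal (4 * wk_c / \<alpha>) * (\<integral>\<^sup>+x\<in>above f (\<alpha> / 4). ennreal (norm (f x)) \<partial>rho) +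
    (\<Sum>k. ennreal (C / 2 ^ (k * m)) * emeasure rho (above f (\<alpha> / 4 ^ (k + 2))))) + ennreal e"
  proof (intro add_right_mono add_mono hi)
    have "emeasure rho (\<Union>k<N. level (res (shell f \<alpha> k) f) (\<alpha> / 2 ^ (k + 2))) \<le> (\<Sum>k<N. emeasure rho (level (res (shell f \<alpha> k) f) (\<alpha> / 2 ^ (k + 2))))"
      by (intro emeasure_subadditive_finite) (use ls shell_sets f in auto)
    also have "\<dots> \<le> (\<Sum>k<N. ennreal (C / 2 ^ (k * m)) * emeasure rho (above f (\<alpha> / 4 ^ (k + 2))))"
      by (intro sum_mono sh)
    also have "\<dots> \<le> (\<Sum>k. ennreal (C / 2 ^ (k * m)) * emeasure rho (above f (\<alpha> / 4 ^ (k + 2))))"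
      by (rule sum_le_suminf) auto
    finally show "emeasure rho (\<Union>k<N. level (res (shell f \<alpha> k) f) (\<alpha> / 2 ^ (k + 2))) \<le> \<dots>" .
  qed
  finally show "emeasure rho (level f \<alpha>) \<le> (ennreal (4 * wk_c / \<alpha>) * (\<integral>\<^sup>+x\<in>above f (\<alpha> / 4). ennreal (norm (f x)) \<partial>rho) +
    (\<Sum>k. ennreal (C / 2 ^ (k * m)) * emeasure rho (above f (\<alpha> / 4 ^ (k + 2))))) + ennreal e" .
qed

text \<open>The weak type term leads to the weight \<alpha>^(p - 2), which is integrable near 0
  because p > 1. Layer k contributes a multiple of 4^((k + 2) p) / 2^(k m) times the integral of the
  p-th power of |f|, and these factors form a convergent series by the choice of
  \<open>m\<close>.\<close>

theorem strong_type:
  assumes p: "1 < p"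
  obtains C where "0 \<le> C" "\<And>f. f \<in> linf_c \<Longrightarrow>
    (\<integral>\<^sup>+x. ennreal (enn2real (max_sing K f x) powr p) \<partial>rho) \<le> ennreal C * (\<integral>\<^sup>+x. ennreal (norm (f x) powr p) \<partial>rho)"
proof -
  \<comment> \<open>The inequality m >= 2 p + 1 leaves a factor 2^(-k) after the growth 4^(k p) of
    the layers.\<close>
  define m where "m = nat \<lceil>2 * p\<rceil> + 1"
  have m: "2 \<le> m" "2 * p + 1 \<le> real m" using p by (auto simp: m_def) linarith+
  obtain C where C: "0 \<le> C" "\<And>f a l. f \<in> linf_c \<Longrightarrow> 0 < a \<Longrightarrow> (AE x in rho. norm (f x) \<le> a) \<Longrightarrow> a \<le> l \<Longrightarrow>
    emeasure rho (level f l) \<le> ennreal (C * (a / l) ^ m / a) * (\<integral>\<^sup>+x. ennreal (norm (f x)) \<partial>rho)"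
    by (rule jn_decay[of m thesis]) (rule that)
  define c1 where "c1 = 4 * wk_c * (p / (p - 1)) * 4 powr (p - 1)"
  define c2 where "c2 = C * 16 powr p * 2"
  have c: "0 \<le> c1" "0 \<le> c2" using p wk_pos C by (auto simp: c1_def c2_def)
  show thesis
  proof (rule that[of "c1 + c2"])
    show "0 \<le> c1 + c2" using c by simp
    fix f :: "'n pt \<Rightarrow> complex" assume f: "f \<in> linf_c"
    define J where "J = (\<integral>\<^sup>+x. ennreal (norm (f x) powr p) \<partial>rho)"
    define h where "h x = enn2real (max_sing K f x)" for x
    note fm [measurable] = linf_c_measurable[OF f] and [measurable] = max_sing_measurable[OF f]
    have hm: "h \<in> borel_measurable rho" unfolding h_def[abs_def] by measurable
    have nm: "(\<lambda>x. ennreal (norm (f x))) \<in> borel_measurable rho" by measurable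
    have one: "(\<lambda>x. 1 :: ennreal) \<in> borel_measurable (rho :: 'n pt measure)" by simp
    have scale: "(\<lambda>x. norm (f x) * s) \<in> borel_measurable rho" for s by measurable
    have ab: "above f (\<alpha> / s) = S \<inter> {x. \<alpha> < norm (f x) * s}" if "0 < s" for \<alpha> s
      using that by (auto simp: above_def divide_less_eq)
    have T1: "(\<integral>\<^sup>+x\<in>above f (\<alpha> / 4). ennreal (norm (f x)) \<partial>rho) = (\<integral>\<^sup>+x. ennreal (norm (f x)) * indicator {x. \<alpha> < norm (f x) * 4} x \<partial>rho)" for \<alpha>
      by (intro nn_integral_cong) (auto simp: ab split: split_indicator)
    have T2: "emeasure rho (above f (\<alpha> / 4 ^ (k + 2))) = (\<integral>\<^sup>+x. 1 * indicator {x. \<alpha> < norm (f x) * 4 ^ (k + 2)} x \<partial>rho)" for \<alpha> k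
    proof -
      have "emeasure rho (above f (\<alpha> / 4 ^ (k + 2))) = (\<integral>\<^sup>+x. indicator (above f (\<alpha> / 4 ^ (k + 2))) x \<partial>rho)"
        using shell_sets(3)[OF f] by simp
      also have "\<dots> = (\<integral>\<^sup>+x. 1 * indicator {x. \<alpha> < norm (f x) * 4 ^ (k + 2)} x \<partial>rho)"
        by (intro nn_integral_cong) (auto simp: ab simp del: power_Suc split: split_indicator)
      finally show ?thesis .
    qed
    \<comment> \<open>Only an inequality is claimed, as \<open>enn2real\<close> sends infinity to 0;
      it is in the required direction.\<close>
    have T3: "(\<integral>\<^sup>+x. 1 * indicator {x. \<alpha> < h x} x \<partial>rho) \<le> emeasure rho (level f \<alpha>)" if "0 < \<alpha>" for \<alpha>
    proof -
      have "x \<in> level f \<alpha>" if "\<alpha> < h x" "x \<in> S" for x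
      proof -
        have "ennreal \<alpha> < max_sing K f x"
          using that \<open>0 < \<alpha>\<close> by (cases "max_sing K f x") (auto simp: h_def ennreal_less_iff)
        then show ?thesis using that by (simp add: level_def)
      qed
      then have "(\<integral>\<^sup>+x. 1 * indicator {x. \<alpha> < h x} x \<partial>rho) \<le> (\<integral>\<^sup>+x. indicator (level f \<alpha>) x \<partial>rho)"
        by (intro nn_integral_mono) (auto split: split_indicator)
      then show ?thesis using level_sets[OF f] by simp
    qed
    define U where "U \<alpha> = (\<integral>\<^sup>+x. ennreal (norm (f x)) * indicator {x. \<alpha> < norm (f x) * 4} x \<partial>rho)" for \<alpha>
    define V where "V k \<alpha> = (\<integral>\<^sup>+x. 1 * indicator {x. \<alpha> < norm (f x) * 4 ^ (k + 2)} x \<partial>rho)" for k \<alpha>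
    have Um [measurable]: "U \<in> borel_measurable lborel"
      unfolding U_def[abs_def] by (rule pw_fubini(2)[OF scale nm, of 1]) auto
    have Vm [measurable]: "V k \<in> borel_measurable lborel" for k
      unfolding V_def[abs_def] by (rule pw_fubini(2)[OF scale one, of 1]) auto
    have "(\<integral>\<^sup>+x. ennreal (h x powr p) \<partial>rho) = (\<integral>\<^sup>+\<alpha>. pw p \<alpha> * (\<integral>\<^sup>+x. 1 * indicator {x. \<alpha> < h x} x \<partial>rho) \<partial>lborel)"
      by (subst pw_fubini(1)[OF hm one]) (use p in \<open>auto simp: h_def\<close>)
    also have "\<dots> \<le> (\<integral>\<^sup>+\<alpha>. ennreal (4 * wk_c * (p / (p - 1))) * (pw (p - 1) \<alpha> * U \<alpha>) + (\<Sum>k. ennreal (C / 2 ^ (k * m)) * (pw p \<alpha> * V k \<alpha>)) \<partial>lborel)"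
    proof (rule nn_integral_mono)
      fix \<alpha> :: real
      show "pw p \<alpha> * (\<integral>\<^sup>+x. 1 * indicator {x. \<alpha> < h x} x \<partial>rho) \<le>
        ennreal (4 * wk_c * (p / (p - 1))) * (pw (p - 1) \<alpha> * U \<alpha>) + (\<Sum>k. ennreal (C / 2 ^ (k * m)) * (pw p \<alpha> * V k \<alpha>))"
      proof (cases "0 < \<alpha>")
        case True
        \<comment> \<open>Dividing by \<alpha> lowers the exponent of the weight by 1, at the price
          of the factor p / (p - 1).\<close>
        have w: "pw p \<alpha> * ennreal (4 * wk_c / \<alpha>) = ennreal (4 * wk_c * (p / (p - 1))) * pw (p - 1) \<alpha>"
        proof -
          have "\<alpha> powr (p - 1) = \<alpha> * \<alpha> powr (p - 1 - 1)"
            using powr_add[of \<alpha> 1 "p - 1 - 1"] True by simp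
          then have "p * \<alpha> powr (p - 1) * (4 * wk_c / \<alpha>) = 4 * wk_c * (p / (p - 1)) * ((p - 1) * \<alpha> powr (p - 1 - 1))"
            using True p by (simp add: field_simps)
          then show ?thesis
            using True p wk_pos by (simp add: pw_def ennreal_mult[symmetric])
        qed
        have "pw p \<alpha> * (\<integral>\<^sup>+x. 1 * indicator {x. \<alpha> < h x} x \<partial>rho) \<le> pw p \<alpha> * emeasure rho (level f \<alpha>)"
          by (intro mult_left_mono T3 True) simp
        also have "\<dots> \<le> pw p \<alpha> * (ennreal (4 * wk_c / \<alpha>) * U \<alpha> + (\<Sum>k. ennreal (C / 2 ^ (k * m)) * V k \<alpha>))"
        proof (rule mult_left_mono)
          show "emeasure rho (level f \<alpha>) \<le> ennreal (4 * wk_c / \<alpha>) * U \<alpha> + (\<Sum>k. ennreal (C / 2 ^ (k * m)) * V k \<alpha>)"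
            unfolding U_def V_def T1[symmetric] T2[symmetric]
            by (rule distribution_bound[of C m, OF C(1) _ m(1) f True]) (rule C(2))
        qed simp
        also have "\<dots> = ennreal (4 * wk_c * (p / (p - 1))) * (pw (p - 1) \<alpha> * U \<alpha>) + (\<Sum>k. ennreal (C / 2 ^ (k * m)) * (pw p \<alpha> * V k \<alpha>))"
        proof -
          have "pw p \<alpha> * (ennreal (4 * wk_c / \<alpha>) * U \<alpha>) = ennreal (4 * wk_c * (p / (p - 1))) * (pw (p - 1) \<alpha> * U \<alpha>)"
            unfolding mult.assoc[symmetric] w ..
          moreover have "pw p \<alpha> * (\<Sum>k. ennreal (C / 2 ^ (k * m)) * V k \<alpha>) = (\<Sum>k. pw p \<alpha> * (ennreal (C / 2 ^ (k * m)) * V k \<alpha>))"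
            by (rule ennreal_suminf_cmult[symmetric])
          moreover have "pw p \<alpha> * (ennreal (C / 2 ^ (k * m)) * V k \<alpha>) = ennreal (C / 2 ^ (k * m)) * (pw p \<alpha> * V k \<alpha>)" for k
            by (rule mult.left_commute)
          ultimately show ?thesis by (simp only: distrib_left)
        qed
        finally show ?thesis .
      qed (simp add: pw_def)
    qed
    also have "\<dots> = (\<integral>\<^sup>+\<alpha>. ennreal (4 * wk_c * (p / (p - 1))) * (pw (p - 1) \<alpha> * U \<alpha>) \<partial>lborel) +
       (\<integral>\<^sup>+\<alpha>. (\<Sum>k. ennreal (C / 2 ^ (k * m)) * (pw p \<alpha> * V k \<alpha>)) \<partial>lborel)"
      by (rule nn_integral_add) measurable
    also have "(\<integral>\<^sup>+\<alpha>. ennreal (4 * wk_c * (p / (p - 1))) * (pw (p - 1) \<alpha> * U \<alpha>) \<partial>lborel) = ennreal c1 * J"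
    proof -
      have "(\<integral>\<^sup>+\<alpha>. ennreal (4 * wk_c * (p / (p - 1))) * (pw (p - 1) \<alpha> * U \<alpha>) \<partial>lborel) =
          ennreal (4 * wk_c * (p / (p - 1))) * (\<integral>\<^sup>+\<alpha>. pw (p - 1) \<alpha> * U \<alpha> \<partial>lborel)"
        by (rule nn_integral_cmult) measurable
      also have "(\<integral>\<^sup>+\<alpha>. pw (p - 1) \<alpha> * U \<alpha> \<partial>lborel) = (\<integral>\<^sup>+x. ennreal (norm (f x)) * ennreal ((norm (f x) * 4) powr (p - 1)) \<partial>rho)"
        unfolding U_def by (rule pw_fubini(1)[OF scale nm]) (use p in auto)
      also have "\<dots> = (\<integral>\<^sup>+x. ennreal (4 powr (p - 1)) * ennreal (norm (f x) powr p) \<partial>rho)"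
      proof (rule nn_integral_cong)
        fix x
        have "norm (f x) * (norm (f x) * 4) powr (p - 1) = 4 powr (p - 1) * norm (f x) powr p"
        proof (cases "f x = 0")
          case False
          then have "norm (f x) powr p = norm (f x) * norm (f x) powr (p - 1)" by (simp add: powr_diff)
          then show ?thesis by (simp add: powr_mult)
        qed simp
        then show "ennreal (norm (f x)) * ennreal ((norm (f x) * 4) powr (p - 1)) = ennreal (4 powr (p - 1)) * ennreal (norm (f x) powr p)"
          by (simp add: ennreal_mult[symmetric])
      qed
      also have "\<dots> = ennreal (4 powr (p - 1)) * J" unfolding J_def by (rule nn_integral_cmult) measurable
      also have "ennreal (4 * wk_c * (p / (p - 1))) * \<dots> = ennreal c1 * J"
        unfolding c1_def by (rule ennreal_scale) (use p wk_pos in auto)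
      finally show ?thesis .
    qed
    also have "(\<integral>\<^sup>+\<alpha>. (\<Sum>k. ennreal (C / 2 ^ (k * m)) * (pw p \<alpha> * V k \<alpha>)) \<partial>lborel) \<le> ennreal c2 * J"
    proof -
      have summand: "(\<integral>\<^sup>+\<alpha>. ennreal (C / 2 ^ (k * m)) * (pw p \<alpha> * V k \<alpha>) \<partial>lborel) \<le> ennreal (C * 16 powr p * (1 / 2) ^ k) * J" for k
      proof -
        have "(\<integral>\<^sup>+\<alpha>. ennreal (C / 2 ^ (k * m)) * (pw p \<alpha> * V k \<alpha>) \<partial>lborel) =
          ennreal (C / 2 ^ (k * m)) * (\<integral>\<^sup>+\<alpha>. pw p \<alpha> * V k \<alpha> \<partial>lborel)"
          by (rule nn_integral_cmult) measurable
        also have "(\<integral>\<^sup>+\<alpha>. pw p \<alpha> * V k \<alpha> \<partial>lborel) = (\<integral>\<^sup>+x. 1 * ennreal ((norm (f x) * 4 ^ (k + 2)) powr p) \<partial>rho)"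
          unfolding V_def by (rule pw_fubini(1)[OF scale one]) (use p in auto)
        also have "\<dots> = (\<integral>\<^sup>+x. ennreal ((4 ^ (k + 2)) powr p) * ennreal (norm (f x) powr p) \<partial>rho)"
          by (intro nn_integral_cong) (simp add: powr_mult ennreal_mult[symmetric] mult.commute del: power_Suc power_add)
        also have "\<dots> = ennreal ((4 ^ (k + 2)) powr p) * J" unfolding J_def by (rule nn_integral_cmult) measurable
        also have "ennreal (C / 2 ^ (k * m)) * \<dots> = ennreal (C / 2 ^ (k * m) * (4 ^ (k + 2)) powr p) * J"
          by (rule ennreal_scale) (use C in simp)
        also have "\<dots> \<le> ennreal (C * 16 powr p * (1 / 2) ^ k) * J"
        proof (intro mult_right_mono ennreal_leI)
          have "(4 ^ (k + 2)) powr p = 16 powr p * (4 ^ k) powr p"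
            by (simp add: powr_mult[symmetric])
          also have "((4::real) ^ k) powr p = 2 powr (2 * real k * p)"
          proof -
            have "(4::real) ^ k = 2 ^ (2 * k)" by (simp add: power_mult)
            also have "\<dots> = 2 powr real (2 * k)" by (simp only: powr_realpow)
            finally show ?thesis by (simp add: powr_powr)
          qed
          finally have e: "(4 ^ (k + 2)) powr p = 16 powr p * 2 powr (2 * real k * p)" .
          have "2 powr (2 * real k * p) \<le> 2 powr (real k * (real m - 1))"
          proof (rule powr_mono)
            have "real k * (2 * p) \<le> real k * (real m - 1)" using m(2) by (intro mult_left_mono) auto
            then show "2 * real k * p \<le> real k * (real m - 1)" by (simp add: mult_ac)
          qed simp
          also have "\<dots> = 2 ^ (k * m) * (1 / 2) ^ k"
          proof -
            have "real k * (real m - 1) = real (k * m) - real k" by (simp add: algebra_simps)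
            then have "(2::real) powr (real k * (real m - 1)) = 2 powr real (k * m) / 2 powr real k"
              by (simp only: powr_diff)
            also have "\<dots> = 2 ^ (k * m) / 2 ^ k"
              by (simp only: powr_realpow[of 2, OF zero_less_numeral])
            finally show ?thesis by (simp add: power_one_over)
          qed
          finally have "2 powr (2 * real k * p) / 2 ^ (k * m) \<le> (1 / 2) ^ k" by (simp add: divide_le_eq mult.commute)
          then have "C * 16 powr p * (2 powr (2 * real k * p) / 2 ^ (k * m)) \<le> C * 16 powr p * (1 / 2) ^ k"
            using C(1) by (intro mult_left_mono) auto
          then show "C / 2 ^ (k * m) * (4 ^ (k + 2)) powr p \<le> C * 16 powr p * (1 / 2) ^ k"
            unfolding e by (simp add: mult_ac)
        qed simp
        finally show ?thesis .
      qed
      have "(\<integral>\<^sup>+\<alpha>. (\<Sum>k. ennreal (C / 2 ^ (k * m)) * (pw p \<alpha> * V k \<alpha>)) \<partial>lborel) =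
        (\<Sum>k. \<integral>\<^sup>+\<alpha>. ennreal (C / 2 ^ (k * m)) * (pw p \<alpha> * V k \<alpha>) \<partial>lborel)"
        by (rule nn_integral_suminf) measurable
      also have "\<dots> \<le> (\<Sum>k. ennreal (C * 16 powr p * (1 / 2) ^ k) * J)"
        by (intro suminf_le summableI summand)
      also have "\<dots> = (\<Sum>k. ennreal (C * 16 powr p * (1 / 2) ^ k)) * J" by (rule ennreal_suminf_multc)
      also have "(\<Sum>k. ennreal (C * 16 powr p * (1 / 2) ^ k)) = ennreal c2"
      proof -
        have "(\<lambda>k. C * 16 powr p * (1 / 2) ^ k) sums (C * 16 powr p * (1 / (1 - 1 / 2)))"
          by (intro sums_mult geometric_sums) simp
        then have "(\<lambda>k. C * 16 powr p * (1 / 2) ^ k) sums c2" by (simp add: c2_def)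
        then show ?thesis using C(1) by (intro suminf_ennreal_eq) auto
      qed
      finally show ?thesis .
    qed
    finally have "(\<integral>\<^sup>+x. ennreal (h x powr p) \<partial>rho) \<le> ennreal c1 * J + ennreal c2 * J" by (simp add: add_left_mono)
    also have "\<dots> = ennreal (c1 + c2) * J" using c by (simp add: ennreal_plus distrib_right)
    finally show "(\<integral>\<^sup>+x. ennreal (enn2real (max_sing K f x) powr p) \<partial>rho) \<le> ennreal (c1 + c2) * (\<integral>\<^sup>+x. ennreal (norm (f x) powr p) \<partial>rho)"
      by (simp add: h_def J_def)
  qed
qed

end

section \<open>Norm bounds and the BMO estimate\<close>

lemma set_nn_integral_mean_le:
  fixes F :: "('n::finite) pt \<Rightarrow> complex"
  assumes R: "R \<in> cz_sets" and F: "set_integrable rho R F"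
  shows "(\<integral>\<^sup>+x\<in>R. ennreal (norm (F x - cz_mean F R)) \<partial>rho) \<le> 2 * (\<integral>\<^sup>+x\<in>R. ennreal (norm (F x - c)) \<partial>rho)"
proof -
  have Rs: "R \<in> sets rho" and Rf: "emeasure rho R < \<infinity>" and Rp: "0 < emeasure rho R"
    using cz_sets_rho[OF R] emeasure_cz_finite[OF R] emeasure_cz_pos[OF R] by blast+
  define m where "m = measure rho R"
  have mR: "emeasure rho R = ennreal m"
    using Rf by (simp add: m_def emeasure_eq_ennreal_measure)
  have m: "0 < m" using Rp by (simp add: mR)
  have const: "set_integrable rho R (\<lambda>x. c)" for c :: complex
    using Rs Rf by (simp add: set_integrable_def)
  have int: "set_integrable rho R (\<lambda>x. F x - c)"
    using F const by (rule set_integral_diff)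
  define I where "I = (LINT x:R|rho. norm (F x - c))"
  have I: "(\<integral>\<^sup>+x\<in>R. ennreal (norm (F x - c)) \<partial>rho) = ennreal I"
  proof -
    have "(\<integral>\<^sup>+x\<in>R. ennreal (norm (F x - c)) \<partial>rho) = (\<integral>\<^sup>+x. ennreal (norm (indicator R x *\<^sub>R (F x - c))) \<partial>rho)"
      by (intro nn_integral_cong) (auto simp: indicator_def)
    also have "\<dots> = ennreal (LINT x|rho. norm (indicator R x *\<^sub>R (F x - c)))"
      using integrable_norm[OF int[unfolded set_integrable_def]] by (intro nn_integral_eq_integral) simp_all
    also have "(LINT x|rho. norm (indicator R x *\<^sub>R (F x - c))) = I"
      unfolding I_def set_lebesgue_integral_def by (intro Bochner_Integration.integral_cong) (auto simp: indicator_def)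
    finally show ?thesis .
  qed
  have "(LINT x:R|rho. F x - c) = (LINT x:R|rho. F x) - of_real m * c"
  proof -
    have "(LINT x:R|rho. c) = of_real m * c"
      using Rs Rf by (simp add: set_integral_const m_def scaleR_conv_of_real)
    then show ?thesis by (simp only: set_integral_diff(2)[OF F const])
  qed
  then have "cz_mean F R - c = (LINT x:R|rho. F x - c) / of_real m"
    using m by (simp add: cz_mean_def m_def field_simps)
  \<comment> \<open>The mean differs from any constant \<open>c\<close> by at most the average of |F
    - c|, which is the origin of the factor 2.\<close>
  then have "norm (cz_mean F R - c) = norm (LINT x:R|rho. F x - c) / m"
    using m by (simp add: norm_divide)
  also have "\<dots> \<le> I / m"
  proof (rule divide_right_mono)
    show "norm (LINT x:R|rho. F x - c) \<le> I"
      unfolding I_def using set_integral_norm_bound[OF int] .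
  qed (use m in simp)
  finally have d: "norm (cz_mean F R - c) \<le> I / m" .
  have "(\<integral>\<^sup>+x\<in>R. ennreal (norm (F x - cz_mean F R)) \<partial>rho)
      \<le> (\<integral>\<^sup>+x. ennreal (norm (F x - c)) * indicator R x + ennreal (I / m) * indicator R x \<partial>rho)"
  proof (intro nn_integral_mono)
    fix x
    have "norm (F x - cz_mean F R) \<le> norm (F x - c) + I / m"
      using norm_triangle_ineq4[of "F x - c" "cz_mean F R - c"] d by simp
    moreover have "0 \<le> I / m" using d norm_ge_zero order_trans by blast
    ultimately have "ennreal (norm (F x - cz_mean F R)) \<le> ennreal (norm (F x - c)) + ennreal (I / m)"
      by (metis ennreal_leI ennreal_plus norm_ge_zero)
    then show "ennreal (norm (F x - cz_mean F R)) * indicator R x \<le> ennreal (norm (F x - c)) * indicator R x + ennreal (I / m) * indicator R x"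
      by (auto simp: indicator_def)
  qed
  also have "\<dots> = ennreal I + ennreal (I / m) * emeasure rho R"
  proof -
    have "(\<lambda>x. ennreal (norm (F x - c)) * indicator R x) = (\<lambda>x. ennreal (norm (indicator R x *\<^sub>R (F x - c))))"
      by (auto simp: indicator_def)
    then have "(\<lambda>x. ennreal (norm (F x - c)) * indicator R x) \<in> borel_measurable rho"
      using measurable_compose[OF measurable_compose[OF borel_measurable_integrable[OF int[unfolded set_integrable_def]]
        borel_measurable_norm] measurable_ennreal]
      by (simp only:)
    then show ?thesis using Rs by (simp add: nn_integral_add I nn_integral_cmult_indicator)
  qed
  also have "ennreal (I / m) * emeasure rho R = ennreal I"
  proof -
    have "0 \<le> I / m" using d norm_ge_zero order_trans by blast
    then show ?thesis using m by (simp add: mR flip: ennreal_mult)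
  qed
  finally show ?thesis by (simp add: I mult_2)
qed

lemma ennreal_enn2real_le: "ennreal (enn2real x) \<le> x"
  by (cases x) auto

lemma enn2real_diff_le:
  assumes "u \<le> v + ennreal r" "v \<le> u + ennreal r" "0 \<le> r" "u < \<infinity>" "v < \<infinity>"
  shows "\<bar>enn2real u - enn2real v\<bar> \<le> r"
proof -
  obtain a b where "u = ennreal a" "0 \<le> a" "v = ennreal b" "0 \<le> b"
    using assms(4,5) by (cases u; cases v) auto
  then show ?thesis using assms by (auto simp flip: ennreal_plus)
qed

context cz_op begin

text \<open>The set where the value is infinite lies in every level set, and the weak type bound
  tends to 0 as the height grows.\<close>

lemma max_sing_AE_finite:
  assumes f: "f \<in> linf_c"
  shows "AE x in rho. max_sing K f x < \<infinity>"
proof -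
  define I where "I = (\<integral>\<^sup>+x. ennreal (norm (f x)) \<partial>rho)"
  have I: "I < \<infinity>" unfolding I_def by (rule linf_c_nn_integral_norm[OF f])
  obtain i where i: "I = ennreal i" "0 \<le> i" using I by (cases I) auto
  define N where "N = (\<Inter>n::nat. level f (real (Suc n)))"
  have N: "N \<in> sets rho" unfolding N_def using level_sets[OF f] by blast
  have "emeasure rho N \<le> ennreal (wk_c * i * inverse (real (Suc n)))" for n
  proof -
    have "emeasure rho N \<le> emeasure rho (level f (real (Suc n)))"
      by (rule emeasure_mono) (auto simp: N_def level_sets[OF f])
    also have "\<dots> \<le> ennreal (wk_c / real (Suc n)) * I"
      unfolding I_def by (rule level_weak11[OF f]) simp
    also have "\<dots> = ennreal (wk_c * i * inverse (real (Suc n)))"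
      using wk_pos i by (simp add: divide_inverse mult_ac flip: ennreal_mult)
    finally show ?thesis .
  qed
  moreover have "(\<lambda>n. ennreal (wk_c * i * inverse (real (Suc n)))) \<longlonglongrightarrow> ennreal (wk_c * i * 0)"
    by (intro tendsto_ennrealI tendsto_mult tendsto_const LIMSEQ_inverse_real_of_nat)
  ultimately have "emeasure rho N \<le> ennreal (wk_c * i * 0)"
    by (intro LIMSEQ_le_const) auto
  then have "N \<in> null_sets rho" using N by auto
  then show ?thesis
  proof (rule AE_I')
    show "{x \<in> space rho. \<not> max_sing K f x < \<infinity>} \<subseteq> N"
    proof
      fix x :: "'n pt" assume "x \<in> {x \<in> space rho. \<not> max_sing K f x < \<infinity>}"
      then have "x \<in> S" "max_sing K f x = top" by (auto simp flip: less_top)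
      then show "x \<in> N" by (simp add: N_def level_def del: of_nat_Suc)
    qed
  qed
qed

lemma max_sing_weak_type: "bounded_from_to (lp_norm 1) weak_l1_norm (max_sing K)"
  unfolding bounded_from_to_def
proof (intro exI[of _ wk_c] ballI conjI)
  fix f :: "'n pt \<Rightarrow> complex" assume f: "f \<in> linf_c"
  show "max_sing K f \<in> borel_measurable rho" "AE x in rho. max_sing K f x < \<infinity>"
    by (fact max_sing_measurable[OF f] max_sing_AE_finite[OF f])+
  define I where "I = (\<integral>\<^sup>+x. ennreal (norm (f x)) \<partial>rho)"
  have I: "I < \<infinity>" unfolding I_def by (rule linf_c_nn_integral_norm[OF f])
  have lp: "lp_norm 1 f = I" using I by (simp add: lp_norm_def Let_def less_top flip: I_def)
  show "weak_l1_norm (\<lambda>x. complex_of_real (enn2real (max_sing K f x))) \<le> ennreal wk_c * lp_norm 1 f"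
    unfolding weak_l1_norm_def
  proof (rule SUP_least)
    fix \<alpha> :: real assume "\<alpha> \<in> {0<..}"
    then have a: "0 < \<alpha>" by simp
    have sub: "{x \<in> space rho. \<alpha> < norm (complex_of_real (enn2real (max_sing K f x)))} \<subseteq> level f \<alpha>"
    proof safe
      fix x :: "'n pt" assume x: "x \<in> space rho" "\<alpha> < norm (complex_of_real (enn2real (max_sing K f x)))"
      then have "ennreal \<alpha> < ennreal (enn2real (max_sing K f x))"
        using a by (simp add: ennreal_less_iff)
      also have "\<dots> \<le> max_sing K f x" by (rule ennreal_enn2real_le)
      finally show "x \<in> level f \<alpha>" using x by (simp add: level_def)
    qed
    have "ennreal \<alpha> * emeasure rho {x \<in> space rho. \<alpha> < norm (complex_of_real (enn2real (max_sing K f x)))}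
        \<le> ennreal \<alpha> * (ennreal (wk_c / \<alpha>) * I)"
      unfolding I_def using sub a
      by (intro mult_left_mono order_trans[OF emeasure_mono[OF sub level_sets[OF f]] level_weak11[OF f]]) auto
    also have "\<dots> = ennreal wk_c * lp_norm 1 f"
      using a by (simp add: ennreal_scale lp)
    finally show "ennreal \<alpha> * emeasure rho {x \<in> space rho. \<alpha> < norm (complex_of_real (enn2real (max_sing K f x)))}
        \<le> ennreal wk_c * lp_norm 1 f" .
  qed
qed

lemma max_sing_strong_type:
  assumes p: "1 < p"
  shows "bounded_from_to (lp_norm p) (lp_norm p) (max_sing K)"
proof -
  obtain C where C: "0 \<le> C" "\<And>f :: 'n pt \<Rightarrow> complex. f \<in> linf_c \<Longrightarrow>
    (\<integral>\<^sup>+x. ennreal (enn2real (max_sing K f x) powr p) \<partial>rho) \<le> ennreal C * (\<integral>\<^sup>+x. ennreal (norm (f x) powr p) \<partial>rho)"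
    using strong_type[OF p] by blast
  show ?thesis
    unfolding bounded_from_to_def
  proof (intro exI[of _ "C powr (1 / p)"] ballI conjI)
    fix f :: "'n pt \<Rightarrow> complex" assume f: "f \<in> linf_c"
    show "max_sing K f \<in> borel_measurable rho" "AE x in rho. max_sing K f x < \<infinity>"
      by (fact max_sing_measurable[OF f] max_sing_AE_finite[OF f])+
    have "(C powr (1 / p)) powr p = C" using C(1) p by (simp add: powr_powr)
    then show "lp_norm p (\<lambda>x. complex_of_real (enn2real (max_sing K f x))) \<le> ennreal (C powr (1 / p)) * lp_norm p f"
      using C(2)[OF f] p linf_c_nn_integral[OF f, of p] by (subst lp_norm_le_iff) auto
  qed
qed

text \<open>The strong type with p = 2 gives square integrability, and on sets of finite measure u
  <= 1 + u^2 turns this into integrability.\<close>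

lemma max_sing_l1_loc:
  assumes f: "f \<in> linf_c"
  shows "(\<lambda>x. complex_of_real (enn2real (max_sing K f x))) \<in> l1_loc"
    and "X \<in> sets rho \<Longrightarrow> emeasure rho X < \<infinity> \<Longrightarrow>
      set_integrable rho X (\<lambda>x. complex_of_real (enn2real (max_sing K f x)))"
proof -
  define u where "u = (\<lambda>x. enn2real (max_sing K f x))"
  have u [measurable]: "u \<in> borel_measurable rho"
    unfolding u_def using max_sing_measurable[OF f] by measurable
  obtain C where C: "0 \<le> C" "\<And>f :: 'n pt \<Rightarrow> complex. f \<in> linf_c \<Longrightarrow>
    (\<integral>\<^sup>+x. ennreal (enn2real (max_sing K f x) powr 2) \<partial>rho) \<le> ennreal C * (\<integral>\<^sup>+x. ennreal (norm (f x) powr 2) \<partial>rho)"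
    using strong_type[of 2] by auto
  have u2: "(\<integral>\<^sup>+x. ennreal (u x powr 2) \<partial>rho) < \<infinity>"
    unfolding u_def
  proof (rule order_le_less_trans[OF C(2)[OF f]])
    show "ennreal C * (\<integral>\<^sup>+x. ennreal (norm (f x) powr 2) \<partial>rho) < \<infinity>"
      using linf_c_nn_integral[OF f, of 2] by (simp add: ennreal_mult_less_top)
  qed
  have *: "set_integrable rho X (\<lambda>x. complex_of_real (u x))" if X: "X \<in> sets rho" "emeasure rho X < \<infinity>" for X
    unfolding set_integrable_def
  proof (rule integrableI_bounded)
    show "(\<lambda>x. indicator X x *\<^sub>R complex_of_real (u x)) \<in> borel_measurable rho"
      using X by measurable
    have "(\<integral>\<^sup>+x. ennreal (norm (indicator X x *\<^sub>R complex_of_real (u x))) \<partial>rho)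
        \<le> (\<integral>\<^sup>+x. indicator X x + ennreal (u x powr 2) \<partial>rho)"
    proof (intro nn_integral_mono)
      fix x
      have "0 \<le> u x" by (simp add: u_def)
      moreover have "u x \<le> 1 + (u x)\<^sup>2" using zero_le_power2[of "u x - 1/2"] by (simp add: power2_eq_square algebra_simps)
      ultimately have "ennreal (u x) \<le> 1 + ennreal (u x powr 2)"
        by (simp add: ennreal_leI flip: ennreal_plus ennreal_1)
      then show "ennreal (norm (indicator X x *\<^sub>R complex_of_real (u x))) \<le> indicator X x + ennreal (u x powr 2)"
        using \<open>0 \<le> u x\<close> by (auto simp: indicator_def)
    qed
    also have "\<dots> = emeasure rho X + (\<integral>\<^sup>+x. ennreal (u x powr 2) \<partial>rho)"
      using X by (subst nn_integral_add) auto
    also have "\<dots> < \<infinity>" using X u2 by (simp add: less_top)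
    finally show "(\<integral>\<^sup>+x. ennreal (norm (indicator X x *\<^sub>R complex_of_real (u x))) \<partial>rho) < \<infinity>" .
  qed
  show "X \<in> sets rho \<Longrightarrow> emeasure rho X < \<infinity> \<Longrightarrow>
      set_integrable rho X (\<lambda>x. complex_of_real (enn2real (max_sing K f x)))"
    using * by (simp add: u_def)
  have "set_integrable rho X (\<lambda>x. complex_of_real (u x))" if "compact X" "X \<subseteq> S" for X
  proof (rule *)
    show "X \<in> sets rho" using that by (simp add: sets_rho_iff borel_compact)
    show "emeasure rho X < \<infinity>" using that by (rule emeasure_rho_compact)
  qed
  then show "(\<lambda>x. complex_of_real (enn2real (max_sing K f x))) \<in> l1_loc"
    using u by (auto simp: l1_loc_def u_def)
qed

text \<open>The strong type with p = 2 is applied to the part of \<open>f\<close> on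
  \<open>cz_star R\<close>, a set of measure comparable to that of \<open>R\<close>. In place of the
  Cauchy-Schwarz inequality, u <= a + u^2 / a is integrated over \<open>R\<close>.\<close>

lemma max_sing_near_average:
  obtains C where "0 \<le> C" "\<And>f a R. f \<in> linf_c \<Longrightarrow> 0 < a \<Longrightarrow> (AE x in rho. norm (f x) \<le> a) \<Longrightarrow> R \<in> cz_sets \<Longrightarrow>
    (\<integral>\<^sup>+x\<in>R. ennreal (enn2real (max_sing K (res (cz_star R) f) x)) \<partial>rho) \<le> ennreal (a * C) * emeasure rho R"
proof -
  obtain C where C: "0 \<le> C" "\<And>f :: 'n pt \<Rightarrow> complex. f \<in> linf_c \<Longrightarrow>
    (\<integral>\<^sup>+x. ennreal (enn2real (max_sing K f x) powr 2) \<partial>rho) \<le> ennreal C * (\<integral>\<^sup>+x. ennreal (norm (f x) powr 2) \<partial>rho)"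
    using strong_type[of 2] by auto
  define D where "D = cz_cs TYPE('n)"
  have D: "0 \<le> D" using cz_cs_ge_1[where 'n='n] by (simp add: D_def)
  show ?thesis
  proof (rule that[of "1 + C * D"])
    show "0 \<le> 1 + C * D" using C D by simp
    fix f :: "'n pt \<Rightarrow> complex" and a :: real and R :: "'n pt set"
    assume f: "f \<in> linf_c" "0 < a" "AE x in rho. norm (f x) \<le> a" and R: "R \<in> cz_sets"
    define g where "g = res (cz_star R) f"
    have Rs [measurable]: "R \<in> sets rho" "cz_star R \<in> sets rho" using R by (auto simp: cz_sets_rho cz_star_sets_rho)
    have g: "g \<in> linf_c" unfolding g_def by (rule res_linf_c[OF _ f(1)]) fact
    define u where "u = (\<lambda>x. enn2real (max_sing K g x))"
    have u [measurable]: "u \<in> borel_measurable rho"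
      unfolding u_def using max_sing_measurable[OF g] by measurable
    have "(\<integral>\<^sup>+x. ennreal (norm (g x) powr 2) \<partial>rho) \<le> (\<integral>\<^sup>+x. ennreal (a\<^sup>2) * indicator (cz_star R) x \<partial>rho)"
    proof (rule nn_integral_mono_AE)
      show "AE x in rho. ennreal (norm (g x) powr 2) \<le> ennreal (a\<^sup>2) * indicator (cz_star R) x"
        using f(3) by eventually_elim
          (auto simp: g_def norm_res powr_2_norm indicator_def intro!: ennreal_leI power_mono)
    qed
    also have "\<dots> = ennreal (a\<^sup>2) * emeasure rho (cz_star R)" by (simp add: nn_integral_cmult_indicator)
    also have "\<dots> \<le> ennreal (a\<^sup>2) * (ennreal D * emeasure rho R)"
      unfolding D_def by (intro mult_left_mono emeasure_cz_star R) simp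
    finally have "(\<integral>\<^sup>+x. ennreal (u x powr 2) \<partial>rho) \<le> ennreal C * (ennreal (a\<^sup>2) * (ennreal D * emeasure rho R))"
      unfolding u_def using C(2)[OF g] by (meson mult_left_mono order_trans zero_le)
    also have "\<dots> = ennreal (C * D * a\<^sup>2) * emeasure rho R"
      using C(1) D by (simp only: ennreal_scale mult_nonneg_nonneg zero_le_power2 mult.assoc mult.commute[of D])
    finally have u2: "(\<integral>\<^sup>+x. ennreal (u x powr 2) \<partial>rho) \<le> ennreal (C * D * a\<^sup>2) * emeasure rho R" .
    have "(\<integral>\<^sup>+x\<in>R. ennreal (u x) \<partial>rho) \<le> (\<integral>\<^sup>+x. ennreal a * indicator R x + ennreal (1 / a) * ennreal (u x powr 2) \<partial>rho)"
    proof (intro nn_integral_mono)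
      fix x
      have u0: "0 \<le> u x" by (simp add: u_def)
      have "a * u x \<le> a\<^sup>2 + (u x)\<^sup>2"
        using zero_le_power2[of "u x - a"] mult_nonneg_nonneg[OF less_imp_le[OF f(2)] u0]
        by (simp add: power2_eq_square algebra_simps)
      then have "u x \<le> a + (1 / a) * (u x powr 2)"
        using f(2) u0 by (simp add: field_simps power2_eq_square)
      then have "ennreal (u x) \<le> ennreal a + ennreal (1 / a) * ennreal (u x powr 2)"
        using f(2) by (simp add: ennreal_leI flip: ennreal_mult ennreal_plus del: powr_numeral)
      then show "ennreal (u x) * indicator R x \<le> ennreal a * indicator R x + ennreal (1 / a) * ennreal (u x powr 2)"
        by (auto simp: indicator_def)
    qed
    also have "\<dots> = ennreal a * emeasure rho R + ennreal (1 / a) * (\<integral>\<^sup>+x. ennreal (u x powr 2) \<partial>rho)"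
      by (simp add: nn_integral_add nn_integral_cmult nn_integral_cmult_indicator)
    also have "\<dots> \<le> ennreal a * emeasure rho R + ennreal (1 / a) * (ennreal (C * D * a\<^sup>2) * emeasure rho R)"
      by (intro add_left_mono mult_left_mono u2) simp
    also have "\<dots> = (ennreal a + ennreal (1 / a * (C * D * a\<^sup>2))) * emeasure rho R"
      using f(2) by (simp only: ennreal_scale distrib_right zero_le_divide_1_iff less_imp_le)
    also have "ennreal a + ennreal (1 / a * (C * D * a\<^sup>2)) = ennreal (a + 1 / a * (C * D * a\<^sup>2))"
      using f(2) C D by (intro ennreal_plus[symmetric]) auto
    also have "a + 1 / a * (C * D * a\<^sup>2) = a * (1 + C * D)"
      using f(2) by (simp add: field_simps power2_eq_square)
    finally show "(\<integral>\<^sup>+x\<in>R. ennreal (enn2real (max_sing K (res (cz_star R) f) x)) \<partial>rho) \<le> ennreal (a * (1 + C * D)) * emeasure rho R"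
      by (simp add: u_def g_def)
  qed
qed

text \<open>The constant subtracted on \<open>R\<close> is the value of the maximal operator of the
  far part at one point \<open>x0\<close> of \<open>R\<close>. By \<open>max_sing_far\<close> that
  value changes over \<open>R\<close> by at most a far_c, and the near part is controlled on average
  by \<open>max_sing_near_average\<close>.\<close>

lemma max_sing_bmo_bound:
  obtains C where "0 \<le> C" "\<And>f a. f \<in> linf_c \<Longrightarrow> 0 < a \<Longrightarrow> (AE x in rho. norm (f x) \<le> a) \<Longrightarrow>
    bmo_norm (\<lambda>x. complex_of_real (enn2real (max_sing K f x))) \<le> ennreal (C * a)"
proof -
  obtain C where C: "0 \<le> C" "\<And>(f :: 'n pt \<Rightarrow> complex) a R. f \<in> linf_c \<Longrightarrow> 0 < a \<Longrightarrow> (AE x in rho. norm (f x) \<le> a) \<Longrightarrow> R \<in> cz_sets \<Longrightarrow>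
    (\<integral>\<^sup>+x\<in>R. ennreal (enn2real (max_sing K (res (cz_star R) f) x)) \<partial>rho) \<le> ennreal (a * C) * emeasure rho R"
    using max_sing_near_average by blast
  show ?thesis
  proof (rule that[of "2 * (C + far_c)"])
    show "0 \<le> 2 * (C + far_c)" using C far_c_pos by simp
    fix f :: "'n pt \<Rightarrow> complex" and a :: real
    assume f: "f \<in> linf_c" "0 < a" "AE x in rho. norm (f x) \<le> a"
    define F where "F = (\<lambda>x. complex_of_real (enn2real (max_sing K f x)))"
    have F: "F \<in> l1_loc" unfolding F_def by (rule max_sing_l1_loc[OF f(1)])
    have "(\<integral>\<^sup>+x\<in>R. ennreal (norm (F x - cz_mean F R)) \<partial>rho) / emeasure rho R \<le> ennreal (2 * (C + far_c) * a)"
      if R: "R \<in> cz_sets" for R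
    proof -
      have Rs [measurable]: "R \<in> sets rho" "cz_star R \<in> sets rho" and Rf: "emeasure rho R < \<infinity>" and Rp: "0 < emeasure rho R"
        using cz_sets_rho[OF R] cz_star_sets_rho[OF R] emeasure_cz_finite[OF R] emeasure_cz_pos[OF R] by blast+
      define f1 where "f1 = res (cz_star R) f"
      define f2 where "f2 = res (S - cz_star R) f"
      have f1: "f1 \<in> linf_c" and f2: "f2 \<in> linf_c"
        unfolding f1_def f2_def using R by (auto intro!: res_linf_c f(1) compl_star_sets)
      have u [measurable]: "max_sing K f1 \<in> borel_measurable rho" by (rule max_sing_measurable[OF f1])
      \<comment> \<open>Such a point exists since the maximal function is finite almost everywhere
        and \<open>R\<close> has positive measure.\<close>
      have "\<exists>x0\<in>R. max_sing K f2 x0 < \<infinity>"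
      proof (rule ccontr)
        assume "\<not> (\<exists>x0\<in>R. max_sing K f2 x0 < \<infinity>)"
        then have "AE x in rho. x \<notin> R" using max_sing_AE_finite[OF f2] by (auto elim: eventually_mono)
        then have "emeasure rho R = 0" using Rs by (subst (asm) AE_iff_measurable[OF Rs(1)]) (use cz_sets_subset_S[OF R] in auto)
        then show False using Rp by simp
      qed
      then obtain x0 where x0: "x0 \<in> R" "max_sing K f2 x0 < \<infinity>" by blast
      define c where "c = enn2real (max_sing K f2 x0)"
      have "AE x in rho. ennreal (norm (F x - complex_of_real c)) * indicator R x
          \<le> ennreal (enn2real (max_sing K f1 x)) * indicator R x + ennreal (a * far_c) * indicator R x"
        using max_sing_AE_finite[OF f1] max_sing_AE_finite[OF f2] max_sing_AE_finite[OF f(1)]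
      proof eventually_elim
        case (elim x)
        show ?case
        proof (cases "x \<in> R")
          case True
          have far: "max_sing K f2 x \<le> max_sing K f2 x0 + ennreal (a * far_c)"
            "max_sing K f2 x0 \<le> max_sing K f2 x + ennreal (a * far_c)"
            unfolding f2_def using f True x0 R by (auto intro!: max_sing_far)
          have nf: "max_sing K f x \<le> max_sing K f1 x + max_sing K f2 x"
            "max_sing K f2 x \<le> max_sing K f x + max_sing K f1 x"
            unfolding f1_def f2_def by (rule max_sing_near_far[OF f(1) R])+
          obtain r where r: "max_sing K f1 x = ennreal r" "0 \<le> r" using elim by (cases "max_sing K f1 x") auto
          have e: "ennreal (r + a * far_c) = max_sing K f1 x + ennreal (a * far_c)"
            using r f(2) far_c_pos by simp
          have "\<bar>enn2real (max_sing K f x) - enn2real (max_sing K f2 x0)\<bar> \<le> r + a * far_c"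
          proof (rule enn2real_diff_le)
            show "max_sing K f x \<le> max_sing K f2 x0 + ennreal (r + a * far_c)"
              using order_trans[OF nf(1) add_left_mono[OF far(1)]] by (simp add: e ac_simps)
            show "max_sing K f2 x0 \<le> max_sing K f x + ennreal (r + a * far_c)"
              using order_trans[OF far(2) add_right_mono[OF nf(2)]] by (simp add: e ac_simps)
            show "0 \<le> r + a * far_c" using r f(2) far_c_pos by simp
          qed (use elim x0 in auto)
          then have "norm (F x - complex_of_real c) \<le> r + a * far_c"
            unfolding F_def c_def by (metis norm_of_real of_real_diff)
          then show ?thesis using True r f(2) far_c_pos
            by (simp add: ennreal_leI flip: ennreal_plus)
        qed simp
      qed
      then have "(\<integral>\<^sup>+x\<in>R. ennreal (norm (F x - complex_of_real c)) \<partial>rho)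
          \<le> (\<integral>\<^sup>+x. ennreal (enn2real (max_sing K f1 x)) * indicator R x + ennreal (a * far_c) * indicator R x \<partial>rho)"
        by (rule nn_integral_mono_AE)
      also have "\<dots> = (\<integral>\<^sup>+x\<in>R. ennreal (enn2real (max_sing K f1 x)) \<partial>rho) + ennreal (a * far_c) * emeasure rho R"
        by (simp add: nn_integral_add nn_integral_cmult_indicator)
      also have "\<dots> \<le> ennreal (a * C) * emeasure rho R + ennreal (a * far_c) * emeasure rho R"
        unfolding f1_def by (intro add_right_mono C(2) f R)
      also have "\<dots> = (ennreal (a * C) + ennreal (a * far_c)) * emeasure rho R" by (simp only: distrib_right)
      also have "ennreal (a * C) + ennreal (a * far_c) = ennreal (a * (C + far_c))"
        using f(2) C far_c_pos by (simp add: distrib_left flip: ennreal_plus)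
      finally have b: "(\<integral>\<^sup>+x\<in>R. ennreal (norm (F x - complex_of_real c)) \<partial>rho) \<le> ennreal (a * (C + far_c)) * emeasure rho R" .
      have "(\<integral>\<^sup>+x\<in>R. ennreal (norm (F x - cz_mean F R)) \<partial>rho) \<le> ennreal 2 * (ennreal (a * (C + far_c)) * emeasure rho R)"
        using order_trans[OF set_nn_integral_mean_le[OF R] mult_left_mono[OF b]]
          max_sing_l1_loc(2)[OF f(1) Rs(1) Rf] by (simp add: F_def)
      also have "\<dots> = ennreal (2 * (C + far_c) * a) * emeasure rho R"
        by (subst ennreal_scale) (simp_all add: mult_ac)
      finally show ?thesis
        by (intro divide_le_posI_ennreal[OF Rp]) (simp only: mult.commute)
    qed
    then show "bmo_norm (\<lambda>x. complex_of_real (enn2real (max_sing K f x))) \<le> ennreal (2 * (C + far_c) * a)"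
      unfolding bmo_norm_def F_def[symmetric] if_P[OF F] by (rule SUP_least)
  qed
qed

lemma max_sing_bmo: "bounded_from_to linf_norm bmo_norm (max_sing K)"
proof -
  obtain C where C: "0 \<le> C" "\<And>(f :: 'n pt \<Rightarrow> complex) a. f \<in> linf_c \<Longrightarrow> 0 < a \<Longrightarrow> (AE x in rho. norm (f x) \<le> a) \<Longrightarrow>
    bmo_norm (\<lambda>x. complex_of_real (enn2real (max_sing K f x))) \<le> ennreal (C * a)"
    using max_sing_bmo_bound by blast
  show ?thesis
    unfolding bounded_from_to_def
  proof (intro exI[of _ C] ballI conjI)
    fix f :: "'n pt \<Rightarrow> complex" assume f: "f \<in> linf_c"
    show "max_sing K f \<in> borel_measurable rho" "AE x in rho. max_sing K f x < \<infinity>"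
      by (fact max_sing_measurable[OF f] max_sing_AE_finite[OF f])+
    have [measurable]: "f \<in> borel_measurable rho" by (rule linf_c_measurable[OF f])
    have "linf_norm f < \<infinity>" using f by (simp add: linf_c_def)
    then obtain a where a: "linf_norm f = ennreal a" "0 \<le> a" by (cases "linf_norm f") auto
    have "AE x in rho. ennreal (norm (f x)) \<le> linf_norm f"
      unfolding linf_norm_def by (rule esssup_AE)
    then have AE: "AE x in rho. norm (f x) \<le> a" using a by simp
    \<comment> \<open>The norm \<open>a\<close> may be 0, whereas the bound requires a positive
      number; slightly larger numbers are inserted and the excess tends to 0.\<close>
    have "bmo_norm (\<lambda>x. complex_of_real (enn2real (max_sing K f x))) \<le> ennreal (C * (a + inverse (real (Suc n))))" for n
    proof (rule C(2)[OF f])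
      show "0 < a + inverse (real (Suc n))" using a(2) by (simp add: add_nonneg_pos)
      show "AE x in rho. norm (f x) \<le> a + inverse (real (Suc n))"
        using AE by eventually_elim (simp add: add_increasing2)
    qed
    moreover have "(\<lambda>n. ennreal (C * (a + inverse (real (Suc n))))) \<longlonglongrightarrow> ennreal (C * (a + 0))"
      by (intro tendsto_ennrealI tendsto_mult tendsto_add tendsto_const LIMSEQ_inverse_real_of_nat)
    ultimately have "bmo_norm (\<lambda>x. complex_of_real (enn2real (max_sing K f x))) \<le> ennreal (C * (a + 0))"
      by (intro LIMSEQ_le_const) auto
    then show "bmo_norm (\<lambda>x. complex_of_real (enn2real (max_sing K f x))) \<le> ennreal C * linf_norm f"
      using C(1) a by (simp add: ennreal_mult)
  qed
qed

end

section \<open>Values of the kernel on the diagonal\<close>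

definition off_diag :: "(('n::finite) pt \<Rightarrow> 'n pt \<Rightarrow> complex) \<Rightarrow> 'n pt \<Rightarrow> 'n pt \<Rightarrow> complex" where
  "off_diag K x y = (if x = y then 0 else K x y)"

text \<open>Local integrability gives measurability only on compact sets off the diagonal. The
  complement of the diagonal in the product is open and exhausted by a sequence of compact sets, and
  the kernel extended by 0 is the pointwise limit of its restrictions to them.\<close>

lemma off_diag_measurable:
  fixes K :: "('n::finite) pt \<Rightarrow> 'n pt \<Rightarrow> complex"
  assumes "loc_integrable_off_diag K"
  shows "case_prod (off_diag K) \<in> borel_measurable (rho \<Otimes>\<^sub>M rho)"
proof -
  have "open ((S :: 'n pt set) \<times> (S :: 'n pt set) - Id)"
  proof (intro open_Diff open_Times open_S)
    have "(Id :: ('n pt \<times> 'n pt) set) = {y. \<exists>x. y = (x, x)}" by auto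
    then show "closed (Id :: ('n pt \<times> 'n pt) set)" using closed_diagonal[where 'a="'n pt"] by (simp only:)
  qed
  then obtain C :: "nat \<Rightarrow> ('n pt \<times> 'n pt) set" where C: "\<And>n. compact (C n)" "\<And>n. C n \<subseteq> S \<times> S - Id"
      "\<And>n. C n \<subseteq> interior (C (Suc n))" "\<Union>(range C) = S \<times> S - Id"
    by (rule open_Union_compact_subsets) auto
  have mono: "C n \<subseteq> C m" if "n \<le> m" for n m
    using C(3) interior_subset that by (intro lift_Suc_mono_le[of C n m]) blast+
  show ?thesis
  proof (rule borel_measurable_LIMSEQ_metric)
    show "(\<lambda>z. indicator (C n) z *\<^sub>R (case z of (x, y) \<Rightarrow> K x y)) \<in> borel_measurable (rho \<Otimes>\<^sub>M rho)" for n
      using assms C(1,2)[of n] unfolding loc_integrable_off_diag_def set_integrable_def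
      by (intro borel_measurable_integrable) blast
    fix z :: "'n pt \<times> 'n pt" assume "z \<in> space (rho \<Otimes>\<^sub>M rho)"
    then have z: "z \<in> S \<times> S" by (simp add: space_pair_measure)
    show "(\<lambda>n. indicator (C n) z *\<^sub>R (case z of (x, y) \<Rightarrow> K x y)) \<longlonglongrightarrow> case_prod (off_diag K) z"
    proof (cases "z \<in> Id")
      case True
      then have "z \<notin> C n" for n using C(2) by blast
      then have "(\<lambda>n. indicator (C n) z *\<^sub>R (case z of (x, y) \<Rightarrow> K x y)) = (\<lambda>n. 0)" by simp
      moreover have "case_prod (off_diag K) z = 0" using True by (auto simp: off_diag_def)
      ultimately show ?thesis by simp
    next
      case False
      then obtain N where "z \<in> C N" using C(4) z by blast
      then have "indicator (C n) z *\<^sub>R (case z of (x, y) \<Rightarrow> K x y) = case_prod (off_diag K) z" if "N \<le> n" for n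
        using mono[OF that] False by (auto simp: off_diag_def split: prod.split)
      then show ?thesis by (intro tendsto_eventually) (auto simp: eventually_sequentially)
    qed
  qed
qed

text \<open>A box containing \<open>x\<close> is part of its own star, so y = x never occurs in a
  truncation at \<open>x\<close>.\<close>

lemma max_sing_off_diag:
  fixes K :: "('n::finite) pt \<Rightarrow> 'n pt \<Rightarrow> complex"
  shows "max_sing (off_diag K) = max_sing K"
proof (intro ext)
  fix f and x :: "'n pt"
  have "(LINT y:(S - cz_star R)|rho. off_diag K x y * f y) = (LINT y:(S - cz_star R)|rho. K x y * f y)"
    if "R \<in> cz_sets" "x \<in> R" for R
    unfolding set_lebesgue_integral_def using cz_subset_star[OF that(1)] that(2)
    by (intro Bochner_Integration.integral_cong) (auto simp: off_diag_def indicator_def)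
  then show "max_sing (off_diag K) f x = max_sing K f x"
    unfolding max_sing_def by (intro SUP_cong) auto
qed

text \<open>For fixed \<open>x\<close> the kernel is changed at one point only, which has measure
  zero.\<close>

lemma has_kernel_off_diag:
  assumes "has_kernel T K"
  shows "has_kernel T (off_diag K)"
proof -
  have "(LINT y|rho. off_diag K x y * f y) = (LINT y|rho. K x y * f y)" for x f
    by (rule integral_discrete_difference[where X = "{x} \<inter> S"]) (auto simp: off_diag_def sets_rho_iff)
  then show ?thesis using assms by (simp add: has_kernel_def)
qed

lemma cz_op_off_diag:
  fixes K :: "('n::finite) pt \<Rightarrow> 'n pt \<Rightarrow> complex"
    and T :: "('n pt \<Rightarrow> complex) \<Rightarrow> 'n pt \<Rightarrow> complex"
  assumes K: "loc_integrable_off_diag K"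
    and size: "(SUP y\<in>S. SUP r\<in>{0<..}.
            \<integral>\<^sup>+x\<in>{x \<in> S. r < hdist x y \<and> hdist x y \<le> 2 * r}.
              (ennreal (norm (K x y)) + ennreal (norm (K y x))) \<partial>rho) < \<infinity>" (is "?M < \<infinity>")
    and hoermander: "(SUP R\<in>cz_sets. SUP y\<in>R. SUP y'\<in>R.
            \<integral>\<^sup>+x\<in>S - cz_star R.
              (ennreal (norm (K x y - K x y')) + ennreal (norm (K y x - K y' x))) \<partial>rho) < \<infinity>" (is "?N < \<infinity>")
    and T: "linear_on_l2 T" "has_kernel T K" "bounded_on_l2 T"
  obtains A H B where "cz_op (off_diag K) T A H B"
proof -
  obtain C :: real where C: "\<And>f. f \<in> lp_space 2 \<Longrightarrow> T f \<in> borel_measurable rho \<and> lp_norm 2 (T f) \<le> ennreal C * lp_norm 2 f"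
    using T(3) unfolding bounded_on_l2_def by blast
  \<comment> \<open>The maximum with 1, like the summand 1 in \<open>A\<close> and \<open>H\<close>,
    secures the strict positivity demanded by the locale.\<close>
  define D where "D = max C 1"
  define A where "A = enn2real ?M + 1"
  define H where "H = enn2real ?N + 1"
  have A: "?M \<le> ennreal A" and H: "?N \<le> ennreal H"
    using size hoermander by (simp_all add: A_def H_def)
  have lc: "f \<in> lp_space 2" if "f \<in> linf_c" for f :: "'n pt \<Rightarrow> complex"
    using linf_c_nn_integral[OF that, of 2] linf_c_measurable[OF that]
    by (simp add: lp_space_def lp_norm_def Let_def less_top)
  have hN: "(\<integral>\<^sup>+x\<in>S - cz_star R. (ennreal (norm (K x y - K x y')) + ennreal (norm (K y x - K y' x))) \<partial>rho) \<le> ennreal H"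
    if "R \<in> cz_sets" "y \<in> R" "y' \<in> R" for R y y'
    by (rule order_trans[OF _ H], rule SUP_upper2[OF that(1)], rule SUP_upper2[OF that(2)], rule SUP_upper2[OF that(3)]) simp
  have "cz_op (off_diag K) T A H (D powr 2)"
  proof
    show "0 < A" "0 < H" "0 < D powr 2" by (auto simp: A_def H_def D_def add_nonneg_pos)
    show "case_prod (off_diag K) \<in> borel_measurable (rho \<Otimes>\<^sub>M rho)" by (rule off_diag_measurable[OF K])
    show "has_kernel T (off_diag K)" by (rule has_kernel_off_diag[OF T(2)])
  next
    fix x :: "'n pt" and r :: real assume x: "x \<in> S" and r: "0 < r"
    have "(\<integral>\<^sup>+y\<in>{y \<in> S. r < hdist x y \<and> hdist x y \<le> 2 * r}. ennreal (norm (off_diag K x y)) \<partial>rho)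
        \<le> (\<integral>\<^sup>+y\<in>{y \<in> S. r < hdist y x \<and> hdist y x \<le> 2 * r}. (ennreal (norm (K y x)) + ennreal (norm (K x y))) \<partial>rho)"
      by (intro nn_integral_mono) (auto simp: off_diag_def indicator_def hdist_commute)
    also have "\<dots> \<le> ennreal A"
      by (rule order_trans[OF _ A], rule SUP_upper2[OF x], rule SUP_upper2[of r]) (use r in simp_all)
    finally show "(\<integral>\<^sup>+y\<in>{y \<in> S. r < hdist x y \<and> hdist x y \<le> 2 * r}. ennreal (norm (off_diag K x y)) \<partial>rho) \<le> ennreal A" .
  next
    fix R and y y' :: "'n pt" assume R: "R \<in> cz_sets" "y \<in> R" "y' \<in> R"
    have ne: "x \<noteq> y" "x \<noteq> y'" if "x \<in> S - cz_star R" for x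
      using cz_subset_star[OF R(1)] R that by auto
    have "(\<integral>\<^sup>+x\<in>S - cz_star R. ennreal (norm (off_diag K x y - off_diag K x y')) \<partial>rho)
        \<le> (\<integral>\<^sup>+x\<in>S - cz_star R. (ennreal (norm (K x y - K x y')) + ennreal (norm (K y x - K y' x))) \<partial>rho)"
      by (intro nn_integral_mono) (use ne in \<open>auto simp: off_diag_def indicator_def\<close>)
    from order_trans[OF this hN[OF R]]
    show "(\<integral>\<^sup>+x\<in>S - cz_star R. ennreal (norm (off_diag K x y - off_diag K x y')) \<partial>rho) \<le> ennreal H" .
    have "(\<integral>\<^sup>+x\<in>S - cz_star R. ennreal (norm (off_diag K y x - off_diag K y' x)) \<partial>rho)
        \<le> (\<integral>\<^sup>+x\<in>S - cz_star R. (ennreal (norm (K x y - K x y')) + ennreal (norm (K y x - K y' x))) \<partial>rho)"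
      by (intro nn_integral_mono) (use ne in \<open>auto simp: off_diag_def indicator_def\<close>)
    from order_trans[OF this hN[OF R]]
    show "(\<integral>\<^sup>+x\<in>S - cz_star R. ennreal (norm (off_diag K y x - off_diag K y' x)) \<partial>rho) \<le> ennreal H" .
  next
    fix f :: "'n pt \<Rightarrow> complex" assume f: "f \<in> linf_c"
    show "T f \<in> borel_measurable rho" using C[OF lc[OF f]] by blast
    have "ennreal C * lp_norm 2 f \<le> ennreal D * lp_norm 2 f"
      by (intro mult_right_mono ennreal_leI) (auto simp: D_def)
    then have "lp_norm 2 (T f) \<le> ennreal D * lp_norm 2 f"
      using C[OF lc[OF f]] order_trans by blast
    then show "(\<integral>\<^sup>+x. ennreal ((norm (T f x))\<^sup>2) \<partial>rho) \<le> ennreal (D powr 2) * (\<integral>\<^sup>+x. ennreal ((norm (f x))\<^sup>2) \<partial>rho)"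
      using lp_norm_le_iff[of 2 D f "T f"] linf_c_nn_integral[OF f, of 2]
      by (simp only: powr_2_norm) (simp add: D_def)
  next
    fix f g :: "'n pt \<Rightarrow> complex" assume fg: "f \<in> linf_c" "g \<in> linf_c"
    have "AE x in rho. T (\<lambda>z. 1 * f z + 1 * g z) x = 1 * T f x + 1 * T g x"
      using T(1) lc[OF fg(1)] lc[OF fg(2)] unfolding linear_on_l2_def by blast
    then show "AE x in rho. T (\<lambda>z. f z + g z) x = T f x + T g x" by simp
  qed
  then show thesis by (rule that)
qed

theorem theorem4p2:
  fixes K :: "('n::finite) pt \<Rightarrow> 'n pt \<Rightarrow> complex"
    and T :: "('n pt \<Rightarrow> complex) \<Rightarrow> 'n pt \<Rightarrow> complex"
  assumes "loc_integrable_off_diag K"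
    and "(SUP y\<in>S. SUP r\<in>{0<..}.
            \<integral>\<^sup>+x\<in>{x \<in> S. r < hdist x y \<and> hdist x y \<le> 2 * r}.
              (ennreal (norm (K x y)) + ennreal (norm (K y x))) \<partial>rho) < \<infinity>"
    and "(SUP R\<in>cz_sets. SUP y\<in>R. SUP y'\<in>R.
            \<integral>\<^sup>+x\<in>S - cz_star R.
              (ennreal (norm (K x y - K x y')) + ennreal (norm (K y x - K y' x))) \<partial>rho) < \<infinity>"
    and "linear_on_l2 T"
    and "has_kernel T K"
    and "bounded_on_l2 T"
  shows "bounded_from_to (lp_norm 1) weak_l1_norm (max_sing K)
    \<and> (\<forall>p>1. bounded_from_to (lp_norm p) (lp_norm p) (max_sing K))
    \<and> bounded_from_to linf_norm bmo_norm (max_sing K)"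
proof -
  obtain A H B where "cz_op (off_diag K) T A H B"
    using cz_op_off_diag[OF assms] .
  then interpret cz_op "off_diag K" T A H B .
  show ?thesis
    using max_sing_weak_type max_sing_strong_type max_sing_bmo by (simp only: max_sing_off_diag) blast
qed

end
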